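(* Let $T>0$, $u_0\in V$ and $f\in L^2(Q_T)$, where $Q_T=\Omega\times(0,T)$. Then the strong solution on $[0,T]$ of the problem $$\partial_t u=(\Delta u+f)_+ \ \text{in } \Omega\times(0,T),\quad u=0 \text{ on } \Gamma_D\times(0,T),\quad \partial_\nu u=0 \text{ on } \Gamma_N\times(0,T),\quad u|_{t=0}=u_0 \text{ in }\Omega$$ is unique (i.e. any two strong solutions on $[0,T]$ with the same data $u_0,f$ coincide).
   Context: $\Omega\subset\mathbb{R}^n$ ($n\in\mathbb{N}$) is a bounded Lipschitz domain whose boundary $\Gamma$ is the disjoint union of $\Gamma_D$ (relatively open in $\Gamma$) and $\Gamma_N$; one of these may be empty, in which case the corresponding boundary condition is ignored. $\nu$ is the outward unit normal, $\gamma_0$ is the trace operator, $\mathcal{H}^{n-1}$ is the $(n-1)$-dimensional Hausdorff measure, $\partial_\nu u=\gamma_0(\nabla u)\cdot\nu$, and $(s)_+=\max\{s,0\}$. $V:=\{v\in H^1(\Omega):\gamma_0 v=0\ \mathcal{H}^{n-1}\text{-a.e. on }\Gamma_D\}$ with the $H^1(\Omega)$ norm, and $X:=\{v\in H^2(\Omega):\gamma_0(\nabla v)\cdot\nu=0\ \mathcal{H}^{n-1}\text{-a.e. on }\Gamma_N\}$ with the $H^2(\Omega)$ norm. Strong solution on $[0,T]$: a function $u\in C([0,T];L^2(\Omega))$ such that (i) $u\in W^{1,2}(0,T;L^2(\Omega))\cap L^2(0,T;X\cap V)$; (ii) $\partial_t u=(\Delta u+f)_+$ holds a.e. in $Q_T$;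 (iii) $u|_{t=0}=u_0$ a.e. in $\Omega$. *)

theory Defs
  imports "HOL-Analysis.Analysis"
begin

section \<open>Hausdorff measure\<close>

text \<open>
  The usual construction, with the normalisation for which the \<open>k\<close>-dimensional measure agrees with
  Lebesgue measure on \<open>\<real>\<^sup>k\<close>. The conventions are \<open>(diam {})^0 = 0\<close> and \<open>(diam C)^0 = 1\<close> for nonempty
  \<open>C\<close>, so that dimension \<open>0\<close> gives counting measure. Covers consist of bounded sets because
  \<^const>\<open>diameter\<close> has no meaningful value on unbounded ones.
\<close>

definition hausdorff_gauge :: "nat \<Rightarrow> 'a::metric_space set \<Rightarrow> ennreal" where
  "hausdorff_gauge k C =
     (if C = {} then 0 else ennreal (unit_ball_vol (real k) * (diameter C / 2) ^ k))"

definition fine_covers :: "real \<Rightarrow> 'a::metric_space set \<Rightarrow> (nat \<Rightarrow> 'a set) set" where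
  "fine_covers \<delta> A = {C. A \<subseteq> (\<Union>i. C i) \<and> (\<forall>i. bounded (C i) \<and> diameter (C i) \<le> \<delta>)}"

definition hausdorff_content :: "nat \<Rightarrow> real \<Rightarrow> 'a::metric_space set \<Rightarrow> ennreal" where
  "hausdorff_content k \<delta> A = (INF C\<in>fine_covers \<delta> A. \<Sum>i. hausdorff_gauge k (C i))"

definition hausdorff_outer :: "nat \<Rightarrow> 'a::metric_space set \<Rightarrow> ennreal" where
  "hausdorff_outer k A = (SUP \<delta>\<in>{0<..}. hausdorff_content k \<delta> A)"

definition hausdorff_measure :: "nat \<Rightarrow> 'a::metric_space measure" where
  "hausdorff_measure k =
     measure_of UNIV (lambda_system UNIV UNIV (hausdorff_outer k)) (hausdorff_outer k)"

text \<open>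
  Since \<^const>\<open>measure_of\<close> and \<^const>\<open>restrict_space\<close> degenerate on ill-formed input, we check that
  the above is a measure extending to all Borel sets.
\<close>

lemma hausdorff_content_mono: "A \<subseteq> B \<Longrightarrow> hausdorff_content k \<delta> A \<le> hausdorff_content k \<delta> B"
  unfolding hausdorff_content_def by (rule INF_superset_mono) (auto simp: fine_covers_def)

lemma hausdorff_content_antimono:
  "\<delta> \<le> \<epsilon> \<Longrightarrow> hausdorff_content k \<epsilon> A \<le> hausdorff_content k \<delta> A"
  unfolding hausdorff_content_def
  by (rule INF_superset_mono) (auto simp: fine_covers_def intro: order_trans)

lemma hausdorff_content_empty: "0 < \<delta> \<Longrightarrow> hausdorff_content k \<delta> ({} :: 'a::metric_space set) = 0"
proof -
  assume "0 < \<delta>"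
  then have "(\<lambda>i. {}) \<in> fine_covers \<delta> ({} :: 'a set)" by (auto simp: fine_covers_def)
  then have "hausdorff_content k \<delta> ({} :: 'a set) \<le> (\<Sum>i. hausdorff_gauge k ({}::'a set))"
    unfolding hausdorff_content_def by (rule INF_lower2) simp
  then show ?thesis by (simp add: hausdorff_gauge_def)
qed

lemma hausdorff_content_UN:
  "hausdorff_content k \<delta> (\<Union>i. A i) \<le> (\<Sum>i. hausdorff_content k \<delta> (A i))"
proof (cases "\<exists>i. hausdorff_content k \<delta> (A i) = \<infinity>")
  case True
  then have "(\<Sum>i. hausdorff_content k \<delta> (A i)) = \<infinity>"
    by (metis ennreal_suminf_lessD infinity_ennreal_def order_less_irrefl top.not_eq_extremum)
  then show ?thesis by simp
next
  case fin: False
  show ?thesis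
  proof (rule ennreal_le_epsilon)
    fix e :: real assume e: "0 < e"
    have "\<exists>C\<in>fine_covers \<delta> (A i). (\<Sum>j. hausdorff_gauge k (C j))
            \<le> hausdorff_content k \<delta> (A i) + ennreal (e * (1/2)^Suc i)" for i
    proof -
      have "hausdorff_content k \<delta> (A i) < hausdorff_content k \<delta> (A i) + ennreal (e * (1/2)^Suc i)"
        using fin e by (simp add: less_top ennreal_add_left_cancel_less)
      then show ?thesis
        unfolding hausdorff_content_def INF_less_iff by (auto intro: less_imp_le)
    qed
    then obtain C where C: "\<And>i. C i \<in> fine_covers \<delta> (A i)"
      "\<And>i. (\<Sum>j. hausdorff_gauge k (C i j))
            \<le> hausdorff_content k \<delta> (A i) + ennreal (e * (1/2)^Suc i)"
      by metis
    define D where "D = (\<lambda>n. case prod_decode n of (i, j) \<Rightarrow> C i j)"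
    have D: "D \<in> fine_covers \<delta> (\<Union>i. A i)"
    proof -
      have "x \<in> (\<Union>n. D n)" if "x \<in> A i" for x i
      proof -
        from that C(1)[of i] obtain j where "x \<in> C i j" by (auto simp: fine_covers_def)
        then have "x \<in> D (prod_encode (i, j))" by (simp add: D_def)
        then show ?thesis by blast
      qed
      moreover have "bounded (D n) \<and> diameter (D n) \<le> \<delta>" for n
        using C(1) by (auto simp: fine_covers_def D_def split: prod.split)
      ultimately show ?thesis unfolding fine_covers_def by blast
    qed
    have "hausdorff_content k \<delta> (\<Union>i. A i) \<le> (\<Sum>n. hausdorff_gauge k (D n))"
      unfolding hausdorff_content_def by (rule INF_lower[OF D])
    also have "\<dots> = (\<Sum>i. \<Sum>j. hausdorff_gauge k (C i j))"
      by (subst suminf_ennreal_2dimen[where f="\<lambda>(i, j). hausdorff_gauge k (C i j)", symmetric])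
         (auto simp: D_def comp_def split_def)
    also have "\<dots> \<le> (\<Sum>i. hausdorff_content k \<delta> (A i) + ennreal (e * (1/2)^Suc i))"
      by (intro suminf_le C(2)) auto
    also have "\<dots> = (\<Sum>i. hausdorff_content k \<delta> (A i)) + (\<Sum>i. ennreal (e * (1/2)^Suc i))"
      by (rule suminf_add[symmetric]) auto
    also have "(\<Sum>i. ennreal (e * (1/2)^Suc i)) = ennreal e"
    proof -
      have "(\<lambda>i. e * (1/2)^Suc i) sums (e * 1)"
        by (rule sums_mult[OF power_half_series])
      then show ?thesis using e by (intro suminf_ennreal_eq) auto
    qed
    finally show "hausdorff_content k \<delta> (\<Union>i. A i)
      \<le> (\<Sum>i. hausdorff_content k \<delta> (A i)) + ennreal e" .
  qed
qed

lemma hausdorff_outer_mono: "A \<subseteq> B \<Longrightarrow> hausdorff_outer k A \<le> hausdorff_outer k B"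
  unfolding hausdorff_outer_def by (intro SUP_mono' hausdorff_content_mono)

lemma hausdorff_outer_empty [simp]: "hausdorff_outer k ({} :: 'a::metric_space set) = 0"
proof -
  have "hausdorff_outer k ({}::'a set) = (SUP \<delta>\<in>{0::real<..}. 0)"
    unfolding hausdorff_outer_def by (rule SUP_cong) (auto simp: hausdorff_content_empty)
  then show ?thesis by simp
qed

lemma hausdorff_outer_UN:
  "hausdorff_outer k (\<Union>i. A i) \<le> (\<Sum>i. hausdorff_outer k (A i))" for A :: "nat \<Rightarrow> _"
proof -
  have "hausdorff_content k \<delta> (\<Union>i. A i) \<le> (\<Sum>i. hausdorff_outer k (A i))" if "0 < \<delta>" for \<delta>
  proof -
    have "hausdorff_content k \<delta> (A i) \<le> hausdorff_outer k (A i)" for i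
      unfolding hausdorff_outer_def using that by (intro SUP_upper) auto
    then have "(\<Sum>i. hausdorff_content k \<delta> (A i)) \<le> (\<Sum>i. hausdorff_outer k (A i))"
      by (intro suminf_le) auto
    with hausdorff_content_UN[of k \<delta> A] show ?thesis by (rule order_trans)
  qed
  then show ?thesis by (subst hausdorff_outer_def) (auto intro!: SUP_least)
qed

lemma outer_measure_space_hausdorff: "outer_measure_space UNIV (hausdorff_outer k)"
  unfolding outer_measure_space_def positive_def increasing_def countably_subadditive_def
  by (auto intro: hausdorff_outer_mono hausdorff_outer_UN)

lemma hausdorff_outer_Un:
  "hausdorff_outer k (A \<union> B) \<le> hausdorff_outer k A + hausdorff_outer k B"
  for A B :: "'a::metric_space set"
proof -
  interpret sigma_algebra UNIV "UNIV :: 'a set set" using sigma_algebra_Pow[of "UNIV :: 'a set"] by simp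
  have "subadditive UNIV (hausdorff_outer k :: 'a set \<Rightarrow> _)"
    using outer_measure_space_hausdorff unfolding outer_measure_space_def
    by (intro countably_subadditive_subadditive) auto
  then have "hausdorff_outer k (A \<union> (B - A)) \<le> hausdorff_outer k A + hausdorff_outer k (B - A)"
    by (rule subadditiveD) auto
  also have "\<dots> \<le> hausdorff_outer k A + hausdorff_outer k B"
    by (intro add_left_mono hausdorff_outer_mono) auto
  finally show ?thesis by simp
qed

lemma measure_space_hausdorff:
  "measure_space UNIV (lambda_system UNIV UNIV (hausdorff_outer k)) (hausdorff_outer k :: 'a::metric_space set \<Rightarrow> _)"
proof -
  interpret sigma_algebra UNIV "UNIV :: 'a set set" using sigma_algebra_Pow[of "UNIV :: 'a set"] by simp
  show ?thesis by (rule caratheodory_lemma[OF outer_measure_space_hausdorff])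
qed

lemma space_hausdorff [simp]: "space (hausdorff_measure k) = UNIV"
  by (simp add: hausdorff_measure_def space_measure_of_conv)

lemma sets_hausdorff:
  "sets (hausdorff_measure k) = lambda_system UNIV UNIV (hausdorff_outer k :: 'a::metric_space set \<Rightarrow> _)"
  unfolding hausdorff_measure_def
  using measure_space_hausdorff[where 'a='a, of k]
  by (simp add: measure_space_def sets_measure_of_conv sigma_algebra.sigma_sets_eq)

lemma emeasure_hausdorff:
  "A \<in> sets (hausdorff_measure k) \<Longrightarrow> emeasure (hausdorff_measure k) A = hausdorff_outer k A"
  for A :: "'a::metric_space set"
  using measure_space_hausdorff[where 'a='a, of k] unfolding sets_hausdorff
  unfolding hausdorff_measure_def measure_space_def
  by (intro emeasure_measure_of_sigma) auto


lemma hausdorff_content_Un_separated: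
  fixes A B :: "'a::metric_space set"
  assumes sep: "\<And>x y. x \<in> A \<Longrightarrow> y \<in> B \<Longrightarrow> r \<le> dist x y" and "\<delta> < r"
  shows "hausdorff_content k \<delta> A + hausdorff_content k \<delta> B \<le> hausdorff_content k \<delta> (A \<union> B)"
  unfolding hausdorff_content_def[of k \<delta> "A \<union> B"]
proof (rule INF_greatest)
  fix C assume "C \<in> fine_covers \<delta> (A \<union> B)"
  then have cov: "A \<union> B \<subseteq> (\<Union>i. C i)" and C: "\<And>i. bounded (C i)" "\<And>i. diameter (C i) \<le> \<delta>"
    by (auto simp: fine_covers_def)
  have "0 \<le> \<delta>" using diameter_ge_0[OF C(1)[of 0]] C(2)[of 0] by simp
  define D where "D i = (if C i \<inter> A = {} then {} else C i)" for i
  define E where "E i = (if C i \<inter> A = {} then C i else {})" for i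
  have D: "D \<in> fine_covers \<delta> A"
    using cov C \<open>0 \<le> \<delta>\<close> unfolding fine_covers_def D_def by (auto split: if_splits) blast
  have "x \<in> (\<Union>i. E i)" if x: "x \<in> B" for x
  proof -
    obtain i where i: "x \<in> C i" using cov x by auto
    have "C i \<inter> A = {}"
    proof (rule ccontr)
      assume "C i \<inter> A \<noteq> {}"
      then obtain y where "y \<in> C i" "y \<in> A" by auto
      with sep[OF _ x] diameter_bounded_bound[OF C(1) _ i] C(2)[of i] \<open>\<delta> < r\<close>
      show False by fastforce
    qed
    with i show ?thesis by (auto simp: E_def)
  qed
  then have E: "E \<in> fine_covers \<delta> B"
    using C \<open>0 \<le> \<delta>\<close> by (auto simp: fine_covers_def E_def)
  have "hausdorff_content k \<delta> A + hausdorff_content k \<delta> B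
      \<le> (\<Sum>i. hausdorff_gauge k (D i)) + (\<Sum>i. hausdorff_gauge k (E i))"
    unfolding hausdorff_content_def by (intro add_mono INF_lower D E)
  also have "\<dots> = (\<Sum>i. hausdorff_gauge k (D i) + hausdorff_gauge k (E i))"
    by (rule suminf_add) auto
  also have "\<dots> = (\<Sum>i. hausdorff_gauge k (C i))"
    by (rule suminf_cong) (auto simp: D_def E_def hausdorff_gauge_def)
  finally show "hausdorff_content k \<delta> A + hausdorff_content k \<delta> B
      \<le> (\<Sum>i. hausdorff_gauge k (C i))" .
qed

lemma hausdorff_outer_Un_separated:
  fixes A B :: "'a::metric_space set"
  assumes sep: "\<And>x y. x \<in> A \<Longrightarrow> y \<in> B \<Longrightarrow> r \<le> dist x y" and "0 < r"
  shows "hausdorff_outer k A + hausdorff_outer k B \<le> hausdorff_outer k (A \<union> B)"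
proof -
  have "hausdorff_content k \<delta> A + hausdorff_content k \<epsilon> B \<le> hausdorff_outer k (A \<union> B)"
    if "0 < \<delta>" "0 < \<epsilon>" for \<delta> \<epsilon>
  proof -
    define \<eta> where "\<eta> = Min {\<delta>, \<epsilon>, r / 2}"
    have \<eta>: "0 < \<eta>" "\<eta> < r" "\<eta> \<le> \<delta>" "\<eta> \<le> \<epsilon>"
      using that \<open>0 < r\<close> by (auto simp: \<eta>_def min_def)
    have "hausdorff_content k \<delta> A + hausdorff_content k \<epsilon> B
        \<le> hausdorff_content k \<eta> A + hausdorff_content k \<eta> B"
      by (intro add_mono hausdorff_content_antimono \<eta>)
    also have "\<dots> \<le> hausdorff_content k \<eta> (A \<union> B)"
      by (rule hausdorff_content_Un_separated[OF sep \<open>\<eta> < r\<close>])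
    also have "\<dots> \<le> hausdorff_outer k (A \<union> B)"
      unfolding hausdorff_outer_def using \<eta> by (intro SUP_upper) auto
    finally show ?thesis .
  qed
  then have "hausdorff_content k \<delta> A + hausdorff_outer k B \<le> hausdorff_outer k (A \<union> B)"
    if "0 < \<delta>" for \<delta>
    unfolding hausdorff_outer_def[of k B] using that
    by (subst ennreal_SUP_add_right) (auto intro!: SUP_least)
  then show ?thesis
    unfolding hausdorff_outer_def[of k A]
    by (subst ennreal_SUP_add_left[symmetric]) (auto intro!: SUP_least)
qed

lemma closed_in_lambda_system:
  fixes E :: "'a::metric_space set"
  assumes "closed E"
  shows "E \<in> lambda_system UNIV UNIV (hausdorff_outer k)"
proof -
  have main: "hausdorff_outer k (A \<inter> E) + hausdorff_outer k (A - E) \<le> hausdorff_outer k A" for A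
  proof (cases "E = {} \<or> hausdorff_outer k A = top")
    case True
    then show ?thesis by (auto simp: top_unique)
  next
    case False
    define H where "H = (hausdorff_outer k :: 'a set \<Rightarrow> ennreal)"
    from False have "E \<noteq> {}" and fin: "H A < top" by (auto simp: H_def less_top)
    define d where "d x = infdist x E" for x
    define t where "t j = 1 / real (Suc j)" for j
    have t: "t j < t i" if "i < j" for i j
      using that by (simp add: t_def frac_less2)
    have t0: "0 < t j" for j by (simp add: t_def)
    define S where "S j = {x \<in> A. t j \<le> d x}" for j
    define R where "R j = {x \<in> A. t (Suc j) \<le> d x \<and> d x < t j}" for j
    have d_diff: "d y - d x \<le> dist x y" for x y
      using infdist_triangle[of y E x] by (simp add: d_def dist_commute)
    have alt: "(\<Sum>j<n. H (R (2 * j + p))) \<le> H A" for n p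
    proof -
      have "(\<Sum>j<n. H (R (2 * j + p))) \<le> H (\<Union>j<n. R (2 * j + p))"
      proof (induction n)
        case (Suc n)
        have sep: "t (2 * n + p - 1) - t (2 * n + p) \<le> dist y x"
          if "y \<in> (\<Union>j<n. R (2 * j + p))" "x \<in> R (2 * n + p)" for x y
        proof -
          from that(1) obtain j where j: "j < n" "t (Suc (2 * j + p)) \<le> d y" by (auto simp: R_def)
          have "t (2 * n + p - 1) \<le> t (Suc (2 * j + p))"
            using j(1) t[of "Suc (2 * j + p)" "2 * n + p - 1"]
            by (cases "Suc (2 * j + p) = 2 * n + p - 1") (auto intro: less_imp_le)
          moreover have "d x < t (2 * n + p)" using that(2) by (simp add: R_def)
          ultimately show ?thesis using d_diff[of y x] j(2) d_diff[of x y] by (simp add: dist_commute)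
        qed
        have "(\<Sum>j<Suc n. H (R (2 * j + p))) \<le> H (\<Union>j<n. R (2 * j + p)) + H (R (2 * n + p))"
          using Suc by (simp add: add_right_mono)
        also have "\<dots> \<le> H ((\<Union>j<n. R (2 * j + p)) \<union> R (2 * n + p))"
        proof (cases "n = 0")
          case True then show ?thesis by (simp add: H_def)
        next
          case False
          then have "0 < t (2 * n + p - 1) - t (2 * n + p)" using t by simp
          then show ?thesis unfolding H_def
            using sep by (intro hausdorff_outer_Un_separated) auto
        qed
        also have "(\<Union>j<n. R (2 * j + p)) \<union> R (2 * n + p) = (\<Union>j<Suc n. R (2 * j + p))"
          by (auto simp: lessThan_Suc)
        finally show ?case .
      qed simp
      also have "\<dots> \<le> H A" unfolding H_def by (rule hausdorff_outer_mono) (auto simp: R_def)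
      finally show ?thesis .
    qed
    have "(\<Sum>j<n. H (R j)) \<le> H A + H A" for n
    proof -
      have "(\<Sum>j<n. H (R j)) \<le> (\<Sum>j<2 * n. H (R j))" by (rule sum_mono2) auto
      also have "\<dots> = (\<Sum>j<n. H (R (2 * j + 0))) + (\<Sum>j<n. H (R (2 * j + 1)))"
        by (induction n) (auto simp: algebra_simps)
      also have "\<dots> \<le> H A + H A" by (intro add_mono alt)
      finally show ?thesis .
    qed
    then have "(\<Sum>j. H (R j)) \<le> H A + H A" by (intro suminf_le_const) auto
    also have "\<dots> < top" using fin by simp
    finally have finR: "(\<Sum>j. H (R j)) \<noteq> top" by simp
    have bound: "H (A \<inter> E) + H (A - E) \<le> H A + ((\<Sum>j. H (R j)) - (\<Sum>j<n. H (R j)))" for n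
    proof -
      have "A - E \<subseteq> S n \<union> (\<Union>j. R (j + n))"
      proof
        fix x assume x: "x \<in> A - E"
        have "0 < d x"
          using x \<open>closed E\<close> \<open>E \<noteq> {}\<close> by (simp add: d_def infdist_pos_not_in_closed)
        then obtain m where m: "t m < d x"
          using reals_Archimedean unfolding t_def inverse_eq_divide by blast
        define l where "l = (LEAST m. t m \<le> d x)"
        have l: "t l \<le> d x" using LeastI[of "\<lambda>i. t i \<le> d x" m] m by (simp add: l_def)
        have l': "d x < t i" if "i < l" for i
          using not_less_Least[OF that[unfolded l_def]] by simp
        show "x \<in> S n \<union> (\<Union>j. R (j + n))"
        proof (cases "l \<le> n")
          case True
          then have "t n \<le> t l" using t[of l n] by (cases "l = n") auto
          with l x show ?thesis by (auto simp: S_def)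
        next
          case False
          then have "x \<in> R ((l - Suc n) + n)" using l l' x by (simp add: R_def Suc_diff_Suc)
          then show ?thesis by blast
        qed
      qed
      then have "H (A - E) \<le> H (S n \<union> (\<Union>j. R (j + n)))"
        unfolding H_def by (rule hausdorff_outer_mono)
      also have "\<dots> \<le> H (S n) + H (\<Union>j. R (j + n))"
        unfolding H_def by (rule hausdorff_outer_Un)
      also have "\<dots> \<le> H (S n) + (\<Sum>j. H (R (j + n)))"
        unfolding H_def by (intro add_left_mono hausdorff_outer_UN)
      also have "(\<Sum>j. H (R (j + n))) = (\<Sum>j. H (R j)) - (\<Sum>j<n. H (R j))"
      proof -
        have "(\<Sum>j. H (R j)) = (\<Sum>j. H (R (j + n))) + (\<Sum>j<n. H (R j))"
          by (rule suminf_offset) simp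
        moreover have "(\<Sum>j<n. H (R j)) \<noteq> top"
          using finR calculation by auto
        ultimately show ?thesis by simp
      qed
      finally have "H (A \<inter> E) + H (A - E)
          \<le> (H (A \<inter> E) + H (S n)) + ((\<Sum>j. H (R j)) - (\<Sum>j<n. H (R j)))"
        by (simp add: add.assoc add_left_mono)
      also have "H (A \<inter> E) + H (S n) \<le> H ((A \<inter> E) \<union> S n)"
        unfolding H_def
      proof (rule hausdorff_outer_Un_separated[OF _ t0[of n]])
        fix x y assume "x \<in> A \<inter> E" "y \<in> S n"
        then show "t n \<le> dist x y"
          using infdist_le[of x E y] by (auto simp: S_def d_def dist_commute)
      qed
      also have "\<dots> \<le> H A" unfolding H_def by (rule hausdorff_outer_mono) (auto simp: S_def)
      finally show ?thesis by (simp add: add_right_mono)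
    qed
    have "(\<lambda>n. H A + ((\<Sum>j. H (R j)) - (\<Sum>j<n. H (R j))))
        \<longlonglongrightarrow> H A + ((\<Sum>j. H (R j)) - (\<Sum>j. H (R j)))"
      using finR by (intro tendsto_add tendsto_diff_ennreal tendsto_const summable_LIMSEQ summableI) auto
    then have "(\<lambda>n. H A + ((\<Sum>j. H (R j)) - (\<Sum>j<n. H (R j)))) \<longlonglongrightarrow> H A"
      using finR by (simp add: less_top)
    then have "H (A \<inter> E) + H (A - E) \<le> H A"
      by (rule LIMSEQ_le_const) (use bound in auto)
    then show ?thesis by (simp add: H_def)
  qed
  have "hausdorff_outer k (E \<inter> A) + hausdorff_outer k ((UNIV - E) \<inter> A) = hausdorff_outer k A" for A
  proof (rule antisym)
    show "hausdorff_outer k (E \<inter> A) + hausdorff_outer k ((UNIV - E) \<inter> A) \<le> hausdorff_outer k A"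
      using main[of A] by (simp add: Int_commute Diff_eq)
    have "A = (E \<inter> A) \<union> ((UNIV - E) \<inter> A)" by auto
    then show "hausdorff_outer k A \<le> hausdorff_outer k (E \<inter> A) + hausdorff_outer k ((UNIV - E) \<inter> A)"
      using hausdorff_outer_Un by metis
  qed
  then show ?thesis by (simp add: lambda_system_def)
qed

lemma borel_subset_sets_hausdorff: "sets borel \<subseteq> sets (hausdorff_measure k :: 'a::metric_space measure)"
proof -
  have "sets (borel :: 'a::metric_space measure) = sigma_sets UNIV (Collect closed)"
    by (simp add: borel_eq_closed)
  also have "\<dots> \<subseteq> sets (hausdorff_measure k :: 'a measure)"
    using sets.sigma_sets_subset[of "Collect closed" "hausdorff_measure k :: 'a measure"]
    using closed_in_lambda_system unfolding sets_hausdorff by auto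
  finally show ?thesis .
qed


section \<open>Bounded Lipschitz domains\<close>

text \<open>
  Near each boundary point the domain is the strict epigraph of a Lipschitz function over the
  hyperplane orthogonal to some unit vector \<open>e\<close>.
\<close>

definition lipschitz_boundary :: "'a::euclidean_space set \<Rightarrow> bool" where
  "lipschitz_boundary \<Omega> \<longleftrightarrow>
     (\<forall>x\<in>frontier \<Omega>. \<exists>r>0. \<exists>e L. \<exists>g :: 'a \<Rightarrow> real. norm e = 1 \<and>
        L-lipschitz_on {z. z \<bullet> e = 0} g \<and>
        (\<forall>y\<in>ball x r. y \<in> \<Omega> \<longleftrightarrow> g (y - (y \<bullet> e) *\<^sub>R e) < y \<bullet> e))"

definition bounded_lipschitz_domain :: "'a::euclidean_space set \<Rightarrow> bool" where
  "bounded_lipschitz_domain \<Omega> \<longleftrightarrow>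
     open \<Omega> \<and> connected \<Omega> \<and> \<Omega> \<noteq> {} \<and> bounded \<Omega> \<and> lipschitz_boundary \<Omega>"

definition boundary_measure :: "'a::euclidean_space set \<Rightarrow> 'a measure" where
  "boundary_measure \<Omega> = restrict_space (hausdorff_measure (DIM('a) - 1)) (frontier \<Omega>)"

text \<open>
  \<open>\<nu>\<close> is the outward unit normal at \<open>x\<close> if the boundary has a tangent hyperplane at \<open>x\<close>,
  orthogonal to \<open>\<nu>\<close>, with \<open>\<Omega>\<close> on the side of \<open>- \<nu>\<close>. There is at most one such \<open>\<nu>\<close>, and on a
  Lipschitz boundary it exists almost everywhere, since the local graph functions are almost
  everywhere differentiable.
\<close>

definition outward_unit_normal :: "'a::euclidean_space set \<Rightarrow> 'a \<Rightarrow> 'a \<Rightarrow> bool" where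
  "outward_unit_normal \<Omega> x \<nu> \<longleftrightarrow> norm \<nu> = 1 \<and>
     (\<forall>\<epsilon>>0. \<exists>r>0. \<forall>y\<in>ball x r.
        ((y - x) \<bullet> \<nu> < - \<epsilon> * norm (y - x) \<longrightarrow> y \<in> \<Omega>) \<and>
        ((y - x) \<bullet> \<nu> > \<epsilon> * norm (y - x) \<longrightarrow> y \<notin> closure \<Omega>))"

lemma outward_unit_normal_unique:
  assumes "outward_unit_normal \<Omega> x \<mu>" "outward_unit_normal \<Omega> x \<nu>"
  shows "\<mu> = \<nu>"
proof (rule ccontr)
  assume neq: "\<mu> \<noteq> \<nu>"
  define z where "z = \<nu> - \<mu>"
  define c where "c = 1 - \<mu> \<bullet> \<nu>"
  have unit: "\<mu> \<bullet> \<mu> = 1" "\<nu> \<bullet> \<nu> = 1"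
    using assms by (auto simp: outward_unit_normal_def norm_eq_1)
  then have z: "z \<bullet> \<mu> = - c" "z \<bullet> \<nu> = c" "z \<bullet> z = 2 * c"
    by (auto simp: z_def c_def inner_diff inner_commute)
  have "0 < z \<bullet> z" using neq by (simp add: z_def)
  then have c: "0 < c" and nz: "0 < norm z" using z by auto
  define \<epsilon> where "\<epsilon> = c / (2 * norm z)"
  have \<epsilon>: "0 < \<epsilon>" "\<epsilon> * norm z = c / 2" using c nz by (auto simp: \<epsilon>_def)
  obtain r where r: "0 < r" "\<And>y. y \<in> ball x r \<Longrightarrow> (y - x) \<bullet> \<mu> < - \<epsilon> * norm (y - x) \<Longrightarrow> y \<in> \<Omega>"
    using assms(1) \<epsilon>(1) unfolding outward_unit_normal_def by metis
  obtain q where q: "0 < q" "\<And>y. y \<in> ball x q \<Longrightarrow> (y - x) \<bullet> \<nu> > \<epsilon> * norm (y - x) \<Longrightarrow> y \<notin> closure \<Omega>"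
    using assms(2) \<epsilon>(1) unfolding outward_unit_normal_def by metis
  define s where "s = min r q / (2 * norm z)"
  have s: "0 < s" "s * norm z < r" "s * norm z < q"
    using r(1) q(1) nz by (auto simp: s_def min_def field_simps)
  define y where "y = x + s *\<^sub>R z"
  have y: "y \<in> ball x r" "y \<in> ball x q" using s by (auto simp: y_def dist_norm)
  have yx: "(y - x) \<bullet> \<mu> = - (s * c)" "(y - x) \<bullet> \<nu> = s * c" using z by (simp_all add: y_def)
  have "\<epsilon> * norm (y - x) = s * (\<epsilon> * norm z)" using s(1) by (simp add: y_def)
  also have "\<dots> < s * c" unfolding \<epsilon>(2) using s(1) c by simp
  finally have "\<epsilon> * norm (y - x) < s * c" .
  then have "y \<in> \<Omega>" "y \<notin> closure \<Omega>"
    using r(2)[OF y(1)] q(2)[OF y(2)] yx by simp_all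
  then show False using closure_subset by auto
qed


section \<open>Lebesgue and Sobolev spaces\<close>

text \<open>
  Elements of all function spaces are represented by functions, with equality almost everywhere on
  the underlying set in place of equality; values outside that set are irrelevant.
\<close>

definition L2_space :: "'a::euclidean_space set \<Rightarrow> ('a \<Rightarrow> real) set" where
  "L2_space S = {u \<in> borel_measurable (lebesgue_on S). integrable (lebesgue_on S) (\<lambda>x. (u x)\<^sup>2)}"

definition L2_norm :: "'a::euclidean_space set \<Rightarrow> ('a \<Rightarrow> real) \<Rightarrow> real" where
  "L2_norm S u = sqrt (LINT x|lebesgue_on S. (u x)\<^sup>2)"

definition partial_deriv :: "'a::euclidean_space \<Rightarrow> ('a \<Rightarrow> real) \<Rightarrow> 'a \<Rightarrow> real" where
  "partial_deriv b \<phi> x = frechet_derivative \<phi> (at x) b"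

primrec C_fun :: "nat \<Rightarrow> ('a::euclidean_space \<Rightarrow> real) \<Rightarrow> bool" where
  "C_fun 0 \<phi> \<longleftrightarrow> continuous_on UNIV \<phi>"
| "C_fun (Suc k) \<phi> \<longleftrightarrow>
     (\<forall>x. \<phi> differentiable (at x)) \<and> (\<forall>b\<in>Basis. C_fun k (partial_deriv b \<phi>))"

definition smooth_fun :: "('a::euclidean_space \<Rightarrow> real) \<Rightarrow> bool" where
  "smooth_fun \<phi> \<longleftrightarrow> (\<forall>k. C_fun k \<phi>)"

definition test_fun :: "'a::euclidean_space set \<Rightarrow> ('a \<Rightarrow> real) \<Rightarrow> bool" where
  "test_fun S \<phi> \<longleftrightarrow> smooth_fun \<phi> \<and> (\<exists>K. compact K \<and> K \<subseteq> S \<and> (\<forall>x. x \<notin> K \<longrightarrow> \<phi> x = 0))"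

definition has_weak_partial ::
    "'a::euclidean_space set \<Rightarrow> 'a \<Rightarrow> ('a \<Rightarrow> real) \<Rightarrow> ('a \<Rightarrow> real) \<Rightarrow> bool" where
  "has_weak_partial \<Omega> b u w \<longleftrightarrow>
     (\<forall>\<phi>. test_fun \<Omega> \<phi> \<longrightarrow>
        (LINT x|lebesgue_on \<Omega>. u x * partial_deriv b \<phi> x) = - (LINT x|lebesgue_on \<Omega>. w x * \<phi> x))"

text \<open>Some representative of the weak derivative, which is unique almost everywhere on \<open>\<Omega>\<close>.\<close>

definition weak_partial :: "'a::euclidean_space set \<Rightarrow> 'a \<Rightarrow> ('a \<Rightarrow> real) \<Rightarrow> 'a \<Rightarrow> real" where
  "weak_partial \<Omega> b u = (SOME w. w \<in> L2_space \<Omega> \<and> has_weak_partial \<Omega> b u w)"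

definition sobolev_H1 :: "'a::euclidean_space set \<Rightarrow> ('a \<Rightarrow> real) set" where
  "sobolev_H1 \<Omega> = {u \<in> L2_space \<Omega>. \<forall>b\<in>Basis. \<exists>w\<in>L2_space \<Omega>. has_weak_partial \<Omega> b u w}"

definition H1_norm :: "'a::euclidean_space set \<Rightarrow> ('a \<Rightarrow> real) \<Rightarrow> real" where
  "H1_norm \<Omega> u = sqrt ((L2_norm \<Omega> u)\<^sup>2 + (\<Sum>b\<in>Basis. (L2_norm \<Omega> (weak_partial \<Omega> b u))\<^sup>2))"

definition sobolev_H2 :: "'a::euclidean_space set \<Rightarrow> ('a \<Rightarrow> real) set" where
  "sobolev_H2 \<Omega> = {u \<in> sobolev_H1 \<Omega>. \<forall>b\<in>Basis. weak_partial \<Omega> b u \<in> sobolev_H1 \<Omega>}"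

definition H2_norm :: "'a::euclidean_space set \<Rightarrow> ('a \<Rightarrow> real) \<Rightarrow> real" where
  "H2_norm \<Omega> u = sqrt ((L2_norm \<Omega> u)\<^sup>2 + (\<Sum>b\<in>Basis. (L2_norm \<Omega> (weak_partial \<Omega> b u))\<^sup>2)
     + (\<Sum>b\<in>Basis. \<Sum>c\<in>Basis. (L2_norm \<Omega> (weak_partial \<Omega> c (weak_partial \<Omega> b u)))\<^sup>2))"

definition laplacian :: "'a::euclidean_space set \<Rightarrow> ('a \<Rightarrow> real) \<Rightarrow> 'a \<Rightarrow> real" where
  "laplacian \<Omega> u x = (\<Sum>b\<in>Basis. weak_partial \<Omega> b (weak_partial \<Omega> b u) x)"

text \<open>
  The trace operator \<open>H\<^sup>1(\<Omega>) \<rightarrow> L\<^sup>2(\<Gamma>)\<close> is the continuous extension of the restriction map from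
  functions smooth up to the boundary, which are dense in \<open>H\<^sup>1(\<Omega>)\<close> when \<open>\<Omega>\<close> is a bounded Lipschitz
  domain. The relation says that \<open>g\<close> represents the trace of \<open>u\<close>.
\<close>

definition has_trace :: "'a::euclidean_space set \<Rightarrow> ('a \<Rightarrow> real) \<Rightarrow> ('a \<Rightarrow> real) \<Rightarrow> bool" where
  "has_trace \<Omega> u g \<longleftrightarrow> u \<in> sobolev_H1 \<Omega> \<and> g \<in> borel_measurable (boundary_measure \<Omega>) \<and>
     (\<exists>\<phi> :: nat \<Rightarrow> 'a \<Rightarrow> real. (\<forall>i. smooth_fun (\<phi> i)) \<and>
        (\<lambda>i. H1_norm \<Omega> (\<lambda>x. \<phi> i x - u x)) \<longlonglongrightarrow> 0 \<and>
        (\<lambda>i. \<integral>\<^sup>+ x. ennreal ((\<phi> i x - g x)\<^sup>2) \<partial>boundary_measure \<Omega>) \<longlonglongrightarrow> 0)"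

definition has_gradient_trace ::
    "'a::euclidean_space set \<Rightarrow> ('a \<Rightarrow> real) \<Rightarrow> ('a \<Rightarrow> 'a) \<Rightarrow> bool" where
  "has_gradient_trace \<Omega> u G \<longleftrightarrow> (\<forall>b\<in>Basis. has_trace \<Omega> (weak_partial \<Omega> b u) (\<lambda>x. G x \<bullet> b))"

definition space_V :: "'a::euclidean_space set \<Rightarrow> 'a set \<Rightarrow> ('a \<Rightarrow> real) set" where
  "space_V \<Omega> \<Gamma>\<^sub>D = {v \<in> sobolev_H1 \<Omega>.
     \<exists>g. has_trace \<Omega> v g \<and> (AE x in boundary_measure \<Omega>. x \<in> \<Gamma>\<^sub>D \<longrightarrow> g x = 0)}"

definition space_X :: "'a::euclidean_space set \<Rightarrow> 'a set \<Rightarrow> ('a \<Rightarrow> real) set" where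
  "space_X \<Omega> \<Gamma>\<^sub>N = {v \<in> sobolev_H2 \<Omega>.
     \<exists>G. has_gradient_trace \<Omega> v G \<and>
         (AE x in boundary_measure \<Omega>. x \<in> \<Gamma>\<^sub>N \<longrightarrow> (\<exists>\<nu>. outward_unit_normal \<Omega> x \<nu> \<and> G x \<bullet> \<nu> = 0))}"


section \<open>Functions of time with values in a function space\<close>

text \<open>
  The spaces above are not types, so Bochner measurability and the Bochner integral are set up for a
  linear space \<open>Y\<close> of functions with a seminorm \<open>N\<close>, over a finite measure space \<open>M\<close>.
\<close>

definition simple_fun_in ::
    "'t measure \<Rightarrow> ('a \<Rightarrow> real) set \<Rightarrow> ('t \<Rightarrow> 'a \<Rightarrow> real) \<Rightarrow> bool" where
  "simple_fun_in M Y s \<longleftrightarrow> simple_function M s \<and> s ` space M \<subseteq> Y"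

definition bochner_measurable ::
    "'t measure \<Rightarrow> ('a \<Rightarrow> real) set \<Rightarrow> (('a \<Rightarrow> real) \<Rightarrow> real) \<Rightarrow> ('t \<Rightarrow> 'a \<Rightarrow> real) \<Rightarrow> bool" where
  "bochner_measurable M Y N F \<longleftrightarrow> (AE t in M. F t \<in> Y) \<and>
     (\<exists>s :: nat \<Rightarrow> 't \<Rightarrow> 'a \<Rightarrow> real. (\<forall>i. simple_fun_in M Y (s i)) \<and>
        (AE t in M. (\<lambda>i. N (\<lambda>x. s i t x - F t x)) \<longlonglongrightarrow> 0))"

definition simple_integral_in :: "'t measure \<Rightarrow> ('t \<Rightarrow> 'a \<Rightarrow> real) \<Rightarrow> 'a \<Rightarrow> real" where
  "simple_integral_in M s x = (\<Sum>y\<in>s ` space M. measure M {t \<in> space M. s t = y} * y x)"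

definition has_bochner_integral_in ::
    "'t measure \<Rightarrow> ('a \<Rightarrow> real) set \<Rightarrow> (('a \<Rightarrow> real) \<Rightarrow> real) \<Rightarrow>
     ('t \<Rightarrow> 'a \<Rightarrow> real) \<Rightarrow> ('a \<Rightarrow> real) \<Rightarrow> bool" where
  "has_bochner_integral_in M Y N F I \<longleftrightarrow> I \<in> Y \<and> bochner_measurable M Y N F \<and>
     (\<exists>s :: nat \<Rightarrow> 't \<Rightarrow> 'a \<Rightarrow> real. (\<forall>i. simple_fun_in M Y (s i)) \<and>
        (\<lambda>i. \<integral>\<^sup>+ t. ennreal (N (\<lambda>x. s i t x - F t x)) \<partial>M) \<longlonglongrightarrow> 0 \<and>
        (\<lambda>i. N (\<lambda>x. simple_integral_in M (s i) x - I x)) \<longlonglongrightarrow> 0)"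

definition bochner_L2 ::
    "real \<Rightarrow> ('a \<Rightarrow> real) set \<Rightarrow> (('a \<Rightarrow> real) \<Rightarrow> real) \<Rightarrow> (real \<Rightarrow> 'a \<Rightarrow> real) set" where
  "bochner_L2 T Y N = {u. bochner_measurable (lebesgue_on {0<..<T}) Y N u \<and>
     integrable (lebesgue_on {0<..<T}) (\<lambda>t. (N (u t))\<^sup>2)}"

definition continuous_L2_valued ::
    "real \<Rightarrow> 'a::euclidean_space set \<Rightarrow> (real \<Rightarrow> 'a \<Rightarrow> real) \<Rightarrow> bool" where
  "continuous_L2_valued T \<Omega> u \<longleftrightarrow> (\<forall>t\<in>{0..T}. u t \<in> L2_space \<Omega> \<and>
     ((\<lambda>s. L2_norm \<Omega> (\<lambda>x. u s x - u t x)) \<longlongrightarrow> 0) (at t within {0..T}))"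

text \<open>
  \<open>u \<in> W\<^sup>1\<^sup>,\<^sup>2(0,T;L\<^sup>2(\<Omega>))\<close> with weak derivative \<open>d\<close>: the Bochner integrals of \<open>\<phi>' u\<close> and \<open>\<phi> d\<close> are
  opposite for all test functions \<open>\<phi>\<close>.
\<close>

definition has_W12_deriv ::
    "real \<Rightarrow> 'a::euclidean_space set \<Rightarrow> (real \<Rightarrow> 'a \<Rightarrow> real) \<Rightarrow> (real \<Rightarrow> 'a \<Rightarrow> real) \<Rightarrow> bool" where
  "has_W12_deriv T \<Omega> u d \<longleftrightarrow>
     u \<in> bochner_L2 T (L2_space \<Omega>) (L2_norm \<Omega>) \<and> d \<in> bochner_L2 T (L2_space \<Omega>) (L2_norm \<Omega>) \<and>
     (\<forall>\<phi>. test_fun {0<..<T} \<phi> \<longrightarrow>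
        (\<exists>I. has_bochner_integral_in (lebesgue_on {0<..<T}) (L2_space \<Omega>) (L2_norm \<Omega>)
               (\<lambda>t x. deriv \<phi> t * u t x) I \<and>
             has_bochner_integral_in (lebesgue_on {0<..<T}) (L2_space \<Omega>) (L2_norm \<Omega>)
               (\<lambda>t x. \<phi> t * d t x) (\<lambda>x. - I x)))"

text \<open>
  The identification of \<open>L\<^sup>2(0,T;L\<^sup>2(\<Omega>))\<close> with \<open>L\<^sup>2(Q\<^sub>T)\<close>: the function \<open>w\<close> on \<open>Q\<^sub>T\<close> represents
  \<open>t \<mapsto> F t\<close>.
\<close>

definition represents_on_QT ::
    "real \<Rightarrow> 'a::euclidean_space set \<Rightarrow> (real \<Rightarrow> 'a \<Rightarrow> real) \<Rightarrow> ('a \<times> real \<Rightarrow> real) \<Rightarrow> bool" where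
  "represents_on_QT T \<Omega> F w \<longleftrightarrow> w \<in> L2_space (\<Omega> \<times> {0<..<T}) \<and>
     (AE t in lebesgue_on {0<..<T}. AE x in lebesgue_on \<Omega>. w (x, t) = F t x)"


section \<open>Strong solutions\<close>

definition strong_solution ::
    "'a::euclidean_space set \<Rightarrow> 'a set \<Rightarrow> 'a set \<Rightarrow> real \<Rightarrow> ('a \<Rightarrow> real) \<Rightarrow> ('a \<times> real \<Rightarrow> real) \<Rightarrow>
     (real \<Rightarrow> 'a \<Rightarrow> real) \<Rightarrow> bool" where
  "strong_solution \<Omega> \<Gamma>\<^sub>D \<Gamma>\<^sub>N T u\<^sub>0 f u \<longleftrightarrow>
     continuous_L2_valued T \<Omega> u \<and>
     u \<in> bochner_L2 T (space_X \<Omega> \<Gamma>\<^sub>N \<inter> space_V \<Omega> \<Gamma>\<^sub>D) (H2_norm \<Omega>) \<and>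
     (\<exists>d u\<^sub>t lap. has_W12_deriv T \<Omega> u d \<and>
        represents_on_QT T \<Omega> d u\<^sub>t \<and> represents_on_QT T \<Omega> (\<lambda>t. laplacian \<Omega> (u t)) lap \<and>
        (AE z in lebesgue_on (\<Omega> \<times> {0<..<T}). u\<^sub>t z = max (lap z + f z) 0)) \<and>
     (AE x in lebesgue_on \<Omega>. u 0 x = u\<^sub>0 x)"

end

theory Submission
  imports Defs
begin

text \<open>
  Let \<open>u\<close> and \<open>v\<close> be two solutions and \<open>w = u - v\<close>. Monotonicity of the positive part gives
  \<open>(\<partial>\<^sub>t w)\<^sup>2 \<le> \<partial>\<^sub>t w \<Delta> w\<close>, while formally \<open>\<integral> \<partial>\<^sub>t w \<Delta> w = - (1/2) d/dt \<integral> |\<nabla> w|\<^sup>2\<close>, so that \<open>\<partial>\<^sub>t w = 0\<close>. Instead of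
  a chain rule only the convexity of the Dirichlet energy is used, applied at the times \<open>t - h\<close> and \<open>t\<close>
  and integrated over \<open>t\<close>, with \<open>w\<close> extended by \<open>0\<close> to negative times; then \<open>h\<close> tends to \<open>0\<close>.

  This needs Green's formula without boundary terms for functions in \<open>X\<close> and \<open>V\<close>. By approximation it
  suffices to bound \<open>|\<integral> div F|\<close> over \<open>\<Omega>\<close> by a multiple of the boundary integral of \<open>h\<close> if, at almost
  every boundary point, \<open>|F| \<le> h\<close> or \<open>|F \<bullet> \<nu>| \<le> h\<close>. Neither local charts nor the area formula are
  needed for this: \<open>F\<close> is cut off near a cover of the boundary by small balls that is nearly optimal for
  the Hausdorff measure, with cut-off functions which near a point with a normal \<open>\<nu>\<close> are constant along
  the tangent plane, up to a small error.
\<close>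

section \<open>Functions of class \<open>C\<^sup>k\<close>\<close>

text \<open>Nothing is known about a time derivative of the gradient of a solution, and a solution
  lies in the spaces of Green's formula only at almost every time; this is why two separate times
  are compared. Because the initial data agree, the extension by 0 turns the comparison into an
  inequality valid for almost every real \<open>t\<close>. The energy is 0 outside (0, T) and enters
  as the difference of its values at \<open>t - h\<close> and \<open>t\<close>, so its contribution
  integrates to 0 over the line. On the boundary any constant will do: the flux bound is applied to
  products of smooth approximations of the two functions in Green's formula, for which the integral
  of the bound tends to 0. The scale of the caps is dictated by cancellation: thinning a cap by
  \<open>\<epsilon>\<close> divides its volume and multiplies its normal derivative by the same
  factor, so what is left is the field's normal component times \<open>r ^ (n - 1)\<close>, the
  scale of the boundary measure.\<close>

lemma partial_deriv_eq:
  assumes "(f has_derivative f') (at x)"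
  shows "partial_deriv b f x = f' b"
  using frechet_derivative_at[OF assms] by (simp add: partial_deriv_def)

lemma C_fun_differentiable: "C_fun (Suc k) f \<Longrightarrow> f differentiable (at x)"
  by simp

lemma C_fun_continuous: "C_fun k f \<Longrightarrow> continuous_on UNIV f"
  by (cases k) (auto simp: differentiable_imp_continuous_on differentiable_on_def)

lemma C_fun_lower: "C_fun (Suc k) f \<Longrightarrow> C_fun k f"
proof (induction k arbitrary: f)
  case 0
  then show ?case using C_fun_continuous[of "Suc 0" f] by (simp del: C_fun.simps(2))
next
  case (Suc k)
  have "C_fun (Suc k) (partial_deriv b f)" if "b \<in> Basis" for b
    using Suc.prems that by (subst (asm) C_fun.simps(2)) blast
  then have "C_fun k (partial_deriv b f)" if "b \<in> Basis" for b
    using Suc.IH that by blast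
  then show ?case using C_fun_differentiable[OF Suc.prems] by simp
qed

lemma partial_deriv_add:
  "f differentiable (at x) \<Longrightarrow> g differentiable (at x) \<Longrightarrow>
    partial_deriv b (\<lambda>x. f x + g x) x = partial_deriv b f x + partial_deriv b g x"
  by (rule partial_deriv_eq[THEN trans, OF has_derivative_add])
    (auto simp: partial_deriv_def frechet_derivative_works)

lemma partial_deriv_mult:
  fixes f g :: "'a::euclidean_space \<Rightarrow> real"
  shows "f differentiable (at x) \<Longrightarrow> g differentiable (at x) \<Longrightarrow>
    partial_deriv b (\<lambda>x. f x * g x) x = f x * partial_deriv b g x + partial_deriv b f x * g x"
  by (rule partial_deriv_eq[THEN trans, OF has_derivative_mult])
    (auto simp: partial_deriv_def frechet_derivative_works)

lemma partial_deriv_const: "partial_deriv b (\<lambda>x. c) x = 0"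
  by (rule partial_deriv_eq[THEN trans, OF has_derivative_const]) simp

lemma C_fun_const: "C_fun k (\<lambda>x. c)"
proof (induction k arbitrary: c)
  case (Suc k)
  have "partial_deriv b (\<lambda>x::'a. c) = (\<lambda>x. 0)" for b
    by (rule ext) (rule partial_deriv_const)
  then show ?case using Suc by simp
qed simp

lemma C_fun_add: "C_fun k f \<Longrightarrow> C_fun k g \<Longrightarrow> C_fun k (\<lambda>x. f x + g x)"
proof (induction k arbitrary: f g)
  case (Suc k)
  then have "partial_deriv b (\<lambda>x. f x + g x) = (\<lambda>x. partial_deriv b f x + partial_deriv b g x)" for b
    by (intro ext partial_deriv_add) auto
  then show ?case using Suc by auto
qed (simp add: continuous_on_add)

lemma C_fun_mult: "C_fun k f \<Longrightarrow> C_fun k g \<Longrightarrow> C_fun k (\<lambda>x. f x * g x)"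
proof (induction k arbitrary: f g)
  case (Suc k)
  then have "partial_deriv b (\<lambda>x. f x * g x) = (\<lambda>x. f x * partial_deriv b g x + partial_deriv b f x * g x)" for b
    by (intro ext partial_deriv_mult) auto
  moreover have "C_fun k f" "C_fun k g" using Suc.prems C_fun_lower by blast+
  ultimately show ?case using Suc by (auto intro!: C_fun_add)
qed (simp add: continuous_on_mult)

lemma C_fun_uminus: "C_fun k f \<Longrightarrow> C_fun k (\<lambda>x. - f x)"
  using C_fun_mult[OF C_fun_const, of k f "-1"] by simp

lemma C_fun_diff: "C_fun k f \<Longrightarrow> C_fun k g \<Longrightarrow> C_fun k (\<lambda>x. f x - g x)"
  using C_fun_add[OF _ C_fun_uminus, of k f g] by simp

lemma C_fun_prod: "(\<And>i. i \<in> I \<Longrightarrow> C_fun k (f i)) \<Longrightarrow> C_fun k (\<lambda>x. \<Prod>i\<in>I. f i x)"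
  by (induction I rule: infinite_finite_induct) (auto intro: C_fun_const C_fun_mult)

lemma smooth_fun_C_fun: "smooth_fun f \<Longrightarrow> C_fun k f"
  by (simp add: smooth_fun_def)

lemma smooth_fun_partial_deriv: "smooth_fun f \<Longrightarrow> b \<in> Basis \<Longrightarrow> smooth_fun (partial_deriv b f)"
  unfolding smooth_fun_def by (metis C_fun.simps(2))

section \<open>Difference quotients and integrals of derivatives\<close>

lemma has_real_derivative_along_line:
  fixes k :: "'a::euclidean_space \<Rightarrow> real"
  assumes diff: "k differentiable (at (x + t *\<^sub>R b))"
  shows "((\<lambda>t. k (x + t *\<^sub>R b)) has_real_derivative partial_deriv b k (x + t *\<^sub>R b)) (at t)"
proof -
  have "(k has_derivative frechet_derivative k (at (x + t *\<^sub>R b))) (at (x + t *\<^sub>R b))"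
    using diff frechet_derivative_works by blast
  moreover have "((\<lambda>t. x + t *\<^sub>R b) has_derivative (\<lambda>t. t *\<^sub>R b)) (at t)"
    by (auto intro!: derivative_eq_intros)
  ultimately have "((\<lambda>t. k (x + t *\<^sub>R b)) has_derivative
      (\<lambda>s. frechet_derivative k (at (x + t *\<^sub>R b)) (s *\<^sub>R b))) (at t)"
    by (rule has_derivative_compose[rotated])
  then show ?thesis
    using linear_scale[OF linear_frechet_derivative[OF diff]]
    by (simp add: has_field_derivative_def partial_deriv_def mult.commute[of _ "frechet_derivative _ _ _"])
qed

lemma partial_deriv_bound_diff:
  fixes k :: "'a::euclidean_space \<Rightarrow> real"
  assumes diff: "\<And>x. k differentiable (at x)" and bnd: "\<And>x. \<bar>partial_deriv b k x\<bar> \<le> M"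
  shows "\<bar>k (x + s *\<^sub>R b) - k x\<bar> \<le> M * \<bar>s\<bar>"
proof -
  have der: "((\<lambda>t. k (x + t *\<^sub>R b)) has_real_derivative partial_deriv b k (x + t *\<^sub>R b)) (at t)" for t
    by (rule has_real_derivative_along_line[OF diff])
  have "norm (k (x + s *\<^sub>R b) - k (x + 0 *\<^sub>R b)) \<le> M * norm (s - 0)"
    by (rule field_differentiable_bound[where S=UNIV and f="\<lambda>t. k (x + t *\<^sub>R b)"]) (use der bnd in auto)
  then show ?thesis by simp
qed

lemma partial_deriv_LIMSEQ:
  fixes k :: "'a::euclidean_space \<Rightarrow> real"
  assumes diff: "k differentiable (at x)"
  shows "(\<lambda>n. real (Suc n) * (k (x + (1 / real (Suc n)) *\<^sub>R b) - k x)) \<longlonglongrightarrow> partial_deriv b k x"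
proof -
  have "((\<lambda>t. k (x + t *\<^sub>R b)) has_real_derivative partial_deriv b k x) (at 0)"
    using has_real_derivative_along_line[of k x 0 b] diff by simp
  then have "((\<lambda>h. (k (x + h *\<^sub>R b) - k x) / h) \<longlongrightarrow> partial_deriv b k x) (at 0)"
    by (simp add: DERIV_def)
  moreover have "filterlim (\<lambda>n. 1 / real (Suc n)) (at 0) sequentially"
    unfolding filterlim_at using LIMSEQ_inverse_real_of_nat by (auto simp: inverse_eq_divide)
  ultimately have "(\<lambda>n. (k (x + (1 / real (Suc n)) *\<^sub>R b) - k x) / (1 / real (Suc n))) \<longlonglongrightarrow> partial_deriv b k x"
    by (rule filterlim_compose)
  then show ?thesis by (simp add: mult.commute)
qed

text \<open>The derivative is a pointwise limit of difference quotients, each of which is Borel.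
  This will cover functions extended by 0 from a domain, whose derivatives are controlled only in
  size.\<close>

lemma differentiable_imp_borel_measurable:
  fixes k :: "'a::euclidean_space \<Rightarrow> real"
  assumes diff: "\<And>x. k differentiable (at x)"
  shows "k \<in> borel_measurable borel" "partial_deriv b k \<in> borel_measurable borel"
proof -
  show k: "k \<in> borel_measurable borel"
    by (intro borel_measurable_continuous_onI)
      (use diff in \<open>auto simp: differentiable_imp_continuous_on differentiable_on_def\<close>)
  show "partial_deriv b k \<in> borel_measurable borel"
    by (rule borel_measurable_LIMSEQ_real[OF partial_deriv_LIMSEQ[OF diff]])
      (use k in measurable)
qed

lemma integrable_indicator_cball: "integrable lborel (\<lambda>y. indicat_real (cball x R) y *\<^sub>R M)"
  for x :: "'a::euclidean_space" and M :: real
proof -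
  have "emeasure lborel (cball x R) < \<infinity>" by (rule emeasure_bounded_finite) simp
  then have "integrable lborel (indicat_real (cball x R))" by (intro integrable_real_indicator) simp_all
  then show ?thesis by (rule integrable_scaleR_left)
qed

text \<open>Translation invariance of Lebesgue measure makes the integral of every difference
  quotient vanish. By the mean value inequality the bound on the derivative dominates the quotients,
  so the limit passes under the integral.\<close>

lemma integral_partial_deriv_eq_0:
  fixes k :: "'a::euclidean_space \<Rightarrow> real"
  assumes diff: "\<And>x. k differentiable (at x)" and bnd: "\<And>x. \<bar>partial_deriv b k x\<bar> \<le> M"
    and supp: "\<And>x. x \<notin> cball 0 R \<Longrightarrow> k x = 0"
  shows "(LINT x|lborel. partial_deriv b k x) = 0"
proof -
  define q where "q n x = real (Suc n) * (k (x + (1 / real (Suc n)) *\<^sub>R b) - k x)" for n x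
  have k: "k \<in> borel_measurable borel" by (rule differentiable_imp_borel_measurable[OF diff])
  have "continuous_on UNIV k"
    using diff by (auto simp: differentiable_imp_continuous_on differentiable_on_def)
  then have "compact (k ` cball 0 R)"
    by (intro compact_continuous_image) (auto intro: continuous_on_subset)
  then obtain B where B: "\<And>x. x \<in> cball 0 R \<Longrightarrow> \<bar>k x\<bar> \<le> B"
    by (force dest!: compact_imp_bounded simp: bounded_iff)
  have int: "integrable lborel k"
  proof (rule Bochner_Integration.integrable_bound)
    show "integrable lborel (\<lambda>x. indicator (cball 0 R) x *\<^sub>R B)"
      by (rule integrable_indicator_cball)
    show "k \<in> borel_measurable lborel" using k by simp
    show "AE x in lborel. norm (k x) \<le> norm (indicator (cball 0 R) x *\<^sub>R B)"
    proof (intro AE_I2)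
      fix x show "norm (k x) \<le> norm (indicator (cball 0 R) x *\<^sub>R B)"
        using B[of x] supp[of x] by (cases "x \<in> cball 0 R") simp_all
    qed
  qed
  have q0: "(LINT x|lborel. q n x) = 0" for n
  proof -
    define c where "c = (1 / real (Suc n)) *\<^sub>R b"
    have m: "(\<lambda>x. c + x) \<in> measurable lborel borel" by simp
    have "integrable lborel (\<lambda>x. k (c + x))"
      using int integrable_distr_eq[OF m k] by (simp add: lborel_distr_plus)
    moreover have "(LINT x|lborel. k (c + x)) = (LINT x|lborel. k x)"
      using integral_distr[OF m k] by (simp add: lborel_distr_plus)
    ultimately show ?thesis using int unfolding q_def c_def[symmetric] by (simp add: add.commute)
  qed
  \<comment> \<open>A quotient can be nonzero at distance up to \<open>norm b\<close> from the
    support, since the step \<open>1 / real (Suc n)\<close> is at most 1; hence the larger ball in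
    the majorant.\<close>
  have "(\<lambda>n. LINT x|lborel. q n x) \<longlonglongrightarrow> (LINT x|lborel. partial_deriv b k x)"
  proof (rule integral_dominated_convergence[where w="\<lambda>x. indicator (cball 0 (R + norm b)) x *\<^sub>R M"])
    show "partial_deriv b k \<in> borel_measurable lborel"
      using differentiable_imp_borel_measurable[OF diff] by simp
    show "q n \<in> borel_measurable lborel" for n
      unfolding q_def using k by measurable
    show "integrable lborel (\<lambda>x. indicator (cball 0 (R + norm b)) x *\<^sub>R M)"
      by (rule integrable_indicator_cball)
    show "AE x in lborel. (\<lambda>n. q n x) \<longlonglongrightarrow> partial_deriv b k x"
      unfolding q_def using partial_deriv_LIMSEQ[OF diff] by auto
    show "AE x in lborel. norm (q n x) \<le> indicator (cball 0 (R + norm b)) x *\<^sub>R M" for n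
    proof (intro AE_I2)
      fix x
      show "norm (q n x) \<le> indicator (cball 0 (R + norm b)) x *\<^sub>R M"
      proof (cases "x \<in> cball 0 (R + norm b)")
        case True
        have "\<bar>k (x + (1 / real (Suc n)) *\<^sub>R b) - k x\<bar> \<le> M * \<bar>1 / real (Suc n)\<bar>"
          by (rule partial_deriv_bound_diff[OF diff bnd])
        then have "real (Suc n) * \<bar>k (x + (1 / real (Suc n)) *\<^sub>R b) - k x\<bar> \<le> M"
          by (simp add: field_simps)
        then show ?thesis using True by (simp add: q_def abs_mult)
      next
        case False
        from False have nx: "R + norm b < norm x" by simp
        have "norm x \<le> norm (x + (1 / real (Suc n)) *\<^sub>R b) + norm ((1 / real (Suc n)) *\<^sub>R b)"
          by (metis add_diff_cancel norm_triangle_ineq4)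
        moreover have "norm ((1 / real (Suc n)) *\<^sub>R b) \<le> norm b"
          by (simp add: divide_le_eq mult_le_cancel_left1)
        ultimately have "R < norm (x + (1 / real (Suc n)) *\<^sub>R b)"
          using nx by linarith
        then have "k (x + (1 / real (Suc n)) *\<^sub>R b) = 0"
          by (intro supp) simp
        moreover have "R < norm x" using nx norm_ge_zero[of b] by linarith
        then have "k x = 0" by (intro supp) simp
        ultimately show ?thesis using False by (simp add: q_def)
      qed
    qed
  qed
  then show ?thesis by (simp add: q0 LIMSEQ_const_iff)
qed

section \<open>Flat cut-off functions\<close>

lemma integral_lebesgue_on_eq_lborel:
  fixes f :: "'a::euclidean_space \<Rightarrow> real"
  assumes "open \<Omega>" "(\<lambda>x. indicat_real \<Omega> x *\<^sub>R f x) \<in> borel_measurable borel"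
  shows "(LINT x|lebesgue_on \<Omega>. f x) = (LINT x|lborel. indicat_real \<Omega> x *\<^sub>R f x)"
  using assms by (subst integral_restrict_space) (auto intro: integral_completion)

text \<open>Extension by 0 reduces this to the whole space: near the frontier the extension is 0 on
  both sides, so it is differentiable everywhere, and its derivative is bounded by compactness of
  the closure.\<close>

lemma integral_partial_deriv_on:
  fixes k :: "'a::euclidean_space \<Rightarrow> real"
  assumes "open \<Omega>" "bounded \<Omega>" and k: "C_fun (Suc 0) k" and b: "b \<in> Basis"
    and van: "\<And>y. y \<in> frontier \<Omega> \<Longrightarrow> \<exists>U. open U \<and> y \<in> U \<and> (\<forall>z\<in>U. k z = 0)"
  shows "(LINT x|lebesgue_on \<Omega>. partial_deriv b k x) = 0"
proof -
  define K where "K x = (if x \<in> \<Omega> then k x else 0)" for x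
  have out: "\<exists>U. open U \<and> x \<in> U \<and> (\<forall>z\<in>U. K z = 0)" if x: "x \<notin> \<Omega>" for x
  proof (cases "x \<in> frontier \<Omega>")
    case True
    then show ?thesis using van[of x] by (auto simp: K_def)
  next
    case False
    then have "x \<in> - closure \<Omega>" using x \<open>open \<Omega>\<close> by (simp add: frontier_def interior_open)
    then show ?thesis using closure_subset[of \<Omega>] by (intro exI[of _ "- closure \<Omega>"]) (auto simp: K_def)
  qed
  have der: "(K has_derivative (if x \<in> \<Omega> then frechet_derivative k (at x) else (\<lambda>v. 0))) (at x)" for x
  proof (cases "x \<in> \<Omega>")
    case True
    have "(k has_derivative frechet_derivative k (at x)) (at x)"
      using k frechet_derivative_works by auto
    then have "(K has_derivative frechet_derivative k (at x)) (at x)"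
      by (rule has_derivative_transform_within_open[OF _ \<open>open \<Omega>\<close> True]) (simp add: K_def)
    then show ?thesis using True by simp
  next
    case False
    then obtain U where "open U" "x \<in> U" "\<forall>z\<in>U. K z = 0" using out by blast
    then have "(K has_derivative (\<lambda>v. 0)) (at x)"
      by (intro has_derivative_transform_within_open[OF has_derivative_const[of 0]]) auto
    then show ?thesis using False by simp
  qed
  have diff: "K differentiable (at x)" for x using der[of x] by (rule differentiableI)
  have pd: "partial_deriv b K x = indicat_real \<Omega> x *\<^sub>R partial_deriv b k x" for x
    using partial_deriv_eq[OF der, of b x] by (simp add: partial_deriv_def)
  have "continuous_on UNIV (partial_deriv b k)" using k b by simp
  moreover have "compact (closure \<Omega>)" using \<open>bounded \<Omega>\<close> by simp
  ultimately have "bounded (partial_deriv b k ` closure \<Omega>)"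
    by (intro compact_imp_bounded compact_continuous_image) (auto intro: continuous_on_subset)
  then obtain M where M: "\<And>x. x \<in> closure \<Omega> \<Longrightarrow> \<bar>partial_deriv b k x\<bar> \<le> M" and "0 < M"
    by (auto simp: bounded_pos)
  have bnd: "\<bar>partial_deriv b K x\<bar> \<le> M" for x
    using M[of x] closure_subset[of \<Omega>] \<open>0 < M\<close> by (auto simp: pd indicator_def)
  obtain R where R: "\<Omega> \<subseteq> cball 0 R"
    using bounded_subset_ballD[OF \<open>bounded \<Omega>\<close>, of 0] ball_subset_cball by blast
  have "(LINT x|lborel. partial_deriv b K x) = 0"
    by (rule integral_partial_deriv_eq_0[OF diff bnd, of R]) (use R in \<open>auto simp: K_def\<close>)
  moreover have "partial_deriv b K \<in> borel_measurable borel"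
    by (rule differentiable_imp_borel_measurable[OF diff])
  moreover have "partial_deriv b K = (\<lambda>x. indicat_real \<Omega> x *\<^sub>R partial_deriv b k x)" by (rule ext) (rule pd)
  ultimately show ?thesis
    by (subst integral_lebesgue_on_eq_lborel[OF \<open>open \<Omega>\<close>]) simp_all
qed

text \<open>Disjoint translates of the strip in the direction \<open>e\<close> fit into a ball of comparable radius.\<close>

lemma measure_strip_le:
  fixes S :: "'a::euclidean_space set" and \<psi> :: "'a \<Rightarrow> real"
  assumes S: "S \<in> lmeasurable" "S \<subseteq> cball x R" and e: "norm e = 1"
    and \<psi>: "\<And>y t. \<psi> (y + t *\<^sub>R e) = \<psi> y + t" "\<And>y. y \<in> S \<Longrightarrow> \<bar>\<psi> y\<bar> \<le> \<tau>"
    and \<tau>: "0 < \<tau>" "\<tau> \<le> R"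
  shows "measure lebesgue S \<le> \<tau> / R * (unit_ball_vol (DIM('a)) * (4 * R) ^ DIM('a))"
proof -
  have R: "0 < R" using \<tau> by simp
  \<comment> \<open>The number of translates, \<open>R / \<tau>\<close> rounded up.\<close>
  define J where "J = nat \<lceil>R / \<tau>\<rceil>"
  have "1 \<le> R / \<tau>" using \<tau> by simp
  then have J: "R / \<tau> \<le> real J" "real J < R / \<tau> + 1"
    unfolding J_def by linarith+
  \<comment> \<open>The spacing \<open>3 * \<tau>\<close> exceeds the width
    \<open>2 * \<tau>\<close> of the range of \<open>\<psi>\<close> on \<open>S\<close>, which makes
    the translates disjoint. The shifts have length at most \<open>3 * R\<close>, so the translates
    stay in the ball of radius \<open>4 * R\<close>.\<close>
  define S' where "S' j = (+) ((3 * \<tau> * real j) *\<^sub>R e) ` S" for j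
  have S'm: "S' j \<in> lmeasurable" for j
    unfolding S'_def by (rule measurable_translation[OF S(1)])
  have dis: "disjnt (S' i) (S' j)" if "i \<noteq> j" for i j
  proof -
    have False if y: "y \<in> S" "z \<in> S" and eq: "(3 * \<tau> * real i) *\<^sub>R e + y = (3 * \<tau> * real j) *\<^sub>R e + z" for y z
    proof -
      have "\<psi> y + 3 * \<tau> * real i = \<psi> z + 3 * \<tau> * real j"
        using \<psi>(1)[of y "3 * \<tau> * real i"] \<psi>(1)[of z "3 * \<tau> * real j"] eq by (simp add: add.commute)
      then have "\<psi> z - \<psi> y = 3 * \<tau> * (real i - real j)" by (simp add: algebra_simps)
      then have "3 * \<tau> * \<bar>real i - real j\<bar> = \<bar>\<psi> z - \<psi> y\<bar>"
        using \<tau> by (simp add: abs_mult)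
      also have "\<dots> \<le> 2 * \<tau>" using \<psi>(2)[OF y(1)] \<psi>(2)[OF y(2)] by linarith
      finally have "\<bar>real i - real j\<bar> * 3 \<le> 2" using \<tau> by simp
      moreover have "1 \<le> \<bar>real i - real j\<bar>" using \<open>i \<noteq> j\<close> by linarith
      ultimately have "\<bar>real i - real j\<bar> * 3 < \<bar>real i - real j\<bar> * 3"
        using mult_right_mono[of 1 "\<bar>real i - real j\<bar>" 3] by simp
      then show False by simp
    qed
    then show ?thesis by (auto simp: disjnt_def S'_def)
  qed
  have sub: "S' j \<subseteq> cball x (4 * R)" if "j < J" for j
  proof
    fix z assume "z \<in> S' j"
    then obtain y where y: "y \<in> S" "z = (3 * \<tau> * real j) *\<^sub>R e + y" by (auto simp: S'_def)
    have "real j + 1 \<le> real J" using that by simp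
    then have "real j \<le> R / \<tau>" using J by linarith
    then have "\<tau> * real j \<le> R" using \<tau> by (simp add: field_simps)
    then have 1: "norm ((3 * \<tau> * real j) *\<^sub>R e) \<le> 3 * R" using e \<tau> by simp
    have 2: "norm (y - x) \<le> R" using y S(2) by (auto simp: dist_norm norm_minus_commute)
    have zx: "z - x = (3 * \<tau> * real j) *\<^sub>R e + (y - x)" using y by simp
    have "norm (z - x) \<le> norm ((3 * \<tau> * real j) *\<^sub>R e) + norm (y - x)"
      by (subst zx) (rule norm_triangle_ineq)
    with 1 2 have "norm (z - x) \<le> 4 * R" by linarith
    then show "z \<in> cball x (4 * R)" by (simp add: dist_norm norm_minus_commute)
  qed
  have "real J * measure lebesgue S = (\<Sum>j<J. measure lebesgue (S' j))"
    by (simp add: S'_def measure_translation)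
  also have "\<dots> = measure lebesgue (\<Union>j<J. S' j)"
    by (rule measure_UNION'[symmetric]) (use S'm dis in \<open>auto simp: pairwise_def\<close>)
  also have "\<dots> \<le> measure lebesgue (cball x (4 * R))"
  proof (rule measure_mono_fmeasurable)
    show "(\<Union>j<J. S' j) \<subseteq> cball x (4 * R)" using sub by blast
    show "(\<Union>j<J. S' j) \<in> sets lebesgue" using S'm by (intro sets.finite_UN) auto
  qed simp
  also have "\<dots> = unit_ball_vol (DIM('a)) * (4 * R) ^ DIM('a)"
    using R by (simp add: content_cball)
  finally have "real J * measure lebesgue S \<le> unit_ball_vol (DIM('a)) * (4 * R) ^ DIM('a)" .
  moreover have "R / \<tau> * measure lebesgue S \<le> real J * measure lebesgue S"
    using J by (intro mult_right_mono) auto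
  ultimately have "R / \<tau> * measure lebesgue S \<le> unit_ball_vol (DIM('a)) * (4 * R) ^ DIM('a)" by linarith
  then show ?thesis using R \<tau> by (simp add: field_simps)
qed

text \<open>The square of a positive part is continuously differentiable: the inner square smooths
  the joint at 1, where the function leaves the value 1, and the outer one the joint at 2, where it
  reaches 0.\<close>

definition cutoff :: "real \<Rightarrow> real" where
  "cutoff s = (max 0 (1 - (max 0 (s - 1))\<^sup>2))\<^sup>2"

definition cutoff' :: "real \<Rightarrow> real" where
  "cutoff' s = - 4 * max 0 (1 - (max 0 (s - 1))\<^sup>2) * max 0 (s - 1)"

lemma has_real_derivative_max0_square:
  "((\<lambda>t. (max 0 t)\<^sup>2) has_real_derivative 2 * max 0 t) (at (t::real))"
proof -
  consider "t > 0" | "t < 0" | "t = 0" by linarith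
  then show ?thesis
  proof cases
    case 1
    have "((\<lambda>t. t\<^sup>2) has_real_derivative 2 * t) (at t)" by (auto intro!: derivative_eq_intros)
    then have "((\<lambda>t. (max 0 t)\<^sup>2) has_real_derivative 2 * t) (at t)"
      by (rule has_field_derivative_transform_within_open[where S="{0<..}"]) (use 1 in auto)
    then show ?thesis using 1 by simp
  next
    case 2
    have "((\<lambda>t. (max 0 t)\<^sup>2) has_real_derivative 0) (at t)"
      by (rule has_field_derivative_transform_within_open[where S="{..<0}", OF DERIV_const[of 0]]) (use 2 in auto)
    then show ?thesis using 2 by simp
  next
    case 3
    have "((\<lambda>h::real. (max 0 h)\<^sup>2 / h) \<longlongrightarrow> 0) (at 0)"
    proof (rule tendsto_rabs_zero_cancel, rule tendsto_sandwich[of "\<lambda>h. 0" _ _ "\<lambda>h::real. \<bar>h\<bar>"])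
      show "\<forall>\<^sub>F h::real in at 0. \<bar>(max 0 h)\<^sup>2 / h\<bar> \<le> \<bar>h\<bar>"
        by (intro always_eventually allI) (auto simp: max_def power2_eq_square abs_mult)
    qed (auto intro: tendsto_rabs_zero)
    then show ?thesis using 3 by (simp add: DERIV_def)
  qed
qed

lemma has_real_derivative_cutoff: "(cutoff has_real_derivative cutoff' s) (at s)"
proof -
  have 1: "((\<lambda>s. (max 0 (s - 1))\<^sup>2) has_real_derivative 2 * max 0 (s - 1) * 1) (at s)"
    by (rule DERIV_chain2[OF has_real_derivative_max0_square]) (auto intro!: derivative_eq_intros)
  have 2: "((\<lambda>s. 1 - (max 0 (s - 1))\<^sup>2) has_real_derivative 0 - 2 * max 0 (s - 1) * 1) (at s)"
    by (rule DERIV_diff[OF DERIV_const 1])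
  show ?thesis
    unfolding cutoff_def[abs_def] cutoff'_def
    by (rule DERIV_cong[OF DERIV_chain2[OF has_real_derivative_max0_square 2]]) (simp add: algebra_simps)
qed

lemma continuous_on_cutoff': "continuous_on A cutoff'"
  unfolding cutoff'_def[abs_def] by (intro continuous_intros)

lemma cutoff_bounds: "0 \<le> cutoff s" "cutoff s \<le> 1"
  unfolding cutoff_def by (auto simp: power2_eq_square mult_le_one)

lemma cutoff_eq: "s \<le> 1 \<Longrightarrow> cutoff s = 1" "2 \<le> s \<Longrightarrow> cutoff s = 0"
  "s \<le> 1 \<Longrightarrow> cutoff' s = 0" "2 \<le> s \<Longrightarrow> cutoff' s = 0"
proof -
  have "1 \<le> (max 0 (s - 1))\<^sup>2" if "2 \<le> s"
    using that by (simp add: one_le_power)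
  then show "2 \<le> s \<Longrightarrow> cutoff s = 0" "2 \<le> s \<Longrightarrow> cutoff' s = 0"
    by (simp_all add: cutoff_def cutoff'_def)
qed (simp_all add: cutoff_def cutoff'_def)

lemma cutoff'_bound: "\<bar>cutoff' s\<bar> \<le> 4"
proof (cases "2 \<le> s")
  case False
  then have "max 0 (1 - (max 0 (s - 1))\<^sup>2) * max 0 (s - 1) \<le> 1 * 1"
    by (intro mult_mono) auto
  then show ?thesis by (simp add: cutoff'_def abs_mult)
qed (simp add: cutoff_eq)

lemma C_fun_compose_cutoff:
  fixes q :: "'a::euclidean_space \<Rightarrow> real"
  assumes q: "C_fun (Suc 0) q"
  shows "C_fun (Suc 0) (\<lambda>x. cutoff (q x))"
    and "partial_deriv b (\<lambda>x. cutoff (q x)) x = cutoff' (q x) * partial_deriv b q x"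
proof -
  have der: "((\<lambda>x. cutoff (q x)) has_derivative (\<lambda>v. cutoff' (q x) * frechet_derivative q (at x) v)) (at x)" for x
  proof -
    have "(q has_derivative frechet_derivative q (at x)) (at x)"
      using q frechet_derivative_works by auto
    from has_derivative_compose[OF this has_real_derivative_cutoff[of "q x", unfolded has_field_derivative_def]]
    show ?thesis by simp
  qed
  show pd: "partial_deriv b (\<lambda>x. cutoff (q x)) x = cutoff' (q x) * partial_deriv b q x" for b x
    using partial_deriv_eq[OF der] by (simp add: partial_deriv_def)
  have "continuous_on UNIV (\<lambda>x. cutoff' (q x))"
    by (rule continuous_on_compose2[OF continuous_on_cutoff' C_fun_continuous[OF q]]) auto
  then have "continuous_on UNIV (partial_deriv b (\<lambda>x. cutoff (q x)))" if "b \<in> Basis" for b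
    using q that unfolding pd[abs_def] by (auto intro!: continuous_on_mult)
  then show "C_fun (Suc 0) (\<lambda>x. cutoff (q x))"
    using der by (auto intro: differentiableI)
qed

text \<open>Squared arguments avoid the singularities of the norm at \<open>x\<close> and of the
  absolute value on the plane through \<open>x\<close>. The function vanishes as soon as one of the
  quotients is at least the square root of 2, so the slab defined next, with its factor 2, contains
  the support.\<close>

definition flat_cap :: "'a::euclidean_space \<Rightarrow> 'a \<Rightarrow> real \<Rightarrow> real \<Rightarrow> 'a \<Rightarrow> real" where
  "flat_cap x \<nu> r \<epsilon> y =
     cutoff ((((y - x) \<bullet> \<nu>) / (\<epsilon> * r))\<^sup>2) * cutoff ((norm (y - x) / r)\<^sup>2)"

definition slab :: "'a::euclidean_space \<Rightarrow> 'a \<Rightarrow> real \<Rightarrow> real \<Rightarrow> 'a set" where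
  "slab x \<nu> r \<epsilon> = {y. norm (y - x) \<le> 2 * r \<and> \<bar>(y - x) \<bullet> \<nu>\<bar> \<le> 2 * \<epsilon> * r}"

lemma slab_measurable: "slab x \<nu> r \<epsilon> \<in> lmeasurable"
proof (rule lmeasurable_compact)
  have "closed (slab x \<nu> r \<epsilon>)" unfolding slab_def
    by (intro closed_Collect_conj closed_Collect_le continuous_intros)
  moreover have "bounded (slab x \<nu> r \<epsilon>)"
    by (rule bounded_subset[OF bounded_cball[of x "2 * r"]])
       (auto simp: slab_def dist_norm norm_minus_commute)
  ultimately show "compact (slab x \<nu> r \<epsilon>)" by (simp add: compact_eq_bounded_closed)
qed

text \<open>The slab is a strip of half-width \<open>2 * \<epsilon> * r\<close> in a ball of radius
  \<open>2 * r\<close>: the ratio of these lengths is the factor \<open>\<epsilon>\<close>, and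
  \<open>8\<close> is \<open>4 * 2\<close>, with \<open>4\<close> from the strip estimate.\<close>

lemma measure_slab_le:
  fixes x :: "'a::euclidean_space"
  assumes "norm \<nu> = 1" "0 < r" "0 < \<epsilon>" "\<epsilon> \<le> 1"
  shows "measure lebesgue (slab x \<nu> r \<epsilon>) \<le> unit_ball_vol (DIM('a)) * 8 ^ DIM('a) * \<epsilon> * r ^ DIM('a)"
proof -
  have "measure lebesgue (slab x \<nu> r \<epsilon>)
      \<le> (2 * \<epsilon> * r) / (2 * r) * (unit_ball_vol (DIM('a)) * (4 * (2 * r)) ^ DIM('a))"
  proof (rule measure_strip_le[where e=\<nu> and x=x and \<psi>="\<lambda>y. (y - x) \<bullet> \<nu>"])
    show "slab x \<nu> r \<epsilon> \<subseteq> cball x (2 * r)" by (auto simp: slab_def dist_norm norm_minus_commute)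
    show "(y + t *\<^sub>R \<nu> - x) \<bullet> \<nu> = (y - x) \<bullet> \<nu> + t" for y t
      using assms(1) by (simp add: inner_diff_left inner_add_left norm_eq_1)
      show "\<And>y. y \<in> slab x \<nu> r \<epsilon> \<Longrightarrow> \<bar>(y - x) \<bullet> \<nu>\<bar> \<le> 2 * \<epsilon> * r" by (simp add: slab_def)
  qed (use assms in \<open>simp_all add: slab_measurable\<close>)
  also have "\<dots> = unit_ball_vol (DIM('a)) * 8 ^ DIM('a) * \<epsilon> * r ^ DIM('a)"
    using assms by (simp add: power_mult_distrib)
  finally show ?thesis .
qed

text \<open>In the last estimate \<open>16\<close> is the bound \<open>4\<close> for
  \<open>cutoff'\<close> times the factor \<open>4\<close> from differentiating the squared
  quotients on the slab. Testing the gradient against \<open>v\<close>, rather than bounding its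
  norm, is what confines the factor \<open>1 / \<epsilon>\<close> to the normal component of
  \<open>v\<close>.\<close>

lemma flat_cap:
  fixes x :: "'a::euclidean_space"
  assumes \<nu>: "norm \<nu> = 1" and r: "0 < r" and \<epsilon>: "0 < \<epsilon>" "\<epsilon> \<le> 1"
  shows "C_fun (Suc 0) (flat_cap x \<nu> r \<epsilon>)"
    and "0 \<le> flat_cap x \<nu> r \<epsilon> y" "flat_cap x \<nu> r \<epsilon> y \<le> 1"
    and "norm (y - x) < r \<Longrightarrow> \<bar>(y - x) \<bullet> \<nu>\<bar> \<le> \<epsilon> * norm (y - x) \<Longrightarrow>
      \<exists>U. open U \<and> y \<in> U \<and> (\<forall>z\<in>U. flat_cap x \<nu> r \<epsilon> z = 1)"
    and "y \<notin> slab x \<nu> r \<epsilon> \<Longrightarrow> flat_cap x \<nu> r \<epsilon> y = 0"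
    and "y \<notin> slab x \<nu> r \<epsilon> \<Longrightarrow> partial_deriv b (flat_cap x \<nu> r \<epsilon>) y = 0"
    and "\<bar>\<Sum>b\<in>Basis. (v \<bullet> b) * partial_deriv b (flat_cap x \<nu> r \<epsilon>) y\<bar> \<le> 16 / r * (\<bar>v \<bullet> \<nu>\<bar> / \<epsilon> + norm v)"
proof -
  define p q where "p y = (((y - x) \<bullet> \<nu>) / (\<epsilon> * r))\<^sup>2" and "q y = (norm (y - x) / r)\<^sup>2" for y
  have w: "flat_cap x \<nu> r \<epsilon> = (\<lambda>y. cutoff (p y) * cutoff (q y))"
    by (simp add: flat_cap_def p_def q_def fun_eq_iff)
  have er: "0 < \<epsilon> * r" using r \<epsilon> by simp
  have dp: "(p has_derivative (\<lambda>v. 2 * ((y - x) \<bullet> \<nu>) * (v \<bullet> \<nu>) / (\<epsilon> * r)\<^sup>2)) (at y)" for y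
  proof -
    have "((\<lambda>y. ((y - x) \<bullet> \<nu>)\<^sup>2) has_derivative (\<lambda>v. 2 * ((y - x) \<bullet> \<nu>) * (v \<bullet> \<nu>))) (at y)"
      by (auto intro!: derivative_eq_intros)
    from has_derivative_mult_left[OF this, of "1 / (\<epsilon> * r)\<^sup>2"]
    show ?thesis unfolding p_def[abs_def] power_divide by simp
  qed
  have q_eq: "q = (\<lambda>y. ((y - x) \<bullet> (y - x)) / r\<^sup>2)"
    by (simp add: q_def fun_eq_iff power_divide power2_norm_eq_inner)
  have dq: "(q has_derivative (\<lambda>v. 2 * ((y - x) \<bullet> v) / r\<^sup>2)) (at y)" for y
  proof -
    have "((\<lambda>y. (y - x) \<bullet> (y - x)) has_derivative (\<lambda>v. 2 * ((y - x) \<bullet> v))) (at y)"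
      by (auto intro!: derivative_eq_intros simp: inner_commute)
    from has_derivative_mult_left[OF this, of "1 / r\<^sup>2"]
    show ?thesis unfolding q_eq by simp
  qed
  have Cp: "C_fun (Suc 0) p" "C_fun (Suc 0) q"
    using dp dq partial_deriv_eq[OF dp] partial_deriv_eq[OF dq] r \<epsilon>
    by (auto intro!: differentiableI continuous_intros simp: fun_eq_iff[symmetric] cong: continuous_on_cong)
  note cp = C_fun_compose_cutoff[OF Cp(1)] and cq = C_fun_compose_cutoff[OF Cp(2)]
  show C: "C_fun (Suc 0) (flat_cap x \<nu> r \<epsilon>)"
    unfolding w by (rule C_fun_mult[OF cp(1) cq(1)])
  show "0 \<le> flat_cap x \<nu> r \<epsilon> y" "flat_cap x \<nu> r \<epsilon> y \<le> 1"
    unfolding w by (auto intro!: mult_nonneg_nonneg mult_le_one cutoff_bounds)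
  have pd: "partial_deriv b (flat_cap x \<nu> r \<epsilon>) y =
      cutoff (p y) * (cutoff' (q y) * (2 * ((y - x) \<bullet> b) / r\<^sup>2))
      + cutoff' (p y) * (2 * ((y - x) \<bullet> \<nu>) * (b \<bullet> \<nu>) / (\<epsilon> * r)\<^sup>2) * cutoff (q y)" for y b
    unfolding w using cp(1) cq(1)
    by (subst partial_deriv_mult) (auto simp: cp(2) cq(2) partial_deriv_eq[OF dp] partial_deriv_eq[OF dq])
  show "\<exists>U. open U \<and> y \<in> U \<and> (\<forall>z\<in>U. flat_cap x \<nu> r \<epsilon> z = 1)"
    if "norm (y - x) < r" "\<bar>(y - x) \<bullet> \<nu>\<bar> \<le> \<epsilon> * norm (y - x)"
  proof (intro exI conjI ballI)
    \<comment> \<open>On this open set neither quotient exceeds 1. The point \<open>y\<close>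
      belongs to it because \<open>norm (y - x) < r\<close> turns the flatness inequality into a
      strict one with \<open>r\<close> on the right.\<close>
    let ?U = "{z. norm (z - x) < r \<and> \<bar>(z - x) \<bullet> \<nu>\<bar> < \<epsilon> * r}"
    show "open ?U" by (intro open_Collect_conj open_Collect_less continuous_intros)
    show "y \<in> ?U" using that \<epsilon> by (auto intro: order_le_less_trans)
    fix z assume z: "z \<in> ?U"
    have "\<bar>(z - x) \<bullet> \<nu> / (\<epsilon> * r)\<bar> \<le> 1" "\<bar>norm (z - x) / r\<bar> \<le> 1"
      using z r \<epsilon> by (auto simp: abs_mult)
    then have "p z \<le> 1" "q z \<le> 1"
      unfolding p_def q_def by (simp_all add: abs_square_le_1)
    then show "flat_cap x \<nu> r \<epsilon> z = 1" by (simp add: w cutoff_eq)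
  qed
  \<comment> \<open>Outside the slab one of the two quotients is at least 2 in absolute value. Its
    square is then at least 4, where the cut-off vanishes together with its derivative.\<close>
  have big: "2 \<le> p y \<or> 2 \<le> q y" if "y \<notin> slab x \<nu> r \<epsilon>" for y
  proof -
    from that consider "2 \<le> norm (y - x) / r" | "2 \<le> \<bar>((y - x) \<bullet> \<nu>) / (\<epsilon> * r)\<bar>"
      using r er by (auto simp: slab_def field_simps)
    then show ?thesis
    proof cases
      case 1
      then have "2\<^sup>2 \<le> q y" unfolding q_def by (intro power_mono) auto
      then show ?thesis by simp
    next
      case 2
      then have "2\<^sup>2 \<le> \<bar>((y - x) \<bullet> \<nu>) / (\<epsilon> * r)\<bar>\<^sup>2" by (intro power_mono) auto
      then show ?thesis by (simp only: power2_abs) (simp add: p_def)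
    qed
  qed
  show "flat_cap x \<nu> r \<epsilon> y = 0" "partial_deriv b (flat_cap x \<nu> r \<epsilon>) y = 0" if "y \<notin> slab x \<nu> r \<epsilon>"
    using big[OF that] unfolding pd by (auto simp: w cutoff_eq)
  show "\<bar>\<Sum>b\<in>Basis. (v \<bullet> b) * partial_deriv b (flat_cap x \<nu> r \<epsilon>) y\<bar> \<le> 16 / r * (\<bar>v \<bullet> \<nu>\<bar> / \<epsilon> + norm v)"
  proof (cases "y \<in> slab x \<nu> r \<epsilon>")
    case True
    have lin: "(\<Sum>b\<in>Basis. (v \<bullet> b) * (A * ((y - x) \<bullet> b) + B * (b \<bullet> \<nu>))) = A * ((y - x) \<bullet> v) + B * (v \<bullet> \<nu>)" for A B
      by (simp add: euclidean_inner[of "y - x" v] euclidean_inner[of v \<nu>] sum_distrib_left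
          sum.distrib[symmetric] inner_commute[of \<nu>] distrib_left mult_ac)
    have "(\<Sum>b\<in>Basis. (v \<bullet> b) * partial_deriv b (flat_cap x \<nu> r \<epsilon>) y)
       = (\<Sum>b\<in>Basis. (v \<bullet> b) * (cutoff (p y) * cutoff' (q y) * 2 / r\<^sup>2 * ((y - x) \<bullet> b) +
           cutoff' (p y) * 2 * ((y - x) \<bullet> \<nu>) / (\<epsilon> * r)\<^sup>2 * cutoff (q y) * (b \<bullet> \<nu>)))"
      unfolding pd by (simp add: mult_ac)
    also have "\<dots> = cutoff (p y) * (cutoff' (q y) * (2 * ((y - x) \<bullet> v) / r\<^sup>2))
      + cutoff' (p y) * (2 * ((y - x) \<bullet> \<nu>) * (v \<bullet> \<nu>) / (\<epsilon> * r)\<^sup>2) * cutoff (q y)"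
      unfolding lin by (simp add: mult_ac)
    finally have eq: "(\<Sum>b\<in>Basis. (v \<bullet> b) * partial_deriv b (flat_cap x \<nu> r \<epsilon>) y) = \<dots>" .
    have 1: "\<bar>2 * ((y - x) \<bullet> v) / r\<^sup>2\<bar> \<le> 4 / r * norm v"
    proof -
      have "\<bar>(y - x) \<bullet> v\<bar> \<le> norm (y - x) * norm v" by (rule Cauchy_Schwarz_ineq2)
      also have "\<dots> \<le> 2 * r * norm v" using True by (intro mult_right_mono) (auto simp: slab_def)
      finally show ?thesis using r by (simp add: abs_mult power2_eq_square field_simps)
    qed
    have 2: "\<bar>2 * ((y - x) \<bullet> \<nu>) * (v \<bullet> \<nu>) / (\<epsilon> * r)\<^sup>2\<bar> \<le> 4 / (\<epsilon> * r) * \<bar>v \<bullet> \<nu>\<bar>"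
    proof -
      have "\<bar>(y - x) \<bullet> \<nu>\<bar> * \<bar>v \<bullet> \<nu>\<bar> \<le> 2 * (\<epsilon> * r) * \<bar>v \<bullet> \<nu>\<bar>"
        using True by (intro mult_right_mono) (auto simp: slab_def)
      then have "2 * (\<bar>(y - x) \<bullet> \<nu>\<bar> * \<bar>v \<bullet> \<nu>\<bar>) / (\<epsilon> * r)\<^sup>2 \<le> 2 * (2 * (\<epsilon> * r) * \<bar>v \<bullet> \<nu>\<bar>) / (\<epsilon> * r)\<^sup>2"
        by (intro divide_right_mono mult_left_mono) simp_all
      also have "\<dots> = 4 / (\<epsilon> * r) * \<bar>v \<bullet> \<nu>\<bar>"
        using r \<epsilon> by (simp add: power2_eq_square divide_simps)
      finally show ?thesis by (simp add: abs_mult mult.assoc)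
    qed
    have m: "\<bar>s * (t * a)\<bar> \<le> 4 * A" if "0 \<le> s" "s \<le> 1" "\<bar>t\<bar> \<le> 4" "\<bar>a\<bar> \<le> A" for s t a A :: real
    proof -
      have "\<bar>s * (t * a)\<bar> = s * (\<bar>t\<bar> * \<bar>a\<bar>)" using that by (simp add: abs_mult)
      also have "\<dots> \<le> 1 * (4 * A)" using that by (intro mult_mono) auto
      finally show ?thesis by simp
    qed
    define X Y where "X = cutoff (p y) * (cutoff' (q y) * (2 * ((y - x) \<bullet> v) / r\<^sup>2))"
      and "Y = cutoff (q y) * (cutoff' (p y) * (2 * ((y - x) \<bullet> \<nu>) * (v \<bullet> \<nu>) / (\<epsilon> * r)\<^sup>2))"
    have "\<bar>X\<bar> \<le> 4 * (4 / r * norm v)"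
      unfolding X_def by (rule m[OF cutoff_bounds cutoff'_bound 1])
    moreover have "\<bar>Y\<bar> \<le> 4 * (4 / (\<epsilon> * r) * \<bar>v \<bullet> \<nu>\<bar>)"
      unfolding Y_def by (rule m[OF cutoff_bounds cutoff'_bound 2])
    moreover have "16 / r * (\<bar>v \<bullet> \<nu>\<bar> / \<epsilon> + norm v) = 4 * (4 / r * norm v) + 4 * (4 / (\<epsilon> * r) * \<bar>v \<bullet> \<nu>\<bar>)"
      using r \<epsilon> by (simp add: field_simps)
    moreover have "(\<Sum>b\<in>Basis. (v \<bullet> b) * partial_deriv b (flat_cap x \<nu> r \<epsilon>) y) = X + Y"
      unfolding eq X_def Y_def by (simp add: mult_ac)
    ultimately show ?thesis using abs_triangle_ineq[of X Y] by linarith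
  next
    case False
    then show ?thesis
      using \<open>y \<notin> slab x \<nu> r \<epsilon> \<Longrightarrow> partial_deriv _ (flat_cap x \<nu> r \<epsilon>) y = 0\<close> big[OF False] r \<epsilon>
      unfolding pd by (auto simp: cutoff_eq)
  qed
qed

section \<open>Products of cut-offs and the field cut off near the boundary\<close>

lemma integrable_lebesgue_on:
  fixes f :: "'a::euclidean_space \<Rightarrow> real"
  assumes "integrable lebesgue f" "\<Omega> \<in> sets lebesgue"
  shows "integrable (lebesgue_on \<Omega>) f"
  using assms by (subst integrable_restrict_space) (auto intro!: integrable_mult_indicator simp del: real_scaleR_def)

lemma integrable_lebesgue_on_continuous:
  fixes f :: "'a::euclidean_space \<Rightarrow> real"
  assumes "open \<Omega>" "bounded \<Omega>" "continuous_on UNIV f"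
  shows "integrable (lebesgue_on \<Omega>) f"
proof -
  let ?g = "\<lambda>x. indicat_real (closure \<Omega>) x *\<^sub>R f x"
  have "compact (closure \<Omega>)" using \<open>bounded \<Omega>\<close> by simp
  then have "integrable lborel ?g"
    using assms(3) by (intro borel_integrable_compact) (auto intro: continuous_on_subset)
  then have "integrable lebesgue ?g"
    by (subst integrable_completion) auto
  then have "integrable (lebesgue_on \<Omega>) ?g"
    using assms by (intro integrable_lebesgue_on) auto
  then show ?thesis
    by (rule Bochner_Integration.integrable_cong[THEN iffD1, rotated 2])
       (use closure_subset[of \<Omega>] in \<open>auto simp: space_restrict_space\<close>)
qed

text \<open>The union bound of probability, obtained by splitting off one factor.\<close>

lemma one_minus_prod_bounds:
  fixes w :: "'i \<Rightarrow> real"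
  assumes "finite I" "\<And>i. i \<in> I \<Longrightarrow> 0 \<le> w i \<and> w i \<le> 1"
  shows "0 \<le> 1 - (\<Prod>i\<in>I. 1 - w i) \<and> 1 - (\<Prod>i\<in>I. 1 - w i) \<le> (\<Sum>i\<in>I. w i)"
  using assms
proof (induction I)
  case (insert i I)
  have "0 \<le> w i" "w i \<le> 1" using insert.prems by auto
  moreover have "0 \<le> 1 - (\<Prod>i\<in>I. 1 - w i) \<and> 1 - (\<Prod>i\<in>I. 1 - w i) \<le> (\<Sum>i\<in>I. w i)"
    using insert.prems by (intro insert.IH) auto
  moreover have "0 \<le> (\<Prod>i\<in>I. 1 - w i)" using insert.prems by (intro prod_nonneg) auto
  then have "w i * (\<Prod>i\<in>I. 1 - w i) \<le> w i" "0 \<le> w i * (\<Prod>i\<in>I. 1 - w i)"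
    using calculation by (auto intro: mult_left_le)
  ultimately show ?case using insert.hyps by (simp add: left_diff_distrib)
qed simp

text \<open>In the product rule each derivative is multiplied by factors \<open>1 - w i\<close> from
  the unit interval, which are discarded. The estimates for single caps can thus be added however
  the caps overlap.\<close>

lemma partial_deriv_prod_bound:
  fixes w :: "'i \<Rightarrow> 'a::euclidean_space \<Rightarrow> real"
  assumes "finite I" and "\<And>i. i \<in> I \<Longrightarrow> C_fun (Suc 0) (w i)"
    and "\<And>i. i \<in> I \<Longrightarrow> 0 \<le> w i y \<and> w i y \<le> 1"
  shows "\<bar>\<Sum>b\<in>Basis. (v \<bullet> b) * partial_deriv b (\<lambda>x. \<Prod>i\<in>I. 1 - w i x) y\<bar>
           \<le> (\<Sum>i\<in>I. \<bar>\<Sum>b\<in>Basis. (v \<bullet> b) * partial_deriv b (w i) y\<bar>)"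
  using assms
proof (induction I)
  case empty
  show ?case by (simp add: partial_deriv_const)
next
  case (insert i I)
  have P: "0 \<le> (\<Prod>i\<in>I. 1 - w i y)" "(\<Prod>i\<in>I. 1 - w i y) \<le> 1"
    using insert.prems by (auto intro!: prod_nonneg prod_le_1)
  have wi: "0 \<le> w i y" "w i y \<le> 1" using insert.prems by auto
  have C1: "C_fun (Suc 0) (\<lambda>x. \<Prod>i\<in>I. 1 - w i x)"
    by (intro C_fun_prod C_fun_diff C_fun_const insert.prems) simp
  have C2: "C_fun (Suc 0) (\<lambda>x. 1 - w i x)"
    by (intro C_fun_diff C_fun_const insert.prems) simp
  have 1: "partial_deriv b (\<lambda>x. 1 - w i x) y = - partial_deriv b (w i) y" for b
  proof -
    have "(w i has_derivative frechet_derivative (w i) (at y)) (at y)"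
      using insert.prems(1)[of i] frechet_derivative_works by auto
    from partial_deriv_eq[OF has_derivative_diff[OF has_derivative_const this]]
    show ?thesis by (simp add: partial_deriv_def)
  qed
  define S T where "S = (\<Sum>b\<in>Basis. (v \<bullet> b) * partial_deriv b (\<lambda>x. \<Prod>i\<in>I. 1 - w i x) y)"
    and "T = (\<Sum>b\<in>Basis. (v \<bullet> b) * partial_deriv b (w i) y)"
  have "(\<Sum>b\<in>Basis. (v \<bullet> b) * partial_deriv b (\<lambda>x. \<Prod>i\<in>insert i I. 1 - w i x) y)
    = (\<Sum>b\<in>Basis. (v \<bullet> b) * partial_deriv b (\<lambda>x. (1 - w i x) * (\<Prod>i\<in>I. 1 - w i x)) y)"
    using insert.hyps by simp
  also have "\<dots> = (\<Sum>b\<in>Basis. (v \<bullet> b) * ((1 - w i y) * partial_deriv b (\<lambda>x. \<Prod>i\<in>I. 1 - w i x) y +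
         - partial_deriv b (w i) y * (\<Prod>i\<in>I. 1 - w i y)))"
    using C1 C2 by (subst partial_deriv_mult) (auto simp: 1)
  also have "\<dots> = (1 - w i y) * S - (\<Prod>i\<in>I. 1 - w i y) * T"
    unfolding S_def T_def
    by (simp add: sum_distrib_left sum_subtractf[symmetric] algebra_simps)
  finally have eq: "(\<Sum>b\<in>Basis. (v \<bullet> b) * partial_deriv b (\<lambda>x. \<Prod>i\<in>insert i I. 1 - w i x) y) = \<dots>" .
  have "\<bar>(1 - w i y) * S\<bar> \<le> \<bar>S\<bar>" "\<bar>(\<Prod>i\<in>I. 1 - w i y) * T\<bar> \<le> \<bar>T\<bar>"
    using P wi unfolding abs_mult by (auto intro!: mult_left_le_one_le)
  moreover have "\<bar>S\<bar> \<le> (\<Sum>i\<in>I. \<bar>\<Sum>b\<in>Basis. (v \<bullet> b) * partial_deriv b (w i) y\<bar>)"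
    unfolding S_def by (intro insert.IH insert.prems) auto
  ultimately show ?case unfolding eq using insert.hyps by (simp add: T_def)
qed

definition divergence :: "('a::euclidean_space \<Rightarrow> 'a) \<Rightarrow> 'a \<Rightarrow> real" where
  "divergence F x = (\<Sum>b\<in>Basis. partial_deriv b (\<lambda>x. F x \<bullet> b) x)"

lemma continuous_on_divergence:
  assumes "\<And>b. b \<in> Basis \<Longrightarrow> C_fun (Suc 0) (\<lambda>x. F x \<bullet> b)"
  shows "continuous_on UNIV (divergence F)"
  unfolding divergence_def[abs_def] using assms by (intro continuous_on_sum) auto

text \<open>
  The field is cut off near the boundary by the product of the functions \<open>1 - flat_cap\<close>. A cap of
  radius \<open>r\<close> and flatness \<open>\<epsilon>\<close> has volume of order \<open>\<epsilon> r\<^sup>n\<close> and a gradient of order \<open>1 / (\<epsilon> r)\<close> in the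
  direction \<open>\<nu>\<close> but only \<open>1 / r\<close> in the others.
\<close>

lemma divergence_integral_le_caps:
  fixes \<Omega> :: "'a::euclidean_space set" and F :: "'a \<Rightarrow> 'a"
    and x \<nu> :: "'i \<Rightarrow> 'a" and r \<epsilon> c :: "'i \<Rightarrow> real"
  assumes \<Omega>: "open \<Omega>" "bounded \<Omega>"
    and F: "\<And>b. b \<in> Basis \<Longrightarrow> C_fun (Suc 0) (\<lambda>x. F x \<bullet> b)"
    and M: "\<And>y. y \<in> \<Omega> \<Longrightarrow> \<bar>divergence F y\<bar> \<le> M"
    and I: "finite I"
    and \<nu>: "\<And>i. i \<in> I \<Longrightarrow> norm (\<nu> i) = 1"
    and r: "\<And>i. i \<in> I \<Longrightarrow> 0 < r i \<and> M * r i \<le> c i"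
    and \<epsilon>: "\<And>i. i \<in> I \<Longrightarrow> 0 < \<epsilon> i \<and> \<epsilon> i \<le> 1"
    and cov: "frontier \<Omega> \<subseteq> (\<Union>i\<in>I. ball (x i) (r i))"
    and flat: "\<And>i y. i \<in> I \<Longrightarrow> y \<in> frontier \<Omega> \<Longrightarrow> y \<in> ball (x i) (r i) \<Longrightarrow>
                 \<bar>(y - x i) \<bullet> \<nu> i\<bar> \<le> \<epsilon> i * norm (y - x i)"
    and c: "\<And>i y. i \<in> I \<Longrightarrow> y \<in> slab (x i) (\<nu> i) (r i) (\<epsilon> i) \<Longrightarrow> \<bar>F y \<bullet> \<nu> i\<bar> + \<epsilon> i * norm (F y) \<le> c i"
  shows "\<bar>LINT y|lebesgue_on \<Omega>. divergence F y\<bar>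
      \<le> 17 * unit_ball_vol (DIM('a)) * 8 ^ DIM('a) * (\<Sum>i\<in>I. c i * r i ^ (DIM('a) - 1))"
proof -
  define w where "w i = flat_cap (x i) (\<nu> i) (r i) (\<epsilon> i)" for i
  define S where "S i = slab (x i) (\<nu> i) (r i) (\<epsilon> i)" for i
  define \<zeta> where "\<zeta> y = (\<Prod>i\<in>I. 1 - w i y)" for y
  \<comment> \<open>\<open>G\<close> is the divergence of \<open>\<zeta> F\<close>. This field
    vanishes near the frontier, where some factor of \<open>\<zeta>\<close> is 0, so
    \<open>G\<close> has integral 0 and only \<open>divergence F - G\<close> remains to be
    estimated.\<close>
  define G where "G y = (\<Sum>b\<in>Basis. partial_deriv b (\<lambda>y. \<zeta> y * (F y \<bullet> b)) y)" for y
  note cap = flat_cap[where x="x i" and \<nu>="\<nu> i" and r="r i" and \<epsilon>="\<epsilon> i" for i,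
      OF \<nu> conjunct1[OF r] conjunct1[OF \<epsilon>] conjunct2[OF \<epsilon>], folded w_def]
  have Cw: "C_fun (Suc 0) (w i)" if "i \<in> I" for i
    by (rule cap(1)[OF that that that that])
  have Cz: "C_fun (Suc 0) \<zeta>"
    unfolding \<zeta>_def[abs_def] by (intro C_fun_prod C_fun_diff C_fun_const Cw)
  have CzF: "C_fun (Suc 0) (\<lambda>y. \<zeta> y * (F y \<bullet> b))" if "b \<in> Basis" for b
    using Cz F[OF that] by (rule C_fun_mult)
  \<comment> \<open>\<open>M\<close> bounds an absolute value on \<open>\<Omega>\<close> and is
    therefore nonnegative unless \<open>\<Omega>\<close> is empty, a case treated apart
    below.\<close>
  have Mpos: "0 \<le> M \<or> \<Omega> = {}" using M abs_ge_zero by (metis all_not_in_conv order_trans)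
  have van: "\<exists>U. open U \<and> y \<in> U \<and> (\<forall>z\<in>U. \<zeta> z * (F z \<bullet> b) = 0)" if y: "y \<in> frontier \<Omega>" for y b
  proof -
    obtain i where i: "i \<in> I" "y \<in> ball (x i) (r i)" using cov y by auto
    obtain U where "open U" "y \<in> U" "\<forall>z\<in>U. w i z = 1"
      using cap(4)[OF i(1) i(1) i(1) i(1), of y] flat[OF i(1) y i(2)] i(2)
      by (auto simp: dist_norm norm_minus_commute)
    then show ?thesis using i I by (intro exI[of _ U]) (auto simp: \<zeta>_def intro!: bexI[of _ i])
  qed
  have "(LINT y|lebesgue_on \<Omega>. G y) = (\<Sum>b\<in>Basis. LINT y|lebesgue_on \<Omega>. partial_deriv b (\<lambda>y. \<zeta> y * (F y \<bullet> b)) y)"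
    unfolding G_def using CzF
    by (intro Bochner_Integration.integral_sum integrable_lebesgue_on_continuous \<Omega>) auto
  also have "\<dots> = 0"
    by (intro sum.neutral ballI integral_partial_deriv_on \<Omega> CzF van)
  finally have G0: "(LINT y|lebesgue_on \<Omega>. G y) = 0" .
  have intG: "integrable (lebesgue_on \<Omega>) G"
    unfolding G_def[abs_def] using CzF
    by (intro Bochner_Integration.integrable_sum integrable_lebesgue_on_continuous \<Omega>) auto
  have intD: "integrable (lebesgue_on \<Omega>) (divergence F)"
    by (intro integrable_lebesgue_on_continuous \<Omega> continuous_on_divergence F)
  have S: "S i \<in> lmeasurable" for i unfolding S_def by (rule slab_measurable)
  have intS: "integrable lebesgue (indicat_real (S i))" for i
    using S[of i] unfolding fmeasurable_def by (intro integrable_real_indicator) blast+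
  have Gd: "G y = \<zeta> y * divergence F y + (\<Sum>b\<in>Basis. (F y \<bullet> b) * partial_deriv b \<zeta> y)" for y
  proof -
    have "G y = (\<Sum>b\<in>Basis. \<zeta> y * partial_deriv b (\<lambda>y. F y \<bullet> b) y + partial_deriv b \<zeta> y * (F y \<bullet> b))"
      unfolding G_def using Cz F by (intro sum.cong refl partial_deriv_mult) auto
    then show ?thesis by (simp add: divergence_def sum.distrib sum_distrib_left mult.commute)
  qed
  \<comment> \<open>\<open>divergence F - G\<close> is \<open>(1 - \<zeta>) divergence F\<close>
    minus the derivative of \<open>\<zeta>\<close> along \<open>F\<close>, both supported in the
    slabs. The derivative of one cap along \<open>F\<close> is at most
    \<open>16 * c i / (r i * \<epsilon> i)\<close>; multiplied by the volume of its slab, of order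
    \<open>\<epsilon> i * r i ^ n\<close>, this leaves \<open>c i * r i ^ (n - 1)\<close> with no
    trace of \<open>\<epsilon> i\<close>.\<close>
  have pt: "\<bar>divergence F y - G y\<bar> \<le> (\<Sum>i\<in>I. (M + 16 * c i / (r i * \<epsilon> i)) * indicat_real (S i) y)"
    if y: "y \<in> \<Omega>" for y
  proof -
    have "0 \<le> M" using Mpos y by auto
    have wb: "0 \<le> w i y \<and> w i y \<le> 1" if "i \<in> I" for i using cap(2,3) that by blast
    have wS: "w i y \<le> indicat_real (S i) y" if "i \<in> I" for i
      using wb[OF that] cap(5)[OF that that that that, of y] by (auto simp: S_def indicator_def)
    have 1: "0 \<le> 1 - \<zeta> y \<and> 1 - \<zeta> y \<le> (\<Sum>i\<in>I. w i y)"
      unfolding \<zeta>_def by (rule one_minus_prod_bounds[OF I wb])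
    have "\<bar>(1 - \<zeta> y) * divergence F y\<bar> \<le> (\<Sum>i\<in>I. w i y) * M"
      unfolding abs_mult using 1 M[OF y] by (intro mult_mono) auto
    also have "\<dots> \<le> (\<Sum>i\<in>I. indicat_real (S i) y) * M"
      using wS \<open>0 \<le> M\<close> by (intro mult_right_mono sum_mono)
    finally have a: "\<bar>(1 - \<zeta> y) * divergence F y\<bar> \<le> (\<Sum>i\<in>I. M * indicat_real (S i) y)"
      by (simp add: sum_distrib_left mult.commute)
    have "\<bar>\<Sum>b\<in>Basis. (F y \<bullet> b) * partial_deriv b \<zeta> y\<bar>
        \<le> (\<Sum>i\<in>I. \<bar>\<Sum>b\<in>Basis. (F y \<bullet> b) * partial_deriv b (w i) y\<bar>)"
      unfolding \<zeta>_def[abs_def] by (rule partial_deriv_prod_bound[OF I Cw wb])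
    also have "\<dots> \<le> (\<Sum>i\<in>I. 16 * c i / (r i * \<epsilon> i) * indicat_real (S i) y)"
    proof (rule sum_mono)
      fix i assume i: "i \<in> I"
      show "\<bar>\<Sum>b\<in>Basis. (F y \<bullet> b) * partial_deriv b (w i) y\<bar> \<le> 16 * c i / (r i * \<epsilon> i) * indicat_real (S i) y"
      proof (cases "y \<in> S i")
        case True
        have "\<bar>\<Sum>b\<in>Basis. (F y \<bullet> b) * partial_deriv b (w i) y\<bar> \<le> 16 / r i * (\<bar>F y \<bullet> \<nu> i\<bar> / \<epsilon> i + norm (F y))"
          by (rule cap(7)[OF i i i i])
        also have "\<dots> = 16 / (r i * \<epsilon> i) * (\<bar>F y \<bullet> \<nu> i\<bar> + \<epsilon> i * norm (F y))"
          using r[OF i] \<epsilon>[OF i] by (simp add: field_simps)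
        also have "\<dots> \<le> 16 / (r i * \<epsilon> i) * c i"
          using r[OF i] \<epsilon>[OF i] c[OF i] True by (intro mult_left_mono) (auto simp: S_def)
        finally show ?thesis using True by simp
      next
        case False
        then show ?thesis using cap(6)[OF i i i i, of y] by (simp add: S_def)
      qed
    qed
    finally have b: "\<bar>\<Sum>b\<in>Basis. (F y \<bullet> b) * partial_deriv b \<zeta> y\<bar> \<le> \<dots>" .
    have "divergence F y - G y = (1 - \<zeta> y) * divergence F y - (\<Sum>b\<in>Basis. (F y \<bullet> b) * partial_deriv b \<zeta> y)"
      by (simp add: Gd algebra_simps)
    then have "\<bar>divergence F y - G y\<bar> \<le> (\<Sum>i\<in>I. M * indicat_real (S i) y) + (\<Sum>i\<in>I. 16 * c i / (r i * \<epsilon> i) * indicat_real (S i) y)"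
      using a b by linarith
    then show ?thesis by (simp add: sum.distrib distrib_right)
  qed
  have intR: "integrable (lebesgue_on \<Omega>) (indicat_real (S i))" for i
    using intS \<Omega> by (intro integrable_lebesgue_on) auto
  have measR: "(LINT y|lebesgue_on \<Omega>. indicat_real (S i) y) \<le> measure lebesgue (S i)" for i
  proof -
    have "(LINT y|lebesgue_on \<Omega>. indicat_real (S i) y) = (LINT y|lebesgue. indicat_real \<Omega> y *\<^sub>R indicat_real (S i) y)"
      using \<Omega> by (subst integral_restrict_space) auto
    also have "\<dots> \<le> (LINT y|lebesgue. indicat_real (S i) y)"
      by (intro integral_mono integrable_mult_indicator intS) (use \<Omega> in \<open>simp_all add: mult_left_le_one_le\<close>)
    finally show ?thesis using S by simp
  qed
  have "\<bar>LINT y|lebesgue_on \<Omega>. divergence F y\<bar> = \<bar>LINT y|lebesgue_on \<Omega>. divergence F y - G y\<bar>"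
    using intG intD G0 by simp
  also have "\<dots> \<le> (LINT y|lebesgue_on \<Omega>. \<bar>divergence F y - G y\<bar>)"
    using integral_norm_bound[of "lebesgue_on \<Omega>" "\<lambda>y. divergence F y - G y"] by simp
  also have "\<dots> \<le> (LINT y|lebesgue_on \<Omega>. (\<Sum>i\<in>I. (M + 16 * c i / (r i * \<epsilon> i)) * indicat_real (S i) y))"
    by (intro integral_mono integrable_abs Bochner_Integration.integrable_diff intD intG
        Bochner_Integration.integrable_sum integrable_mult_right intR pt) (use \<Omega> in \<open>auto simp: space_restrict_space\<close>)
  also have "\<dots> = (\<Sum>i\<in>I. (M + 16 * c i / (r i * \<epsilon> i)) * (LINT y|lebesgue_on \<Omega>. indicat_real (S i) y))"
    by (subst Bochner_Integration.integral_sum) (auto intro!: intR)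
  also have "\<dots> \<le> (\<Sum>i\<in>I. 17 * unit_ball_vol (DIM('a)) * 8 ^ DIM('a) * (c i * r i ^ (DIM('a) - 1)))"
  proof (cases "\<Omega> = {}")
    case True
    then have "frontier \<Omega> = {}" by simp
    show ?thesis
    proof (rule sum_mono)
      fix i assume i: "i \<in> I"
      have "x i \<in> slab (x i) (\<nu> i) (r i) (\<epsilon> i)" using r[OF i] \<epsilon>[OF i] by (auto simp: slab_def)
      then have "0 \<le> c i" using c[OF i, of "x i"] \<epsilon>[OF i]
        by (smt (verit) mult_nonneg_nonneg norm_ge_zero)
      then show "(M + 16 * c i / (r i * \<epsilon> i)) * (LINT y|lebesgue_on \<Omega>. indicat_real (S i) y)
        \<le> 17 * unit_ball_vol (DIM('a)) * 8 ^ DIM('a) * (c i * r i ^ (DIM('a) - 1))"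
        using True r[OF i] by (simp add: integral_restrict_space)
    qed
  next
    case False
    then have M0: "0 \<le> M" using Mpos by simp
    show ?thesis
    proof (rule sum_mono)
      fix i assume i: "i \<in> I"
      let ?V = "unit_ball_vol (DIM('a)) * 8 ^ DIM('a)"
      have c0: "0 \<le> c i" using r[OF i] M0 by (metis less_imp_le mult_nonneg_nonneg order_trans)
      have rn: "r i ^ DIM('a) = r i * r i ^ (DIM('a) - 1)"
        by (metis DIM_positive power_eq_if less_not_refl)
      have "(M + 16 * c i / (r i * \<epsilon> i)) * (LINT y|lebesgue_on \<Omega>. indicat_real (S i) y)
          \<le> (M + 16 * c i / (r i * \<epsilon> i)) * (?V * \<epsilon> i * r i ^ DIM('a))"
        using measR[of i] measure_slab_le[OF \<nu>[OF i], of "r i" "\<epsilon> i" "x i"] r[OF i] \<epsilon>[OF i] M0 c0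
        by (intro mult_left_mono) (auto simp: S_def)
      also have "\<dots> = ?V * r i ^ (DIM('a) - 1) * (\<epsilon> i * (M * r i) + 16 * c i)"
        using r[OF i] \<epsilon>[OF i] by (simp add: rn field_simps)
      \<comment> \<open>\<open>17\<close> is \<open>16\<close> from the gradient of the cap plus
        \<open>1\<close> from the divergence of \<open>F\<close>, by the assumption
        \<open>M * r i \<le> c i\<close>.\<close>
      also have "\<dots> \<le> ?V * r i ^ (DIM('a) - 1) * (17 * c i)"
      proof (rule mult_left_mono)
        have "\<epsilon> i * (M * r i) \<le> 1 * c i" using r[OF i] \<epsilon>[OF i] M0 by (intro mult_mono) auto
        then show "\<epsilon> i * (M * r i) + 16 * c i \<le> 17 * c i" by simp
        show "0 \<le> ?V * r i ^ (DIM('a) - 1)" using r[OF i] by simp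
      qed
      finally show "(M + 16 * c i / (r i * \<epsilon> i)) * (LINT y|lebesgue_on \<Omega>. indicat_real (S i) y)
        \<le> 17 * unit_ball_vol (DIM('a)) * 8 ^ DIM('a) * (c i * r i ^ (DIM('a) - 1))"
        by (simp add: mult_ac)
    qed
  qed
  finally show ?thesis by (simp add: sum_distrib_left)
qed

section \<open>Coverings by small balls\<close>

text \<open>The ratio of the \<open>k\<close>-th power of the diameter of a set to its gauge. It
  appears because a covering set will be replaced by a ball whose radius, not diameter, is about the
  diameter of the set.\<close>

definition ball_cover_const :: "nat \<Rightarrow> real" where
  "ball_cover_const k = 2 ^ k / unit_ball_vol (real k)"

lemma ball_cover_const_pos: "0 < ball_cover_const k"
  by (simp add: ball_cover_const_def)

text \<open>A nearly optimal cover by sets of small diameter becomes a cover by balls centred in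
  \<open>A\<close>: each set lies in a ball around any of its points with radius just above its
  diameter. The sum is stated for finite subfamilies because compactness will extract one.\<close>

lemma hausdorff_ball_cover:
  fixes A :: "'a::euclidean_space set"
  assumes h: "hausdorff_outer k A = ennreal h" "0 \<le> h" and "0 < \<delta>" "0 < e"
  shows "\<exists>(L :: nat set) x r. A \<subseteq> (\<Union>l\<in>L. ball (x l) (r l)) \<and> (\<forall>l\<in>L. x l \<in> A \<and> 0 < r l \<and> r l < \<delta>) \<and>
    (\<forall>D. finite D \<longrightarrow> D \<subseteq> L \<longrightarrow> (\<Sum>l\<in>D. r l ^ k) \<le> ball_cover_const k * h + e)"
proof -
  let ?K = "ball_cover_const k"
  note K = ball_cover_const_pos[of k]
  \<comment> \<open>Half of the allowance \<open>e\<close> goes to the choice of the cover, since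
    \<open>?K * e1 = e / 2\<close>, and half to the enlargement of the radii.\<close>
  define e1 where "e1 = e / (2 * ?K)"
  have e1: "0 < e1" using \<open>0 < e\<close> K by (simp add: e1_def)
  have "hausdorff_content k (\<delta> / 2) A \<le> hausdorff_outer k A"
    unfolding hausdorff_outer_def using \<open>0 < \<delta>\<close> by (intro SUP_upper) auto
  also have "\<dots> < ennreal (h + e1)" using h e1 by (simp add: ennreal_lessI)
  finally obtain C where C: "C \<in> fine_covers (\<delta> / 2) A"
    and sum: "(\<Sum>i. hausdorff_gauge k (C i)) < ennreal (h + e1)"
    unfolding hausdorff_content_def INF_less_iff by blast
  have bd: "bounded (C l)" "diameter (C l) \<le> \<delta> / 2" and cov: "A \<subseteq> (\<Union>l. C l)" for l
    using C by (auto simp: fine_covers_def)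
  \<comment> \<open>Sets that miss \<open>A\<close> are dropped. The others provide a centre in
    \<open>A\<close>, and being nonempty they have the gauge given by the formula.\<close>
  define L where "L = {l. C l \<inter> A \<noteq> {}}"
  have "\<forall>l\<in>L. \<exists>x. x \<in> C l \<inter> A" by (auto simp: L_def)
  then obtain x where x: "\<And>l. l \<in> L \<Longrightarrow> x l \<in> C l \<and> x l \<in> A" by (metis IntE)
  \<comment> \<open>The balls are open, hence a radius strictly above the diameter. Continuity of
    the power from the right keeps the surplus below the \<open>l\<close>-th term of a geometric
    series.\<close>
  have "\<exists>r. diameter (C l) < r \<and> r < \<delta> \<and> r ^ k < diameter (C l) ^ k + e / 2 * (1/2) ^ Suc l" for l
  proof -
    have "((\<lambda>r. r ^ k) \<longlongrightarrow> diameter (C l) ^ k) (at_right (diameter (C l)))"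
      by (intro tendsto_intros)
    then have "\<forall>\<^sub>F r in at_right (diameter (C l)). r ^ k < diameter (C l) ^ k + e / 2 * (1/2) ^ Suc l"
      using \<open>0 < e\<close> by (intro order_tendstoD) auto
    moreover have "\<forall>\<^sub>F r in at_right (diameter (C l)). r \<in> {diameter (C l)<..<\<delta>}"
      using bd(2)[of l] \<open>0 < \<delta>\<close> by (intro eventually_at_right_real) auto
    ultimately have "\<forall>\<^sub>F r in at_right (diameter (C l)). diameter (C l) < r \<and> r < \<delta> \<and> r ^ k < diameter (C l) ^ k + e / 2 * (1/2) ^ Suc l"
      by eventually_elim auto
    from eventually_happens'[OF _ this] show ?thesis by simp
  qed
  then obtain r where r: "\<And>l. diameter (C l) < r l" "\<And>l. r l < \<delta>"
    "\<And>l. r l ^ k < diameter (C l) ^ k + e / 2 * (1/2) ^ Suc l" by metis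
  show ?thesis
  proof (rule exI[of _ L], rule exI[of _ x], rule exI[of _ r], intro conjI allI impI ballI)
    show "A \<subseteq> (\<Union>l\<in>L. ball (x l) (r l))"
    proof
      fix y assume y: "y \<in> A"
      then obtain l where l: "y \<in> C l" using cov by auto
      with y have "l \<in> L" by (auto simp: L_def)
      have "dist (x l) y \<le> diameter (C l)"
        using diameter_bounded_bound[OF bd(1)] x[OF \<open>l \<in> L\<close>] l by blast
      then show "y \<in> (\<Union>l\<in>L. ball (x l) (r l))"
        using \<open>l \<in> L\<close> r(1)[of l] by (intro UN_I[of l]) auto
    qed
    fix l assume "l \<in> L"
    show "x l \<in> A" using x[OF \<open>l \<in> L\<close>] by simp
    show "r l < \<delta>" by (rule r(2))
    show "0 < r l" using diameter_ge_0[OF bd(1), of l] r(1)[of l] by linarith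
  next
    fix D assume D: "finite D" "D \<subseteq> L"
    have "ennreal (\<Sum>l\<in>D. diameter (C l) ^ k / ?K) = (\<Sum>l\<in>D. hausdorff_gauge k (C l))"
    proof (subst sum_ennreal[symmetric])
      show "0 \<le> diameter (C l) ^ k / ?K" for l
        using diameter_ge_0[OF bd(1)] K by simp
      show "(\<Sum>l\<in>D. ennreal (diameter (C l) ^ k / ?K)) = (\<Sum>l\<in>D. hausdorff_gauge k (C l))"
        using D by (intro sum.cong refl)
          (auto simp: hausdorff_gauge_def L_def ball_cover_const_def power_divide mult_ac)
    qed
    also have "\<dots> \<le> (\<Sum>l. hausdorff_gauge k (C l))" by (intro sum_le_suminf) (use D in auto)
    also have "\<dots> < ennreal (h + e1)" by (rule sum)
    finally have lt: "ennreal (\<Sum>l\<in>D. diameter (C l) ^ k / ?K) < ennreal (h + e1)" .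
    have "0 \<le> (\<Sum>l\<in>D. diameter (C l) ^ k / ?K)"
      using diameter_ge_0[OF bd(1)] K by (intro sum_nonneg) simp
    from lt[unfolded ennreal_less_iff[OF this]]
    have "(\<Sum>l\<in>D. diameter (C l) ^ k / ?K) \<le> h + e1" by simp
    then have "?K * (\<Sum>l\<in>D. diameter (C l) ^ k / ?K) \<le> ?K * (h + e1)"
      using K by (intro mult_left_mono) auto
    moreover have "?K * (\<Sum>l\<in>D. diameter (C l) ^ k / ?K) = (\<Sum>l\<in>D. diameter (C l) ^ k)"
      using K by (simp add: sum_distrib_left)
    moreover have "?K * (h + e1) = ?K * h + e / 2"
      using K by (simp add: e1_def distrib_left)
    ultimately have 1: "(\<Sum>l\<in>D. diameter (C l) ^ k) \<le> ?K * h + e / 2" by simp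
    have "(\<Sum>l\<in>D. (1/2::real) ^ Suc l) \<le> (\<Sum>l. (1/2) ^ Suc l)"
      using D sums_summable[OF power_half_series] by (intro sum_le_suminf) auto
    also have "\<dots> = 1" by (rule sums_unique[OF power_half_series, symmetric])
    finally have "(\<Sum>l\<in>D. e / 2 * (1/2) ^ Suc l) \<le> e / 2"
      unfolding sum_distrib_left[symmetric] using \<open>0 < e\<close> by (simp add: mult_left_le)
    moreover have "(\<Sum>l\<in>D. r l ^ k) \<le> (\<Sum>l\<in>D. diameter (C l) ^ k + e / 2 * (1/2) ^ Suc l)"
      by (intro sum_mono less_imp_le r(3))
    ultimately show "(\<Sum>l\<in>D. r l ^ k) \<le> ?K * h + e" using 1 by (simp add: sum.distrib)
  qed
qed

lemma hausdorff_measurable_ident: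
  "(\<lambda>x. x) \<in> measurable (restrict_space (hausdorff_measure k :: 'a::metric_space measure) A) borel"
  by (rule measurable_restrict_space1)
     (use borel_subset_sets_hausdorff in \<open>auto simp: measurable_def\<close>)

text \<open>
  The set is cut into pieces on which \<open>c\<close> varies by at most the factor \<open>2\<close>; this is the factor \<open>2\<close> in
  the bound.
\<close>

lemma hausdorff_weighted_ball_cover:
  fixes k :: nat and A :: "'a::euclidean_space set" and c :: "'a \<Rightarrow> real" and P :: "nat \<Rightarrow> 'a set"
  defines "B \<equiv> restrict_space (hausdorff_measure k) A"
  assumes A: "compact A" and fin: "hausdorff_outer k A < top"
    and c: "c \<in> borel_measurable B" "0 < \<kappa>" "\<And>x. x \<in> A \<Longrightarrow> \<kappa> \<le> c x"
    and I: "(\<integral>\<^sup>+x. ennreal (c x) \<partial>B) \<le> ennreal I" "0 \<le> I"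
    and P: "\<And>j. P j \<in> sets B" "A \<subseteq> (\<Union>j. P j)" and \<delta>: "\<And>j. 0 < \<delta> j" and "0 < e"
  shows "\<exists>(D :: nat set) x r. finite D \<and> A \<subseteq> (\<Union>i\<in>D. ball (x i) (r i)) \<and>
     (\<forall>i\<in>D. x i \<in> A \<and> 0 < r i \<and> (\<exists>j. x i \<in> P j \<and> r i < \<delta> j)) \<and>
     (\<Sum>i\<in>D. c (x i) * r i ^ k) \<le> 2 * ball_cover_const k * I + e"
proof -
  let ?K = "ball_cover_const k"
  note K = ball_cover_const_pos[of k]
  have Aset: "A \<in> sets (hausdorff_measure k)"
    using borel_subset_sets_hausdorff borel_closed[OF compact_imp_closed[OF A]] by blast
  have spB: "space B = A" by (simp add: B_def space_restrict_space)
  have emB: "emeasure B Q = hausdorff_outer k Q" if "Q \<in> sets B" for Q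
  proof -
    have "Q \<subseteq> A" "Q \<in> sets (hausdorff_measure k)"
      using that Aset by (auto simp: B_def sets_restrict_space_iff)
    then show ?thesis
      unfolding B_def using Aset by (subst emeasure_restrict_space) (auto simp: emeasure_hausdorff)
  qed
  \<comment> \<open>A number \<open>i\<close> codes a pair: the index \<open>J i\<close> of a set of
    the cover \<open>P\<close>, and the level \<open>m i\<close> of \<open>c\<close> in steps of
    \<open>\<kappa>\<close>.\<close>
  define J where "J i = fst (prod_decode i)" for i
  define m where "m i = snd (prod_decode i)" for i
  define Q where "Q i = disjointed P (J i) \<inter> {x \<in> space B. real (m i) * \<kappa> \<le> c x \<and> c x < real (m i + 1) * \<kappa>}" for i
  have dP: "range (disjointed P) \<subseteq> sets B"
    using P(1) by (intro sets.range_disjointed_sets) auto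
  have Q: "Q i \<in> sets B" for i
  proof -
    have "{x \<in> space B. real (m i) * \<kappa> \<le> c x \<and> c x < real (m i + 1) * \<kappa>} \<in> sets B"
      using c(1) by measurable
    then show ?thesis unfolding Q_def using dP by blast
  qed
  have QA: "Q i \<subseteq> A" for i using Q sets.sets_into_space spB by blast
  have QP: "Q i \<subseteq> P (J i)" for i using disjointed_subset[of P "J i"] by (auto simp: Q_def)
  have Qdisj: "i = i'" if "y \<in> Q i" "y \<in> Q i'" for i i' y
  proof -
    have "J i = J i'"
      using that disjoint_family_disjointed[of P] by (auto simp: Q_def disjoint_family_on_def)
    moreover have "m i = m i'"
    proof -
      have "real (m i) * \<kappa> < real (m i' + 1) * \<kappa>" "real (m i') * \<kappa> < real (m i + 1) * \<kappa>"
        using that by (auto simp: Q_def)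
      then show ?thesis using \<open>0 < \<kappa>\<close> by simp
    qed
    ultimately have "prod_decode i = prod_decode i'" unfolding J_def m_def by (rule prod_eqI)
    then show ?thesis by (metis prod_decode_inverse)
  qed
  have Qcov: "A \<subseteq> (\<Union>i. Q i)"
  proof
    fix y assume y: "y \<in> A"
    then have "y \<in> (\<Union>j. disjointed P j)" using P(2) by (auto simp: UN_disjointed_eq)
    then obtain j where j: "y \<in> disjointed P j" by blast
    define n where "n = nat \<lfloor>c y / \<kappa>\<rfloor>"
    have "0 \<le> c y / \<kappa>" using c(3)[OF y] \<open>0 < \<kappa>\<close> by simp
    then have "real n \<le> c y / \<kappa>" "c y / \<kappa> < real n + 1" unfolding n_def by linarith+
    then have "real n * \<kappa> \<le> c y" "c y < real (n + 1) * \<kappa>" using \<open>0 < \<kappa>\<close> by (auto simp: field_simps)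
    then have "y \<in> Q (prod_encode (j, n))" using j y by (simp add: Q_def J_def m_def spB)
    then show "y \<in> (\<Union>i. Q i)" by blast
  qed
  define H where "H i = enn2real (hausdorff_outer k (Q i))" for i
  have H: "hausdorff_outer k (Q i) = ennreal (H i)" "0 \<le> H i" for i
  proof -
    have "hausdorff_outer k (Q i) < top"
      using hausdorff_outer_mono[OF QA] fin by (rule le_less_trans)
    then show "hausdorff_outer k (Q i) = ennreal (H i)" "0 \<le> H i" by (simp_all add: H_def)
  qed
  \<comment> \<open>The allowance for the piece \<open>i\<close>: multiplied by the upper bound
    \<open>real (m i + 1) * \<kappa>\<close> of \<open>c\<close> on the piece, it is the
    \<open>i\<close>-th term of a geometric series with sum \<open>e\<close>.\<close>
  define E where "E i = e * (1/2) ^ Suc i / (real (m i + 1) * \<kappa>)" for i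
  have E: "0 < E i" for i using \<open>0 < e\<close> \<open>0 < \<kappa>\<close> by (simp add: E_def)
  have "\<forall>i. \<exists>(L :: nat set) x r. Q i \<subseteq> (\<Union>l\<in>L. ball (x l) (r l)) \<and> (\<forall>l\<in>L. x l \<in> Q i \<and> 0 < r l \<and> r l < \<delta> (J i)) \<and>
    (\<forall>D. finite D \<longrightarrow> D \<subseteq> L \<longrightarrow> (\<Sum>l\<in>D. r l ^ k) \<le> ?K * H i + E i)"
    by (intro allI hausdorff_ball_cover[OF H \<delta> E])
  from choice[OF this] obtain L :: "nat \<Rightarrow> nat set" where
    "\<forall>i. \<exists>x r. Q i \<subseteq> (\<Union>l\<in>L i. ball (x l) (r l)) \<and> (\<forall>l\<in>L i. x l \<in> Q i \<and> 0 < r l \<and> r l < \<delta> (J i)) \<and>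
    (\<forall>D. finite D \<longrightarrow> D \<subseteq> L i \<longrightarrow> (\<Sum>l\<in>D. r l ^ k) \<le> ?K * H i + E i)" ..
  from choice[OF this] obtain x where
    "\<forall>i. \<exists>r. Q i \<subseteq> (\<Union>l\<in>L i. ball (x i l) (r l)) \<and> (\<forall>l\<in>L i. x i l \<in> Q i \<and> 0 < r l \<and> r l < \<delta> (J i)) \<and>
    (\<forall>D. finite D \<longrightarrow> D \<subseteq> L i \<longrightarrow> (\<Sum>l\<in>D. r l ^ k) \<le> ?K * H i + E i)" ..
  from choice[OF this] obtain r where xr_all:
    "\<forall>i. Q i \<subseteq> (\<Union>l\<in>L i. ball (x i l) (r i l)) \<and> (\<forall>l\<in>L i. x i l \<in> Q i \<and> 0 < r i l \<and> r i l < \<delta> (J i)) \<and>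
    (\<forall>D. finite D \<longrightarrow> D \<subseteq> L i \<longrightarrow> (\<Sum>l\<in>D. r i l ^ k) \<le> ?K * H i + E i)" ..
  have cov: "Q i \<subseteq> (\<Union>l\<in>L i. ball (x i l) (r i l))" for i using xr_all by (elim allE[of _ i] conjE)
  have xr: "x i l \<in> Q i \<and> 0 < r i l \<and> r i l < \<delta> (J i)" if "l \<in> L i" for i l
    using that xr_all by (elim allE[of _ i] conjE) (erule (1) bspec)
  have sumr: "(\<Sum>l\<in>D. r i l ^ k) \<le> ?K * H i + E i" if "finite D" "D \<subseteq> L i" for i D
    using that xr_all by (elim allE[of _ i] conjE) simp
  define X R where "X p = x (fst p) (snd p)" and "R p = r (fst p) (snd p)" for p :: "nat \<times> nat"
  have "A \<subseteq> (\<Union>p\<in>Sigma UNIV L. ball (X p) (R p))"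
  proof
    fix y assume "y \<in> A"
    then obtain i where i: "y \<in> Q i" using Qcov by blast
    then obtain l where "l \<in> L i" "y \<in> ball (x i l) (r i l)" using cov by blast
    then show "y \<in> (\<Union>p\<in>Sigma UNIV L. ball (X p) (R p))"
      by (intro UN_I[of "(i, l)"]) (auto simp: X_def R_def)
  qed
  then obtain D where D: "D \<subseteq> Sigma UNIV L" "finite D" "A \<subseteq> (\<Union>p\<in>D. ball (X p) (R p))"
    using compactE_image[OF A, of "Sigma UNIV L" "\<lambda>p. ball (X p) (R p)"] by blast
  define N where "N = fst ` D"
  define D' where "D' i = {l. (i, l) \<in> D}" for i
  have finN: "finite N" using D by (simp add: N_def)
  have finD': "finite (D' i)" for i
    using finite_subset[of "D' i" "snd ` D"] D by (force simp: D'_def)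
  have D'L: "D' i \<subseteq> L i" for i using D by (auto simp: D'_def)
  have part: "(\<Sum>l\<in>D' i. c (x i l) * r i l ^ k) \<le> 2 * ?K * (real (m i) * \<kappa> * H i) + e * (1/2) ^ Suc i" for i
  proof (cases "D' i = {}")
    case True
    then show ?thesis using K H \<open>0 < \<kappa>\<close> \<open>0 < e\<close> by simp
  next
    case False
    then obtain l where "x i l \<in> Q i" using D'L xr by blast
    \<comment> \<open>On a nonempty piece \<open>\<kappa> \<le> c\<close> excludes level 0, and
      \<open>real (m i + 1) \<le> 2 * real (m i)\<close> at all other levels. Hence the lower and
      upper bounds of \<open>c\<close> on the piece differ by at most the factor 2.\<close>
    then have "\<kappa> < real (m i + 1) * \<kappa>" using c(3) by (auto simp: Q_def spB intro: le_less_trans)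
    then have m1: "1 \<le> real (m i)" using \<open>0 < \<kappa>\<close> by simp
    have "(\<Sum>l\<in>D' i. c (x i l) * r i l ^ k) \<le> (\<Sum>l\<in>D' i. real (m i + 1) * \<kappa> * r i l ^ k)"
    proof (intro sum_mono mult_right_mono)
      fix l assume "l \<in> D' i"
      then have "l \<in> L i" using D'L by blast
      then show "c (x i l) \<le> real (m i + 1) * \<kappa>" "0 \<le> r i l ^ k"
        using xr[of l i] by (auto simp: Q_def)
    qed
    also have "\<dots> = real (m i + 1) * \<kappa> * (\<Sum>l\<in>D' i. r i l ^ k)" by (simp add: sum_distrib_left)
    also have "\<dots> \<le> real (m i + 1) * \<kappa> * (?K * H i + E i)"
      using sumr[OF finD' D'L] \<open>0 < \<kappa>\<close> by (intro mult_left_mono) auto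
    also have "\<dots> = real (m i + 1) * (\<kappa> * ?K * H i) + e * (1/2) ^ Suc i"
    proof -
      have "real (m i + 1) * \<kappa> * E i = e * (1/2) ^ Suc i" using \<open>0 < \<kappa>\<close> by (simp add: E_def)
      then show ?thesis by (simp add: distrib_left mult_ac)
    qed
    also have "\<dots> \<le> (2 * real (m i)) * (\<kappa> * ?K * H i) + e * (1/2) ^ Suc i"
      using m1 K H(2)[of i] \<open>0 < \<kappa>\<close> by (intro add_right_mono mult_right_mono) auto
    finally show ?thesis by (simp add: mult_ac)
  qed
  \<comment> \<open>The pieces are disjoint and \<open>real (m i) * \<kappa>\<close> bounds
    \<open>c\<close> from below on \<open>Q i\<close>, so the step function with these values lies
    below \<open>c\<close>.\<close>
  have mass: "(\<Sum>i\<in>N. real (m i) * \<kappa> * H i) \<le> I"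
  proof -
    have "ennreal (\<Sum>i\<in>N. real (m i) * \<kappa> * H i) = (\<Sum>i\<in>N. ennreal (real (m i) * \<kappa>) * emeasure B (Q i))"
      using H \<open>0 < \<kappa>\<close> Q by (subst sum_ennreal[symmetric]) (auto simp: emB ennreal_mult)
    also have "\<dots> = (\<Sum>i\<in>N. \<integral>\<^sup>+y. ennreal (real (m i) * \<kappa>) * indicator (Q i) y \<partial>B)"
      using Q by (simp add: nn_integral_cmult_indicator)
    also have "\<dots> = (\<integral>\<^sup>+y. (\<Sum>i\<in>N. ennreal (real (m i) * \<kappa>) * indicator (Q i) y) \<partial>B)"
      using Q by (subst nn_integral_sum) auto
    also have "\<dots> \<le> (\<integral>\<^sup>+y. ennreal (c y) \<partial>B)"
    proof (rule nn_integral_mono)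
      fix y assume "y \<in> space B"
      show "(\<Sum>i\<in>N. ennreal (real (m i) * \<kappa>) * indicator (Q i) y) \<le> ennreal (c y)"
      proof (cases "\<exists>i\<in>N. y \<in> Q i")
        case True
        then obtain i where i: "i \<in> N" "y \<in> Q i" by blast
        have "(\<Sum>i\<in>N. ennreal (real (m i) * \<kappa>) * indicator (Q i) y)
            = ennreal (real (m i) * \<kappa>) * indicator (Q i) y
              + (\<Sum>j\<in>N - {i}. ennreal (real (m j) * \<kappa>) * indicator (Q j) y)"
          by (rule sum.remove[OF finN i(1)])
        also have "(\<Sum>j\<in>N - {i}. ennreal (real (m j) * \<kappa>) * indicator (Q j) y) = 0"
          using Qdisj[OF i(2)] by (intro sum.neutral) (auto simp: indicator_def)
        finally show ?thesis using i by (auto simp: Q_def intro: ennreal_leI)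
      next
        case False
        then show ?thesis by simp
      qed
    qed
    also have "\<dots> \<le> ennreal I" by (rule I(1))
    finally show ?thesis using I(2) by (simp add: ennreal_le_iff)
  qed
  have Dsig: "D = Sigma N D'" by (force simp: N_def D'_def)
  have "(\<Sum>p\<in>D. c (X p) * R p ^ k) = (\<Sum>i\<in>N. \<Sum>l\<in>D' i. c (x i l) * r i l ^ k)"
    unfolding Dsig X_def R_def using finN finD' by (subst sum.Sigma) (auto simp: split_def)
  also have "\<dots> \<le> (\<Sum>i\<in>N. 2 * ?K * (real (m i) * \<kappa> * H i) + e * (1/2) ^ Suc i)"
    by (intro sum_mono part)
  also have "\<dots> = 2 * ?K * (\<Sum>i\<in>N. real (m i) * \<kappa> * H i) + e * (\<Sum>i\<in>N. (1/2) ^ Suc i)"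
    by (simp add: sum.distrib sum_distrib_left)
  also have "\<dots> \<le> 2 * ?K * I + e * 1"
  proof (intro add_mono mult_left_mono mass)
    have "(\<Sum>i\<in>N. (1/2::real) ^ Suc i) \<le> (\<Sum>l. (1/2) ^ Suc l)"
      using finN sums_summable[OF power_half_series] by (intro sum_le_suminf) auto
    also have "\<dots> = 1" by (rule sums_unique[OF power_half_series, symmetric])
    finally show "(\<Sum>i\<in>N. (1/2::real) ^ Suc i) \<le> 1" .
  qed (use K \<open>0 < e\<close> in auto)
  finally have total: "(\<Sum>p\<in>D. c (X p) * R p ^ k) \<le> 2 * ?K * I + e" by simp
  have props: "X p \<in> A \<and> 0 < R p \<and> (\<exists>j. X p \<in> P j \<and> R p < \<delta> j)" if "p \<in> D" for p
  proof -
    have "snd p \<in> L (fst p)" using that D(1) by auto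
    from xr[OF this] QA QP show ?thesis unfolding X_def R_def by blast
  qed
  show ?thesis
    using D(2,3) total props
    by (intro exI[of _ "prod_encode ` D"] exI[of _ "X \<circ> prod_decode"] exI[of _ "R \<circ> prod_decode"])
       (auto simp: sum.reindex inj_prod_encode)
qed

section \<open>Flux through the boundary\<close>

text \<open>The first factors are those of the estimate by caps. The last is the constant of the
  weighted cover, doubled because the weight used there is
  \<open>2 * h' + 2 * \<kappa>\<close>.\<close>

definition flux_const :: "nat \<Rightarrow> real" where
  "flux_const n = 17 * unit_ball_vol (real n) * 8 ^ n * (4 * ball_cover_const (n - 1))"

text \<open>Normals are given point by point, without a measurable choice. Pulling this closed set
  back by \<open>x \<mapsto> (x, h' x)\<close> shows that the points which are flat at a fixed scale
  \<open>d\<close> form a measurable set. In a limit of such points the directions subconverge by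
  compactness of the sphere.\<close>

lemma closed_flat_points:
  fixes \<Gamma> :: "'a::euclidean_space set" and F :: "'a \<Rightarrow> 'a"
  assumes \<Gamma>: "closed \<Gamma>" and F: "continuous_on UNIV F"
  shows "closed {(x, s). x \<in> \<Gamma> \<and> (\<exists>\<nu>. norm \<nu> = 1 \<and> \<bar>F x \<bullet> \<nu>\<bar> \<le> s \<and>
    (\<forall>y\<in>\<Gamma>. dist x y < d \<longrightarrow> \<bar>(y - x) \<bullet> \<nu>\<bar> \<le> \<epsilon> * norm (y - x)))}" (is "closed ?Z")
  unfolding closed_sequential_limits
proof (intro allI impI, elim conjE)
  fix p :: "nat \<Rightarrow> 'a \<times> real" and l
  assume p: "\<forall>n. p n \<in> ?Z" and lim: "p \<longlonglongrightarrow> l"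
  define x s where "x n = fst (p n)" and "s n = snd (p n)" for n
  have "\<forall>n. \<exists>\<nu>. norm \<nu> = 1 \<and> \<bar>F (x n) \<bullet> \<nu>\<bar> \<le> s n \<and>
    (\<forall>y\<in>\<Gamma>. dist (x n) y < d \<longrightarrow> \<bar>(y - x n) \<bullet> \<nu>\<bar> \<le> \<epsilon> * norm (y - x n))"
    using p by (auto simp: x_def s_def split: prod.splits) (metis prod.collapse)
  from choice[OF this] obtain \<nu> where \<nu>: "\<And>n. norm (\<nu> n) = 1" "\<And>n. \<bar>F (x n) \<bullet> \<nu> n\<bar> \<le> s n"
    "\<And>n y. y \<in> \<Gamma> \<Longrightarrow> dist (x n) y < d \<Longrightarrow> \<bar>(y - x n) \<bullet> \<nu> n\<bar> \<le> \<epsilon> * norm (y - x n)" by blast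
  have "\<forall>n. \<nu> n \<in> sphere 0 1" using \<nu>(1) by simp
  then obtain \<mu> and r :: "nat \<Rightarrow> nat" where \<mu>: "\<mu> \<in> sphere 0 1" "strict_mono r" "(\<nu> \<circ> r) \<longlonglongrightarrow> \<mu>"
    using compact_sphere[of "0::'a" 1] unfolding compact_def by metis
  have limr: "(\<lambda>n. \<nu> (r n)) \<longlonglongrightarrow> \<mu>" using \<mu>(3) by (simp add: o_def)
  have limx: "(\<lambda>n. x (r n)) \<longlonglongrightarrow> fst l" "(\<lambda>n. s (r n)) \<longlonglongrightarrow> snd l"
    using LIMSEQ_subseq_LIMSEQ[OF tendsto_fst[OF lim] \<mu>(2)] LIMSEQ_subseq_LIMSEQ[OF tendsto_snd[OF lim] \<mu>(2)]
    by (simp_all add: x_def s_def o_def)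
  have limF: "(\<lambda>n. F (x (r n))) \<longlonglongrightarrow> F (fst l)"
    using continuous_on_tendsto_compose[OF F limx(1)] by simp
  have "x n \<in> \<Gamma>" for n using p by (auto simp: x_def split: prod.splits) (metis prod.collapse)
  then have "fst l \<in> \<Gamma>" using closed_sequentially[OF \<Gamma> _ limx(1)] by simp
  moreover have "norm \<mu> = 1" using \<mu>(1) by simp
  moreover have "\<bar>F (fst l) \<bullet> \<mu>\<bar> \<le> snd l"
    by (rule LIMSEQ_le[OF tendsto_rabs[OF tendsto_inner[OF limF limr]] limx(2)]) (use \<nu>(2) in auto)
  moreover have "\<bar>(y - fst l) \<bullet> \<mu>\<bar> \<le> \<epsilon> * norm (y - fst l)" if y: "y \<in> \<Gamma>" "dist (fst l) y < d" for y
  proof (rule LIMSEQ_le)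
    show "(\<lambda>n. \<bar>(y - x (r n)) \<bullet> \<nu> (r n)\<bar>) \<longlonglongrightarrow> \<bar>(y - fst l) \<bullet> \<mu>\<bar>"
      by (intro tendsto_intros limx limr)
    show "(\<lambda>n. \<epsilon> * norm (y - x (r n))) \<longlonglongrightarrow> \<epsilon> * norm (y - fst l)"
      by (intro tendsto_intros limx)
    \<comment> \<open>Because \<open>dist (fst l) y < d\<close> is strict, it is inherited by the
      centres \<open>x (r n)\<close> for large \<open>n\<close>, whose flatness at \<open>y\<close>
      can then be used.\<close>
    have "(\<lambda>n. dist (x (r n)) y) \<longlonglongrightarrow> dist (fst l) y" by (intro tendsto_intros limx)
    then have "\<forall>\<^sub>F n in sequentially. dist (x (r n)) y < d" using y(2) by (rule order_tendstoD)
    then obtain N where "\<forall>n\<ge>N. dist (x (r n)) y < d" by (auto simp: eventually_sequentially)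
    then show "\<exists>N. \<forall>n\<ge>N. \<bar>(y - x (r n)) \<bullet> \<nu> (r n)\<bar> \<le> \<epsilon> * norm (y - x (r n))"
      using \<nu>(3)[OF y(1)] by blast
  qed
  ultimately show "l \<in> ?Z" by (auto simp: case_prod_beta)
qed

text \<open>A frontier point lies neither in \<open>\<Omega>\<close> nor outside its closure, so it
  avoids both cones in the definition of the normal.\<close>

lemma outward_unit_normal_flat:
  assumes "outward_unit_normal \<Omega> x \<nu>" "open \<Omega>" "0 < \<epsilon>"
  shows "\<exists>r>0. \<forall>y\<in>frontier \<Omega>. dist x y < r \<longrightarrow> \<bar>(y - x) \<bullet> \<nu>\<bar> \<le> \<epsilon> * norm (y - x)"
proof -
  obtain r where r: "0 < r" "\<And>y. y \<in> ball x r \<Longrightarrow>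
      ((y - x) \<bullet> \<nu> < - \<epsilon> * norm (y - x) \<longrightarrow> y \<in> \<Omega>) \<and>
      ((y - x) \<bullet> \<nu> > \<epsilon> * norm (y - x) \<longrightarrow> y \<notin> closure \<Omega>)"
    using assms unfolding outward_unit_normal_def by blast
  have "\<bar>(y - x) \<bullet> \<nu>\<bar> \<le> \<epsilon> * norm (y - x)" if y: "y \<in> frontier \<Omega>" "dist x y < r" for y
  proof -
    have "y \<notin> \<Omega>" "y \<in> closure \<Omega>" using y(1) \<open>open \<Omega>\<close> by (auto simp: frontier_def interior_open)
    then show ?thesis using r(2)[of y] y(2) by (auto simp: abs_le_iff not_less)
  qed
  then show ?thesis using r(1) by blast
qed

text \<open>
  Points with \<open>norm (F x) \<le> h x\<close> are covered by caps of flatness \<open>1\<close>, for which the slab condition is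
  void, the other ones by caps that are flat in the direction of the normal.
\<close>

lemma divergence_integral_le_boundary:
  fixes \<Omega> :: "'a::euclidean_space set" and F :: "'a \<Rightarrow> 'a" and h :: "'a \<Rightarrow> real"
  assumes \<Omega>: "open \<Omega>" "bounded \<Omega>" and fin: "hausdorff_outer (DIM('a) - 1) (frontier \<Omega>) < top"
    and F: "\<And>b. b \<in> Basis \<Longrightarrow> C_fun (Suc 0) (\<lambda>x. F x \<bullet> b)"
    and h: "h \<in> borel_measurable (boundary_measure \<Omega>)" "\<And>x. 0 \<le> h x"
    and AE: "AE x in boundary_measure \<Omega>.
       norm (F x) \<le> h x \<or> (\<exists>\<nu>. outward_unit_normal \<Omega> x \<nu> \<and> \<bar>F x \<bullet> \<nu>\<bar> \<le> h x)"
    and I: "(\<integral>\<^sup>+x. ennreal (h x) \<partial>boundary_measure \<Omega>) \<le> ennreal I" "0 \<le> I"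
  shows "\<bar>LINT y|lebesgue_on \<Omega>. divergence F y\<bar> \<le> flux_const (DIM('a)) * I"
proof -
  define k where "k = DIM('a) - 1"
  define \<Gamma> where "\<Gamma> = frontier \<Omega>"
  define B where "B = boundary_measure \<Omega>"
  have B: "B = restrict_space (hausdorff_measure k) \<Gamma>" by (simp add: B_def boundary_measure_def k_def \<Gamma>_def)
  have \<Gamma>: "compact \<Gamma>" unfolding \<Gamma>_def using \<Omega> by (rule_tac compact_frontier_bounded)
  have \<Gamma>set: "\<Gamma> \<in> sets (hausdorff_measure k)"
    using borel_subset_sets_hausdorff borel_closed[OF compact_imp_closed[OF \<Gamma>]] by blast
  have spB: "space B = \<Gamma>" by (simp add: B space_restrict_space)
  define H where "H = enn2real (hausdorff_outer k \<Gamma>)"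
  have H: "emeasure B \<Gamma> = ennreal H" "0 \<le> H"
    using fin \<Gamma>set by (simp_all add: B emeasure_restrict_space emeasure_hausdorff H_def k_def \<Gamma>_def less_top)
  have contF: "continuous_on UNIV F"
  proof (subst continuous_on_componentwise, rule ballI)
    fix b :: 'a assume "b \<in> Basis"
    then show "continuous_on UNIV (\<lambda>x. F x \<bullet> b)" using C_fun_continuous[OF F] by blast
  qed
  obtain R where R: "\<Gamma> \<subseteq> ball 0 R" "0 < R"
    using bounded_subset_ballD[OF compact_imp_bounded[OF \<Gamma>], of 0] by blast
  \<comment> \<open>All radii will be below 1 and slabs reach twice as far, so \<open>T\<close>
    contains every slab around a boundary point.\<close>
  define T where "T = cball (0::'a) (R + 2)"
  have "compact T" by (simp add: T_def)
  then have "bounded (F ` T)"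
    by (intro compact_imp_bounded compact_continuous_image continuous_on_subset[OF contF]) auto
  then obtain Mf where Mf: "0 < Mf" "\<And>y. y \<in> T \<Longrightarrow> norm (F y) \<le> Mf"
    by (auto simp: bounded_pos)
  have "bounded (divergence F ` closure \<Omega>)"
    using \<Omega> by (intro compact_imp_bounded compact_continuous_image
        continuous_on_subset[OF continuous_on_divergence[OF F]]) auto
  then obtain M where M: "0 < M" "\<And>y. y \<in> closure \<Omega> \<Longrightarrow> \<bar>divergence F y\<bar> \<le> M"
    by (auto simp: bounded_pos)
  have ucont: "uniformly_continuous_on T F"
    by (rule compact_uniformly_continuous[OF continuous_on_subset[OF contF] \<open>compact T\<close>]) simp
  obtain N where N: "N \<in> null_sets B" "\<And>x. x \<in> \<Gamma> - N \<Longrightarrow> norm (F x) \<le> h x \<or> (\<exists>\<nu>. outward_unit_normal \<Omega> x \<nu> \<and> \<bar>F x \<bullet> \<nu>\<bar> \<le> h x)"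
    using AE[folded B_def] unfolding eventually_ae_filter spB by blast
  \<comment> \<open>On the exceptional null set the bound is raised to \<open>Mf\<close>, an upper
    bound for the field there, so that every boundary point satisfies one of the two alternatives.
    The integral does not change.\<close>
  define h' where "h' x = (if x \<in> N then Mf else h x)" for x
  have Nset: "N \<in> sets B" using N by auto
  have hB: "h \<in> borel_measurable B" using h(1) by (simp add: B_def)
  have h': "h' \<in> borel_measurable B"
    unfolding h'_def[abs_def] by (rule measurable_If_set) (use Nset hB spB in \<open>auto simp: sets.Int\<close>)
  have h'0: "0 \<le> h' x" for x using h(2) Mf by (simp add: h'_def)
  have intB: "(\<integral>\<^sup>+x. ennreal (h' x) \<partial>B) = (\<integral>\<^sup>+x. ennreal (h x) \<partial>B)"
    by (rule nn_integral_cong_AE) (use AE_not_in[OF N(1)] in eventually_elim, simp add: h'_def)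
  let ?K = "ball_cover_const k" and ?C = "17 * unit_ball_vol (DIM('a)) * 8 ^ DIM('a)"
  note K = ball_cover_const_pos[of k]
  have est: "\<bar>LINT y|lebesgue_on \<Omega>. divergence F y\<bar> \<le> ?C * (2 * ?K * (2 * I + 2 * \<kappa> * H) + \<kappa>)"
    if \<kappa>: "0 < \<kappa>" "\<kappa> \<le> 1" for \<kappa>
  proof -
    define \<epsilon> where "\<epsilon> = min 1 (\<kappa> / Mf)"
    have \<epsilon>: "0 < \<epsilon>" "\<epsilon> \<le> 1" "\<epsilon> * Mf \<le> \<kappa>"
      using \<kappa> Mf by (auto simp: \<epsilon>_def min_def field_simps)
    obtain \<delta>0 where \<delta>0: "0 < \<delta>0" "\<And>x y. x \<in> T \<Longrightarrow> y \<in> T \<Longrightarrow> dist y x < \<delta>0 \<Longrightarrow> dist (F y) (F x) < \<kappa>"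
      using ucont \<kappa> unfolding uniformly_continuous_on_def by metis
    define d where "d j = 1 / real (Suc j)" for j
    \<comment> \<open>Four demands on a radius below \<open>\<delta> j\<close>: \<open>F\<close>
      varies by less than \<open>\<kappa>\<close> over the slab, which is twice as large as the
      ball; \<open>M\<close> times the radius is at most \<open>\<kappa>\<close>; the flatness of
      the boundary at scale \<open>d j\<close> holds in the whole ball; the slab stays in
      \<open>T\<close>.\<close>
    define \<delta> where "\<delta> j = min (\<delta>0 / 2) (min (\<kappa> / M) (min (d j) 1))" for j
    have \<delta>: "0 < \<delta> j" "\<delta> j \<le> \<delta>0 / 2" "\<delta> j \<le> \<kappa> / M" "\<delta> j \<le> d j" "\<delta> j \<le> 1" for j
    proof -
      show "0 < \<delta> j" using \<delta>0(1) \<kappa> M(1) by (simp add: \<delta>_def d_def)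
    qed (unfold \<delta>_def, linarith+)
    define Z where "Z j = {(x, s). x \<in> \<Gamma> \<and> (\<exists>\<nu>. norm \<nu> = 1 \<and> \<bar>F x \<bullet> \<nu>\<bar> \<le> s \<and>
      (\<forall>y\<in>\<Gamma>. dist x y < d j \<longrightarrow> \<bar>(y - x) \<bullet> \<nu>\<bar> \<le> \<epsilon> * norm (y - x)))}" for j
    have Zcl: "closed (Z j)" for j
      unfolding Z_def by (rule closed_flat_points[OF compact_imp_closed[OF \<Gamma>] contF])
    define Dir where "Dir = {x \<in> \<Gamma>. norm (F x) \<le> h' x}"
    define P where "P j = Dir \<union> {x \<in> \<Gamma>. (x, h' x) \<in> Z j}" for j
    have idB: "(\<lambda>x. x) \<in> measurable B borel" unfolding B by (rule hausdorff_measurable_ident)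
    have "(\<lambda>x. (x, h' x)) \<in> measurable B borel"
      unfolding borel_prod[symmetric] by (intro measurable_Pair idB h')
    then have "(\<lambda>x. (x, h' x)) -` Z j \<inter> space B \<in> sets B" for j
      by (rule measurable_sets) (simp add: Zcl borel_closed)
    moreover have "Dir \<in> sets B"
    proof -
      have "(\<lambda>x. norm (F x)) \<in> borel_measurable borel"
        by (intro borel_measurable_continuous_onI continuous_on_norm contF)
      then have "(\<lambda>x. norm (F x)) \<in> borel_measurable B"
        using measurable_compose[OF idB] by blast
      then show ?thesis unfolding Dir_def spB[symmetric] using h' by measurable
    qed
    ultimately have P: "P j \<in> sets B" for j
      unfolding P_def by (intro sets.Un) (auto simp: spB vimage_def Int_def conj_commute)
    have cov: "\<Gamma> \<subseteq> (\<Union>j. P j)"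
    proof
      fix x assume x: "x \<in> \<Gamma>"
      show "x \<in> (\<Union>j. P j)"
      proof (cases "norm (F x) \<le> h' x")
        case True
        then show ?thesis using x by (auto simp: P_def Dir_def)
      next
        case False
        have "x \<in> T" using R x by (auto simp: T_def)
        with False have "x \<notin> N" using Mf(2)[of x] by (auto simp: h'_def)
        with False obtain \<nu> where \<nu>: "outward_unit_normal \<Omega> x \<nu>" "\<bar>F x \<bullet> \<nu>\<bar> \<le> h' x"
          using N(2)[of x] x by (auto simp: h'_def)
        obtain r where r: "0 < r" "\<forall>y\<in>\<Gamma>. dist x y < r \<longrightarrow> \<bar>(y - x) \<bullet> \<nu>\<bar> \<le> \<epsilon> * norm (y - x)"
          using outward_unit_normal_flat[OF \<nu>(1) \<Omega>(1) \<epsilon>(1)] by (auto simp: \<Gamma>_def)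
        obtain j where j: "d j < r"
          using reals_Archimedean[OF r(1)] by (auto simp: d_def inverse_eq_divide)
        have "norm \<nu> = 1" using \<nu>(1) by (simp add: outward_unit_normal_def)
        then have "(x, h' x) \<in> Z j" using x \<nu>(2) r(2) j unfolding Z_def by fastforce
        then show ?thesis using x by (auto simp: P_def)
      qed
    qed
    \<comment> \<open>For caps of flatness 1 the quantity to be bounded is at most
      \<open>2 * norm (F y)\<close>, hence \<open>2 * (h' + \<kappa>)\<close>; for flat caps it is
      at most \<open>h' + \<kappa> + \<epsilon> * Mf\<close>. This weight serves both, and it is at
      least \<open>\<kappa>\<close>, as the weighted cover requires.\<close>
    define c where "c x = 2 * h' x + 2 * \<kappa>" for x
    have c: "c \<in> borel_measurable B" "\<And>x. x \<in> \<Gamma> \<Longrightarrow> \<kappa> \<le> c x"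
      using h' h'0 \<kappa> by (auto simp: c_def[abs_def])
    have ic: "(\<integral>\<^sup>+x. ennreal (c x) \<partial>B) \<le> ennreal (2 * I + 2 * \<kappa> * H)"
    proof -
      have "(\<integral>\<^sup>+x. ennreal (c x) \<partial>B) = (\<integral>\<^sup>+x. 2 * ennreal (h' x) + ennreal (2 * \<kappa>) \<partial>B)"
        using h'0 \<kappa> by (intro nn_integral_cong) (simp add: c_def ennreal_mult')
      also have "\<dots> = 2 * (\<integral>\<^sup>+x. ennreal (h' x) \<partial>B) + ennreal (2 * \<kappa>) * emeasure B (space B)"
        using h' by (subst nn_integral_add) (auto simp: nn_integral_cmult)
      also have "\<dots> \<le> 2 * ennreal I + ennreal (2 * \<kappa>) * ennreal H"
        unfolding intB spB H(1) using I(1)[folded B_def] by (intro add_mono mult_left_mono) auto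
      also have "\<dots> = ennreal (2 * I + 2 * \<kappa> * H)"
        using I(2) H(2) \<kappa> by (simp add: ennreal_mult' ennreal_mult)
      finally show ?thesis .
    qed
    have I': "0 \<le> 2 * I + 2 * \<kappa> * H" using I(2) H(2) \<kappa> by simp
    have fin': "hausdorff_outer k \<Gamma> < top" using fin by (simp add: k_def \<Gamma>_def)
    have "\<exists>(D :: nat set) x r. finite D \<and> \<Gamma> \<subseteq> (\<Union>i\<in>D. ball (x i) (r i)) \<and>
       (\<forall>i\<in>D. x i \<in> \<Gamma> \<and> 0 < r i \<and> (\<exists>j. x i \<in> P j \<and> r i < \<delta> j)) \<and>
       (\<Sum>i\<in>D. c (x i) * r i ^ k) \<le> 2 * ?K * (2 * I + 2 * \<kappa> * H) + \<kappa>"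
      by (rule hausdorff_weighted_ball_cover[OF \<Gamma> fin' c(1)[unfolded B] \<kappa>(1) c(2) ic[unfolded B] I'
            P[unfolded B] cov \<delta>(1) \<kappa>(1)])
    then obtain D :: "nat set" and x r where D: "finite D" "\<Gamma> \<subseteq> (\<Union>i\<in>D. ball (x i) (r i))"
      and xr_all: "\<forall>i\<in>D. x i \<in> \<Gamma> \<and> 0 < r i \<and> (\<exists>j. x i \<in> P j \<and> r i < \<delta> j)"
      and sum: "(\<Sum>i\<in>D. c (x i) * r i ^ k) \<le> 2 * ?K * (2 * I + 2 * \<kappa> * H) + \<kappa>"
      by (elim exE conjE)
    note xr = bspec[OF xr_all]
    have "\<exists>\<nu> \<eta>. norm \<nu> = 1 \<and> 0 < \<eta> \<and> \<eta> \<le> 1 \<and>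
        (\<forall>y\<in>\<Gamma> \<inter> ball (x i) (r i). \<bar>(y - x i) \<bullet> \<nu>\<bar> \<le> \<eta> * norm (y - x i)) \<and>
        (\<forall>y\<in>slab (x i) \<nu> (r i) \<eta>. \<bar>F y \<bullet> \<nu>\<bar> + \<eta> * norm (F y) \<le> c (x i))" if i: "i \<in> D" for i
    proof -
      from xr[OF i] obtain j where xi: "x i \<in> \<Gamma>" "x i \<in> P j" and ri: "0 < r i" "r i < \<delta> j" by blast
      have near: "norm (F y - F (x i)) \<le> \<kappa> \<and> norm (F y) \<le> Mf" if "norm (y - x i) \<le> 2 * r i" for y
      proof -
        have "norm (x i) < R" using xi R by auto
        moreover have "norm y \<le> norm (x i) + norm (y - x i)"
          using norm_triangle_ineq[of "x i" "y - x i"] by simp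
        moreover have "r i < 1" "2 * r i < \<delta>0" using ri \<delta>(2)[of j] \<delta>(5)[of j] by linarith+
        ultimately have "y \<in> T" "x i \<in> T" "dist y (x i) < \<delta>0"
          using that by (auto simp: T_def dist_norm)
        then show ?thesis using \<delta>0(2)[of "x i" y] Mf(2)[of y] by (auto simp: dist_norm)
      qed
      show ?thesis
      proof (cases "norm (F (x i)) \<le> h' (x i)")
        case True
        obtain \<nu> :: 'a where \<nu>: "\<nu> \<in> Basis" using nonempty_Basis by blast
        show ?thesis
        proof (intro exI[of _ \<nu>] exI[of _ 1] conjI ballI)
          show n1: "norm \<nu> = 1" using \<nu> by simp
          fix y
          show "\<bar>(y - x i) \<bullet> \<nu>\<bar> \<le> 1 * norm (y - x i)"
            using Cauchy_Schwarz_ineq2[of "y - x i" \<nu>] n1 by simp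
          assume "y \<in> slab (x i) \<nu> (r i) 1"
          then have "norm (F y - F (x i)) \<le> \<kappa>" using near[of y] by (simp add: slab_def)
          moreover have "norm (F y) \<le> norm (F (x i)) + norm (F y - F (x i))"
            using norm_triangle_ineq[of "F (x i)" "F y - F (x i)"] by simp
          moreover have "\<bar>F y \<bullet> \<nu>\<bar> \<le> norm (F y)" using Cauchy_Schwarz_ineq2[of "F y" \<nu>] n1 by simp
          ultimately show "\<bar>F y \<bullet> \<nu>\<bar> + 1 * norm (F y) \<le> c (x i)" using True by (simp add: c_def)
        qed auto
      next
        case False
        then have "(x i, h' (x i)) \<in> Z j" using xi by (auto simp: P_def Dir_def)
        then obtain \<nu> where \<nu>: "norm \<nu> = 1" "\<bar>F (x i) \<bullet> \<nu>\<bar> \<le> h' (x i)"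
          "\<forall>y\<in>\<Gamma>. dist (x i) y < d j \<longrightarrow> \<bar>(y - x i) \<bullet> \<nu>\<bar> \<le> \<epsilon> * norm (y - x i)"
          unfolding Z_def by blast
        show ?thesis
        proof (intro exI[of _ \<nu>] exI[of _ \<epsilon>] conjI ballI \<nu>(1) \<epsilon>(1,2))
          fix y
          assume "y \<in> \<Gamma> \<inter> ball (x i) (r i)"
          then show "\<bar>(y - x i) \<bullet> \<nu>\<bar> \<le> \<epsilon> * norm (y - x i)"
            using \<nu>(3) ri(2) \<delta>(4)[of j] by (auto simp: less_le_trans)
        next
          fix y
          assume "y \<in> slab (x i) \<nu> (r i) \<epsilon>"
          then have "norm (F y - F (x i)) \<le> \<kappa>" "norm (F y) \<le> Mf" using near[of y] by (auto simp: slab_def)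
          moreover have "F y \<bullet> \<nu> = F (x i) \<bullet> \<nu> + (F y - F (x i)) \<bullet> \<nu>" by (simp add: inner_diff_left)
          moreover have "\<bar>(F y - F (x i)) \<bullet> \<nu>\<bar> \<le> norm (F y - F (x i))"
            using Cauchy_Schwarz_ineq2[of "F y - F (x i)" \<nu>] \<nu>(1) by simp
          ultimately have "\<bar>F y \<bullet> \<nu>\<bar> \<le> h' (x i) + \<kappa>" using \<nu>(2) by linarith
          moreover have "\<epsilon> * norm (F y) \<le> \<epsilon> * Mf"
            using \<open>norm (F y) \<le> Mf\<close> \<epsilon> by (intro mult_left_mono) auto
          ultimately show "\<bar>F y \<bullet> \<nu>\<bar> + \<epsilon> * norm (F y) \<le> c (x i)"
            using \<epsilon>(3) h'0[of "x i"] by (simp add: c_def)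
        qed
      qed
    qed
    then have "\<forall>i\<in>D. \<exists>\<nu> \<eta>. norm \<nu> = 1 \<and> 0 < \<eta> \<and> \<eta> \<le> 1 \<and>
        (\<forall>y\<in>\<Gamma> \<inter> ball (x i) (r i). \<bar>(y - x i) \<bullet> \<nu>\<bar> \<le> \<eta> * norm (y - x i)) \<and>
        (\<forall>y\<in>slab (x i) \<nu> (r i) \<eta>. \<bar>F y \<bullet> \<nu>\<bar> + \<eta> * norm (F y) \<le> c (x i))" by (rule ballI)
    from bchoice[OF this] obtain \<nu> where "\<forall>i\<in>D. \<exists>\<eta>. norm (\<nu> i) = 1 \<and> 0 < \<eta> \<and> \<eta> \<le> 1 \<and>
        (\<forall>y\<in>\<Gamma> \<inter> ball (x i) (r i). \<bar>(y - x i) \<bullet> \<nu> i\<bar> \<le> \<eta> * norm (y - x i)) \<and>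
        (\<forall>y\<in>slab (x i) (\<nu> i) (r i) \<eta>. \<bar>F y \<bullet> \<nu> i\<bar> + \<eta> * norm (F y) \<le> c (x i))" ..
    from bchoice[OF this] obtain \<eta> where \<nu>\<eta>: "\<And>i. i \<in> D \<Longrightarrow> norm (\<nu> i) = 1 \<and> 0 < \<eta> i \<and> \<eta> i \<le> 1 \<and>
        (\<forall>y\<in>\<Gamma> \<inter> ball (x i) (r i). \<bar>(y - x i) \<bullet> \<nu> i\<bar> \<le> \<eta> i * norm (y - x i)) \<and>
        (\<forall>y\<in>slab (x i) (\<nu> i) (r i) (\<eta> i). \<bar>F y \<bullet> \<nu> i\<bar> + \<eta> i * norm (F y) \<le> c (x i))" by blast
    have "\<bar>LINT y|lebesgue_on \<Omega>. divergence F y\<bar>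
      \<le> ?C * (\<Sum>i\<in>D. c (x i) * r i ^ (DIM('a) - 1))"
    proof (rule divergence_integral_le_caps[OF \<Omega> F _ D(1), where M=M and \<nu>=\<nu> and \<epsilon>=\<eta> and x=x])
      show "\<bar>divergence F y\<bar> \<le> M" if "y \<in> \<Omega>" for y using M(2) that closure_subset by blast
      fix i assume i: "i \<in> D"
      show "norm (\<nu> i) = 1" "0 < \<eta> i \<and> \<eta> i \<le> 1" using \<nu>\<eta>[OF i] by auto
      obtain j where j: "x i \<in> \<Gamma>" "0 < r i" "r i < \<delta> j" using xr[OF i] by blast
      have "M * r i \<le> M * (\<kappa> / M)" using j \<delta>(3)[of j] M by (intro mult_left_mono) auto
      then show "0 < r i \<and> M * r i \<le> c (x i)" using j c(2)[OF j(1)] M by simp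
      show "\<bar>(y - x i) \<bullet> \<nu> i\<bar> \<le> \<eta> i * norm (y - x i)" if "y \<in> frontier \<Omega>" "y \<in> ball (x i) (r i)" for y
        using \<nu>\<eta>[OF i] that by (simp add: \<Gamma>_def)
      show "\<bar>F y \<bullet> \<nu> i\<bar> + \<eta> i * norm (F y) \<le> c (x i)" if "y \<in> slab (x i) (\<nu> i) (r i) (\<eta> i)" for y
        using \<nu>\<eta>[OF i] that by blast
    qed (use D(2) in \<open>auto simp: \<Gamma>_def\<close>)
    also have "\<dots> \<le> ?C * (2 * ?K * (2 * I + 2 * \<kappa> * H) + \<kappa>)"
      using sum by (intro mult_left_mono) (auto simp: k_def)
    finally show ?thesis .
  qed
  \<comment> \<open>\<open>\<kappa> * b\<close> is the part of the estimate that is linear in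
    \<open>\<kappa>\<close>.\<close>
  define b where "b = ?C * (4 * ?K * H + 1)"
  have b: "0 < b" unfolding b_def using K H(2) by (intro mult_pos_pos add_nonneg_pos) auto
  show ?thesis
  proof (rule field_le_epsilon)
    fix e :: real assume "0 < e"
    define \<kappa> where "\<kappa> = min 1 (e / b)"
    have \<kappa>: "0 < \<kappa>" "\<kappa> \<le> 1" "\<kappa> * b \<le> e"
      using \<open>0 < e\<close> b by (auto simp: \<kappa>_def min_def field_simps)
    have "?C * (2 * ?K * (2 * I + 2 * \<kappa> * H) + \<kappa>) = flux_const (DIM('a)) * I + \<kappa> * b"
      by (simp add: flux_const_def b_def k_def algebra_simps)
    with est[OF \<kappa>(1,2)] \<kappa>(3)
    show "\<bar>LINT y|lebesgue_on \<Omega>. divergence F y\<bar> \<le> flux_const (DIM('a)) * I + e" by linarith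
  qed
qed

section \<open>Finiteness of the boundary measure\<close>

lemma hausdorff_outer_finite_UN:
  fixes A :: "'i \<Rightarrow> 'a::metric_space set"
  assumes "finite I" "\<And>i. i \<in> I \<Longrightarrow> hausdorff_outer k (A i) < top"
  shows "hausdorff_outer k (\<Union>i\<in>I. A i) < top"
  using assms
proof (induction I)
  case (insert i I)
  have "hausdorff_outer k (A i \<union> (\<Union>i\<in>I. A i)) \<le> hausdorff_outer k (A i) + hausdorff_outer k (\<Union>i\<in>I. A i)"
    by (rule hausdorff_outer_Un)
  also have "\<dots> < top" using insert by simp
  finally show ?case by simp
qed simp

text \<open>The packing bound limits the size of separated sets, so a largest
  \<open>\<delta>\<close>-separated subset of \<open>A\<close> exists. The balls of radius
  \<open>\<delta>\<close> around its points cover \<open>A\<close>, and the same bound controls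
  their total gauge.\<close>

lemma hausdorff_outer_finite_packing:
  fixes A :: "'a::euclidean_space set"
  assumes "0 < \<delta>1" "0 \<le> C"
    and pack: "\<And>\<delta> S. 0 < \<delta> \<Longrightarrow> \<delta> \<le> \<delta>1 \<Longrightarrow> finite S \<Longrightarrow> S \<subseteq> A \<Longrightarrow>
      (\<And>p q. p \<in> S \<Longrightarrow> q \<in> S \<Longrightarrow> p \<noteq> q \<Longrightarrow> \<delta> \<le> dist p q) \<Longrightarrow> real (card S) * \<delta> ^ k \<le> C"
  shows "hausdorff_outer k A < top"
proof -
  have "hausdorff_content k \<delta>' A \<le> ennreal (unit_ball_vol (real k) * C)" if "0 < \<delta>'" for \<delta>'
  proof -
    define \<delta> where "\<delta> = min \<delta>1 (\<delta>' / 2)"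
    have \<delta>: "0 < \<delta>" "\<delta> \<le> \<delta>1" "2 * \<delta> \<le> \<delta>'" using that \<open>0 < \<delta>1\<close> by (auto simp: \<delta>_def min_def)
    define Sep where "Sep = {S. finite S \<and> S \<subseteq> A \<and> (\<forall>p\<in>S. \<forall>q\<in>S. p \<noteq> q \<longrightarrow> \<delta> \<le> dist p q)}"
    have bnd: "card S \<le> nat \<lceil>C / \<delta> ^ k\<rceil>" if "S \<in> Sep" for S
    proof -
      have "real (card S) * \<delta> ^ k \<le> C" using that pack[OF \<delta>(1,2), of S] by (auto simp: Sep_def)
      then have "real (card S) \<le> C / \<delta> ^ k" using \<delta> by (simp add: field_simps)
      then show ?thesis by linarith
    qed
    have "{} \<in> Sep" by (simp add: Sep_def)
    have "\<forall>S. S \<in> Sep \<longrightarrow> card S < Suc (nat \<lceil>C / \<delta> ^ k\<rceil>)"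
      using bnd by (intro allI impI le_imp_less_Suc)
    from ex_has_greatest_nat[of "\<lambda>S. S \<in> Sep", OF \<open>{} \<in> Sep\<close> this]
    obtain S where S: "S \<in> Sep" and max: "\<forall>S'. S' \<in> Sep \<longrightarrow> card S' \<le> card S"
      by (elim exE conjE)
    have finS: "finite S" and SA: "S \<subseteq> A" and sep: "\<And>p q. p \<in> S \<Longrightarrow> q \<in> S \<Longrightarrow> p \<noteq> q \<Longrightarrow> \<delta> \<le> dist p q"
      using S by (auto simp: Sep_def)
    have near: "\<exists>p\<in>S. dist p a < \<delta>" if a: "a \<in> A" for a
    proof (rule ccontr)
      assume "\<not> (\<exists>p\<in>S. dist p a < \<delta>)"
      then have far: "\<And>p. p \<in> S \<Longrightarrow> \<delta> \<le> dist p a" by (auto simp: not_less)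
      then have "a \<notin> S" using \<delta> by fastforce
      have "insert a S \<in> Sep"
        using finS SA sep far a by (auto simp: Sep_def dist_commute)
      then have "card (insert a S) \<le> card S" using max by simp
      then show False using finS \<open>a \<notin> S\<close> by simp
    qed
    obtain s where s: "bij_betw s {0..<card S} S" using ex_bij_betw_nat_finite[OF finS] by blast
    define D where "D i = (if i < card S then cball (s i) \<delta> else {})" for i
    have "D \<in> fine_covers \<delta>' A"
    proof -
      have "A \<subseteq> (\<Union>i. D i)"
      proof
        fix a assume "a \<in> A"
        then obtain p where p: "p \<in> S" "dist p a < \<delta>" using near by blast
        have "p \<in> s ` {0..<card S}" using p(1) bij_betw_imp_surj_on[OF s] by simp
        then obtain i where "i < card S" "s i = p" by auto
        then show "a \<in> (\<Union>i. D i)" using p by (intro UN_I[of i]) (auto simp: D_def)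
      qed
      moreover have "bounded (D i) \<and> diameter (D i) \<le> \<delta>'" for i
        using \<delta> that by (auto simp: D_def)
      ultimately show ?thesis by (simp add: fine_covers_def)
    qed
    then have "hausdorff_content k \<delta>' A \<le> (\<Sum>i. hausdorff_gauge k (D i))"
      unfolding hausdorff_content_def by (rule INF_lower)
    also have "\<dots> = (\<Sum>i<card S. hausdorff_gauge k (D i))"
      by (rule suminf_finite) (auto simp: D_def hausdorff_gauge_def)
    also have "\<dots> = (\<Sum>i<card S. ennreal (unit_ball_vol (real k) * \<delta> ^ k))"
      using \<delta> by (intro sum.cong) (auto simp: D_def hausdorff_gauge_def)
    also have "\<dots> = ennreal (unit_ball_vol (real k) * (real (card S) * \<delta> ^ k))"
      using \<delta> by (subst sum_ennreal) (auto simp: mult_ac)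
    also have "\<dots> \<le> ennreal (unit_ball_vol (real k) * C)"
      using pack[OF \<delta>(1,2) finS SA sep] by (intro ennreal_leI mult_left_mono) auto
    finally show ?thesis .
  qed
  then have "hausdorff_outer k A \<le> ennreal (unit_ball_vol (real k) * C)"
    unfolding hausdorff_outer_def by (auto intro!: SUP_least)
  also have "\<dots> < top" by simp
  finally show ?thesis .
qed

text \<open>Volume comparison: balls of radius \<open>\<delta> / 2\<close> around
  \<open>\<delta>\<close>-separated points of \<open>A\<close> are disjoint and lie in a strip
  around the zero set of \<open>\<psi>\<close> whose volume is of order \<open>\<delta>\<close>.
  Hence the number of points is at most of order \<open>1 / \<delta> ^ (n - 1)\<close> in dimension
  \<open>n\<close>.\<close>

lemma hausdorff_outer_lipschitz_graph:
  fixes A :: "'a::euclidean_space set" and \<psi> :: "'a \<Rightarrow> real"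
  assumes "0 < r" "0 \<le> L" and e: "norm e = 1" and A: "A \<subseteq> ball x (r / 2)"
    and shift: "\<And>y t. \<psi> (y + t *\<^sub>R e) = \<psi> y + t" and lip: "\<And>y z. \<bar>\<psi> y - \<psi> z\<bar> \<le> L * norm (y - z)"
    and zero: "\<And>y. y \<in> A \<Longrightarrow> \<psi> y = 0"
  shows "hausdorff_outer (DIM('a) - 1) A < top"
proof (rule hausdorff_outer_finite_packing[where ?\<delta>1.0="r / (L + 1)" and C="2 ^ DIM('a) * (L + 1) / r * (4 * r) ^ DIM('a)"])
  show "0 < r / (L + 1)" "0 \<le> 2 ^ DIM('a) * (L + 1) / r * (4 * r) ^ DIM('a)"
    using assms by auto
  fix \<delta> :: real and S :: "'a set"
  assume \<delta>: "0 < \<delta>" "\<delta> \<le> r / (L + 1)" and S: "finite S" "S \<subseteq> A"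
    and sep: "\<And>p q. p \<in> S \<Longrightarrow> q \<in> S \<Longrightarrow> p \<noteq> q \<Longrightarrow> \<delta> \<le> dist p q"
  let ?V = "unit_ball_vol (DIM('a))"
  \<comment> \<open>Working with \<open>L + 1\<close> in place of \<open>L\<close> keeps the strip
    nondegenerate for \<open>L = 0\<close> and gives \<open>\<delta> \<le> r\<close> as
    well.\<close>
  have "\<delta> * (L + 1) \<le> r" using \<delta> \<open>0 \<le> L\<close> by (simp add: field_simps)
  moreover have "\<delta> * 1 \<le> \<delta> * (L + 1)" using \<delta> \<open>0 \<le> L\<close> by (intro mult_left_mono) auto
  ultimately have \<delta>r: "\<delta> \<le> r" "\<delta> * (L + 1) \<le> r" by simp_all
  define U where "U = (\<Union>p\<in>S. ball p (\<delta> / 2))"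
  have Um: "U \<in> lmeasurable" unfolding U_def using S by (intro fmeasurable.finite_UN) auto
  have "real (card S) * (?V * (\<delta> / 2) ^ DIM('a)) = (\<Sum>p\<in>S. measure lebesgue (ball p (\<delta> / 2)))"
    using \<delta> by (simp add: content_ball)
  also have "\<dots> = measure lebesgue U"
    unfolding U_def
  proof (rule measure_UNION'[symmetric])
    show "pairwise (\<lambda>p q. disjnt (ball p (\<delta> / 2)) (ball q (\<delta> / 2))) S"
    proof (rule pairwiseI)
      fix p q assume "p \<in> S" "q \<in> S" "p \<noteq> q"
      then have "\<delta> \<le> dist p q" by (rule sep)
      then show "disjnt (ball p (\<delta> / 2)) (ball q (\<delta> / 2))"
        by (simp add: disjnt_def disjoint_ballI)
    qed
  qed (use S in auto)
  also have "\<dots> \<le> \<delta> * (L + 1) / r * (?V * (4 * r) ^ DIM('a))"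
  proof (rule measure_strip_le[OF Um _ e shift])
    show "U \<subseteq> cball x r"
    proof
      fix y assume "y \<in> U"
      then obtain p where p: "p \<in> S" "dist p y < \<delta> / 2" by (auto simp: U_def)
      have "dist x p < r / 2" using p S A by auto
      then have "dist x y < r" using p(2) \<delta>r(1) dist_triangle[of x y p] by linarith
      then show "y \<in> cball x r" by simp
    qed
    show "\<bar>\<psi> y\<bar> \<le> \<delta> * (L + 1)" if "y \<in> U" for y
    proof -
      from that obtain p where p: "p \<in> S" "norm (y - p) < \<delta> / 2"
        by (auto simp: U_def dist_norm norm_minus_commute)
      have "\<psi> p = 0" using p S zero by auto
      then have "\<bar>\<psi> y\<bar> \<le> L * norm (y - p)" using lip[of y p] by simp
      also have "\<dots> \<le> (L + 1) * \<delta>" using p(2) \<open>0 \<le> L\<close> \<delta> by (intro mult_mono) auto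
      finally show ?thesis by (simp add: mult.commute)
    qed
    show "0 < \<delta> * (L + 1)" using \<delta> \<open>0 \<le> L\<close> by simp
  qed (rule \<delta>r)
  finally have "?V * (real (card S) * (\<delta> / 2) ^ DIM('a)) \<le> ?V * (\<delta> * (L + 1) / r * (4 * r) ^ DIM('a))"
    by (simp add: mult_ac)
  then have main: "real (card S) * (\<delta> / 2) ^ DIM('a) \<le> \<delta> * (L + 1) / r * (4 * r) ^ DIM('a)"
    by (subst (asm) mult_le_cancel_left_pos) auto
  have dn: "\<delta> ^ DIM('a) = \<delta> * \<delta> ^ (DIM('a) - 1)"
    by (metis DIM_positive power_eq_if less_not_refl)
  have "\<delta> * (real (card S) * \<delta> ^ (DIM('a) - 1)) = 2 ^ DIM('a) * (real (card S) * (\<delta> / 2) ^ DIM('a))"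
    by (simp add: power_divide dn)
  also have "\<dots> \<le> 2 ^ DIM('a) * (\<delta> * (L + 1) / r * (4 * r) ^ DIM('a))"
    using main by (intro mult_left_mono) auto
  finally have "\<delta> * (real (card S) * \<delta> ^ (DIM('a) - 1)) \<le> \<delta> * (2 ^ DIM('a) * (L + 1) / r * (4 * r) ^ DIM('a))"
    by (simp add: mult_ac)
  then show "real (card S) * \<delta> ^ (DIM('a) - 1) \<le> 2 ^ DIM('a) * (L + 1) / r * (4 * r) ^ DIM('a)"
    using \<delta>(1) by (subst (asm) mult_le_cancel_left_pos) auto
qed

text \<open>Locally the frontier lies in the zero set of \<open>\<psi>\<close>, the signed height
  above the graph, and by compactness finitely many such pieces suffice. The Lipschitz constant
  \<open>1 + 2 * L\<close> comes from the crude bound 2 for the projection to the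
  hyperplane.\<close>

lemma hausdorff_outer_lipschitz_boundary:
  fixes \<Omega> :: "'a::euclidean_space set"
  assumes \<Omega>: "open \<Omega>" "bounded \<Omega>" and lip: "lipschitz_boundary \<Omega>"
  shows "hausdorff_outer (DIM('a) - 1) (frontier \<Omega>) < top"
proof -
  have loc: "\<exists>r>0. hausdorff_outer (DIM('a) - 1) (frontier \<Omega> \<inter> ball x (r / 2)) < top"
    if x: "x \<in> frontier \<Omega>" for x
  proof -
    from lip x obtain r e L and g :: "'a \<Rightarrow> real" where r: "0 < r" and e: "norm e = 1"
      and g: "L-lipschitz_on {z. z \<bullet> e = 0} g"
      and graph: "\<And>y. y \<in> ball x r \<Longrightarrow> y \<in> \<Omega> \<longleftrightarrow> g (y - (y \<bullet> e) *\<^sub>R e) < y \<bullet> e"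
      unfolding lipschitz_boundary_def by blast
    define \<psi> where "\<psi> y = y \<bullet> e - g (y - (y \<bullet> e) *\<^sub>R e)" for y
    have L: "0 \<le> L" by (rule lipschitz_on_nonneg[OF g])
    have ee: "e \<bullet> e = 1" using e by (simp add: norm_eq_1)
    have ie: "\<bar>v \<bullet> e\<bar> \<le> norm v" for v using Cauchy_Schwarz_ineq2[of v e] e by simp
    have lip\<psi>: "\<bar>\<psi> y - \<psi> z\<bar> \<le> (1 + 2 * L) * norm (y - z)" for y z
    proof -
      let ?y = "y - (y \<bullet> e) *\<^sub>R e" and ?z = "z - (z \<bullet> e) *\<^sub>R e"
      have "dist (g ?y) (g ?z) \<le> L * dist ?y ?z"
        by (rule lipschitz_onD[OF g]) (simp_all add: inner_diff_left ee)
      moreover have "dist ?y ?z \<le> 2 * norm (y - z)"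
      proof -
        have "?y - ?z = (y - z) - ((y - z) \<bullet> e) *\<^sub>R e" by (simp add: inner_diff_left algebra_simps)
        then have "norm (?y - ?z) \<le> norm (y - z) + norm (((y - z) \<bullet> e) *\<^sub>R e)"
          by (metis norm_triangle_ineq4)
        also have "\<dots> \<le> 2 * norm (y - z)" using ie[of "y - z"] e by simp
        finally show ?thesis by (simp add: dist_norm)
      qed
      then have "L * dist ?y ?z \<le> L * (2 * norm (y - z))" using L by (rule mult_left_mono)
      ultimately have "\<bar>g ?y - g ?z\<bar> \<le> 2 * L * norm (y - z)" by (simp add: dist_real_def)
      moreover have "\<bar>y \<bullet> e - z \<bullet> e\<bar> \<le> norm (y - z)" using ie[of "y - z"] by (simp add: inner_diff_left)
      ultimately have "\<bar>\<psi> y - \<psi> z\<bar> \<le> norm (y - z) + 2 * L * norm (y - z)" unfolding \<psi>_def by linarith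
      then show ?thesis by (simp add: distrib_right)
    qed
    have "\<psi> p = 0" if p: "p \<in> frontier \<Omega>" "p \<in> ball x (r / 2)" for p
    proof (rule antisym)
      have pr: "p \<in> ball x r" using p r by auto
      have "p \<notin> \<Omega>" "p \<in> closure \<Omega>" using p(1) \<Omega>(1) by (auto simp: frontier_def interior_open)
      then show "\<psi> p \<le> 0" using graph[OF pr] by (simp add: \<psi>_def not_less)
      show "0 \<le> \<psi> p"
      proof (rule field_le_epsilon)
        fix \<epsilon> :: real assume "0 < \<epsilon>"
        \<comment> \<open>The bound \<open>r / 2\<close> keeps the approximating point
          \<open>y\<close> in the ball where the graph describes \<open>\<Omega>\<close>; the other
          bound lets \<open>\<psi>\<close> change by at most \<open>\<epsilon>\<close> between
          \<open>y\<close> and \<open>p\<close>.\<close>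
        define d where "d = min (r / 2) (\<epsilon> / (1 + 2 * L))"
        have L1: "0 < 1 + 2 * L" using L by simp
        have d: "0 < d" "d \<le> r / 2" "d \<le> \<epsilon> / (1 + 2 * L)"
          unfolding d_def using \<open>0 < \<epsilon>\<close> r L1 by (simp, linarith+)
        then have d3: "d * (1 + 2 * L) \<le> \<epsilon>" using L1 by (simp add: pos_le_divide_eq)
        obtain y where y: "y \<in> \<Omega>" "dist y p < d"
          using \<open>p \<in> closure \<Omega>\<close> d(1) unfolding closure_approachable by blast
        have "dist x y < r" using p(2) y(2) d(2) dist_triangle[of x y p] by (simp add: dist_commute)
        then have "0 < \<psi> y" using graph[of y] y(1) by (simp add: \<psi>_def)
        moreover have "(1 + 2 * L) * norm (y - p) \<le> (1 + 2 * L) * d"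
          using y(2) L by (intro mult_left_mono) (auto simp: dist_norm)
        ultimately show "0 \<le> \<psi> p + \<epsilon>" using lip\<psi>[of y p] d3 by (simp add: mult.commute)
      qed
    qed
    then have "hausdorff_outer (DIM('a) - 1) (frontier \<Omega> \<inter> ball x (r / 2)) < top"
      by (intro hausdorff_outer_lipschitz_graph[OF r _ e _ _ lip\<psi>])
         (use L ee in \<open>auto simp: \<psi>_def inner_add_left scaleR_add_left\<close>)
    then show ?thesis using r by blast
  qed
  then obtain r where r: "\<And>x. x \<in> frontier \<Omega> \<Longrightarrow> 0 < r x"
    "\<And>x. x \<in> frontier \<Omega> \<Longrightarrow> hausdorff_outer (DIM('a) - 1) (frontier \<Omega> \<inter> ball x (r x / 2)) < top"
    by metis
  have "compact (frontier \<Omega>)" using \<Omega> by (simp add: compact_frontier_bounded)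
  then obtain I where I: "I \<subseteq> frontier \<Omega>" "finite I" "frontier \<Omega> \<subseteq> (\<Union>x\<in>I. ball x (r x / 2))"
    by (rule compactE_image[of _ "frontier \<Omega>" "\<lambda>x. ball x (r x / 2)"]) (use r(1) in force)+
  have "frontier \<Omega> \<subseteq> (\<Union>x\<in>I. frontier \<Omega> \<inter> ball x (r x / 2))" using I(3) by blast
  then have "hausdorff_outer (DIM('a) - 1) (frontier \<Omega>)
      \<le> hausdorff_outer (DIM('a) - 1) (\<Union>x\<in>I. frontier \<Omega> \<inter> ball x (r x / 2))"
    by (rule hausdorff_outer_mono)
  also have "\<dots> < top" using I r(2) by (intro hausdorff_outer_finite_UN) auto
  finally show ?thesis .
qed

section \<open>Square integrable functions\<close>

text \<open>Stated over an arbitrary measure because it is used on the domain, on its boundary and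
  on space-time.\<close>

definition sq_integrable :: "'s measure \<Rightarrow> ('s \<Rightarrow> real) set" where
  "sq_integrable M = {u \<in> borel_measurable M. integrable M (\<lambda>x. (u x)\<^sup>2)}"

definition norm2 :: "'s measure \<Rightarrow> ('s \<Rightarrow> real) \<Rightarrow> real" where
  "norm2 M u = sqrt (LINT x|M. (u x)\<^sup>2)"

lemma L2_space_eq: "L2_space S = sq_integrable (lebesgue_on S)"
  and L2_norm_eq: "L2_norm S = norm2 (lebesgue_on S)"
  by (simp_all add: L2_space_def sq_integrable_def L2_norm_def[abs_def] norm2_def[abs_def])

lemma sq_integrableD:
  assumes "u \<in> sq_integrable M"
  shows "u \<in> borel_measurable M" "integrable M (\<lambda>x. (u x)\<^sup>2)"
  using assms by (auto simp: sq_integrable_def)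

lemma sq_integrable_mult:
  assumes u: "u \<in> sq_integrable M" and v: "v \<in> sq_integrable M"
  shows "integrable M (\<lambda>x. u x * v x)"
proof (rule Bochner_Integration.integrable_bound)
  show "integrable M (\<lambda>x. (u x)\<^sup>2 + (v x)\<^sup>2)" using u v by (auto dest: sq_integrableD)
  show "(\<lambda>x. u x * v x) \<in> borel_measurable M"
    using sq_integrableD(1)[OF u] sq_integrableD(1)[OF v] by simp
  have "\<bar>a * b\<bar> \<le> a\<^sup>2 + b\<^sup>2" for a b :: real
  proof -
    have "2 * (\<bar>a\<bar> * \<bar>b\<bar>) \<le> \<bar>a\<bar>\<^sup>2 + \<bar>b\<bar>\<^sup>2" using sum_squares_bound[of "\<bar>a\<bar>" "\<bar>b\<bar>"] by simp
    moreover have "0 \<le> \<bar>a\<bar> * \<bar>b\<bar>" by simp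
    ultimately have "\<bar>a\<bar> * \<bar>b\<bar> \<le> \<bar>a\<bar>\<^sup>2 + \<bar>b\<bar>\<^sup>2" by linarith
    then show ?thesis by (simp add: abs_mult)
  qed
  then show "AE x in M. norm (u x * v x) \<le> norm ((u x)\<^sup>2 + (v x)\<^sup>2)" by simp
qed

lemma sq_integrable_cmult: "u \<in> sq_integrable M \<Longrightarrow> (\<lambda>x. c * u x) \<in> sq_integrable M"
  by (auto simp: sq_integrable_def power_mult_distrib)

lemma sq_integrable_uminus: "u \<in> sq_integrable M \<Longrightarrow> (\<lambda>x. - u x) \<in> sq_integrable M"
  using sq_integrable_cmult[of u M "-1"] by simp

lemma sq_integrable_zero: "(\<lambda>x. 0) \<in> sq_integrable M"
  by (simp add: sq_integrable_def)

lemma sq_integrable_add: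
  assumes u: "u \<in> sq_integrable M" and v: "v \<in> sq_integrable M"
  shows "(\<lambda>x. u x + v x) \<in> sq_integrable M"
  using sq_integrableD[OF u] sq_integrableD[OF v] sq_integrable_mult[OF u v]
  by (auto simp: sq_integrable_def power2_sum mult.assoc)

lemma sq_integrable_diff:
  assumes u: "u \<in> sq_integrable M" and v: "v \<in> sq_integrable M"
  shows "(\<lambda>x. u x - v x) \<in> sq_integrable M"
  using sq_integrable_add[OF u sq_integrable_uminus[OF v]] by simp

lemma sq_integrable_sum:
  "(\<And>i. i \<in> I \<Longrightarrow> u i \<in> sq_integrable M) \<Longrightarrow> (\<lambda>x. \<Sum>i\<in>I. u i x) \<in> sq_integrable M"
  by (induction I rule: infinite_finite_induct) (auto intro: sq_integrable_zero sq_integrable_add)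

lemma norm2_nonneg [simp]: "0 \<le> norm2 M u"
  by (simp add: norm2_def)

lemma norm2_square: "(norm2 M u)\<^sup>2 = (LINT x|M. (u x)\<^sup>2)"
  by (simp add: norm2_def)

lemma norm2_cong_AE:
  assumes "u \<in> borel_measurable M" "v \<in> borel_measurable M" "AE x in M. u x = v x"
  shows "norm2 M u = norm2 M v"
proof -
  have "(LINT x|M. (u x)\<^sup>2) = (LINT x|M. (v x)\<^sup>2)"
    by (rule integral_cong_AE) (use assms in auto)
  then show ?thesis by (simp add: norm2_def)
qed

lemma norm2_Cauchy_Schwarz:
  assumes u: "u \<in> sq_integrable M" and v: "v \<in> sq_integrable M"
  shows "\<bar>LINT x|M. u x * v x\<bar> \<le> norm2 M u * norm2 M v"
proof -
  define a b c where "a = (LINT x|M. (u x)\<^sup>2)" and "b = (LINT x|M. (v x)\<^sup>2)"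
    and "c = (LINT x|M. u x * v x)"
  have q: "0 \<le> a - 2 * t * c + t\<^sup>2 * b" for t
  proof -
    have "0 \<le> (LINT x|M. (u x - t * v x)\<^sup>2)" by simp
    also have "(\<lambda>x. (u x - t * v x)\<^sup>2) = (\<lambda>x. (u x)\<^sup>2 - 2 * t * (u x * v x) + t\<^sup>2 * (v x)\<^sup>2)"
      by (simp add: power2_eq_square algebra_simps)
    also have "(LINT x|M. (u x)\<^sup>2 - 2 * t * (u x * v x) + t\<^sup>2 * (v x)\<^sup>2) = a - 2 * t * c + t\<^sup>2 * b"
      using sq_integrableD[OF u] sq_integrableD[OF v] sq_integrable_mult[OF u v]
      by (simp add: a_def b_def c_def)
    finally show ?thesis .
  qed
  have "c\<^sup>2 \<le> a * b"
  proof (cases "b = 0")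
    case True
    have "c = 0"
    proof (rule ccontr)
      assume "c \<noteq> 0"
      \<comment> \<open>For this \<open>t\<close> and \<open>b = 0\<close> the quadratic takes the
        value -1.\<close>
      then show False using q[of "(a + 1) / (2 * c)"] True by (simp add: field_simps)
    qed
    then show ?thesis using True by simp
  next
    case False
    moreover have "0 \<le> b" by (simp add: b_def)
    ultimately have "0 < b" by simp
    have "0 \<le> a - 2 * (c / b) * c + (c / b)\<^sup>2 * b" by (rule q)
    also have "\<dots> = a - c\<^sup>2 / b" using \<open>0 < b\<close> by (simp add: power2_eq_square field_simps)
    finally show ?thesis using \<open>0 < b\<close> by (simp add: field_simps)
  qed
  then have "sqrt (c\<^sup>2) \<le> sqrt (a * b)" by (rule real_sqrt_le_mono)
  then show ?thesis by (simp add: a_def b_def c_def norm2_def real_sqrt_mult)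
qed

lemma norm2_triangle:
  assumes u: "u \<in> sq_integrable M" and v: "v \<in> sq_integrable M"
  shows "norm2 M (\<lambda>x. u x + v x) \<le> norm2 M u + norm2 M v"
proof (rule power2_le_imp_le)
  have "(norm2 M (\<lambda>x. u x + v x))\<^sup>2 = (LINT x|M. (u x)\<^sup>2 + 2 * (u x * v x) + (v x)\<^sup>2)"
    by (simp add: norm2_square power2_sum algebra_simps)
  also have "\<dots> = (norm2 M u)\<^sup>2 + 2 * (LINT x|M. u x * v x) + (norm2 M v)\<^sup>2"
    using sq_integrableD[OF u] sq_integrableD[OF v] sq_integrable_mult[OF u v]
    by (simp add: norm2_square)
  also have "\<dots> \<le> (norm2 M u)\<^sup>2 + 2 * (norm2 M u * norm2 M v) + (norm2 M v)\<^sup>2"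
    using norm2_Cauchy_Schwarz[OF u v] by (simp add: abs_le_iff)
  finally show "(norm2 M (\<lambda>x. u x + v x))\<^sup>2 \<le> (norm2 M u + norm2 M v)\<^sup>2"
    by (simp add: power2_sum mult_ac)
qed simp

lemma norm2_minus_commute: "norm2 M (\<lambda>x. u x - v x) = norm2 M (\<lambda>x. v x - u x)"
  by (simp add: norm2_def power2_commute)

lemma norm2_triangle_sub:
  assumes u: "u \<in> sq_integrable M" and v: "v \<in> sq_integrable M"
  shows "norm2 M u \<le> norm2 M v + norm2 M (\<lambda>x. u x - v x)"
  using norm2_triangle[OF v sq_integrable_diff[OF u v]] by simp

lemma norm2_tendsto:
  assumes u: "\<And>n. u n \<in> sq_integrable M" "v \<in> sq_integrable M"
    and lim: "(\<lambda>n. norm2 M (\<lambda>x. u n x - v x)) \<longlonglongrightarrow> 0"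
  shows "(\<lambda>n. norm2 M (u n)) \<longlonglongrightarrow> norm2 M v"
proof (rule LIM_zero_cancel, rule Lim_null_comparison[OF _ lim])
  have "\<bar>norm2 M (u n) - norm2 M v\<bar> \<le> norm2 M (\<lambda>x. u n x - v x)" for n
    using norm2_triangle_sub[OF u(1) u(2), of n] norm2_triangle_sub[OF u(2) u(1), of n]
    by (simp add: norm2_minus_commute[of M v] abs_le_iff)
  then show "\<forall>\<^sub>F n in sequentially. norm (norm2 M (u n) - norm2 M v) \<le> norm2 M (\<lambda>x. u n x - v x)"
    by simp
qed

lemma integral_mult_tendsto:
  assumes u: "\<And>n. u n \<in> sq_integrable M" "u' \<in> sq_integrable M"
    and v: "\<And>n. v n \<in> sq_integrable M" "v' \<in> sq_integrable M"
    and limu: "(\<lambda>n. norm2 M (\<lambda>x. u n x - u' x)) \<longlonglongrightarrow> 0"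
    and limv: "(\<lambda>n. norm2 M (\<lambda>x. v n x - v' x)) \<longlonglongrightarrow> 0"
  shows "(\<lambda>n. LINT x|M. u n x * v n x) \<longlonglongrightarrow> (LINT x|M. u' x * v' x)"
proof (rule LIM_zero_cancel, rule Lim_null_comparison)
  have "norm ((LINT x|M. u n x * v n x) - (LINT x|M. u' x * v' x))
      \<le> norm2 M (\<lambda>x. u n x - u' x) * norm2 M (v n) + norm2 M u' * norm2 M (\<lambda>x. v n x - v' x)" for n
  proof -
    have "(LINT x|M. u n x * v n x) - (LINT x|M. u' x * v' x)
        = (LINT x|M. (u n x - u' x) * v n x) + (LINT x|M. u' x * (v n x - v' x))"
      using sq_integrable_mult[OF u(1) v(1), of n n] sq_integrable_mult[OF u(2) v(2)] sq_integrable_mult[OF u(2) v(1), of n]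
      by (simp add: left_diff_distrib right_diff_distrib)
    also have "\<bar>\<dots>\<bar> \<le> norm2 M (\<lambda>x. u n x - u' x) * norm2 M (v n) + norm2 M u' * norm2 M (\<lambda>x. v n x - v' x)"
      using norm2_Cauchy_Schwarz[OF sq_integrable_diff[OF u(1) u(2)] v(1), of n n]
        norm2_Cauchy_Schwarz[OF u(2) sq_integrable_diff[OF v(1) v(2)], of n] by linarith
    finally show ?thesis by simp
  qed
  then show "\<forall>\<^sub>F n in sequentially. norm ((LINT x|M. u n x * v n x) - (LINT x|M. u' x * v' x))
      \<le> norm2 M (\<lambda>x. u n x - u' x) * norm2 M (v n) + norm2 M u' * norm2 M (\<lambda>x. v n x - v' x)" by simp
  have "(\<lambda>n. norm2 M (\<lambda>x. u n x - u' x) * norm2 M (v n) + norm2 M u' * norm2 M (\<lambda>x. v n x - v' x))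
      \<longlonglongrightarrow> 0 * norm2 M v' + norm2 M u' * 0"
    by (intro tendsto_intros limu limv norm2_tendsto[OF v limv])
  then show "(\<lambda>n. norm2 M (\<lambda>x. u n x - u' x) * norm2 M (v n) + norm2 M u' * norm2 M (\<lambda>x. v n x - v' x)) \<longlonglongrightarrow> 0"
    by simp
qed

lemma sq_integrable_imp_integrable:
  assumes "u \<in> sq_integrable M" "finite_measure M"
  shows "integrable M u"
proof -
  interpret finite_measure M by fact
  have "(\<lambda>x. 1) \<in> sq_integrable M" by (simp add: sq_integrable_def)
  from sq_integrable_mult[OF assms(1) this] show ?thesis by simp
qed

lemma sq_integrable_bounded:
  assumes "u \<in> borel_measurable M" "finite_measure M" "AE x in M. \<bar>u x\<bar> \<le> C"
  shows "u \<in> sq_integrable M"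
proof -
  interpret finite_measure M by fact
  have "integrable M (\<lambda>x. (u x)\<^sup>2)"
  proof (rule integrable_const_bound[of _ "C\<^sup>2"])
    show "AE x in M. norm ((u x)\<^sup>2) \<le> C\<^sup>2"
      using assms(3)
    proof eventually_elim
      case (elim x)
      then have "\<bar>u x\<bar>\<^sup>2 \<le> C\<^sup>2" by (intro power_mono) auto
      then show ?case by simp
    qed
  qed (use assms(1) in auto)
  then show ?thesis using assms(1) by (simp add: sq_integrable_def)
qed

section \<open>Test functions\<close>

text \<open>The power of \<open>1 / t\<close> makes the family closed under differentiation: the
  derivative of each member is a combination of two others. Smoothness then follows by induction on
  the order, for all \<open>k\<close> at once.\<close>

definition exp_bump :: "nat \<Rightarrow> real \<Rightarrow> real" where
  "exp_bump k t = (if 0 < t then (1 / t) ^ k * exp (- (1 / t)) else 0)"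

lemma exp_bump_0_bounds: "0 \<le> exp_bump 0 t" "exp_bump 0 t \<le> 1" "0 < exp_bump 0 t \<longleftrightarrow> 0 < t"
  by (auto simp: exp_bump_def)

lemma tendsto_exp_bump_div: "((\<lambda>t. exp_bump k t / t) \<longlongrightarrow> 0) (at 0)"
proof -
  have "((\<lambda>x. x ^ Suc k / exp x) \<longlongrightarrow> (0::real)) at_top" by (rule tendsto_power_div_exp_0)
  then have "((\<lambda>t. inverse t ^ Suc k / exp (inverse t)) \<longlongrightarrow> (0::real)) (at_right 0)"
    by (rule filterlim_compose) (rule filterlim_inverse_at_top_right)
  then have "((\<lambda>t. exp_bump k t / t) \<longlongrightarrow> 0) (at_right 0)"
    by (rule Lim_transform_eventually)
       (auto simp: eventually_at_right_field exp_bump_def exp_minus field_simps intro!: exI[of _ 1])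
  moreover have "((\<lambda>t. exp_bump k t / t) \<longlongrightarrow> 0) (at_left 0)"
    by (rule tendsto_eventually) (auto simp: eventually_at_left_field exp_bump_def intro!: exI[of _ "-1"])
  ultimately show ?thesis by (simp add: filterlim_split_at)
qed

lemma has_real_derivative_exp_bump:
  "(exp_bump k has_real_derivative exp_bump (k + 2) t - real k * exp_bump (Suc k) t) (at t)"
proof -
  consider "0 < t" | "t < 0" | "t = 0" by linarith
  then show ?thesis
  proof cases
    case 1
    have "((\<lambda>t. (1 / t) ^ k * exp (- (1 / t))) has_real_derivative
        exp_bump (k + 2) t - real k * exp_bump (Suc k) t) (at t)"
    proof -
      have d1: "((\<lambda>t. 1 / t) has_real_derivative - ((1 / t)\<^sup>2)) (at t)"
        using 1 by (auto intro!: derivative_eq_intros simp: power2_eq_square)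
      have d2: "((\<lambda>t. exp (- (1 / t))) has_real_derivative exp (- (1 / t)) * (1 / t)\<^sup>2) (at t)"
        using DERIV_chain2[OF DERIV_exp DERIV_minus[OF d1]] by simp
      have eq: "y ^ k * (E * y\<^sup>2) + real k * (- (y\<^sup>2) * y ^ (k - Suc 0)) * E = y ^ (k + 2) * E - real k * (y ^ Suc k * E)" for y E :: real
        by (cases k) (simp_all add: power2_eq_square algebra_simps)
      show ?thesis
        by (rule DERIV_cong[OF DERIV_mult'[OF DERIV_power[OF d1] d2]])
           (use 1 eq[of "1 / t" "exp (- (1 / t))"] in \<open>simp add: exp_bump_def mult_ac\<close>)
    qed
    then show ?thesis
      by (rule has_field_derivative_transform_within_open[where S="{0<..}"]) (use 1 in \<open>auto simp: exp_bump_def\<close>)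
  next
    case 2
    have "(exp_bump k has_real_derivative 0) (at t)"
      by (rule has_field_derivative_transform_within_open[where S="{..<0}", OF DERIV_const[of 0]])
         (use 2 in \<open>auto simp: exp_bump_def\<close>)
    then show ?thesis using 2 by (simp add: exp_bump_def)
  next
    case 3
    then show ?thesis using tendsto_exp_bump_div[of k] by (simp add: DERIV_def exp_bump_def)
  qed
qed

lemma C_fun_exp_bump: "C_fun m (\<lambda>x. exp_bump k (x \<bullet> a + c))"
proof (induction m arbitrary: k)
  case 0
  have "continuous_on UNIV (exp_bump k)"
    using has_real_derivative_exp_bump by (intro DERIV_continuous_on) blast
  then show ?case by (auto intro!: continuous_on_compose2[of UNIV "exp_bump k"] continuous_intros)
next
  case (Suc m)
  have der: "((\<lambda>x. exp_bump k (x \<bullet> a + c)) has_derivative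
      (\<lambda>v. (exp_bump (k + 2) (x \<bullet> a + c) - real k * exp_bump (Suc k) (x \<bullet> a + c)) * (v \<bullet> a))) (at x)" for x
  proof -
    have "((\<lambda>x. x \<bullet> a + c) has_derivative (\<lambda>v. v \<bullet> a)) (at x)"
      by (auto intro!: derivative_eq_intros)
    from has_derivative_compose[OF this has_real_derivative_exp_bump[unfolded has_field_derivative_def]]
    show ?thesis by simp
  qed
  have "partial_deriv b (\<lambda>x. exp_bump k (x \<bullet> a + c)) =
      (\<lambda>x. (exp_bump (k + 2) (x \<bullet> a + c) - real k * exp_bump (Suc k) (x \<bullet> a + c)) * (b \<bullet> a))" for b
    by (intro ext partial_deriv_eq[OF der])
  then show ?case using der Suc
    by (auto intro!: differentiableI C_fun_mult C_fun_diff C_fun_const simp del: power_Suc)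
qed

definition box_bump :: "'a::euclidean_space \<Rightarrow> 'a \<Rightarrow> 'a \<Rightarrow> real" where
  "box_bump l u x = (\<Prod>b\<in>Basis. exp_bump 0 (x \<bullet> b - l \<bullet> b) * exp_bump 0 (u \<bullet> b - x \<bullet> b))"

lemma smooth_box_bump: "smooth_fun (box_bump l u)"
  unfolding smooth_fun_def box_bump_def[abs_def]
proof (intro allI C_fun_prod C_fun_mult)
  fix k and b :: 'a
  show "C_fun k (\<lambda>x. exp_bump 0 (x \<bullet> b - l \<bullet> b))"
    using C_fun_exp_bump[of k 0 b "- (l \<bullet> b)"] by simp
  show "C_fun k (\<lambda>x. exp_bump 0 (u \<bullet> b - x \<bullet> b))"
    using C_fun_exp_bump[of k 0 "- b" "u \<bullet> b"] by (simp add: add.commute)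
qed

lemma box_bump: "0 \<le> box_bump l u x" "box_bump l u x \<le> 1" "0 < box_bump l u x \<longleftrightarrow> x \<in> box l u"
proof -
  have b: "0 \<le> exp_bump 0 s * exp_bump 0 t \<and> exp_bump 0 s * exp_bump 0 t \<le> 1" for s t
    using exp_bump_0_bounds by (auto intro: mult_le_one)
  show "0 \<le> box_bump l u x" "box_bump l u x \<le> 1"
    unfolding box_bump_def using b by (auto intro!: prod_nonneg prod_le_1)
  show "0 < box_bump l u x \<longleftrightarrow> x \<in> box l u"
  proof
    assume "x \<in> box l u"
    then show "0 < box_bump l u x" unfolding box_bump_def
      by (intro prod_pos) (auto simp: mem_box exp_bump_0_bounds intro!: mult_pos_pos)
  next
    assume pos: "0 < box_bump l u x"
    show "x \<in> box l u"
    proof (rule ccontr)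
      assume "x \<notin> box l u"
      then obtain b where b: "b \<in> Basis" "x \<bullet> b \<le> l \<bullet> b \<or> u \<bullet> b \<le> x \<bullet> b"
        by (auto simp: mem_box not_less)
      then have "exp_bump 0 (x \<bullet> b - l \<bullet> b) * exp_bump 0 (u \<bullet> b - x \<bullet> b) = 0"
        by (auto simp: exp_bump_def)
      then have "box_bump l u x = 0" unfolding box_bump_def using b by (intro prod_zero) auto
      then show False using pos by simp
    qed
  qed
qed

section \<open>Smooth approximations of indicators and the fundamental lemma of the calculus of
  variations\<close>

lemma smooth_fun_const: "smooth_fun (\<lambda>x. c)"
  and smooth_fun_diff: "smooth_fun f \<Longrightarrow> smooth_fun g \<Longrightarrow> smooth_fun (\<lambda>x. f x - g x)"
  and smooth_fun_mult: "smooth_fun f \<Longrightarrow> smooth_fun g \<Longrightarrow> smooth_fun (\<lambda>x. f x * g x)"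
  by (auto simp: smooth_fun_def intro: C_fun_const C_fun_diff C_fun_mult)

lemma smooth_fun_power: "smooth_fun f \<Longrightarrow> smooth_fun (\<lambda>x. f x ^ n)"
  by (induction n) (auto intro: smooth_fun_const smooth_fun_mult)

text \<open>The base of the power is below 1 inside the box and equal to 1 outside. These functions
  take the part of mollified indicators: they are smooth, bounded by 1 and supported in the closed
  box.\<close>

lemma box_indicator_LIMSEQ:
  "(\<lambda>n. 1 - (1 - box_bump l u x) ^ n) \<longlonglongrightarrow> indicat_real (box l u) x"
proof (cases "x \<in> box l u")
  case True
  then have "0 < box_bump l u x" "box_bump l u x \<le> 1" using box_bump[of l u x] by auto
  then have "(\<lambda>n. (1 - box_bump l u x) ^ n) \<longlonglongrightarrow> 0" by (intro LIMSEQ_power_zero) (simp add: abs_less_iff)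
  then have "(\<lambda>n. 1 - (1 - box_bump l u x) ^ n) \<longlonglongrightarrow> 1 - 0" by (rule tendsto_diff[OF tendsto_const])
  then show ?thesis using True by simp
next
  case False
  then have "box_bump l u x = 0" using box_bump[of l u x] by (auto simp: not_less intro: antisym)
  then show ?thesis using False by simp
qed

lemma test_fun_box_bump:
  assumes "cbox l u \<subseteq> \<Omega>"
  shows "test_fun \<Omega> (\<lambda>x. 1 - (1 - box_bump l u x) ^ n)"
  unfolding test_fun_def
proof (intro conjI exI[of _ "cbox l u"] allI impI)
  show "smooth_fun (\<lambda>x. 1 - (1 - box_bump l u x) ^ n)"
    by (intro smooth_fun_diff smooth_fun_power smooth_fun_const smooth_box_bump)
  fix x assume "x \<notin> cbox l u"
  then have "x \<notin> box l u" using box_subset_cbox by blast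
  then have "box_bump l u x = 0" using box_bump[of l u x] by (auto simp: not_less intro: antisym)
  then show "1 - (1 - box_bump l u x) ^ n = 0" by simp
qed (use assms in auto)

text \<open>Test functions yield vanishing integrals of \<open>w\<close> over boxes. A Dynkin
  argument extends this to all Borel subsets of a box, among them the sets where \<open>w\<close>
  has a given sign.\<close>

lemma fundamental_lemma_borel:
  fixes w :: "'a::euclidean_space \<Rightarrow> real"
  assumes "open \<Omega>" and w: "integrable lborel w"
    and test: "\<And>\<phi>. test_fun \<Omega> \<phi> \<Longrightarrow> (LINT x|lborel. w x * \<phi> x) = 0"
  shows "AE x in lborel. x \<in> \<Omega> \<longrightarrow> w x = 0"
proof -
  have wm: "w \<in> borel_measurable borel" using w by simp
  have box0: "(LINT x|lborel. w x * indicat_real (box l u) x) = 0" if lu: "cbox l u \<subseteq> \<Omega>" for l u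
  proof -
    have "(\<lambda>n. LINT x|lborel. w x * (1 - (1 - box_bump l u x) ^ n))
        \<longlonglongrightarrow> (LINT x|lborel. w x * indicat_real (box l u) x)"
    proof (rule integral_dominated_convergence[where w="\<lambda>x. \<bar>w x\<bar>"])
      have "box_bump l u \<in> borel_measurable borel"
        using C_fun_continuous[OF smooth_fun_C_fun[OF smooth_box_bump]]
        by (rule borel_measurable_continuous_onI)
      then show "(\<lambda>x. w x * (1 - (1 - box_bump l u x) ^ n)) \<in> borel_measurable lborel" for n
        using wm by simp
      show "AE x in lborel. (\<lambda>n. w x * (1 - (1 - box_bump l u x) ^ n)) \<longlonglongrightarrow> w x * indicat_real (box l u) x"
        by (intro AE_I2 tendsto_mult tendsto_const box_indicator_LIMSEQ)
      show "AE x in lborel. norm (w x * (1 - (1 - box_bump l u x) ^ n)) \<le> \<bar>w x\<bar>" for n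
      proof (rule AE_I2)
        fix x
        have "0 \<le> (1 - box_bump l u x) ^ n" "(1 - box_bump l u x) ^ n \<le> 1"
          using box_bump[of l u x] by (auto intro!: power_le_one)
        then have "\<bar>1 - (1 - box_bump l u x) ^ n\<bar> \<le> 1" by simp
        then show "norm (w x * (1 - (1 - box_bump l u x) ^ n)) \<le> \<bar>w x\<bar>"
          by (simp add: abs_mult mult_left_le)
      qed
    qed (use w wm in auto)
    then show ?thesis by (simp add: test[OF test_fun_box_bump[OF lu]] LIMSEQ_const_iff)
  qed
  have zero_box: "AE x in lborel. x \<in> box L U \<longrightarrow> w x = 0" if LU: "cbox L U \<subseteq> \<Omega>" for L U
  proof -
    have intA: "integrable lborel (\<lambda>x. w x * indicat_real (A \<inter> box L U) x)" if "A \<in> sets borel" for A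
      using integrable_mult_indicator[of "A \<inter> box L U" lborel w] w that by (simp add: mult.commute)
    \<comment> \<open>Intersecting with the fixed box makes the step for complements work: the whole
      space then corresponds to \<open>box L U\<close>, over which the integral of \<open>w\<close>
      is already known to be 0.\<close>
    have P: "(LINT x|lborel. w x * indicat_real (A \<inter> box L U) x) = 0" if "A \<in> sets borel" for A
    proof -
      have eq: "sets borel = sigma_sets UNIV (range (\<lambda>(a, b). box a b :: 'a set))"
        by (subst borel_eq_box) simp
      have sub: "range (\<lambda>(a, b). box a b :: 'a set) \<subseteq> Pow UNIV" by simp
      have stable: "Int_stable (range (\<lambda>(a, b). box a b :: 'a set))"
        by (auto simp: Int_stable_def Int_interval box_Int_box)
      have basic: "(LINT x|lborel. w x * indicat_real (box a b \<inter> box L U) x) = 0" for a b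
        unfolding box_Int_box
      proof (rule box0, rule order_trans[OF _ LU])
        show "cbox (\<Sum>i\<in>Basis. max (a \<bullet> i) (L \<bullet> i) *\<^sub>R i) (\<Sum>i\<in>Basis. min (b \<bullet> i) (U \<bullet> i) *\<^sub>R i) \<subseteq> cbox L U"
          by (auto simp: mem_box)
      qed
      from that[unfolded eq] show ?thesis
      proof (induction rule: sigma_sets_induct_disjoint[OF stable sub, consumes 1, case_names basic empty compl union])
        case (basic A)
        then show ?case using \<open>\<And>a b. (LINT x|lborel. w x * indicat_real (box a b \<inter> box L U) x) = 0\<close> by auto
      next
        case empty
        then show ?case by simp
      next
        case (compl A)
        then have A: "A \<in> sets borel" using eq by simp
        have "(LINT x|lborel. w x * indicat_real ((UNIV - A) \<inter> box L U) x)
            = (LINT x|lborel. w x * indicat_real (box L U \<inter> box L U) x - w x * indicat_real (A \<inter> box L U) x)"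
          by (intro Bochner_Integration.integral_cong) (auto simp: indicator_def)
        also have "\<dots> = 0"
          using intA[OF A] intA[of "box L U"] compl basic[of L U] by (subst Bochner_Integration.integral_diff) auto
        finally show ?case .
      next
        case (union A)
        then have A: "\<And>i. A i \<in> sets borel" using eq by auto
        have "(\<lambda>n. LINT x|lborel. w x * indicat_real ((\<Union>i<n. A i) \<inter> box L U) x)
            \<longlonglongrightarrow> (LINT x|lborel. w x * indicat_real ((\<Union>i. A i) \<inter> box L U) x)"
        proof (rule integral_dominated_convergence[where w="\<lambda>x. \<bar>w x\<bar>"])
          show "AE x in lborel. (\<lambda>n. w x * indicat_real ((\<Union>i<n. A i) \<inter> box L U) x)
              \<longlonglongrightarrow> w x * indicat_real ((\<Union>i. A i) \<inter> box L U) x"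
          proof (intro AE_I2 tendsto_mult tendsto_const)
            fix x
            show "(\<lambda>n. indicat_real ((\<Union>i<n. A i) \<inter> box L U) x) \<longlonglongrightarrow> indicat_real ((\<Union>i. A i) \<inter> box L U) x"
            proof (cases "x \<in> (\<Union>i. A i)")
              case True
              then obtain i where "x \<in> A i" by blast
              then have "\<forall>\<^sub>F n in sequentially. indicat_real ((\<Union>i<n. A i) \<inter> box L U) x = indicat_real ((\<Union>i. A i) \<inter> box L U) x"
                by (intro eventually_sequentiallyI[of "Suc i"]) (auto simp: indicator_def)
              then show ?thesis by (rule tendsto_eventually)
            next
              case False
              then show ?thesis by (auto simp: indicator_def)
            qed
          qed
          show "AE x in lborel. norm (w x * indicat_real ((\<Union>i<n. A i) \<inter> box L U) x) \<le> \<bar>w x\<bar>" for n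
            by (intro AE_I2) (simp add: indicator_def)
        qed (use w wm A in auto)
        moreover have "(LINT x|lborel. w x * indicat_real ((\<Union>i<n. A i) \<inter> box L U) x) = 0" for n
        proof -
          have "(LINT x|lborel. w x * indicat_real ((\<Union>i<n. A i) \<inter> box L U) x)
             = (LINT x|lborel. (\<Sum>i<n. w x * indicat_real (A i \<inter> box L U) x))"
          proof (rule Bochner_Integration.integral_cong)
            fix x
            have "disjoint_family_on (\<lambda>i. A i \<inter> box L U) {..<n}"
              using union(1) by (auto simp: disjoint_family_on_def)
            then have "indicat_real (\<Union>i<n. A i \<inter> box L U) x = (\<Sum>i<n. indicat_real (A i \<inter> box L U) x)"
              by (rule indicator_UN_disjoint[rotated]) simp
            then show "w x * indicat_real ((\<Union>i<n. A i) \<inter> box L U) x = (\<Sum>i<n. w x * indicat_real (A i \<inter> box L U) x)"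
              by (simp add: sum_distrib_left)
          qed simp
          also have "\<dots> = 0" using intA[OF A] union by (subst Bochner_Integration.integral_sum) auto
          finally show ?thesis .
        qed
        ultimately show ?case by (simp add: LIMSEQ_const_iff)
      qed
    qed
    \<comment> \<open>Used with \<open>s = 1\<close> and \<open>s = -1\<close>: over the part of the
      box where \<open>0 < s * w x\<close>, a positive integrand has integral 0.\<close>
    have pos: "AE x in lborel. x \<in> box L U \<longrightarrow> s * w x \<le> 0" for s
    proof -
      define A where "A = {x. 0 < s * w x}"
      have A: "A \<in> sets borel" unfolding A_def using wm by measurable
      have "AE x in lborel. s * w x * indicat_real (A \<inter> box L U) x = 0"
      proof (subst integral_nonneg_eq_0_iff_AE[symmetric])
        show "integrable lborel (\<lambda>x. s * w x * indicat_real (A \<inter> box L U) x)"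
          using integrable_mult_right[OF intA[OF A], of s] by (simp add: mult.assoc)
        show "AE x in lborel. 0 \<le> s * w x * indicat_real (A \<inter> box L U) x"
          by (intro AE_I2) (auto simp: A_def indicator_def)
        show "(LINT x|lborel. s * w x * indicat_real (A \<inter> box L U) x) = 0"
          using P[OF A] by (simp add: mult.assoc)
      qed
      then show ?thesis by eventually_elim (auto simp: A_def indicator_def split: if_splits)
    qed
    show ?thesis using pos[of 1] pos[of "-1"] by eventually_elim auto
  qed
  \<comment> \<open>An open set is a countable union of closed boxes, and a closed box differs from
    its interior by a null set.\<close>
  obtain \<D> where \<D>: "countable \<D>" "\<D> \<subseteq> Pow \<Omega>" "\<And>X. X \<in> \<D> \<Longrightarrow> \<exists>a b. X = cbox a b" "\<Union>\<D> = \<Omega>"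
    using open_countable_Union_open_cbox[OF \<open>open \<Omega>\<close>] by metis
  have "AE x in lborel. x \<in> X \<longrightarrow> w x = 0" if X: "X \<in> \<D>" for X
  proof -
    obtain a b where ab: "X = cbox a b" using \<D>(3)[OF X] by blast
    have "cbox a b \<subseteq> \<Omega>" using X ab \<D>(2) by auto
    then have "AE x in lborel. x \<in> box a b \<longrightarrow> w x = 0" by (rule zero_box)
    moreover have "AE x in lborel. x \<notin> cbox a b - box a b"
    proof (rule AE_not_in)
      have "negligible (cbox a b - box a b)" by (rule negligible_frontier_interval)
      then show "cbox a b - box a b \<in> null_sets lborel"
        by (auto simp: negligible_iff_null_sets null_sets_completion_iff)
    qed
    ultimately show ?thesis unfolding ab by eventually_elim auto
  qed
  then have "AE x in lborel. \<forall>X\<in>\<D>. x \<in> X \<longrightarrow> w x = 0"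
    using \<D>(1) by (subst AE_ball_countable) auto
  then show ?thesis by eventually_elim (use \<D>(4) in blast)
qed

section \<open>Weak derivatives, traces and Green's formula\<close>

lemma finite_measure_lebesgue_on_open:
  fixes \<Omega> :: "'a::euclidean_space set"
  assumes "open \<Omega>" "bounded \<Omega>"
  shows "finite_measure (lebesgue_on \<Omega>)"
proof -
  have "emeasure lborel \<Omega> < \<infinity>" by (rule emeasure_bounded_finite[OF assms(2)])
  then show ?thesis
    using assms by (intro finite_measure_lebesgue_on) (simp add: fmeasurable_def)
qed

lemma test_funD:
  assumes "test_fun \<Omega> \<theta>"
  shows "smooth_fun \<theta>" "\<exists>K. compact K \<and> K \<subseteq> \<Omega> \<and> (\<forall>x. x \<notin> K \<longrightarrow> \<theta> x = 0)"
  using assms by (auto simp: test_fun_def)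

lemma has_weak_partial_C_fun:
  assumes \<Omega>: "open \<Omega>" "bounded \<Omega>" and \<phi>: "C_fun (Suc 0) \<phi>" and b: "b \<in> Basis"
  shows "has_weak_partial \<Omega> b \<phi> (partial_deriv b \<phi>)"
  unfolding has_weak_partial_def
proof (intro allI impI)
  fix \<theta> assume "test_fun \<Omega> \<theta>"
  from test_funD[OF this] obtain K where \<theta>: "smooth_fun \<theta>"
    and K: "compact K" "K \<subseteq> \<Omega>" "\<forall>x. x \<notin> K \<longrightarrow> \<theta> x = 0"
    by (elim exE conjE)
  have C\<theta>: "C_fun (Suc 0) \<theta>" by (rule smooth_fun_C_fun[OF \<theta>])
  have "(LINT x|lebesgue_on \<Omega>. partial_deriv b (\<lambda>x. \<phi> x * \<theta> x) x) = 0"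
  proof (rule integral_partial_deriv_on[OF \<Omega> C_fun_mult[OF \<phi> C\<theta>] b])
    fix y assume "y \<in> frontier \<Omega>"
    then have "y \<in> - K" using K(2) \<Omega> by (auto simp: frontier_def interior_open)
    moreover have "open (- K)" using K(1) by (simp add: compact_imp_closed open_Compl)
    ultimately show "\<exists>U. open U \<and> y \<in> U \<and> (\<forall>z\<in>U. \<phi> z * \<theta> z = 0)"
      using K(3) by (intro exI[of _ "- K"]) auto
  qed
  moreover have "partial_deriv b (\<lambda>x. \<phi> x * \<theta> x) = (\<lambda>x. \<phi> x * partial_deriv b \<theta> x + partial_deriv b \<phi> x * \<theta> x)"
    using \<phi> C\<theta> by (intro ext partial_deriv_mult) auto
  moreover have "integrable (lebesgue_on \<Omega>) (\<lambda>x. \<phi> x * partial_deriv b \<theta> x)"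
    "integrable (lebesgue_on \<Omega>) (\<lambda>x. partial_deriv b \<phi> x * \<theta> x)"
    using \<phi> C\<theta> b C_fun_continuous[OF \<phi>] C_fun_continuous[OF C\<theta>]
    by (auto intro!: integrable_lebesgue_on_continuous[OF \<Omega>] continuous_on_mult)
  ultimately show "(LINT x|lebesgue_on \<Omega>. \<phi> x * partial_deriv b \<theta> x) = - (LINT x|lebesgue_on \<Omega>. partial_deriv b \<phi> x * \<theta> x)"
    by simp
qed

lemma continuous_sq_integrable:
  assumes \<Omega>: "open \<Omega>" "bounded \<Omega>" and "continuous_on UNIV \<phi>"
  shows "\<phi> \<in> sq_integrable (lebesgue_on \<Omega>)"
  using integrable_lebesgue_on_continuous[OF \<Omega> assms(3)]
    integrable_lebesgue_on_continuous[OF \<Omega> continuous_on_power[OF assms(3), of 2]]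
  by (auto simp: sq_integrable_def)

text \<open>Reduction to the Borel case: the extension of \<open>w\<close> by 0 is only Lebesgue
  measurable and is replaced by a Borel function that equals it almost everywhere.\<close>

lemma fundamental_lemma:
  fixes w :: "'a::euclidean_space \<Rightarrow> real"
  assumes \<Omega>: "open \<Omega>" and w: "integrable (lebesgue_on \<Omega>) w"
    and test: "\<And>\<theta>. test_fun \<Omega> \<theta> \<Longrightarrow> (LINT x|lebesgue_on \<Omega>. w x * \<theta> x) = 0"
  shows "AE x in lebesgue_on \<Omega>. w x = 0"
proof -
  define W where "W x = indicat_real \<Omega> x *\<^sub>R w x" for x
  have \<Omega>l: "\<Omega> \<inter> space lebesgue \<in> sets lebesgue" using \<Omega> by simp
  have W: "integrable lebesgue W"
    unfolding W_def[abs_def] using w integrable_restrict_space[OF \<Omega>l, of w] by simp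
  then have "W \<in> borel_measurable (completion lborel)" by simp
  from completion_ex_borel_measurable_real[OF this]
  obtain g where g: "g \<in> borel_measurable lborel" and ae: "AE x in lborel. W x = g x" by blast
  have ae': "AE x in lebesgue. W x = g x" using ae by (rule AE_completion)
  have gm: "g \<in> borel_measurable lebesgue" using g by (rule measurable_completion)
  have "integrable lebesgue g"
    using integrable_cong_AE_imp[OF W gm] ae' by auto
  then have gi: "integrable lborel g" using g integrable_completion by blast
  have "AE x in lborel. x \<in> \<Omega> \<longrightarrow> g x = 0"
  proof (rule fundamental_lemma_borel[OF \<Omega> gi])
    fix \<theta> assume \<theta>: "test_fun \<Omega> \<theta>"
    then have \<theta>m: "\<theta> \<in> borel_measurable borel"
      using C_fun_continuous[OF smooth_fun_C_fun[OF test_funD(1)]] by (intro borel_measurable_continuous_onI)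
    have "(LINT x|lborel. g x * \<theta> x) = (LINT x|lebesgue. g x * \<theta> x)"
      using g \<theta>m by (intro integral_completion[symmetric]) auto
    also have "\<dots> = (LINT x|lebesgue. W x * \<theta> x)"
    proof (rule integral_cong_AE)
      show "(\<lambda>x. g x * \<theta> x) \<in> borel_measurable lebesgue" "(\<lambda>x. W x * \<theta> x) \<in> borel_measurable lebesgue"
        using gm W \<theta>m by (auto intro!: borel_measurable_times intro: measurable_completion)
      show "AE x in lebesgue. g x * \<theta> x = W x * \<theta> x" using ae' by eventually_elim simp
    qed
    also have "\<dots> = (LINT x|lebesgue_on \<Omega>. w x * \<theta> x)"
      using \<Omega>l by (subst integral_restrict_space) (simp_all add: W_def mult.assoc)
    finally show "(LINT x|lborel. g x * \<theta> x) = 0" using test[OF \<theta>] by simp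
  qed
  then have "AE x in lebesgue. x \<in> \<Omega> \<longrightarrow> g x = 0" by (rule AE_completion)
  with ae' have "AE x in lebesgue. x \<in> \<Omega> \<longrightarrow> w x = 0"
    by eventually_elim (auto simp: W_def)
  then show ?thesis using \<Omega>l by (subst AE_restrict_space_iff) auto
qed

text \<open>Since \<open>weak_partial\<close> is an unspecified choice, this is what identifies it
  with a weak derivative that has been computed explicitly.\<close>

lemma has_weak_partial_unique:
  assumes \<Omega>: "open \<Omega>" "bounded \<Omega>"
    and w: "w1 \<in> sq_integrable (lebesgue_on \<Omega>)" "w2 \<in> sq_integrable (lebesgue_on \<Omega>)"
    and wp: "has_weak_partial \<Omega> b u w1" "has_weak_partial \<Omega> b u w2"
  shows "AE x in lebesgue_on \<Omega>. w1 x = w2 x"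
proof -
  note fin = finite_measure_lebesgue_on_open[OF \<Omega>]
  have "AE x in lebesgue_on \<Omega>. w1 x - w2 x = 0"
  proof (rule fundamental_lemma[OF \<Omega>(1)])
    show "integrable (lebesgue_on \<Omega>) (\<lambda>x. w1 x - w2 x)"
      by (intro sq_integrable_imp_integrable[OF _ fin] sq_integrable_diff w)
    fix \<theta> assume \<theta>: "test_fun \<Omega> \<theta>"
    have \<theta>s: "\<theta> \<in> sq_integrable (lebesgue_on \<Omega>)"
      by (rule continuous_sq_integrable[OF \<Omega> C_fun_continuous[OF smooth_fun_C_fun[OF test_funD(1)[OF \<theta>]]]])
    show "(LINT x|lebesgue_on \<Omega>. (w1 x - w2 x) * \<theta> x) = 0"
      using wp \<theta> sq_integrable_mult[OF w(1) \<theta>s] sq_integrable_mult[OF w(2) \<theta>s]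
      by (simp add: left_diff_distrib has_weak_partial_def)
  qed
  then show ?thesis by simp
qed

lemma weak_partial:
  assumes "u \<in> sobolev_H1 \<Omega>" "b \<in> Basis"
  shows "weak_partial \<Omega> b u \<in> sq_integrable (lebesgue_on \<Omega>)" "has_weak_partial \<Omega> b u (weak_partial \<Omega> b u)"
proof -
  have "\<exists>w. w \<in> L2_space \<Omega> \<and> has_weak_partial \<Omega> b u w"
    using assms unfolding sobolev_H1_def by blast
  then have "weak_partial \<Omega> b u \<in> L2_space \<Omega> \<and> has_weak_partial \<Omega> b u (weak_partial \<Omega> b u)"
    unfolding weak_partial_def by (rule someI_ex)
  then show "weak_partial \<Omega> b u \<in> sq_integrable (lebesgue_on \<Omega>)" "has_weak_partial \<Omega> b u (weak_partial \<Omega> b u)"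
    by (simp_all add: L2_space_eq)
qed

lemma sobolev_H1_sq_integrable: "u \<in> sobolev_H1 \<Omega> \<Longrightarrow> u \<in> sq_integrable (lebesgue_on \<Omega>)"
  by (simp add: sobolev_H1_def L2_space_eq)

lemma has_weak_partial_diff_smooth:
  assumes \<Omega>: "open \<Omega>" "bounded \<Omega>" and \<phi>: "smooth_fun \<phi>" and u: "u \<in> sobolev_H1 \<Omega>" and b: "b \<in> Basis"
  shows "has_weak_partial \<Omega> b (\<lambda>x. \<phi> x - u x) (\<lambda>x. partial_deriv b \<phi> x - weak_partial \<Omega> b u x)"
  unfolding has_weak_partial_def
proof (intro allI impI)
  fix \<theta> assume \<theta>: "test_fun \<Omega> \<theta>"
  have sm: "smooth_fun (partial_deriv b \<phi>)" "smooth_fun (partial_deriv b \<theta>)"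
    by (intro smooth_fun_partial_deriv \<phi> test_funD(1)[OF \<theta>] b)+
  have sq: "f \<in> sq_integrable (lebesgue_on \<Omega>)" if "smooth_fun f" for f
    by (rule continuous_sq_integrable[OF \<Omega> C_fun_continuous[OF smooth_fun_C_fun[OF that]]])
  note int = sq_integrable_mult[OF sq[OF \<phi>] sq[OF sm(2)]] sq_integrable_mult[OF sobolev_H1_sq_integrable[OF u] sq[OF sm(2)]]
    sq_integrable_mult[OF sq[OF sm(1)] sq[OF test_funD(1)[OF \<theta>]]]
    sq_integrable_mult[OF weak_partial(1)[OF u b] sq[OF test_funD(1)[OF \<theta>]]]
  have "(LINT x|lebesgue_on \<Omega>. \<phi> x * partial_deriv b \<theta> x) = - (LINT x|lebesgue_on \<Omega>. partial_deriv b \<phi> x * \<theta> x)"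
    using has_weak_partial_C_fun[OF \<Omega> smooth_fun_C_fun[OF \<phi>] b] \<theta> unfolding has_weak_partial_def by blast
  moreover have "(LINT x|lebesgue_on \<Omega>. u x * partial_deriv b \<theta> x) = - (LINT x|lebesgue_on \<Omega>. weak_partial \<Omega> b u x * \<theta> x)"
    using weak_partial(2)[OF u b] \<theta> unfolding has_weak_partial_def by blast
  ultimately show "(LINT x|lebesgue_on \<Omega>. (\<phi> x - u x) * partial_deriv b \<theta> x)
      = - (LINT x|lebesgue_on \<Omega>. (partial_deriv b \<phi> x - weak_partial \<Omega> b u x) * \<theta> x)"
    using int by (simp add: left_diff_distrib)
qed

text \<open>\<open>H1_norm\<close> involves the chosen derivative of the difference
  \<open>\<phi> n - u\<close>. By uniqueness it agrees almost everywhere with the classical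
  derivative of \<open>\<phi> n\<close> minus the chosen derivative of \<open>u\<close>, the form in
  which convergence is used.\<close>

lemma H1_norm_LIMSEQ:
  assumes \<Omega>: "open \<Omega>" "bounded \<Omega>" and \<phi>: "\<And>n. smooth_fun (\<phi> n)" and u: "u \<in> sobolev_H1 \<Omega>"
    and lim: "(\<lambda>n. H1_norm \<Omega> (\<lambda>x. \<phi> n x - u x)) \<longlonglongrightarrow> 0"
  shows "(\<lambda>n. norm2 (lebesgue_on \<Omega>) (\<lambda>x. \<phi> n x - u x)) \<longlonglongrightarrow> 0"
    and "b \<in> Basis \<Longrightarrow> (\<lambda>n. norm2 (lebesgue_on \<Omega>) (\<lambda>x. partial_deriv b (\<phi> n) x - weak_partial \<Omega> b u x)) \<longlonglongrightarrow> 0"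
proof -
  let ?M = "lebesgue_on \<Omega>"
  have sq: "f \<in> sq_integrable (lebesgue_on \<Omega>)" if "smooth_fun f" for f
    by (rule continuous_sq_integrable[OF \<Omega> C_fun_continuous[OF smooth_fun_C_fun[OF that]]])
  have dsq: "(\<lambda>x. partial_deriv b (\<phi> n) x - weak_partial \<Omega> b u x) \<in> sq_integrable ?M" if "b \<in> Basis" for b n
    by (intro sq_integrable_diff sq smooth_fun_partial_deriv \<phi> weak_partial(1)[OF u] that)
  have H1: "(\<lambda>x. \<phi> n x - u x) \<in> sobolev_H1 \<Omega>" for n
    unfolding sobolev_H1_def L2_space_eq
    using sq_integrable_diff[OF sq[OF \<phi>] sobolev_H1_sq_integrable[OF u]] dsq
      has_weak_partial_diff_smooth[OF \<Omega> \<phi> u] by blast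
  have eq: "norm2 ?M (\<lambda>x. partial_deriv b (\<phi> n) x - weak_partial \<Omega> b u x) = norm2 ?M (weak_partial \<Omega> b (\<lambda>x. \<phi> n x - u x))"
    if b: "b \<in> Basis" for b n
    by (rule norm2_cong_AE[OF sq_integrableD(1)[OF dsq[OF b]] sq_integrableD(1)[OF weak_partial(1)[OF H1 b]]])
       (rule has_weak_partial_unique[OF \<Omega> dsq[OF b] weak_partial(1)[OF H1 b]
          has_weak_partial_diff_smooth[OF \<Omega> \<phi> u b] weak_partial(2)[OF H1 b]])
  have "norm2 ?M (\<lambda>x. \<phi> n x - u x) \<le> H1_norm \<Omega> (\<lambda>x. \<phi> n x - u x)" for n
    unfolding H1_norm_def L2_norm_eq by (intro real_le_rsqrt) (simp add: sum_nonneg)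
  then show "(\<lambda>n. norm2 ?M (\<lambda>x. \<phi> n x - u x)) \<longlonglongrightarrow> 0"
    by (intro Lim_null_comparison[OF _ lim]) simp
  show "(\<lambda>n. norm2 (lebesgue_on \<Omega>) (\<lambda>x. partial_deriv b (\<phi> n) x - weak_partial \<Omega> b u x)) \<longlonglongrightarrow> 0" if b: "b \<in> Basis"
  proof (rule Lim_null_comparison[OF _ lim])
    have "norm2 ?M (weak_partial \<Omega> b (\<lambda>x. \<phi> n x - u x)) \<le> H1_norm \<Omega> (\<lambda>x. \<phi> n x - u x)" for n
      unfolding H1_norm_def L2_norm_eq
    proof (intro real_le_rsqrt)
      have "(norm2 ?M (weak_partial \<Omega> b (\<lambda>x. \<phi> n x - u x)))\<^sup>2
          \<le> (\<Sum>b\<in>Basis. (norm2 ?M (weak_partial \<Omega> b (\<lambda>x. \<phi> n x - u x)))\<^sup>2)"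
        using b by (intro member_le_sum) auto
      then show "(norm2 ?M (weak_partial \<Omega> b (\<lambda>x. \<phi> n x - u x)))\<^sup>2
          \<le> (norm2 ?M (\<lambda>x. \<phi> n x - u x))\<^sup>2 + (\<Sum>b\<in>Basis. (norm2 ?M (weak_partial \<Omega> b (\<lambda>x. \<phi> n x - u x)))\<^sup>2)"
        by (simp add: add_increasing)
    qed
    then show "\<forall>\<^sub>F n in sequentially. norm (norm2 ?M (\<lambda>x. partial_deriv b (\<phi> n) x - weak_partial \<Omega> b u x))
        \<le> H1_norm \<Omega> (\<lambda>x. \<phi> n x - u x)"
      by (simp add: eq[OF b])
  qed
qed

section \<open>Square integrable functions on the boundary, and traces\<close>

lemma boundary_measure_finite:
  fixes \<Omega> :: "'a::euclidean_space set"
  assumes "hausdorff_outer (DIM('a) - 1) (frontier \<Omega>) < top"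
  shows "finite_measure (boundary_measure \<Omega>)" "space (boundary_measure \<Omega>) = frontier \<Omega>"
    "(\<lambda>x. x) \<in> measurable (boundary_measure \<Omega>) borel"
proof -
  have f: "frontier \<Omega> \<in> sets (hausdorff_measure (DIM('a) - 1))"
    using borel_subset_sets_hausdorff borel_closed[OF frontier_closed[of \<Omega>]] by blast
  show sp: "space (boundary_measure \<Omega>) = frontier \<Omega>"
    by (simp add: boundary_measure_def space_restrict_space)
  show "(\<lambda>x. x) \<in> measurable (boundary_measure \<Omega>) borel"
    unfolding boundary_measure_def by (rule hausdorff_measurable_ident)
  show "finite_measure (boundary_measure \<Omega>)"
  proof (rule finite_measureI)
    have "emeasure (boundary_measure \<Omega>) (frontier \<Omega>) < top"
      using assms f by (simp add: boundary_measure_def emeasure_restrict_space emeasure_hausdorff)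
    then show "emeasure (boundary_measure \<Omega>) (space (boundary_measure \<Omega>)) \<noteq> \<infinity>" by (simp add: sp)
  qed
qed

lemma continuous_sq_integrable_boundary:
  fixes \<Omega> :: "'a::euclidean_space set"
  assumes fin: "hausdorff_outer (DIM('a) - 1) (frontier \<Omega>) < top" and "bounded \<Omega>" "continuous_on UNIV f"
  shows "f \<in> sq_integrable (boundary_measure \<Omega>)"
proof -
  have "bounded (f ` frontier \<Omega>)"
    by (intro compact_imp_bounded compact_continuous_image compact_frontier_bounded
        continuous_on_subset[OF assms(3)] assms(2)) simp
  then obtain C where "\<And>x. x \<in> frontier \<Omega> \<Longrightarrow> \<bar>f x\<bar> \<le> C" by (auto simp: bounded_iff)
  moreover have "f \<in> borel_measurable (boundary_measure \<Omega>)"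
    using measurable_compose[OF boundary_measure_finite(3)[OF fin] borel_measurable_continuous_onI[OF assms(3)]] .
  ultimately show ?thesis
    by (intro sq_integrable_bounded[where C=C] boundary_measure_finite(1)[OF fin] AE_I2)
       (auto simp: boundary_measure_finite(2)[OF fin])
qed

text \<open>The definition of a trace gives distances on the boundary that tend to 0. Once such a
  distance is finite, \<open>g\<close> differs by a square integrable function from a smooth one,
  which is bounded on a boundary of finite measure.\<close>

lemma has_trace_approximation:
  fixes \<Omega> :: "'a::euclidean_space set"
  assumes \<Omega>: "open \<Omega>" "bounded \<Omega>" and fin: "hausdorff_outer (DIM('a) - 1) (frontier \<Omega>) < top"
    and tr: "has_trace \<Omega> u g"
  shows "g \<in> sq_integrable (boundary_measure \<Omega>)"
    and "\<exists>\<phi>. (\<forall>n::nat. smooth_fun (\<phi> n)) \<and>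
      (\<lambda>n. norm2 (lebesgue_on \<Omega>) (\<lambda>x. \<phi> n x - u x)) \<longlonglongrightarrow> 0 \<and>
      (\<forall>b\<in>Basis. (\<lambda>n. norm2 (lebesgue_on \<Omega>) (\<lambda>x. partial_deriv b (\<phi> n) x - weak_partial \<Omega> b u x)) \<longlonglongrightarrow> 0) \<and>
      (\<lambda>n. norm2 (boundary_measure \<Omega>) (\<lambda>x. \<phi> n x - g x)) \<longlonglongrightarrow> 0"
proof -
  let ?B = "boundary_measure \<Omega>"
  from tr obtain \<phi> where u: "u \<in> sobolev_H1 \<Omega>" and g: "g \<in> borel_measurable ?B"
    and \<phi>: "\<And>n::nat. smooth_fun (\<phi> n)" and lim: "(\<lambda>n. H1_norm \<Omega> (\<lambda>x. \<phi> n x - u x)) \<longlonglongrightarrow> 0"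
    and limB: "(\<lambda>n. \<integral>\<^sup>+ x. ennreal ((\<phi> n x - g x)\<^sup>2) \<partial>?B) \<longlonglongrightarrow> 0"
    unfolding has_trace_def by blast
  have \<phi>B: "\<phi> n \<in> sq_integrable ?B" for n
    by (rule continuous_sq_integrable_boundary[OF fin \<Omega>(2) C_fun_continuous[OF smooth_fun_C_fun[OF \<phi>]]])
  have "\<forall>\<^sub>F n in sequentially. (\<integral>\<^sup>+ x. ennreal ((\<phi> n x - g x)\<^sup>2) \<partial>?B) < 1"
    using limB by (rule order_tendstoD) simp
  then obtain n where n: "(\<integral>\<^sup>+ x. ennreal ((\<phi> n x - g x)\<^sup>2) \<partial>?B) < 1"
    by (auto simp: eventually_sequentially)
  have "(\<lambda>x. \<phi> n x - g x) \<in> sq_integrable ?B"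
    unfolding sq_integrable_def using g sq_integrableD(1)[OF \<phi>B, of n] less_trans[OF n ennreal_one_less_top]
    by (auto intro!: integrableI_nonneg)
  from sq_integrable_diff[OF \<phi>B[of n] this] show gB: "g \<in> sq_integrable ?B" by simp
  have "(\<integral>\<^sup>+ x. ennreal ((\<phi> n x - g x)\<^sup>2) \<partial>?B) = ennreal ((norm2 ?B (\<lambda>x. \<phi> n x - g x))\<^sup>2)" for n
    unfolding norm2_square using sq_integrableD(2)[OF sq_integrable_diff[OF \<phi>B gB]]
    by (intro nn_integral_eq_integral) auto
  then have "(\<lambda>n. (norm2 ?B (\<lambda>x. \<phi> n x - g x))\<^sup>2) \<longlonglongrightarrow> 0"
    using limB tendsto_ennreal_iff[of "\<lambda>n. (norm2 ?B (\<lambda>x. \<phi> n x - g x))\<^sup>2" sequentially 0] by simp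
  then have "(\<lambda>n. sqrt ((norm2 ?B (\<lambda>x. \<phi> n x - g x))\<^sup>2)) \<longlonglongrightarrow> sqrt 0" by (intro tendsto_real_sqrt)
  then have limB': "(\<lambda>n. norm2 ?B (\<lambda>x. \<phi> n x - g x)) \<longlonglongrightarrow> 0" by simp
  show "\<exists>\<phi>. (\<forall>n::nat. smooth_fun (\<phi> n)) \<and>
      (\<lambda>n. norm2 (lebesgue_on \<Omega>) (\<lambda>x. \<phi> n x - u x)) \<longlonglongrightarrow> 0 \<and>
      (\<forall>b\<in>Basis. (\<lambda>n. norm2 (lebesgue_on \<Omega>) (\<lambda>x. partial_deriv b (\<phi> n) x - weak_partial \<Omega> b u x)) \<longlonglongrightarrow> 0) \<and>
      (\<lambda>n. norm2 (boundary_measure \<Omega>) (\<lambda>x. \<phi> n x - g x)) \<longlonglongrightarrow> 0"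
    using \<phi> H1_norm_LIMSEQ[OF \<Omega> \<phi> u lim] limB' by blast
qed

lemma sq_integrable_abs: "u \<in> sq_integrable M \<Longrightarrow> (\<lambda>x. \<bar>u x\<bar>) \<in> sq_integrable M"
  by (auto simp: sq_integrable_def)

lemma norm2_abs: "norm2 M (\<lambda>x. \<bar>u x\<bar>) = norm2 M u"
  by (simp add: norm2_def)

text \<open>The fields with components \<open>\<phi> n * \<psi> b n\<close> have divergence
  integrals that converge to the difference of the two sides. The flux bound forces them to 0,
  because the trace of \<open>v\<close> vanishes on \<open>\<Gamma>\<^sub>D\<close> and the normal
  component of the trace of the gradient of \<open>w\<close> on
  \<open>\<Gamma>\<^sub>N\<close>.\<close>

theorem Green_formula:
  fixes \<Omega> :: "'a::euclidean_space set"
  assumes dom: "bounded_lipschitz_domain \<Omega>" and \<Gamma>: "\<Gamma>\<^sub>D \<union> \<Gamma>\<^sub>N = frontier \<Omega>"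
    and v: "v \<in> space_V \<Omega> \<Gamma>\<^sub>D" and w: "w \<in> space_X \<Omega> \<Gamma>\<^sub>N"
  shows "(LINT x|lebesgue_on \<Omega>. v x * laplacian \<Omega> w x)
       = - (\<Sum>b\<in>Basis. LINT x|lebesgue_on \<Omega>. weak_partial \<Omega> b v x * weak_partial \<Omega> b w x)"
proof -
  let ?M = "lebesgue_on \<Omega>" and ?B = "boundary_measure \<Omega>"
  have \<Omega>: "open \<Omega>" "bounded \<Omega>" and lip: "lipschitz_boundary \<Omega>"
    using dom by (auto simp: bounded_lipschitz_domain_def)
  note fin = hausdorff_outer_lipschitz_boundary[OF \<Omega> lip]
  have vH1: "v \<in> sobolev_H1 \<Omega>" using v by (simp add: space_V_def)
  have wH1: "w \<in> sobolev_H1 \<Omega>" and wbH1: "\<And>b. b \<in> Basis \<Longrightarrow> weak_partial \<Omega> b w \<in> sobolev_H1 \<Omega>"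
    using w by (auto simp: space_X_def sobolev_H2_def)
  obtain g where g: "has_trace \<Omega> v g" "AE x in ?B. x \<in> \<Gamma>\<^sub>D \<longrightarrow> g x = 0"
    using v unfolding space_V_def by blast
  obtain G where G: "\<And>b. b \<in> Basis \<Longrightarrow> has_trace \<Omega> (weak_partial \<Omega> b w) (\<lambda>x. G x \<bullet> b)"
    and GN: "AE x in ?B. x \<in> \<Gamma>\<^sub>N \<longrightarrow> (\<exists>\<nu>. outward_unit_normal \<Omega> x \<nu> \<and> G x \<bullet> \<nu> = 0)"
    using w unfolding space_X_def has_gradient_trace_def by blast
  note gB = has_trace_approximation(1)[OF \<Omega> fin g(1)]
  note GB = has_trace_approximation(1)[OF \<Omega> fin G]
  obtain \<phi> where \<phi>: "\<And>n::nat. smooth_fun (\<phi> n)"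
    and lim\<phi>: "(\<lambda>n. norm2 ?M (\<lambda>x. \<phi> n x - v x)) \<longlonglongrightarrow> 0"
      "\<And>b. b \<in> Basis \<Longrightarrow> (\<lambda>n. norm2 ?M (\<lambda>x. partial_deriv b (\<phi> n) x - weak_partial \<Omega> b v x)) \<longlonglongrightarrow> 0"
      "(\<lambda>n. norm2 ?B (\<lambda>x. \<phi> n x - g x)) \<longlonglongrightarrow> 0"
    using has_trace_approximation(2)[OF \<Omega> fin g(1)] by blast
  have "\<forall>b\<in>Basis. \<exists>\<psi>. (\<forall>n::nat. smooth_fun (\<psi> n)) \<and>
      (\<lambda>n. norm2 ?M (\<lambda>x. \<psi> n x - weak_partial \<Omega> b w x)) \<longlonglongrightarrow> 0 \<and>
      (\<forall>c\<in>Basis. (\<lambda>n. norm2 ?M (\<lambda>x. partial_deriv c (\<psi> n) x - weak_partial \<Omega> c (weak_partial \<Omega> b w) x)) \<longlonglongrightarrow> 0) \<and>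
      (\<lambda>n. norm2 ?B (\<lambda>x. \<psi> n x - G x \<bullet> b)) \<longlonglongrightarrow> 0"
    using has_trace_approximation(2)[OF \<Omega> fin G] by (rule ballI)
  from bchoice[OF this] obtain \<psi> where all\<psi>: "\<forall>b\<in>Basis. (\<forall>n::nat. smooth_fun (\<psi> b n)) \<and>
      (\<lambda>n. norm2 ?M (\<lambda>x. \<psi> b n x - weak_partial \<Omega> b w x)) \<longlonglongrightarrow> 0 \<and>
      (\<forall>c\<in>Basis. (\<lambda>n. norm2 ?M (\<lambda>x. partial_deriv c (\<psi> b n) x - weak_partial \<Omega> c (weak_partial \<Omega> b w) x)) \<longlonglongrightarrow> 0) \<and>
      (\<lambda>n. norm2 ?B (\<lambda>x. \<psi> b n x - G x \<bullet> b)) \<longlonglongrightarrow> 0" ..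
  have \<psi>: "smooth_fun (\<psi> b n)"
    and lim\<psi>: "(\<lambda>n. norm2 ?M (\<lambda>x. \<psi> b n x - weak_partial \<Omega> b w x)) \<longlonglongrightarrow> 0"
      "(\<lambda>n. norm2 ?M (\<lambda>x. partial_deriv b (\<psi> b n) x - weak_partial \<Omega> b (weak_partial \<Omega> b w) x)) \<longlonglongrightarrow> 0"
      "(\<lambda>n. norm2 ?B (\<lambda>x. \<psi> b n x - G x \<bullet> b)) \<longlonglongrightarrow> 0" if "b \<in> Basis" for b n
    using bspec[OF all\<psi> that] that by auto
  have sqM: "f \<in> sq_integrable ?M" if "smooth_fun f" for f
    by (rule continuous_sq_integrable[OF \<Omega> C_fun_continuous[OF smooth_fun_C_fun[OF that]]])
  have sqB: "f \<in> sq_integrable ?B" if "smooth_fun f" for f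
    by (rule continuous_sq_integrable_boundary[OF fin \<Omega>(2) C_fun_continuous[OF smooth_fun_C_fun[OF that]]])
  \<comment> \<open>The components of the gradient of \<open>w\<close> are approximated
    independently, so the functions \<open>\<psi> b n\<close> need not form a gradient; the argument
    uses each component by itself.\<close>
  define F where "F n x = (\<Sum>b\<in>Basis. (\<phi> n x * \<psi> b n x) *\<^sub>R b)" for n x
  have Fb: "F n x \<bullet> b = \<phi> n x * \<psi> b n x" if "b \<in> Basis" for n x b
    unfolding F_def using that by (simp add: inner_sum_left_Basis)
  have Fb': "(\<lambda>x. F n x \<bullet> b) = (\<lambda>x. \<phi> n x * \<psi> b n x)" if "b \<in> Basis" for n b
    using Fb[OF that] by (rule ext)
  have CF: "C_fun (Suc 0) (\<lambda>x. F n x \<bullet> b)" if "b \<in> Basis" for n b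
    unfolding Fb'[OF that] by (intro C_fun_mult smooth_fun_C_fun \<phi> \<psi> that)
  define a where "a = (\<Sum>b\<in>Basis. (LINT x|?M. v x * weak_partial \<Omega> b (weak_partial \<Omega> b w) x)
      + (LINT x|?M. weak_partial \<Omega> b v x * weak_partial \<Omega> b w x))"
  have "(\<lambda>n. LINT x|?M. divergence (F n) x) \<longlonglongrightarrow> a"
  proof -
    have "(LINT x|?M. divergence (F n) x) = (\<Sum>b\<in>Basis. (LINT x|?M. \<phi> n x * partial_deriv b (\<psi> b n) x)
        + (LINT x|?M. partial_deriv b (\<phi> n) x * \<psi> b n x))" for n
    proof -
      have i: "integrable ?M (\<lambda>x. \<phi> n x * partial_deriv b (\<psi> b n) x)" "integrable ?M (\<lambda>x. partial_deriv b (\<phi> n) x * \<psi> b n x)"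
        if "b \<in> Basis" for b
        by (intro sq_integrable_mult sqM smooth_fun_partial_deriv \<phi> \<psi> that)+
      have "divergence (F n) x = (\<Sum>b\<in>Basis. \<phi> n x * partial_deriv b (\<psi> b n) x + partial_deriv b (\<phi> n) x * \<psi> b n x)" for x
        unfolding divergence_def
        by (intro sum.cong refl, subst Fb', assumption, rule partial_deriv_mult)
           (use smooth_fun_C_fun[OF \<phi>, of "Suc 0"] smooth_fun_C_fun[OF \<psi>, of _ "Suc 0"] in auto)
      then show ?thesis using i by (simp add: Bochner_Integration.integral_sum Bochner_Integration.integral_add)
    qed
    moreover have "(\<lambda>n. \<Sum>b\<in>Basis. (LINT x|?M. \<phi> n x * partial_deriv b (\<psi> b n) x)
        + (LINT x|?M. partial_deriv b (\<phi> n) x * \<psi> b n x)) \<longlonglongrightarrow> a"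
      unfolding a_def
      by (intro tendsto_sum tendsto_add integral_mult_tendsto sqM smooth_fun_partial_deriv \<phi> \<psi>
          lim\<phi> lim\<psi> sobolev_H1_sq_integrable vH1 wbH1 weak_partial(1))
    ultimately show ?thesis by simp
  qed
  moreover have "(\<lambda>n. LINT x|?M. divergence (F n) x) \<longlonglongrightarrow> 0"
  proof -
    \<comment> \<open>Each product contains an approximation error on the boundary, which tends to
      0, and a factor whose norm converges.\<close>
    define I where "I n = (\<Sum>b\<in>Basis. norm2 ?B (\<lambda>x. \<phi> n x - g x) * norm2 ?B (\<psi> b n)
        + norm2 ?B (\<phi> n) * norm2 ?B (\<lambda>x. \<psi> b n x - G x \<bullet> b))" for n
    have "I \<longlonglongrightarrow> (\<Sum>b\<in>Basis. 0 * norm2 ?B (\<lambda>x. G x \<bullet> b) + norm2 ?B g * 0)"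
      unfolding I_def[abs_def]
      by (intro tendsto_sum tendsto_add tendsto_mult lim\<phi> lim\<psi> norm2_tendsto sqB \<phi> \<psi> gB GB)
    then have I0: "(\<lambda>n. flux_const (DIM('a)) * I n) \<longlonglongrightarrow> 0"
      using tendsto_mult_left[of I 0 sequentially "flux_const (DIM('a))"] by simp
    have bound: "\<bar>LINT x|?M. divergence (F n) x\<bar> \<le> flux_const (DIM('a)) * I n" for n
    proof -
      \<comment> \<open>This dominates \<open>norm (F n x)\<close> where \<open>g x = 0\<close> and the normal component of \<open>F n x\<close> where that
        of \<open>G x\<close> vanishes, so that no measurability of \<open>\<Gamma>\<^sub>D\<close> is involved.\<close>
      define h where "h x = (\<Sum>b\<in>Basis. \<bar>\<phi> n x - g x\<bar> * \<bar>\<psi> b n x\<bar> + \<bar>\<phi> n x\<bar> * \<bar>\<psi> b n x - G x \<bullet> b\<bar>)" for x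
      have s1: "(\<lambda>x. \<bar>\<phi> n x - g x\<bar>) \<in> sq_integrable ?B" "(\<lambda>x. \<bar>\<phi> n x\<bar>) \<in> sq_integrable ?B"
        by (intro sq_integrable_abs sq_integrable_diff sqB \<phi> gB)+
      have s2: "(\<lambda>x. \<bar>\<psi> b n x\<bar>) \<in> sq_integrable ?B" "(\<lambda>x. \<bar>\<psi> b n x - G x \<bullet> b\<bar>) \<in> sq_integrable ?B" if "b \<in> Basis" for b
        by (intro sq_integrable_abs sq_integrable_diff sqB \<psi> GB that)+
      note i1 = sq_integrable_mult[OF s1(1) s2(1)] and i2 = sq_integrable_mult[OF s1(2) s2(2)]
      have hint: "integrable ?B h"
        unfolding h_def[abs_def] by (intro Bochner_Integration.integrable_sum Bochner_Integration.integrable_add i1 i2)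
      have h0: "0 \<le> h x" for x unfolding h_def by (intro sum_nonneg) auto
      have "(LINT x|?B. h x) = (\<Sum>b\<in>Basis. (LINT x|?B. \<bar>\<phi> n x - g x\<bar> * \<bar>\<psi> b n x\<bar>) + (LINT x|?B. \<bar>\<phi> n x\<bar> * \<bar>\<psi> b n x - G x \<bullet> b\<bar>))"
        unfolding h_def using i1 i2
        by (simp add: Bochner_Integration.integral_sum Bochner_Integration.integral_add)
      also have "\<dots> \<le> I n"
        unfolding I_def
      proof (intro sum_mono add_mono)
        fix b :: 'a assume b: "b \<in> Basis"
        show "(LINT x|?B. \<bar>\<phi> n x - g x\<bar> * \<bar>\<psi> b n x\<bar>) \<le> norm2 ?B (\<lambda>x. \<phi> n x - g x) * norm2 ?B (\<psi> b n)"
          using norm2_Cauchy_Schwarz[OF s1(1) s2(1)[OF b]] by (simp add: norm2_abs abs_le_iff)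
        show "(LINT x|?B. \<bar>\<phi> n x\<bar> * \<bar>\<psi> b n x - G x \<bullet> b\<bar>) \<le> norm2 ?B (\<phi> n) * norm2 ?B (\<lambda>x. \<psi> b n x - G x \<bullet> b)"
          using norm2_Cauchy_Schwarz[OF s1(2) s2(2)[OF b]] by (simp add: norm2_abs abs_le_iff)
      qed
      finally have hI: "(LINT x|?B. h x) \<le> I n" .
      have I0: "0 \<le> I n" unfolding I_def by (intro sum_nonneg) auto
      show ?thesis
      proof (rule divergence_integral_le_boundary[OF \<Omega> fin CF, where h=h])
        show "h \<in> borel_measurable ?B" using hint by simp
        show "(\<integral>\<^sup>+x. ennreal (h x) \<partial>?B) \<le> ennreal (I n)"
          using nn_integral_eq_integral[OF hint] h0 hI by (simp add: ennreal_leI)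
        show "AE x in ?B. norm (F n x) \<le> h x \<or> (\<exists>\<nu>. outward_unit_normal \<Omega> x \<nu> \<and> \<bar>F n x \<bullet> \<nu>\<bar> \<le> h x)"
          using g(2) GN AE_space
        proof eventually_elim
          case (elim x)
          then have "x \<in> \<Gamma>\<^sub>D \<or> x \<in> \<Gamma>\<^sub>N" using \<Gamma> boundary_measure_finite(2)[OF fin] by blast
          then show ?case
          proof
            assume "x \<in> \<Gamma>\<^sub>D"
            then have "g x = 0" using elim by blast
            have "norm (F n x) \<le> (\<Sum>b\<in>Basis. \<bar>F n x \<bullet> b\<bar>)" by (rule norm_le_l1)
            also have "\<dots> \<le> h x" unfolding h_def
              by (intro sum_mono) (simp add: Fb \<open>g x = 0\<close> abs_mult)
            finally show ?thesis ..
          next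
            assume "x \<in> \<Gamma>\<^sub>N"
            then obtain \<nu> where \<nu>: "outward_unit_normal \<Omega> x \<nu>" "G x \<bullet> \<nu> = 0" using elim by blast
            have n1: "norm \<nu> = 1" using \<nu>(1) by (simp add: outward_unit_normal_def)
            \<comment> \<open>Subtracting the vanishing normal component of \<open>G\<close>
              replaces \<open>\<psi> b n\<close> by its approximation error.\<close>
            have "F n x \<bullet> \<nu> = F n x \<bullet> \<nu> - \<phi> n x * (G x \<bullet> \<nu>)" using \<nu>(2) by simp
            also have "\<dots> = (\<Sum>b\<in>Basis. (F n x \<bullet> b) * (\<nu> \<bullet> b)) - \<phi> n x * (\<Sum>b\<in>Basis. (G x \<bullet> b) * (\<nu> \<bullet> b))"
              by (simp only: euclidean_inner[of _ \<nu>])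
            also have "\<dots> = (\<Sum>b\<in>Basis. \<phi> n x * (\<psi> b n x - G x \<bullet> b) * (\<nu> \<bullet> b))"
              by (simp add: Fb sum_distrib_left sum_subtractf[symmetric] algebra_simps)
            finally have "\<bar>F n x \<bullet> \<nu>\<bar> \<le> (\<Sum>b\<in>Basis. \<bar>\<phi> n x * (\<psi> b n x - G x \<bullet> b) * (\<nu> \<bullet> b)\<bar>)"
              by (metis sum_abs)
            also have "\<dots> \<le> h x"
              unfolding h_def
            proof (rule sum_mono)
              fix b :: 'a assume "b \<in> Basis"
              then have "\<bar>\<nu> \<bullet> b\<bar> \<le> 1" using Basis_le_norm[of b \<nu>] n1 by simp
              then have "\<bar>\<phi> n x\<bar> * \<bar>\<psi> b n x - G x \<bullet> b\<bar> * \<bar>\<nu> \<bullet> b\<bar> \<le> \<bar>\<phi> n x\<bar> * \<bar>\<psi> b n x - G x \<bullet> b\<bar>"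
                by (intro mult_left_le) auto
              moreover have "0 \<le> \<bar>\<phi> n x - g x\<bar> * \<bar>\<psi> b n x\<bar>" by simp
              ultimately show "\<bar>\<phi> n x * (\<psi> b n x - G x \<bullet> b) * (\<nu> \<bullet> b)\<bar>
                  \<le> \<bar>\<phi> n x - g x\<bar> * \<bar>\<psi> b n x\<bar> + \<bar>\<phi> n x\<bar> * \<bar>\<psi> b n x - G x \<bullet> b\<bar>"
                unfolding abs_mult by linarith
            qed
            finally show ?thesis using \<nu>(1) by blast
          qed
        qed
      qed (use h0 I0 in auto)
    qed
    show ?thesis by (rule Lim_null_comparison[OF _ I0]) (use bound in auto)
  qed
  ultimately have "a = 0" by (rule LIMSEQ_unique)
  moreover have "(LINT x|?M. v x * laplacian \<Omega> w x) = (\<Sum>b\<in>Basis. LINT x|?M. v x * weak_partial \<Omega> b (weak_partial \<Omega> b w) x)"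
    unfolding laplacian_def sum_distrib_left
    by (intro Bochner_Integration.integral_sum sq_integrable_mult sobolev_H1_sq_integrable[OF vH1] weak_partial(1) wbH1)
  ultimately show ?thesis by (simp add: a_def sum.distrib)
qed

section \<open>Weak time derivatives\<close>

lemma integrable_product:
  fixes f :: "'a::euclidean_space \<Rightarrow> real" and g :: "'b::euclidean_space \<Rightarrow> real"
  assumes f: "integrable lborel f" and g: "integrable lborel g"
  shows "integrable (lborel \<Otimes>\<^sub>M lborel) (\<lambda>(x, y). f x * g y)"
proof (rule lborel_pair.Fubini_integrable)
  have [measurable]: "f \<in> borel_measurable borel" "g \<in> borel_measurable borel" using f g by auto
  show "(\<lambda>(x, y). f x * g y) \<in> borel_measurable (lborel \<Otimes>\<^sub>M lborel)" by measurable
  show "integrable lborel (\<lambda>x. LINT y|lborel. norm (case (x, y) of (x, y) \<Rightarrow> f x * g y))"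
    using f by (simp add: abs_mult)
  show "AE x in lborel. integrable lborel (\<lambda>y. case (x, y) of (x, y) \<Rightarrow> f x * g y)"
    using g by simp
qed

lemma simple_fun_pairing:
  assumes fin: "finite_measure N" and s: "simple_fun_in N (sq_integrable M) s"
    and g: "g \<in> sq_integrable M"
  shows "simple_integral_in N s \<in> sq_integrable M"
    and "integrable N (\<lambda>t. LINT x|M. s t x * g x)"
    and "(LINT t|N. LINT x|M. s t x * g x) = (LINT x|M. simple_integral_in N s x * g x)"
proof -
  interpret N: finite_measure N by fact
  define A where "A y = {t \<in> space N. s t = y}" for y
  have sf: "simple_function N s" and sY: "\<And>y. y \<in> s ` space N \<Longrightarrow> y \<in> sq_integrable M"
    using s by (auto simp: simple_fun_in_def)
  have finS: "finite (s ` space N)" using simple_functionD(1)[OF sf] .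
  have A: "A y \<in> sets N" for y
    using simple_functionD(2)[OF sf, of "{y}"] by (simp add: A_def vimage_def Int_def conj_commute)
  have eq: "(LINT x|M. s t x * g x) = (\<Sum>y\<in>s ` space N. indicat_real (A y) t * (LINT x|M. y x * g x))"
    if "t \<in> space N" for t
  proof -
    have "(\<Sum>y\<in>s ` space N. indicat_real (A y) t * (LINT x|M. y x * g x))
        = (\<Sum>y\<in>s ` space N. if y = s t then (LINT x|M. y x * g x) else 0)"
      using that by (intro sum.cong) (auto simp: A_def)
    then show ?thesis using finS that by (simp add: sum.delta)
  qed
  have iA: "integrable N (indicat_real (A y))" for y
    using A[of y] N.emeasure_finite[of "A y"] by (intro integrable_real_indicator) (simp_all add: less_top[symmetric])
  show sI: "simple_integral_in N s \<in> sq_integrable M"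
    unfolding simple_integral_in_def[abs_def]
    by (intro sq_integrable_sum sq_integrable_cmult sY)
  have "integrable N (\<lambda>t. \<Sum>y\<in>s ` space N. indicat_real (A y) t * (LINT x|M. y x * g x))"
    by (intro Bochner_Integration.integrable_sum integrable_mult_left iA)
  then show "integrable N (\<lambda>t. LINT x|M. s t x * g x)"
    by (subst Bochner_Integration.integrable_cong[OF refl eq])
  have "(LINT t|N. LINT x|M. s t x * g x)
      = (LINT t|N. (\<Sum>y\<in>s ` space N. indicat_real (A y) t * (LINT x|M. y x * g x)))"
    by (rule Bochner_Integration.integral_cong[OF refl eq])
  also have "\<dots> = (\<Sum>y\<in>s ` space N. measure N (A y) * (LINT x|M. y x * g x))"
    using iA A by (subst Bochner_Integration.integral_sum) (auto simp: Int_absorb2 sets.sets_into_space)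
  also have "\<dots> = (LINT x|M. (\<Sum>y\<in>s ` space N. measure N (A y) * (y x * g x)))"
    using sq_integrable_mult[OF sY g] by (subst Bochner_Integration.integral_sum) auto
  also have "\<dots> = (LINT x|M. simple_integral_in N s x * g x)"
    by (simp add: simple_integral_in_def A_def sum_distrib_right mult.assoc)
  finally show "(LINT t|N. LINT x|M. s t x * g x) = (LINT x|M. simple_integral_in N s x * g x)" .
qed

text \<open>For simple functions the identity is linearity, and Cauchy-Schwarz carries the
  approximation in norm over to the pairings. \<open>W\<close> is a measurable version of the
  pairing; it will come from a continuous function of time or from a representative on the
  space-time cylinder.\<close>

lemma bochner_integral_pairing:
  assumes fin: "finite_measure N"
    and F: "has_bochner_integral_in N (sq_integrable M) (norm2 M) F I"
    and g: "g \<in> sq_integrable M" and W: "W \<in> borel_measurable N"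
    and eq: "AE t in N. W t = (LINT x|M. F t x * g x)"
  shows "integrable N W" and "(LINT t|N. W t) = (LINT x|M. I x * g x)"
proof -
  from F obtain s where I: "I \<in> sq_integrable M" and F2: "AE t in N. F t \<in> sq_integrable M"
    and s: "\<And>i::nat. simple_fun_in N (sq_integrable M) (s i)"
    and lim1: "(\<lambda>i. \<integral>\<^sup>+ t. ennreal (norm2 M (\<lambda>x. s i t x - F t x)) \<partial>N) \<longlonglongrightarrow> 0"
    and lim2: "(\<lambda>i. norm2 M (\<lambda>x. simple_integral_in N (s i) x - I x)) \<longlonglongrightarrow> 0"
    unfolding has_bochner_integral_in_def bochner_measurable_def by blast
  define S where "S i t = (LINT x|M. s i t x * g x)" for i t
  have Sint: "integrable N (S i)" for i
    unfolding S_def by (rule simple_fun_pairing(2)[OF fin s g])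
  \<comment> \<open>The summand 1 keeps \<open>c\<close> positive for the division below even if
    \<open>g\<close> has norm 0.\<close>
  define c where "c = norm2 M g + 1"
  have c: "0 < c" unfolding c_def by (simp add: add_nonneg_pos)
  have Sm: "(\<lambda>t. \<bar>W t - S i t\<bar>) \<in> borel_measurable N" for i
    using W borel_measurable_integrable[OF Sint[of i]] by measurable
  have bnd: "(\<integral>\<^sup>+ t. ennreal \<bar>W t - S i t\<bar> \<partial>N) \<le> ennreal c * (\<integral>\<^sup>+ t. ennreal (norm2 M (\<lambda>x. s i t x - F t x)) \<partial>N)" for i
  proof -
    have "(\<integral>\<^sup>+ t. ennreal \<bar>W t - S i t\<bar> \<partial>N) = (\<integral>\<^sup>+ t. ennreal c * ennreal (\<bar>W t - S i t\<bar> / c) \<partial>N)"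
      using c by (intro nn_integral_cong) (simp add: ennreal_mult'[symmetric])
    also have "\<dots> = ennreal c * (\<integral>\<^sup>+ t. ennreal (\<bar>W t - S i t\<bar> / c) \<partial>N)"
      using Sm[of i] by (intro nn_integral_cmult) simp
    also have "(\<integral>\<^sup>+ t. ennreal (\<bar>W t - S i t\<bar> / c) \<partial>N) \<le> (\<integral>\<^sup>+ t. ennreal (norm2 M (\<lambda>x. s i t x - F t x)) \<partial>N)"
    proof (rule nn_integral_mono_AE)
      show "AE t in N. ennreal (\<bar>W t - S i t\<bar> / c) \<le> ennreal (norm2 M (\<lambda>x. s i t x - F t x))"
        using eq F2 AE_space
      proof eventually_elim
        case (elim t)
        have st: "s i t \<in> sq_integrable M" using s[of i] elim(3) by (auto simp: simple_fun_in_def)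
        have "W t - S i t = - (LINT x|M. (s i t x - F t x) * g x)"
          using sq_integrable_mult[OF st g] sq_integrable_mult[OF elim(2) g] elim(1)
          by (simp add: S_def left_diff_distrib)
        then have "\<bar>W t - S i t\<bar> \<le> norm2 M (\<lambda>x. s i t x - F t x) * norm2 M g"
          using norm2_Cauchy_Schwarz[OF sq_integrable_diff[OF st elim(2)] g] by simp
        also have "\<dots> \<le> norm2 M (\<lambda>x. s i t x - F t x) * c" by (intro mult_left_mono) (auto simp: c_def)
        finally show ?case using c by (intro ennreal_leI) (simp add: divide_le_eq)
      qed
    qed
    finally show ?thesis by (simp add: mult_left_mono)
  qed
  have "(\<lambda>i. ennreal c * (\<integral>\<^sup>+ t. ennreal (norm2 M (\<lambda>x. s i t x - F t x)) \<partial>N)) \<longlonglongrightarrow> ennreal c * 0"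
    by (rule ennreal_tendsto_cmult[OF _ lim1]) simp
  then have lim2': "(\<lambda>i. ennreal c * (\<integral>\<^sup>+ t. ennreal (norm2 M (\<lambda>x. s i t x - F t x)) \<partial>N)) \<longlonglongrightarrow> 0"
    by simp
  have lim3: "(\<lambda>i. \<integral>\<^sup>+ t. ennreal \<bar>W t - S i t\<bar> \<partial>N) \<longlonglongrightarrow> 0"
  proof (rule tendsto_sandwich[OF _ _ tendsto_const lim2'])
    show "\<forall>\<^sub>F i in sequentially. (\<integral>\<^sup>+ t. ennreal \<bar>W t - S i t\<bar> \<partial>N)
        \<le> ennreal c * (\<integral>\<^sup>+ t. ennreal (norm2 M (\<lambda>x. s i t x - F t x)) \<partial>N)"
      using bnd by (intro always_eventually allI)
  qed simp
  then have "\<forall>\<^sub>F i in sequentially. (\<integral>\<^sup>+ t. ennreal \<bar>W t - S i t\<bar> \<partial>N) < 1"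
    by (rule order_tendstoD) simp
  then obtain i where "(\<integral>\<^sup>+ t. ennreal \<bar>W t - S i t\<bar> \<partial>N) < 1" by (auto simp: eventually_sequentially)
  then have "(\<integral>\<^sup>+ t. ennreal (norm (W t - S i t)) \<partial>N) < \<infinity>"
    using less_trans[OF _ ennreal_one_less_top] by simp
  then have "integrable N (\<lambda>t. W t - S i t)"
    using W borel_measurable_integrable[OF Sint[of i]] by (intro integrableI_bounded) auto
  from Bochner_Integration.integrable_add[OF this Sint[of i]] show Wint: "integrable N W" by simp
  have "(\<lambda>i. LINT t|N. S i t) \<longlonglongrightarrow> (LINT t|N. W t)"
  proof (rule tendsto_L1_int[OF Sint Wint])
    show "(\<lambda>i. \<integral>\<^sup>+ t. ennreal (norm (S i t - W t)) \<partial>N) \<longlonglongrightarrow> 0"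
      using lim3 by (simp add: abs_minus_commute)
  qed
  moreover have "(\<lambda>i. LINT t|N. S i t) \<longlonglongrightarrow> (LINT x|M. I x * g x)"
    unfolding S_def simple_fun_pairing(3)[OF fin s g]
    by (rule integral_mult_tendsto[OF simple_fun_pairing(1)[OF fin s g] I g g lim2])
       (simp add: norm2_def)
  ultimately show "(LINT t|N. W t) = (LINT x|M. I x * g x)" by (rule LIMSEQ_unique)
qed

section \<open>Test functions of time and the lemma of du Bois-Reymond\<close>

lemma partial_deriv_real: "(f has_real_derivative D) (at t) \<Longrightarrow> partial_deriv 1 f t = D"
  using partial_deriv_eq[of f "(*) D" t 1] by (simp add: has_field_derivative_def)

lemma test_fun_interval:
  assumes \<theta>: "test_fun {0<..<T} \<theta>" and "0 < T"
  shows "\<exists>a b. 0 < a \<and> a < b \<and> b < T \<and> (\<forall>t. t \<notin> {a..b} \<longrightarrow> \<theta> t = 0)"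
    and "(\<theta> has_real_derivative deriv \<theta> t) (at t)"
    and "continuous_on UNIV (deriv \<theta>)" and "continuous_on UNIV \<theta>"
proof -
  from test_funD(2)[OF \<theta>] obtain K where K: "compact K" "K \<subseteq> {0<..<T}" "\<forall>t. t \<notin> K \<longrightarrow> \<theta> t = 0" by blast
  show "\<exists>a b. 0 < a \<and> a < b \<and> b < T \<and> (\<forall>t. t \<notin> {a..b} \<longrightarrow> \<theta> t = 0)"
  proof (cases "K = {}")
    case True
    then show ?thesis using K \<open>0 < T\<close> by (intro exI[of _ "T / 3"] exI[of _ "T / 2"]) auto
  next
    case False
    obtain a where a: "a \<in> K" "\<And>t. t \<in> K \<Longrightarrow> a \<le> t" using compact_attains_inf[OF K(1) False] by blast
    obtain b where b: "b \<in> K" "\<And>t. t \<in> K \<Longrightarrow> t \<le> b" using compact_attains_sup[OF K(1) False] by blast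
    \<comment> \<open>The lower end is halved so that the interval is nondegenerate even when
      \<open>K\<close> is a single point.\<close>
    have "\<theta> t = 0" if "t \<notin> {a / 2..b}" for t
    proof -
      have "0 < a" using a(1) K(2) by auto
      then have "t \<notin> K" using that a(2)[of t] b(2)[of t] by auto
      then show ?thesis using K(3) by blast
    qed
    moreover have "0 < a / 2" "a / 2 < b" "b < T" using a(1) b(1) a(2)[OF b(1)] K(2) by force+
    ultimately show ?thesis by blast
  qed
  have C: "C_fun (Suc 0) \<theta>" by (rule smooth_fun_C_fun[OF test_funD(1)[OF \<theta>]])
  have der: "(\<theta> has_real_derivative deriv \<theta> t) (at t)" for t
    using C by (simp add: DERIV_deriv_iff_real_differentiable)
  then show "(\<theta> has_real_derivative deriv \<theta> t) (at t)" .
  have "partial_deriv 1 \<theta> = deriv \<theta>" using partial_deriv_real[OF der] by (rule ext)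
  then show "continuous_on UNIV (deriv \<theta>)" using C by simp
  show "continuous_on UNIV \<theta>" by (rule C_fun_continuous[OF C])
qed

text \<open>The primitive that vanishes to the left of the support also vanishes to the right of it,
  because the total integral is 0.\<close>

lemma test_fun_primitive:
  assumes \<rho>: "test_fun {0<..<T} \<rho>" and "0 < T" and int0: "(LINT t|lborel. \<rho> t) = 0"
  shows "\<exists>\<theta>. test_fun {0<..<T} \<theta> \<and> deriv \<theta> = \<rho>"
proof -
  obtain a b where ab: "0 < a" "a < b" "b < T" and supp: "\<And>t. t \<notin> {a..b} \<Longrightarrow> \<rho> t = 0"
    using test_fun_interval(1)[OF \<rho> \<open>0 < T\<close>] by blast
  note cont = test_fun_interval(4)[OF \<rho> \<open>0 < T\<close>]
  have ic: "isCont \<rho> t" for t using cont by (simp add: continuous_on_eq_continuous_at)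
  have "\<exists>F. \<forall>x. -\<infinity> < ereal x \<longrightarrow> ereal x < \<infinity> \<longrightarrow> (F has_vector_derivative \<rho> x) (at x)"
    by (rule einterval_antiderivative) (use ic in auto)
  then obtain F where F: "\<And>x. (F has_real_derivative \<rho> x) (at x)"
    by (auto simp: has_real_derivative_iff_has_vector_derivative)
  have FTC: "(LINT t|lborel. \<rho> t * indicator {x..y} t) = F y - F x" if "x \<le> y" for x y
    by (rule integral_FTC_Icc_real[OF that F ic])
  define a' where "a' = a / 2"
  have a': "0 < a'" "a' < a" using ab by (auto simp: a'_def)
  define \<theta> where "\<theta> t = F t - F a'" for t
  have d\<theta>: "(\<theta> has_real_derivative \<rho> t) (at t)" for t
    unfolding \<theta>_def using DERIV_diff[OF F DERIV_const] by simp
  have pd: "partial_deriv 1 \<theta> = \<rho>" using partial_deriv_real[OF d\<theta>] by (rule ext)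
  have diff: "\<theta> differentiable (at t)" for t
    using d\<theta> real_differentiable_def by blast
  have "smooth_fun \<theta>"
    unfolding smooth_fun_def
  proof
    fix k show "C_fun k \<theta>"
    proof (cases k)
      case 0
      then show ?thesis using diff by (auto simp: differentiable_imp_continuous_on differentiable_on_def)
    next
      case (Suc m)
      then show ?thesis using diff smooth_fun_C_fun[OF test_funD(1)[OF \<rho>]] by (simp add: pd)
    qed
  qed
  moreover have "\<theta> t = 0" if t: "t \<notin> {a'..b}" for t
  proof (cases "t < a'")
    case True
    have "F a' - F t = (LINT s|lborel. \<rho> s * indicator {t..a'} s)" using True by (intro FTC[symmetric]) simp
    also have "(\<lambda>s. \<rho> s * indicator {t..a'} s) = (\<lambda>s. 0)"
      using supp a' by (auto simp: indicator_def fun_eq_iff)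
    finally show ?thesis by (simp add: \<theta>_def)
  next
    case False
    then have "b < t" "a' \<le> t" using t a' ab by auto
    have "F t - F a' = (LINT s|lborel. \<rho> s * indicator {a'..t} s)" using False by (intro FTC[symmetric]) simp
    also have "(\<lambda>s. \<rho> s * indicator {a'..t} s) = \<rho>"
    proof (rule ext)
      fix s show "\<rho> s * indicator {a'..t} s = \<rho> s"
        using supp[of s] a' \<open>b < t\<close> by (cases "s \<in> {a..b}") auto
    qed
    finally show ?thesis by (simp add: \<theta>_def int0)
  qed
  ultimately have "test_fun {0<..<T} \<theta>"
    unfolding test_fun_def using a' ab by (intro conjI exI[of _ "{a'..b}"]) auto
  moreover have "deriv \<theta> = \<rho>" using DERIV_imp_deriv[OF d\<theta>] by (rule ext)
  ultimately show ?thesis by blast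
qed

lemma test_fun_diff_cmult:
  assumes "test_fun S \<rho>" "test_fun S \<sigma>"
  shows "test_fun S (\<lambda>x. \<rho> x - c * \<sigma> x)"
proof -
  from assms obtain K L where KL: "compact K" "K \<subseteq> S" "\<forall>x. x \<notin> K \<longrightarrow> \<rho> x = 0"
    "compact L" "L \<subseteq> S" "\<forall>x. x \<notin> L \<longrightarrow> \<sigma> x = 0"
    unfolding test_fun_def by blast
  then have "compact (K \<union> L)" "K \<union> L \<subseteq> S" "\<forall>x. x \<notin> K \<union> L \<longrightarrow> \<rho> x - c * \<sigma> x = 0" by auto
  moreover have "smooth_fun (\<lambda>x. \<rho> x - c * \<sigma> x)"
    using assms by (intro smooth_fun_diff smooth_fun_mult smooth_fun_const) (auto dest: test_funD)
  ultimately show ?thesis unfolding test_fun_def by blast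
qed

lemma test_fun_integrable:
  assumes "test_fun S \<rho>" "continuous_on UNIV f"
  shows "integrable lborel (\<lambda>x. f x * \<rho> x)"
proof -
  from test_funD[OF assms(1)] obtain K where K: "compact K" "\<forall>x. x \<notin> K \<longrightarrow> \<rho> x = 0" and s: "smooth_fun \<rho>" by blast
  have "integrable lborel (\<lambda>x. indicator K x *\<^sub>R (f x * \<rho> x))"
    by (rule borel_integrable_compact[OF K(1)])
       (intro continuous_on_mult continuous_on_subset[OF assms(2)]
          continuous_on_subset[OF C_fun_continuous[OF smooth_fun_C_fun[OF s, of 0]]] subset_UNIV)
  also have "(\<lambda>x. indicator K x *\<^sub>R (f x * \<rho> x)) = (\<lambda>x. f x * \<rho> x)"
    using K(2) by (auto simp: indicator_def fun_eq_iff)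
  finally show ?thesis .
qed

text \<open>Test functions with integral 0 are derivatives of test functions. Subtracting from
  \<open>\<rho>\<close> a multiple of a fixed \<open>\<sigma>\<close> with nonzero integral leads to
  this case and shows that \<open>R - m\<close> annihilates all test functions, where
  \<open>m\<close> is the mean of \<open>R\<close> weighted by \<open>\<sigma>\<close>.\<close>

lemma du_Bois_Reymond:
  fixes R :: "real \<Rightarrow> real"
  assumes "0 < T" and R: "continuous_on UNIV R"
    and test: "\<And>\<theta>. test_fun {0<..<T} \<theta> \<Longrightarrow> (LINT t|lborel. R t * deriv \<theta> t) = 0"
    and t: "t \<in> {0..T}"
  shows "R t = R 0"
proof -
  have op0: "open {0<..<T}" by simp
  \<comment> \<open>If all test functions had integral 0, the fundamental lemma applied to the
    indicator of the interval would make the interval a null set.\<close>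
  have "\<exists>\<rho>. test_fun {0<..<T} \<rho> \<and> (LINT t|lborel. \<rho> t) \<noteq> 0"
  proof (rule ccontr)
    assume "\<not> ?thesis"
    then have 0: "(LINT t|lborel. \<rho> t) = 0" if "test_fun {0<..<T} \<rho>" for \<rho> using that by blast
    have "AE t in lborel. t \<in> {0<..<T} \<longrightarrow> indicat_real {0<..<T} t = 0"
    proof (rule fundamental_lemma_borel[OF op0])
      show "integrable lborel (indicat_real {0<..<T})" using \<open>0 < T\<close> by (intro integrable_real_indicator) auto
      fix \<rho> assume \<rho>: "test_fun {0<..<T} \<rho>"
      then have "(\<lambda>t. indicat_real {0<..<T} t * \<rho> t) = \<rho>"
        by (force simp: test_fun_def indicator_def fun_eq_iff)
      then show "(LINT t|lborel. indicat_real {0<..<T} t * \<rho> t) = 0" using 0[OF \<rho>] by simp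
    qed
    then have "AE t in lborel. t \<notin> {0<..<T}" by eventually_elim (auto simp: indicator_def)
    then have "{0<..<T} \<in> null_sets lborel" by (subst AE_iff_null_sets) auto
    then show False using \<open>0 < T\<close> by (auto dest!: null_setsD1)
  qed
  then obtain \<sigma> where \<sigma>: "test_fun {0<..<T} \<sigma>" "(LINT t|lborel. \<sigma> t) \<noteq> 0" by blast
  define m where "m = (LINT t|lborel. R t * \<sigma> t) / (LINT t|lborel. \<sigma> t)"
  have i1: "integrable lborel \<rho>" if "test_fun {0<..<T} \<rho>" for \<rho>
    using test_fun_integrable[OF that continuous_on_const, of 1] by simp
  have Rm: "continuous_on UNIV (\<lambda>t. R t - m)" by (intro continuous_intros R)
  have "AE t in lborel. t \<in> {0<..<T} \<longrightarrow> indicat_real {0..T} t *\<^sub>R (R t - m) = 0"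
  proof (rule fundamental_lemma_borel[OF op0])
    show "integrable lborel (\<lambda>t. indicat_real {0..T} t *\<^sub>R (R t - m))"
      by (rule borel_integrable_compact[OF _ continuous_on_subset[OF Rm]]) auto
    fix \<rho> assume \<rho>: "test_fun {0<..<T} \<rho>"
    define c where "c = (LINT t|lborel. \<rho> t) / (LINT t|lborel. \<sigma> t)"
    have "(LINT t|lborel. \<rho> t - c * \<sigma> t) = 0"
      using i1[OF \<rho>] i1[OF \<sigma>(1)] \<sigma>(2) by (simp add: c_def)
    then obtain \<theta> where \<theta>: "test_fun {0<..<T} \<theta>" "deriv \<theta> = (\<lambda>t. \<rho> t - c * \<sigma> t)"
      using test_fun_primitive[OF test_fun_diff_cmult[OF \<rho> \<sigma>(1)] \<open>0 < T\<close>] by blast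
    have "(LINT t|lborel. R t * (\<rho> t - c * \<sigma> t)) = 0" using test[OF \<theta>(1)] by (simp add: \<theta>(2))
    then have "(LINT t|lborel. R t * \<rho> t) = c * (LINT t|lborel. R t * \<sigma> t)"
      using test_fun_integrable[OF \<rho> R] test_fun_integrable[OF \<sigma>(1) R]
      by (simp add: right_diff_distrib mult.left_commute[of _ c])
    also have "\<dots> = m * (LINT t|lborel. \<rho> t)" by (simp add: c_def m_def)
    finally have "(LINT t|lborel. (R t - m) * \<rho> t) = 0"
      using test_fun_integrable[OF \<rho> R] i1[OF \<rho>] by (simp add: left_diff_distrib)
    moreover have "(\<lambda>t. indicat_real {0..T} t *\<^sub>R (R t - m) * \<rho> t) = (\<lambda>t. (R t - m) * \<rho> t)"
      using \<rho> by (force simp: test_fun_def indicator_def fun_eq_iff)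
    ultimately show "(LINT t|lborel. indicat_real {0..T} t *\<^sub>R (R t - m) * \<rho> t) = 0" by simp
  qed
  then have ae: "AE t in lborel. t \<notin> {0<..<T} \<inter> {t. R t \<noteq> m}"
    by eventually_elim (auto simp: indicator_def)
  \<comment> \<open>By continuity the exceptional set is open, and an open null set is
    empty.\<close>
  have op: "open ({0<..<T} \<inter> {t. R t \<noteq> m})"
    using R by (intro open_Int open_Collect_neq continuous_on_const) auto
  have "{0<..<T} \<inter> {t. R t \<noteq> m} \<in> null_sets lborel"
    using ae op by (subst AE_iff_null_sets) auto
  then have "negligible ({0<..<T} \<inter> {t. R t \<noteq> m})"
    by (simp add: negligible_iff_null_sets null_sets_completionI)
  then have "{0<..<T} \<inter> {t. R t \<noteq> m} = {}" using open_not_negligible[OF op] by blast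
  then have eqm: "R s = m" if "s \<in> {0<..<T}" for s using that by blast
  have cl: "closure {0<..<T} = {0..T}" using \<open>0 < T\<close> by simp
  have "R s = m" if "s \<in> {0..T}" for s
    by (rule continuous_constant_on_closure[of "{0<..<T}" R m s])
       (use eqm that continuous_on_subset[OF R] in \<open>auto simp: cl\<close>)
  then show ?thesis using t \<open>0 < T\<close> by simp
qed

text \<open>By Fubini the primitive \<open>J\<close> of \<open>E\<close> has the same weak
  derivative as \<open>P\<close>, so the two differ by a constant.\<close>

lemma weak_time_derivative_imp_integral:
  fixes P E :: "real \<Rightarrow> real"
  assumes "0 < T" and P: "continuous_on {0..T} P" and E: "integrable lborel E"
    and weak: "\<And>\<theta>. test_fun {0<..<T} \<theta> \<Longrightarrow>
      (LINT t|lebesgue_on {0<..<T}. deriv \<theta> t * P t) = - (LINT t|lborel. \<theta> t * E t)"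
    and E0: "\<And>s. s \<le> 0 \<Longrightarrow> E s = 0" and t: "t \<in> {0..T}"
  shows "P t - P 0 = (LINT s|lborel. indicat_real {..<t} s * E s)"
proof -
  \<comment> \<open>\<open>Q\<close> continues \<open>P\<close> by its end values, to obtain a
    continuous function on the whole line.\<close>
  define Q where "Q t = P (max 0 (min T t))" for t
  define J where "J t = (LINT s|lborel. indicat_real {..<t} s * E s)" for t
  have Em[measurable]: "E \<in> borel_measurable borel" using E by simp
  have Q: "continuous_on UNIV Q"
    unfolding Q_def using \<open>0 < T\<close>
    by (intro continuous_on_compose2[OF P] continuous_intros) auto
  have J: "continuous_on UNIV J"
  proof (rule continuous_at_imp_continuous_on, rule ballI)
    fix t
    show "isCont J t"
    proof (rule continuous_at_sequentiallyI)
      fix u assume u: "u \<longlonglongrightarrow> t"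
      show "(\<lambda>n. J (u n)) \<longlonglongrightarrow> J t"
        unfolding J_def
      proof (rule integral_dominated_convergence[where w="\<lambda>s. \<bar>E s\<bar>"])
        show "AE s in lborel. (\<lambda>n. indicat_real {..<u n} s * E s) \<longlonglongrightarrow> indicat_real {..<t} s * E s"
          using AE_lborel_singleton[of t]
        proof eventually_elim
          case (elim s)
          have "\<forall>\<^sub>F n in sequentially. indicat_real {..<u n} s = indicat_real {..<t} s"
          proof (cases "s < t")
            case True
            then have "\<forall>\<^sub>F n in sequentially. s < u n" using u by (intro order_tendstoD)
            then show ?thesis by eventually_elim (use True in simp)
          next
            case False
            then have "\<forall>\<^sub>F n in sequentially. u n < s" using u elim by (intro order_tendstoD) auto
            then show ?thesis by eventually_elim (use False in simp)
          qed
          then show ?case by (intro tendsto_mult tendsto_const tendsto_eventually)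
        qed
        show "AE s in lborel. norm (indicat_real {..<u n} s * E s) \<le> \<bar>E s\<bar>" for n
          by (simp add: indicator_def)
      qed (use E in auto)
    qed
  qed
  have "Q t - J t = Q 0 - J 0"
  proof (rule du_Bois_Reymond[OF \<open>0 < T\<close> continuous_on_diff[OF Q J] _ t])
    fix \<theta> assume \<theta>: "test_fun {0<..<T} \<theta>"
    obtain a b where ab: "0 < a" "a < b" "b < T" and supp: "\<And>t. t \<notin> {a..b} \<Longrightarrow> \<theta> t = 0"
      using test_fun_interval(1)[OF \<theta> \<open>0 < T\<close>] by blast
    note d = test_fun_interval(2)[OF \<theta> \<open>0 < T\<close>] and dc = test_fun_interval(3)[OF \<theta> \<open>0 < T\<close>]
    have dsupp: "deriv \<theta> t = 0" if t: "t \<notin> {a..b}" for t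
    proof -
      have "(\<theta> has_real_derivative 0) (at t)"
        by (rule has_field_derivative_transform_within_open[OF DERIV_const[of 0], where S="- {a..b}"])
           (use t supp in \<open>auto simp: open_Compl\<close>)
      then show ?thesis by (rule DERIV_imp_deriv)
    qed
    have int: "integrable lborel (\<lambda>t. f t * deriv \<theta> t)" if "continuous_on UNIV f" for f
    proof -
      have "integrable lborel (\<lambda>t. indicator {a..b} t *\<^sub>R (f t * deriv \<theta> t))"
        by (rule borel_integrable_compact) (auto intro!: continuous_on_mult continuous_on_subset[OF dc] continuous_on_subset[OF that])
      also have "(\<lambda>t. indicator {a..b} t *\<^sub>R (f t * deriv \<theta> t)) = (\<lambda>t. f t * deriv \<theta> t)"
        using dsupp by (auto simp: indicator_def fun_eq_iff)
      finally show ?thesis .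
    qed
    have dint: "integrable lborel (deriv \<theta>)" using int[OF continuous_on_const, of 1] by simp
    have dm[measurable]: "deriv \<theta> \<in> borel_measurable borel" using dint by simp
    have "(LINT t|lborel. Q t * deriv \<theta> t) = (LINT t|lebesgue_on {0<..<T}. deriv \<theta> t * P t)"
    proof -
      have "(LINT t|lebesgue_on {0<..<T}. deriv \<theta> t * P t) = (LINT t|lebesgue_on {0<..<T}. deriv \<theta> t * Q t)"
        by (rule Bochner_Integration.integral_cong) (auto simp: Q_def)
      also have "\<dots> = (LINT t|lborel. indicat_real {0<..<T} t *\<^sub>R (deriv \<theta> t * Q t))"
        using borel_measurable_continuous_onI[OF Q] by (intro integral_lebesgue_on_eq_lborel) auto
      also have "(\<lambda>t. indicat_real {0<..<T} t *\<^sub>R (deriv \<theta> t * Q t)) = (\<lambda>t. Q t * deriv \<theta> t)"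
      proof (rule ext)
        fix t show "indicat_real {0<..<T} t *\<^sub>R (deriv \<theta> t * Q t) = Q t * deriv \<theta> t"
          using dsupp[of t] ab by (cases "t \<in> {a..b}") auto
      qed
      finally show ?thesis by simp
    qed
    also have "\<dots> = - (LINT t|lborel. \<theta> t * E t)" by (rule weak[OF \<theta>])
    finally have 1: "(LINT t|lborel. Q t * deriv \<theta> t) = - (LINT t|lborel. \<theta> t * E t)" .
    have "(LINT t|lborel. J t * deriv \<theta> t) = (LINT t|lborel. LINT s|lborel. deriv \<theta> t * (indicat_real {..<t} s * E s))"
      by (simp add: J_def mult.commute)
    also have "\<dots> = (LINT s|lborel. LINT t|lborel. deriv \<theta> t * (indicat_real {..<t} s * E s))"
    proof (rule lborel_pair.Fubini_integral)
      show "integrable (lborel \<Otimes>\<^sub>M lborel) (\<lambda>(s, t). deriv \<theta> t * (indicat_real {..<t} s * E s))"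
      proof (rule Bochner_Integration.integrable_bound[OF integrable_product[OF E dint]])
        have "(\<lambda>(s, t). deriv \<theta> t * (indicat_real {..<t} s * E s))
            = (\<lambda>p. deriv \<theta> (snd p) * ((if fst p < snd p then 1 else 0) * E (fst p)))"
          by (auto simp: fun_eq_iff indicator_def)
        moreover have "(\<lambda>p. deriv \<theta> (snd p) * ((if fst p < snd p then 1 else 0) * E (fst p))) \<in> borel_measurable (lborel \<Otimes>\<^sub>M lborel)"
          by measurable
        ultimately show "(\<lambda>(s, t). deriv \<theta> t * (indicat_real {..<t} s * E s)) \<in> borel_measurable (lborel \<Otimes>\<^sub>M lborel)"
          by simp
        show "AE p in lborel \<Otimes>\<^sub>M lborel. norm (case p of (s, t) \<Rightarrow> deriv \<theta> t * (indicat_real {..<t} s * E s))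
            \<le> norm (case p of (s, t) \<Rightarrow> E s * deriv \<theta> t)"
          by (intro AE_I2) (auto simp: abs_mult indicator_def)
      qed
    qed
    also have "\<dots> = (LINT s|lborel. - (\<theta> s * E s))"
    proof (rule Bochner_Integration.integral_cong[OF refl])
      fix s :: real
      have "(LINT t|lborel. deriv \<theta> t * (indicat_real {..<t} s * E s)) = (LINT t|lborel. deriv \<theta> t * indicat_real {s<..} t) * E s"
      proof -
        have "(\<lambda>t. deriv \<theta> t * (indicat_real {..<t} s * E s)) = (\<lambda>t. deriv \<theta> t * indicat_real {s<..} t * E s)"
          by (auto simp: indicator_def fun_eq_iff)
        then show ?thesis by (simp only: integral_mult_left_zero)
      qed
      \<comment> \<open>The point \<open>max s T\<close> lies beyond the support of
        \<open>\<theta>\<close> and is not below \<open>s\<close>; integrating up to it leaves no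
        boundary term at the upper end, whatever \<open>s\<close> is.\<close>
      also have "(LINT t|lborel. deriv \<theta> t * indicat_real {s<..} t) = (LINT t|lborel. deriv \<theta> t * indicat_real {s..max s T} t)"
      proof (rule integral_cong_AE)
        show "AE t in lborel. deriv \<theta> t * indicat_real {s<..} t = deriv \<theta> t * indicat_real {s..max s T} t"
          using AE_lborel_singleton[of s]
        proof eventually_elim
          case (elim t)
          then show ?case using dsupp[of t] ab by (auto simp: indicator_def max_def)
        qed
      qed measurable
      also have "\<dots> = \<theta> (max s T) - \<theta> s"
        using dc by (intro integral_FTC_Icc_real d) (auto simp: continuous_on_eq_continuous_at)
      also have "\<theta> (max s T) = 0" using supp[of "max s T"] ab by auto
      finally show "(LINT t|lborel. deriv \<theta> t * (indicat_real {..<t} s * E s)) = - (\<theta> s * E s)" by simp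
    qed
    finally have 2: "(LINT t|lborel. J t * deriv \<theta> t) = - (LINT t|lborel. \<theta> t * E t)" by simp
    show "(LINT t|lborel. (Q t - J t) * deriv \<theta> t) = 0"
      using int[OF Q] int[OF J] 1 2 by (simp add: left_diff_distrib)
  qed
  \<comment> \<open>The integral up to time 0 only meets times where \<open>E\<close>
    vanishes.\<close>
  moreover have "J 0 = 0"
    unfolding J_def using E0 by (intro integral_eq_zero_AE AE_I2) (auto simp: indicator_def)
  moreover have "Q t = P t" "Q 0 = P 0" using t by (auto simp: Q_def)
  ultimately show ?thesis by (simp add: J_def)
qed

section \<open>Solutions as functions on the space-time cylinder\<close>

text \<open>Interchanging the order of the two quantifiers requires a measurable set, so the
  exceptional set is first enlarged to a Borel null set.\<close>

lemma AE_lborel_pair_swap: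
  fixes P :: "'a::euclidean_space \<times> 'b::euclidean_space \<Rightarrow> bool"
  assumes "AE z in lborel. P z"
  shows "AE t in lborel. AE x in lborel. P (x, t)"
proof -
  from assms obtain N where N: "N \<in> null_sets lborel" "{z. \<not> P z} \<subseteq> N"
    unfolding eventually_ae_filter by auto
  have Nb: "N \<in> sets (lborel \<Otimes>\<^sub>M lborel)" unfolding lborel_prod using null_setsD2[OF N(1)] .
  have "AE z in lborel \<Otimes>\<^sub>M lborel. z \<notin> N" unfolding lborel_prod by (rule AE_not_in[OF N(1)])
  from lborel_pair.AE_pair[OF this] have "AE x in lborel. AE t in lborel. (x, t) \<notin> N" .
  moreover have "{z \<in> space (lborel \<Otimes>\<^sub>M lborel). (fst z, snd z) \<notin> N} = space (lborel \<Otimes>\<^sub>M lborel) - N" by auto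
  then have "{z \<in> space (lborel \<Otimes>\<^sub>M lborel). (fst z, snd z) \<notin> N} \<in> sets (lborel \<Otimes>\<^sub>M lborel)"
    using sets.compl_sets[OF Nb] by simp
  then have "{z \<in> space (lborel \<Otimes>\<^sub>M lborel). (\<lambda>x t. (x, t) \<notin> N) (fst z) (snd z)} \<in> sets (lborel \<Otimes>\<^sub>M lborel)"
    by simp
  from lborel_pair.AE_commute[OF this] calculation(1)
  have "AE t in lborel. AE x in lborel. (x, t) \<notin> N" by simp
  then show ?thesis
    by eventually_elim (use N(2) in \<open>auto elim!: eventually_mono\<close>)
qed

lemma integral_lebesgue_on_eq_lborel_support:
  fixes f :: "'a::euclidean_space \<Rightarrow> real"
  assumes "open S" "f \<in> borel_measurable borel" "\<And>x. x \<notin> S \<Longrightarrow> f x = 0"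
  shows "(LINT x|lebesgue_on S. f x) = (LINT x|lborel. f x)"
proof -
  have "(\<lambda>x. indicat_real S x *\<^sub>R f x) = f" using assms(3) by (auto simp: indicator_def fun_eq_iff)
  then show ?thesis using integral_lebesgue_on_eq_lborel[OF assms(1), of f] assms(2) by simp
qed

lemma AE_lebesgue_on_iff:
  fixes S :: "'a::euclidean_space set"
  assumes "open S"
  shows "(AE x in lebesgue_on S. P x) \<longleftrightarrow> (AE x in lborel. x \<in> S \<longrightarrow> P x)"
  using assms by (subst AE_restrict_space_iff) (auto simp: AE_completion_iff)

text \<open>Product measures and translations are treated for \<open>lborel\<close>, whereas
  elements of \<open>L2_space\<close> are only Lebesgue measurable. The value 0 outside
  \<open>Q\<close> lets all later integrals run over the whole space.\<close>

lemma borel_representative: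
  fixes h :: "'a::euclidean_space \<Rightarrow> real"
  assumes Q: "open Q" and h: "h \<in> L2_space Q"
  shows "\<exists>H. H \<in> borel_measurable borel \<and> H \<in> sq_integrable lborel \<and> (\<forall>z. z \<notin> Q \<longrightarrow> H z = 0) \<and>
    (AE z in lborel. z \<in> Q \<longrightarrow> H z = h z)"
proof -
  have Ql: "Q \<inter> space lebesgue \<in> sets lebesgue" using Q by simp
  define W where "W x = indicat_real Q x *\<^sub>R h x" for x
  have hm: "h \<in> borel_measurable (lebesgue_on Q)" and hi: "integrable (lebesgue_on Q) (\<lambda>x. (h x)\<^sup>2)"
    using h by (auto simp: L2_space_def)
  have "W \<in> borel_measurable (completion lborel)"
    unfolding W_def[abs_def] using hm borel_measurable_restrict_space_iff[OF Ql, of h] by simp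
  from completion_ex_borel_measurable_real[OF this]
  obtain g where g: "g \<in> borel_measurable lborel" and ae: "AE x in lborel. W x = g x" by blast
  define H where "H x = indicat_real Q x * g x" for x
  have "indicat_real Q \<in> borel_measurable borel" using Q by simp
  then have Hb: "H \<in> borel_measurable borel" unfolding H_def[abs_def] using g by simp
  have aeH: "AE x in lborel. W x = H x"
    using ae by eventually_elim (auto simp: W_def H_def indicator_def)
  have Wi: "integrable lebesgue (\<lambda>x. (W x)\<^sup>2)"
  proof -
    have "(\<lambda>x. (W x)\<^sup>2) = (\<lambda>x. indicat_real Q x *\<^sub>R (h x)\<^sup>2)" by (auto simp: W_def indicator_def fun_eq_iff)
    then show ?thesis using hi integrable_restrict_space[OF Ql, of "\<lambda>x. (h x)\<^sup>2"] by simp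
  qed
  have "integrable lebesgue (\<lambda>x. (H x)\<^sup>2)"
  proof (rule integrable_cong_AE_imp[OF Wi])
    show "(\<lambda>x. (H x)\<^sup>2) \<in> borel_measurable lebesgue"
      using Hb by (intro measurable_completion) simp
    show "AE x in lebesgue. (W x)\<^sup>2 = (H x)\<^sup>2"
      using AE_completion[OF aeH] by eventually_elim simp
  qed
  then have "integrable lborel (\<lambda>x. (H x)\<^sup>2)" using Hb by (subst (asm) integrable_completion) auto
  then have "H \<in> sq_integrable lborel" using Hb by (simp add: sq_integrable_def)
  moreover have "AE z in lborel. z \<in> Q \<longrightarrow> H z = h z"
    using aeH by eventually_elim (auto simp: W_def)
  moreover have "\<forall>z. z \<notin> Q \<longrightarrow> H z = 0" by (simp add: H_def)
  ultimately show ?thesis using Hb by blast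
qed

lemma representative_slices:
  fixes \<Omega> :: "'a::euclidean_space set"
  assumes \<Omega>: "open \<Omega>" and rep: "represents_on_QT T \<Omega> F w"
    and H: "AE z in lborel. z \<in> \<Omega> \<times> {0<..<T} \<longrightarrow> H z = w z"
  shows "AE t in lborel. t \<in> {0<..<T} \<longrightarrow> (AE x in lebesgue_on \<Omega>. H (x, t) = F t x)"
proof -
  have "AE t in lborel. t \<in> {0<..<T} \<longrightarrow> (AE x in lebesgue_on \<Omega>. w (x, t) = F t x)"
    using rep unfolding represents_on_QT_def by (subst (asm) AE_lebesgue_on_iff) auto
  with AE_lborel_pair_swap[OF H] show ?thesis
  proof eventually_elim
    case (elim t)
    show ?case
    proof
      assume t: "t \<in> {0<..<T}"
      with elim have "AE x in lborel. x \<in> \<Omega> \<longrightarrow> w (x, t) = F t x" by (simp add: AE_lebesgue_on_iff[OF \<Omega>])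
      with elim(1) show "AE x in lebesgue_on \<Omega>. H (x, t) = F t x"
        unfolding AE_lebesgue_on_iff[OF \<Omega>] by eventually_elim (use t in auto)
    qed
  qed
qed

text \<open>Pairing with a spatial test function \<open>g\<close> turns the weak derivative in time
  into a scalar identity. It holds at every \<open>t\<close> because the pairing \<open>P\<close> is
  continuous in time; letting \<open>g\<close> vary, the fundamental lemma recovers the identity
  almost everywhere in \<open>\<Omega>\<close>.\<close>

lemma solution_eq_integral:
  fixes \<Omega> :: "'a::euclidean_space set" and D :: "'a \<times> real \<Rightarrow> real"
  assumes \<Omega>: "open \<Omega>" "bounded \<Omega>" and "0 < T" and cont: "continuous_L2_valued T \<Omega> u"
    and W12: "has_W12_deriv T \<Omega> u d" and D: "D \<in> borel_measurable borel" "integrable lborel D"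
    and D0: "\<And>z. z \<notin> \<Omega> \<times> {0<..<T} \<Longrightarrow> D z = 0"
    and slices: "AE t in lborel. t \<in> {0<..<T} \<longrightarrow> (AE x in lebesgue_on \<Omega>. D (x, t) = d t x)"
    and t: "t \<in> {0..T}"
  shows "AE x in lebesgue_on \<Omega>. u t x - u 0 x = (LINT s|lborel. indicat_real {..<t} s * D (x, s))"
proof -
  let ?M = "lebesgue_on \<Omega>" and ?N = "lebesgue_on {0<..<T}"
  define K where "K x = (LINT s|lborel. indicat_real {..<t} s * D (x, s))" for x
  note finM = finite_measure_lebesgue_on_open[OF \<Omega>]
  have finN: "finite_measure ?N" by (rule finite_measure_lebesgue_on) auto
  have usq: "u s \<in> sq_integrable ?M" if "s \<in> {0..T}" for s
    using cont that by (simp add: continuous_L2_valued_def L2_space_eq)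
  have dsq: "AE s in lborel. s \<in> {0<..<T} \<longrightarrow> d s \<in> sq_integrable ?M"
    using W12 by (simp add: has_W12_deriv_def bochner_L2_def bochner_measurable_def L2_space_eq AE_lebesgue_on_iff)
  have ind: "(\<lambda>p::'a \<times> real. indicat_real {..<t} (snd p)) \<in> borel_measurable borel"
    by (simp add: borel_prod[symmetric])
  \<comment> \<open>Used twice: with the constant 1 for the integrability of \<open>K\<close>, and
    with a test function for exchanging the integrals over space and time.\<close>
  have Dind: "integrable (lborel \<Otimes>\<^sub>M lborel) (\<lambda>(x, s). indicat_real {..<t} s * D (x, s) * g x)"
    if g: "g \<in> borel_measurable borel" "\<And>x. \<bar>g x\<bar> \<le> C" for g :: "'a \<Rightarrow> real" and C
  proof (rule Bochner_Integration.integrable_bound)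
    show "integrable (lborel \<Otimes>\<^sub>M lborel) (\<lambda>z. D z * C)" using D by (simp add: lborel_prod)
    have [measurable]: "D \<in> borel_measurable (borel \<Otimes>\<^sub>M borel)" "g \<in> borel_measurable borel"
      using D(1) g by (simp_all add: borel_prod)
    show "(\<lambda>(x, s). indicat_real {..<t} s * D (x, s) * g x) \<in> borel_measurable (lborel \<Otimes>\<^sub>M lborel)"
      by measurable
    show "AE z in lborel \<Otimes>\<^sub>M lborel. norm (case z of (x, s) \<Rightarrow> indicat_real {..<t} s * D (x, s) * g x) \<le> norm (D z * C)"
    proof (intro AE_I2)
      fix z :: "'a \<times> real"
      obtain x s where z: "z = (x, s)" by force
      have "\<bar>g x\<bar> \<le> \<bar>C\<bar>" using g(2)[of x] by simp
      then show "norm (case z of (x, s) \<Rightarrow> indicat_real {..<t} s * D (x, s) * g x) \<le> norm (D z * C)"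
        by (simp add: z abs_mult indicator_def mult_left_mono)
    qed
  qed
  have K: "integrable lborel K"
    using lborel_pair.integrable_fst[OF Dind[of "\<lambda>x. 1" 1]] by (simp add: K_def[abs_def])
  have K0: "K x = 0" if "x \<notin> \<Omega>" for x
    using that D0 by (simp add: K_def)
  have wint: "integrable ?M (\<lambda>x. u t x - u 0 x - K x)"
  proof -
    have "integrable ?M (\<lambda>x. u t x - u 0 x)"
      using t \<open>0 < T\<close> by (intro sq_integrable_imp_integrable[OF _ finM] sq_integrable_diff usq) auto
    moreover have "integrable ?M K"
      using K \<Omega> by (intro integrable_lebesgue_on) (auto simp: integrable_completion)
    ultimately show ?thesis by simp
  qed
  have "AE x in ?M. u t x - u 0 x - K x = 0"
  proof (rule fundamental_lemma[OF \<Omega>(1) wint])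
    fix g assume g: "test_fun \<Omega> g"
    have gc: "continuous_on UNIV g" by (rule C_fun_continuous[OF smooth_fun_C_fun[OF test_funD(1)[OF g]]])
    have gb[measurable]: "g \<in> borel_measurable borel" by (rule borel_measurable_continuous_onI[OF gc])
    have gsq: "g \<in> sq_integrable ?M" by (rule continuous_sq_integrable[OF \<Omega> gc])
    obtain C where C: "\<And>x. \<bar>g x\<bar> \<le> C"
    proof -
      obtain L where L: "compact L" "\<forall>x. x \<notin> L \<longrightarrow> g x = 0" using test_funD(2)[OF g] by blast
      have "bounded (g ` L)"
        by (intro compact_imp_bounded compact_continuous_image continuous_on_subset[OF gc] L(1)) simp
      then obtain C where C: "0 < C" "\<And>x. x \<in> L \<Longrightarrow> \<bar>g x\<bar> \<le> C" by (auto simp: bounded_pos)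
      have "\<bar>g x\<bar> \<le> C" for x using C L(2) by (cases "x \<in> L") auto
      then show ?thesis by (rule that)
    qed
    define P where "P s = (LINT x|?M. u s x * g x)" for s
    define E where "E s = (LINT x|lborel. D (x, s) * g x)" for s
    have Dg: "integrable (lborel \<Otimes>\<^sub>M lborel) (\<lambda>(x, s). D (x, s) * g x)"
    proof (rule Bochner_Integration.integrable_bound)
      show "integrable (lborel \<Otimes>\<^sub>M lborel) (\<lambda>z. D z * C)" using D by (simp add: lborel_prod)
      have [measurable]: "D \<in> borel_measurable (borel \<Otimes>\<^sub>M borel)" using D(1) by (simp add: borel_prod)
      show "(\<lambda>(x, s). D (x, s) * g x) \<in> borel_measurable (lborel \<Otimes>\<^sub>M lborel)" by measurable
      show "AE z in lborel \<Otimes>\<^sub>M lborel. norm (case z of (x, s) \<Rightarrow> D (x, s) * g x) \<le> norm (D z * C)"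
      proof (intro AE_I2)
        fix z :: "'a \<times> real"
        obtain x s where z: "z = (x, s)" by force
        have "\<bar>g x\<bar> \<le> \<bar>C\<bar>" using C[of x] by simp
        then show "norm (case z of (x, s) \<Rightarrow> D (x, s) * g x) \<le> norm (D z * C)"
          by (simp add: z abs_mult mult_left_mono)
      qed
    qed
    have E: "integrable lborel E" unfolding E_def by (rule lborel_pair.integrable_snd[OF Dg])
    have E0: "E s = 0" if "s \<notin> {0<..<T}" for s using that D0 by (simp add: E_def)
    have P: "continuous_on {0..T} P"
      unfolding continuous_on_def
    proof
      fix s assume s: "s \<in> {0..T}"
      have lim: "((\<lambda>r. norm2 ?M (\<lambda>x. u r x - u s x) * norm2 ?M g) \<longlongrightarrow> 0) (at s within {0..T})"
        using cont s tendsto_mult_left_zero unfolding continuous_L2_valued_def L2_norm_eq by blast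
      show "(P \<longlongrightarrow> P s) (at s within {0..T})"
      proof (rule LIM_zero_cancel, rule Lim_null_comparison[OF _ lim])
        have "norm (P r - P s) \<le> norm2 ?M (\<lambda>x. u r x - u s x) * norm2 ?M g" if r: "r \<in> {0..T}" for r
        proof -
          have "P r - P s = (LINT x|?M. (u r x - u s x) * g x)"
            using sq_integrable_mult[OF usq[OF r] gsq] sq_integrable_mult[OF usq[OF s] gsq]
            by (simp add: P_def left_diff_distrib)
          then show ?thesis using norm2_Cauchy_Schwarz[OF sq_integrable_diff[OF usq[OF r] usq[OF s]] gsq] by simp
        qed
        then show "\<forall>\<^sub>F r in at s within {0..T}. norm (P r - P s) \<le> norm2 ?M (\<lambda>x. u r x - u s x) * norm2 ?M g"
          by (simp add: eventually_at_filter)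
      qed
    qed
    have weak: "(LINT s|?N. deriv \<theta> s * P s) = - (LINT s|lborel. \<theta> s * E s)" if \<theta>: "test_fun {0<..<T} \<theta>" for \<theta>
    proof -
      from W12 \<theta> obtain I where
        I1: "has_bochner_integral_in ?N (sq_integrable ?M) (norm2 ?M) (\<lambda>t x. deriv \<theta> t * u t x) I" and
        I2: "has_bochner_integral_in ?N (sq_integrable ?M) (norm2 ?M) (\<lambda>t x. \<theta> t * d t x) (\<lambda>x. - I x)"
        unfolding has_W12_deriv_def L2_space_eq L2_norm_eq by blast
      have \<theta>b[measurable]: "\<theta> \<in> borel_measurable borel"
        by (rule borel_measurable_continuous_onI[OF test_fun_interval(4)[OF \<theta> \<open>0 < T\<close>]])
      have Eb[measurable]: "E \<in> borel_measurable borel" using E by simp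
      have "(LINT s|?N. deriv \<theta> s * P s) = (LINT x|?M. I x * g x)"
      proof (rule bochner_integral_pairing(2)[OF finN I1 gsq])
        have "continuous_on {0<..<T} (\<lambda>s. deriv \<theta> s * P s)"
          by (intro continuous_on_mult continuous_on_subset[OF test_fun_interval(3)[OF \<theta> \<open>0 < T\<close>]]
              continuous_on_subset[OF P]) auto
        then show "(\<lambda>s. deriv \<theta> s * P s) \<in> borel_measurable ?N"
          by (rule continuous_imp_measurable_on_sets_lebesgue) simp
        show "AE s in ?N. deriv \<theta> s * P s = (LINT x|?M. deriv \<theta> s * u s x * g x)"
          by (simp add: P_def mult.assoc)
      qed
      moreover have "(LINT s|?N. \<theta> s * E s) = (LINT x|?M. - I x * g x)"
      proof (rule bochner_integral_pairing(2)[OF finN I2 gsq])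
        have "(\<lambda>s. \<theta> s * E s) \<in> borel_measurable lebesgue"
          by (intro measurable_completion) simp
        then show "(\<lambda>s. \<theta> s * E s) \<in> borel_measurable ?N" by (rule measurable_restrict_space1)
        show "AE s in ?N. \<theta> s * E s = (LINT x|?M. \<theta> s * d s x * g x)"
          unfolding AE_lebesgue_on_iff[OF open_greaterThanLessThan]
          using slices dsq
        proof eventually_elim
          case (elim s)
          show ?case
          proof
            assume s: "s \<in> {0<..<T}"
            have Ds: "(\<lambda>x. D (x, s)) \<in> borel_measurable borel"
              using D(1) by (simp add: borel_prod[symmetric])
            have "E s = (LINT x|?M. D (x, s) * g x)"
              unfolding E_def using Ds D0
              by (subst integral_lebesgue_on_eq_lborel_support[OF \<Omega>(1)]) auto
            also have "\<dots> = (LINT x|?M. d s x * g x)"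
            proof (rule integral_cong_AE)
              show "(\<lambda>x. D (x, s) * g x) \<in> borel_measurable ?M"
                using Ds gb by (intro measurable_restrict_space1 measurable_completion) simp
              show "(\<lambda>x. d s x * g x) \<in> borel_measurable ?M"
                using elim s sq_integrableD(1)[OF gsq] by (auto dest: sq_integrableD)
              show "AE x in ?M. D (x, s) * g x = d s x * g x"
                using elim(1)[rule_format, OF s] by eventually_elim simp
            qed
            finally show "\<theta> s * E s = (LINT x|?M. \<theta> s * d s x * g x)" by (simp add: mult.assoc)
          qed
        qed
      qed
      moreover have "(LINT s|?N. \<theta> s * E s) = (LINT s|lborel. \<theta> s * E s)"
        using E0 by (intro integral_lebesgue_on_eq_lborel_support) auto
      ultimately show ?thesis by simp
    qed
    have "P t - P 0 = (LINT s|lborel. indicat_real {..<t} s * E s)"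
      by (rule weak_time_derivative_imp_integral[OF \<open>0 < T\<close> P E weak _ t]) (use E0 in auto)
    also have "\<dots> = (LINT s|lborel. LINT x|lborel. indicat_real {..<t} s * D (x, s) * g x)"
      by (simp add: E_def mult.assoc)
    also have "\<dots> = (LINT x|lborel. LINT s|lborel. indicat_real {..<t} s * D (x, s) * g x)"
      by (rule lborel_pair.Fubini_integral[OF Dind[OF gb C]])
    also have "\<dots> = (LINT x|lborel. K x * g x)" by (simp add: K_def)
    also have "\<dots> = (LINT x|?M. K x * g x)"
      using K0 borel_measurable_integrable[OF K]
      by (subst integral_lebesgue_on_eq_lborel_support[OF \<Omega>(1)]) auto
    finally have eq: "P t - P 0 = (LINT x|?M. K x * g x)" .
    have iKg: "integrable ?M (\<lambda>x. K x * g x)"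
    proof (rule integrable_lebesgue_on)
      have "integrable lborel (\<lambda>x. K x * g x)"
      proof (rule Bochner_Integration.integrable_bound)
        show "integrable lborel (\<lambda>x. K x * C)" using K by simp
        show "(\<lambda>x. K x * g x) \<in> borel_measurable lborel" using borel_measurable_integrable[OF K] by simp
        have "\<bar>g x\<bar> \<le> \<bar>C\<bar>" for x using C[of x] by simp
        then show "AE x in lborel. norm (K x * g x) \<le> norm (K x * C)"
          by (intro AE_I2) (simp add: abs_mult mult_left_mono)
      qed
      then show "integrable lebesgue (\<lambda>x. K x * g x)" by (subst integrable_completion) auto
    qed (use \<Omega> in simp)
    have "(LINT x|?M. (u t x - u 0 x - K x) * g x) = P t - P 0 - (LINT x|?M. K x * g x)"
      using sq_integrable_mult[OF usq[OF t] gsq] sq_integrable_mult[OF usq gsq, of 0] \<open>0 < T\<close> iKg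
      by (simp add: P_def left_diff_distrib)
    then show "(LINT x|?M. (u t x - u 0 x - K x) * g x) = 0" using eq by simp
  qed
  then show ?thesis by eventually_elim (simp add: K_def)
qed

section \<open>Continuity of correlations under small shifts\<close>

definition clamp_real :: "real \<Rightarrow> real \<Rightarrow> real" where
  "clamp_real c y = max (- c) (min c y)"

text \<open>Truncation comes first: a bounded measurable function is an almost everywhere limit of
  continuous functions, which can be clamped to the same bound. On a fixed ball the constant bound
  is integrable, so the convergence is also in mean square.\<close>

lemma continuous_approximation:
  fixes D :: "'a::euclidean_space \<Rightarrow> real"
  assumes D: "D \<in> borel_measurable borel" "D \<in> sq_integrable lborel" and "0 < e"
  shows "\<exists>l C. continuous_on UNIV l \<and> (\<forall>z. \<bar>l z\<bar> \<le> C) \<and>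
    norm2 lborel (\<lambda>z. indicat_real (cball 0 r) z * (D z - l z)) < e"
proof -
  define F where "F n z = clamp_real (real n) (D z)" for n z
  have Fm[measurable]: "F n \<in> borel_measurable borel" for n
    unfolding F_def[abs_def] clamp_real_def using D(1) by measurable
  have "(\<lambda>n. LINT z|lborel. (D z - F n z)\<^sup>2) \<longlonglongrightarrow> integral\<^sup>L lborel (\<lambda>z::'a. 0::real)"
  proof (rule integral_dominated_convergence[where w="\<lambda>z. (D z)\<^sup>2"])
    show "AE z in lborel. (\<lambda>n. (D z - F n z)\<^sup>2) \<longlonglongrightarrow> 0"
    proof (intro AE_I2 tendsto_eventually)
      fix z :: 'a
      obtain N :: nat where "\<bar>D z\<bar> \<le> real N" using real_arch_simple by blast
      then show "\<forall>\<^sub>F n in sequentially. (D z - F n z)\<^sup>2 = 0"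
        by (intro eventually_sequentiallyI[of N]) (auto simp: F_def clamp_real_def)
    qed
    have "\<bar>D z - F n z\<bar> \<le> \<bar>D z\<bar>" for n z by (auto simp: F_def clamp_real_def)
    then show "AE z in lborel. norm ((D z - F n z)\<^sup>2) \<le> (D z)\<^sup>2" for n
      by (intro AE_I2) (simp add: abs_le_square_iff)
  qed (use D sq_integrableD[OF D(2)] in auto)
  then have "(\<lambda>n. norm2 lborel (\<lambda>z. D z - F n z)) \<longlonglongrightarrow> sqrt 0"
    unfolding norm2_def by (intro tendsto_real_sqrt) simp
  then have "\<forall>\<^sub>F n in sequentially. norm2 lborel (\<lambda>z. D z - F n z) < e / 2"
    using \<open>0 < e\<close> by (intro order_tendstoD) auto
  then obtain n where n: "norm2 lborel (\<lambda>z. D z - F n z) < e / 2" by (auto simp: eventually_sequentially)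
  have "F n \<in> borel_measurable lebesgue" using Fm by (intro measurable_completion) simp
  then have "F n measurable_on UNIV" by (rule lebesgue_measurable_imp_measurable_on_real) simp
  then obtain N g where N: "negligible N" and g: "\<And>k. continuous_on UNIV (g k)"
    and lim: "\<And>x. x \<notin> N \<Longrightarrow> (\<lambda>k. g k x) \<longlonglongrightarrow> F n x"
    unfolding measurable_on_def by auto
  define l where "l k z = clamp_real (real n) (g k z)" for k :: nat and z
  have lc: "continuous_on UNIV (l k)" for k
    unfolding l_def clamp_real_def by (intro continuous_intros g)
  have lm[measurable]: "l k \<in> borel_measurable borel" for k by (rule borel_measurable_continuous_onI[OF lc])
  have lb: "\<bar>l k z\<bar> \<le> real n" for k z by (auto simp: l_def clamp_real_def)
  have Fb: "\<bar>F n z\<bar> \<le> real n" for z by (auto simp: F_def clamp_real_def)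
  let ?B = "indicat_real (cball (0::'a) r)"
  have Bm: "?B \<in> borel_measurable borel" by (intro borel_measurable_indicator) simp
  have dom: "(?B z * (F n z - l k z))\<^sup>2 \<le> ?B z *\<^sub>R (2 * real n)\<^sup>2" for k z
  proof -
    have "\<bar>F n z - l k z\<bar> \<le> 2 * real n" using Fb[of z] lb[of k z] by linarith
    then have "\<bar>F n z - l k z\<bar>\<^sup>2 \<le> (2 * real n)\<^sup>2" by (intro power_mono) auto
    then show ?thesis by (simp add: indicator_def)
  qed
  have ae: "AE z in lborel. (\<lambda>k. (?B z * (F n z - l k z))\<^sup>2) \<longlonglongrightarrow> 0"
  proof -
    have "AE z in lebesgue. z \<notin> N" using N by (intro AE_not_in) (simp add: negligible_iff_null_sets)
    then have "AE z in lborel. z \<notin> N" by (simp add: AE_completion_iff)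
    then show ?thesis
    proof eventually_elim
      case (elim z)
      have "(\<lambda>k. l k z) \<longlonglongrightarrow> clamp_real (real n) (F n z)"
        unfolding l_def clamp_real_def by (intro tendsto_max tendsto_min tendsto_const lim elim)
      also have "clamp_real (real n) (F n z) = F n z" by (auto simp: F_def clamp_real_def)
      finally have "(\<lambda>k. (?B z * (F n z - l k z))\<^sup>2) \<longlonglongrightarrow> (?B z * (F n z - F n z))\<^sup>2"
        by (intro tendsto_intros)
      then show ?case by simp
    qed
  qed
  have "(\<lambda>k. LINT z|lborel. (?B z * (F n z - l k z))\<^sup>2) \<longlonglongrightarrow> integral\<^sup>L lborel (\<lambda>z::'a. 0::real)"
  proof (rule integral_dominated_convergence[OF _ _ integrable_indicator_cball[of 0 r "(2 * real n)\<^sup>2"] ae])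
    show "(\<lambda>z. (?B z * (F n z - l k z))\<^sup>2) \<in> borel_measurable lborel" for k
      using Bm by (intro borel_measurable_power borel_measurable_times) auto
    show "AE z in lborel. norm ((?B z * (F n z - l k z))\<^sup>2) \<le> ?B z *\<^sub>R (2 * real n)\<^sup>2" for k
      using dom[of _ k] by (intro AE_I2) simp
  qed simp
  then have "(\<lambda>k. norm2 lborel (\<lambda>z. ?B z * (F n z - l k z))) \<longlonglongrightarrow> sqrt 0"
    unfolding norm2_def by (intro tendsto_real_sqrt) simp
  then have "\<forall>\<^sub>F k in sequentially. norm2 lborel (\<lambda>z. ?B z * (F n z - l k z)) < e / 2"
    using \<open>0 < e\<close> by (intro order_tendstoD) auto
  then obtain k where k: "norm2 lborel (\<lambda>z. ?B z * (F n z - l k z)) < e / 2" by (auto simp: eventually_sequentially)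
  have s1: "(\<lambda>z. D z - F n z) \<in> sq_integrable lborel"
  proof -
    have "integrable lborel (\<lambda>z. (D z - F n z)\<^sup>2)"
    proof (rule Bochner_Integration.integrable_bound[OF sq_integrableD(2)[OF D(2)]])
      have "\<bar>D z - F n z\<bar> \<le> \<bar>D z\<bar>" for z by (auto simp: F_def clamp_real_def)
      then show "AE z in lborel. norm ((D z - F n z)\<^sup>2) \<le> norm ((D z)\<^sup>2)"
        by (intro AE_I2) (simp add: abs_le_square_iff)
    qed (use D in simp)
    then show ?thesis using D by (simp add: sq_integrable_def)
  qed
  have s1': "(\<lambda>z. ?B z * (D z - F n z)) \<in> sq_integrable lborel"
  proof -
    have "integrable lborel (\<lambda>z. (?B z * (D z - F n z))\<^sup>2)"
      by (rule Bochner_Integration.integrable_bound[OF sq_integrableD(2)[OF s1]])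
         (use D Bm Fm in \<open>auto simp: indicator_def\<close>)
    then show ?thesis using D(1) Bm Fm by (simp add: sq_integrable_def borel_measurable_times borel_measurable_diff)
  qed
  have s2: "(\<lambda>z. ?B z * (F n z - l k z)) \<in> sq_integrable lborel"
  proof -
    have m: "(\<lambda>z. ?B z * (F n z - l k z)) \<in> borel_measurable lborel"
      using Bm by (intro borel_measurable_times) auto
    have "integrable lborel (\<lambda>z. (?B z * (F n z - l k z))\<^sup>2)"
    proof (rule Bochner_Integration.integrable_bound[OF integrable_indicator_cball[of 0 r "(2 * real n)\<^sup>2"]])
      show "(\<lambda>z. (?B z * (F n z - l k z))\<^sup>2) \<in> borel_measurable lborel"
        using m by (rule borel_measurable_power)
      show "AE z in lborel. norm ((?B z * (F n z - l k z))\<^sup>2) \<le> norm (?B z *\<^sub>R (2 * real n)\<^sup>2)"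
        using dom[of _ k] by (intro AE_I2) simp
    qed
    then show ?thesis using m by (simp add: sq_integrable_def)
  qed
  have "norm2 lborel (\<lambda>z. ?B z * (D z - F n z)) \<le> norm2 lborel (\<lambda>z. D z - F n z)"
    unfolding norm2_def
    by (intro real_sqrt_le_mono integral_mono sq_integrableD(2)[OF s1'] sq_integrableD(2)[OF s1]) (auto simp: indicator_def)
  moreover have "norm2 lborel (\<lambda>z. ?B z * (D z - l k z))
      \<le> norm2 lborel (\<lambda>z. ?B z * (D z - F n z)) + norm2 lborel (\<lambda>z. ?B z * (F n z - l k z))"
  proof -
    have "(\<lambda>z. ?B z * (D z - l k z)) = (\<lambda>z. ?B z * (D z - F n z) + ?B z * (F n z - l k z))"
      by (simp add: algebra_simps)
    then show ?thesis using norm2_triangle[OF s1' s2] by simp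
  qed
  ultimately have "norm2 lborel (\<lambda>z. ?B z * (D z - l k z)) < e" using n k by linarith
  then show ?thesis using lc lb by blast
qed

lemma lborel_shift:
  fixes f :: "'a::euclidean_space \<Rightarrow> real"
  assumes f: "f \<in> borel_measurable borel"
  shows "(LINT z|lborel. f (z + a)) = (LINT z|lborel. f z)"
    and "integrable lborel (\<lambda>z. f (z + a)) \<longleftrightarrow> integrable lborel f"
proof -
  have m: "(\<lambda>z. a + z) \<in> measurable lborel borel" by simp
  show "(LINT z|lborel. f (z + a)) = (LINT z|lborel. f z)"
    using integral_distr[OF m f, unfolded lborel_distr_plus] by (simp add: add.commute)
  show "integrable lborel (\<lambda>z. f (z + a)) \<longleftrightarrow> integrable lborel f"
    using integrable_distr_eq[OF m f, unfolded lborel_distr_plus] by (simp add: add.commute)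
qed

lemma AE_lborel_shift:
  fixes P :: "'a::euclidean_space \<Rightarrow> bool"
  assumes "AE z in lborel. P z"
  shows "AE z in lborel. P (z + a)"
proof -
  have "AE z in distr lborel borel (\<lambda>z. a + z). P z" using assms unfolding lborel_distr_plus .
  from AE_distrD[OF _ this] show ?thesis by (simp add: add.commute)
qed

lemma sq_integrable_shift:
  fixes f :: "'a::euclidean_space \<Rightarrow> real"
  assumes "f \<in> borel_measurable borel" "f \<in> sq_integrable lborel"
  shows "(\<lambda>z. f (z + a)) \<in> sq_integrable lborel" "norm2 lborel (\<lambda>z. f (z + a)) = norm2 lborel f"
proof -
  have m: "(\<lambda>z. (f z)\<^sup>2) \<in> borel_measurable borel" using assms(1) by simp
  show "norm2 lborel (\<lambda>z. f (z + a)) = norm2 lborel f"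
    unfolding norm2_def using lborel_shift(1)[OF m] by simp
  show "(\<lambda>z. f (z + a)) \<in> sq_integrable lborel"
    using lborel_shift(2)[OF m, of a] assms by (simp add: sq_integrable_def)
qed

lemma integrable_of_sq_integrable_support:
  fixes L :: "'a::euclidean_space \<Rightarrow> real"
  assumes "L \<in> sq_integrable lborel" "\<And>z. z \<notin> cball 0 r \<Longrightarrow> L z = 0"
  shows "integrable lborel L"
proof -
  have "indicat_real (cball (0::'a) r) \<in> borel_measurable lborel"
    by (intro borel_measurable_indicator) simp
  then have "indicat_real (cball (0::'a) r) \<in> sq_integrable lborel"
    using integrable_indicator_cball[of "0::'a" r 1]
    by (simp add: sq_integrable_def power2_eq_square indicator_inter_arith[symmetric])
  from sq_integrable_mult[OF this assms(1)]
  have "integrable lborel (\<lambda>z. indicat_real (cball 0 r) z * L z)" .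
  moreover have "(\<lambda>z. indicat_real (cball 0 r) z * L z) = L"
    using assms(2) by (auto simp: indicator_def fun_eq_iff)
  ultimately show ?thesis by simp
qed

text \<open>For a bounded continuous function in place of \<open>D\<close> this is dominated
  convergence. By translation invariance the error of the replacement is uniformly small over shifts
  of length at most 1; such shifts of the support of \<open>L\<close> stay in the ball of radius
  \<open>r + 1\<close>, on which \<open>D\<close> is approximated.\<close>

lemma correlation_tendsto:
  fixes D L :: "'a::euclidean_space \<Rightarrow> real"
  assumes D: "D \<in> borel_measurable borel" "D \<in> sq_integrable lborel"
    and L: "L \<in> borel_measurable borel" "L \<in> sq_integrable lborel" "\<And>z. z \<notin> cball 0 r \<Longrightarrow> L z = 0"
    and a: "norm a \<le> 1"
  shows "((\<lambda>\<sigma>. LINT z|lborel. D (z - \<sigma> *\<^sub>R a) * L z) \<longlongrightarrow> (LINT z|lborel. D z * L z)) (at 0)"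
proof (rule tendstoI)
  fix e :: real assume "0 < e"
  define c where "c = norm2 lborel L + 1"
  have c: "0 < c" unfolding c_def by (simp add: add_nonneg_pos)
  have "0 < e / (3 * c)" using \<open>0 < e\<close> c by simp
  from continuous_approximation[OF D this, of "r + 1"]
  obtain l C where l: "continuous_on UNIV l" "\<And>z. \<bar>l z\<bar> \<le> C"
    and near: "norm2 lborel (\<lambda>z. indicat_real (cball 0 (r + 1)) z * (D z - l z)) < e / (3 * c)" by blast
  define R where "R z = indicat_real (cball 0 (r + 1)) z * (D z - l z)" for z
  have lm[measurable]: "l \<in> borel_measurable borel" by (rule borel_measurable_continuous_onI[OF l(1)])
  have Dm[measurable]: "D \<in> borel_measurable borel" by fact
  have Bm: "indicat_real (cball (0::'a) (r + 1)) \<in> borel_measurable borel" by (intro borel_measurable_indicator) simp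
  have Rm: "R \<in> borel_measurable borel" unfolding R_def[abs_def] using Bm by (intro borel_measurable_times) auto
  have Rsq: "R \<in> sq_integrable lborel"
  proof -
    have i: "integrable lborel (\<lambda>z. indicat_real (cball (0::'a) (r + 1)) z *\<^sub>R C\<^sup>2)"
      by (rule integrable_indicator_cball)
    have "integrable lborel (\<lambda>z. 2 * (D z)\<^sup>2 + 2 * (indicat_real (cball (0::'a) (r + 1)) z *\<^sub>R C\<^sup>2))"
      using i sq_integrableD(2)[OF D(2)] by (intro Bochner_Integration.integrable_add integrable_mult_right)
    then have "integrable lborel (\<lambda>z. (R z)\<^sup>2)"
    proof (rule Bochner_Integration.integrable_bound)
      show "(\<lambda>z. (R z)\<^sup>2) \<in> borel_measurable lborel" using Rm by simp
      have "(D z - l z)\<^sup>2 \<le> 2 * (D z)\<^sup>2 + 2 * C\<^sup>2" for z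
      proof -
        have "(D z - l z)\<^sup>2 + (D z + l z)\<^sup>2 = 2 * (D z)\<^sup>2 + 2 * (l z)\<^sup>2" by (simp add: power2_eq_square algebra_simps)
        moreover have "(l z)\<^sup>2 \<le> C\<^sup>2" using power_mono[OF l(2)[of z], of 2] by simp
        moreover have "0 \<le> (D z + l z)\<^sup>2" by simp
        ultimately show ?thesis by linarith
      qed
      then show "AE z in lborel. norm ((R z)\<^sup>2) \<le> norm (2 * (D z)\<^sup>2 + 2 * (indicat_real (cball (0::'a) (r + 1)) z *\<^sub>R C\<^sup>2))"
        by (intro AE_I2) (simp add: R_def indicator_def)
    qed
    then show ?thesis using Rm by (simp add: sq_integrable_def)
  qed
  have Lint: "integrable lborel L" by (rule integrable_of_sq_integrable_support[OF L(2,3)])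
  have shiftm: "(\<lambda>z. f (z - y)) \<in> borel_measurable borel" if "f \<in> borel_measurable borel" for f :: "'a \<Rightarrow> real" and y
    using that by measurable
  have lL: "integrable lborel (\<lambda>z. l (z - y) * L z)" for y
  proof (rule Bochner_Integration.integrable_bound)
    show "integrable lborel (\<lambda>z. C * L z)" using Lint by simp
    show "(\<lambda>z. l (z - y) * L z) \<in> borel_measurable lborel" using shiftm[OF lm, of y] L(1) by simp
    have "\<bar>l z\<bar> \<le> \<bar>C\<bar>" for z using l(2)[of z] by simp
    then show "AE z in lborel. norm (l (z - y) * L z) \<le> norm (C * L z)"
      by (intro AE_I2) (simp add: abs_mult mult_right_mono)
  qed
  have DL: "integrable lborel (\<lambda>z. D (z - y) * L z)" for y
    using sq_integrable_mult[OF sq_integrable_shift(1)[OF D, of "- y"] L(2)] by simp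
  have approx: "\<bar>(LINT z|lborel. D (z - \<sigma> *\<^sub>R a) * L z) - (LINT z|lborel. l (z - \<sigma> *\<^sub>R a) * L z)\<bar> < e / 3"
    if "\<bar>\<sigma>\<bar> \<le> 1" for \<sigma>
  proof -
    let ?y = "\<sigma> *\<^sub>R a"
    have "norm ?y \<le> 1" using that a by (simp add: mult_le_one)
    have "(LINT z|lborel. D (z - ?y) * L z) - (LINT z|lborel. l (z - ?y) * L z)
        = (LINT z|lborel. (D (z - ?y) - l (z - ?y)) * L z)"
      using DL lL by (simp add: left_diff_distrib)
    also have "\<dots> = (LINT z|lborel. R (z - ?y) * L z)"
    proof (rule Bochner_Integration.integral_cong[OF refl])
      fix z
      show "(D (z - ?y) - l (z - ?y)) * L z = R (z - ?y) * L z"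
      proof (cases "z \<in> cball 0 r")
        case True
        then have "norm (z - ?y) \<le> r + 1" using norm_triangle_ineq4[of z ?y] \<open>norm ?y \<le> 1\<close> by simp
        then show ?thesis by (simp add: R_def)
      qed (simp add: L(3))
    qed
    finally have "\<bar>(LINT z|lborel. D (z - ?y) * L z) - (LINT z|lborel. l (z - ?y) * L z)\<bar>
        \<le> norm2 lborel (\<lambda>z. R (z + (- ?y))) * norm2 lborel L"
      using norm2_Cauchy_Schwarz[OF sq_integrable_shift(1)[OF Rm Rsq, of "- ?y"] L(2)] by simp
    also have "\<dots> = norm2 lborel R * norm2 lborel L" by (simp only: sq_integrable_shift(2)[OF Rm Rsq])
    also have "\<dots> \<le> norm2 lborel R * c" by (intro mult_left_mono) (auto simp: c_def)
    also have "\<dots> < e / (3 * c) * c" using near c by (intro mult_strict_right_mono) (auto simp: R_def[abs_def])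
    also have "\<dots> = e / 3" using c by simp
    finally show ?thesis .
  qed
  have "isCont (\<lambda>\<sigma>. LINT z|lborel. l (z - \<sigma> *\<^sub>R a) * L z) 0"
  proof (rule continuous_at_sequentiallyI)
    fix u :: "nat \<Rightarrow> real" assume u: "u \<longlonglongrightarrow> 0"
    show "(\<lambda>n. LINT z|lborel. l (z - u n *\<^sub>R a) * L z) \<longlonglongrightarrow> (LINT z|lborel. l (z - 0 *\<^sub>R a) * L z)"
    proof (rule integral_dominated_convergence[where w="\<lambda>z. C * \<bar>L z\<bar>"])
      show "AE z in lborel. (\<lambda>n. l (z - u n *\<^sub>R a) * L z) \<longlonglongrightarrow> l (z - 0 *\<^sub>R a) * L z"
      proof (intro AE_I2 tendsto_mult tendsto_const)
        fix z
        have "(\<lambda>n. z - u n *\<^sub>R a) \<longlonglongrightarrow> z - 0 *\<^sub>R a" by (intro tendsto_intros u)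
        then show "(\<lambda>n. l (z - u n *\<^sub>R a)) \<longlonglongrightarrow> l (z - 0 *\<^sub>R a)"
          by (rule continuous_on_tendsto_compose[OF l(1)]) auto
      qed
      show "AE z in lborel. norm (l (z - u n *\<^sub>R a) * L z) \<le> C * \<bar>L z\<bar>" for n
        by (intro AE_I2) (simp add: abs_mult mult_right_mono l(2))
      show "integrable lborel (\<lambda>z. C * \<bar>L z\<bar>)" using Lint by simp
      show "(\<lambda>z. l (z - 0 *\<^sub>R a) * L z) \<in> borel_measurable lborel"
        "\<And>n. (\<lambda>z. l (z - u n *\<^sub>R a) * L z) \<in> borel_measurable lborel"
        using borel_measurable_integrable[OF lL[of "0 *\<^sub>R a"]] borel_measurable_integrable[OF lL[of "u _ *\<^sub>R a"]]
        by blast+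
    qed
  qed
  then have "\<forall>\<^sub>F \<sigma> in at 0. dist (LINT z|lborel. l (z - \<sigma> *\<^sub>R a) * L z) (LINT z|lborel. l (z - 0 *\<^sub>R a) * L z) < e / 3"
    using \<open>0 < e\<close> unfolding isCont_def by (intro tendstoD) auto
  moreover have "\<forall>\<^sub>F \<sigma>::real in at 0. \<bar>\<sigma>\<bar> \<le> 1"
    by (auto simp: eventually_at intro!: exI[of _ 1])
  ultimately show "\<forall>\<^sub>F \<sigma> in at 0. dist (LINT z|lborel. D (z - \<sigma> *\<^sub>R a) * L z) (LINT z|lborel. D z * L z) < e"
  proof eventually_elim
    case (elim \<sigma>)
    have gen: "\<bar>p - q\<bar> < e" if "\<bar>p - p'\<bar> < e / 3" "\<bar>q - q'\<bar> < e / 3" "\<bar>p' - q'\<bar> < e / 3" for p q p' q' :: real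
      using that unfolding abs_less_iff by linarith
    show ?case
      using gen[OF approx[OF elim(2)] approx[of 0]] elim(1) by (simp add: dist_real_def)
  qed
qed

text \<open>
  Integrating the energy inequality over all times shows that the correlations of \<open>L\<close> with the time
  shifts of \<open>D\<close>, averaged over shifts between \<open>0\<close> and \<open>h\<close>, are nonpositive. They are continuous in the
  shift, so the same holds for the shift \<open>0\<close>.
\<close>

lemma correlation_nonpos:
  fixes D L :: "'a::euclidean_space \<times> real \<Rightarrow> real" and K :: "'a \<Rightarrow> real \<Rightarrow> real" and \<phi> :: "real \<Rightarrow> real"
  assumes "0 < T" and \<Omega>: "bounded \<Omega>"
    and D: "D \<in> borel_measurable borel" "D \<in> sq_integrable lborel" "\<And>z. z \<notin> \<Omega> \<times> {0<..<T} \<Longrightarrow> D z = 0"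
    and L: "L \<in> borel_measurable borel" "L \<in> sq_integrable lborel" "\<And>z. z \<notin> \<Omega> \<times> {0<..<T} \<Longrightarrow> L z = 0"
    and K: "\<And>x t. K x t = (LINT s|lborel. indicat_real {..<t} s * D (x, s))"
    and \<phi>: "\<And>t. \<phi> t = - (1 / 2) * (LINT x|lborel. K x t * L (x, t))"
    and energy: "\<And>h. 0 < h \<Longrightarrow> AE t in lborel. (LINT x|lborel. (K x t - K x (t - h)) * L (x, t)) \<le> \<phi> (t - h) - \<phi> t"
  shows "(LINT z|lborel. D z * L z) \<le> 0"
proof (rule ccontr)
  assume "\<not> ?thesis"
  then have pos: "0 < (LINT z|lborel. D z * L z)" by simp
  \<comment> \<open>The unit vector in the direction of time: subtracting
    \<open>\<sigma> *\<^sub>R a\<close> goes back in time by \<open>\<sigma>\<close>.\<close>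
  define a :: "'a \<times> real" where "a = (0, 1)"
  have za: "(x, t) - \<sigma> *\<^sub>R a = (x, t - \<sigma>)" for x t \<sigma> by (simp add: a_def)
  define c where "c \<sigma> = (LINT z|lborel. D (z - \<sigma> *\<^sub>R a) * L z)" for \<sigma>
  have bT: "bounded {0<..<T}" by (rule bounded_subset[OF bounded_closed_interval[of 0 T]]) auto
  obtain r where r: "\<Omega> \<times> {0<..<T} \<subseteq> cball 0 r"
    using bounded_subset_ballD[OF bounded_Times[OF \<Omega> bT], of 0] ball_subset_cball by blast
  have Dint: "integrable lborel D"
    by (rule integrable_of_sq_integrable_support[OF D(2), of r]) (use r D(3) in blast)
  have "norm a \<le> 1" by (simp add: a_def norm_Pair)
  then have "(c \<longlongrightarrow> (LINT z|lborel. D z * L z)) (at 0)"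
    unfolding c_def by (intro correlation_tendsto[OF D(1,2) L(1,2), of r]) (use r L(3) in blast)+
  then have "\<forall>\<^sub>F \<sigma> in at 0. (LINT z|lborel. D z * L z) / 2 < c \<sigma>"
    using pos by (intro order_tendstoD) auto
  then obtain d where d: "0 < d" "\<And>\<sigma>. \<sigma> \<noteq> 0 \<Longrightarrow> \<bar>\<sigma>\<bar> < d \<Longrightarrow> (LINT z|lborel. D z * L z) / 2 < c \<sigma>"
    by (auto simp: eventually_at dist_real_def)
  \<comment> \<open>For shifts in (0, h] the correlation exceeds half of its supposed positive value
    at 0; \<open>h < T\<close> keeps these shifts in the range where Fubini is established.\<close>
  define h where "h = min (d / 2) (T / 2)"
  have h: "0 < h" "h < d" "h < T" using d(1) \<open>0 < T\<close> by (auto simp: h_def)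
  have [measurable]: "D \<in> borel_measurable borel" "L \<in> borel_measurable borel" by fact+
  have Bint: "integrable (lborel \<Otimes>\<^sub>M lborel) (\<lambda>(\<sigma>, z). indicat_real I \<sigma> * (D (z - \<sigma> *\<^sub>R a) * L z))"
    if I: "I \<in> sets borel" "I \<subseteq> {0..T}" for I :: "real set"
  proof (rule lborel_pair.Fubini_integrable)
    have [measurable]: "I \<in> sets borel" by (rule I(1))
    have shm: "(\<lambda>p::real \<times> ('a \<times> real). snd p - fst p *\<^sub>R a) \<in> borel_measurable (borel \<Otimes>\<^sub>M borel)" by measurable
    have m1: "(\<lambda>p. D (snd p - fst p *\<^sub>R a)) \<in> borel_measurable (borel \<Otimes>\<^sub>M borel)"
      by (rule measurable_compose[OF shm D(1)])
    have m2: "(\<lambda>p::real \<times> ('a \<times> real). L (snd p)) \<in> borel_measurable (borel \<Otimes>\<^sub>M borel)" by measurable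
    have m3: "(\<lambda>p::real \<times> ('a \<times> real). indicat_real I (fst p)) \<in> borel_measurable (borel \<Otimes>\<^sub>M borel)"
      by (rule measurable_compose[OF measurable_fst borel_measurable_indicator[OF I(1)]])
    have m: "(\<lambda>(\<sigma>, z). indicat_real I \<sigma> * (D (z - \<sigma> *\<^sub>R a) * L z)) \<in> borel_measurable (borel \<Otimes>\<^sub>M borel)"
      unfolding split_beta' by (intro borel_measurable_times m1 m2 m3)
    then show mm: "(\<lambda>(\<sigma>, z). indicat_real I \<sigma> * (D (z - \<sigma> *\<^sub>R a) * L z)) \<in> borel_measurable (lborel \<Otimes>\<^sub>M lborel)"
      by (simp cong: measurable_cong_sets)
    have i: "integrable lborel (\<lambda>z. D (z - \<sigma> *\<^sub>R a) * L z)" for \<sigma>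
      using sq_integrable_mult[OF sq_integrable_shift(1)[OF D(1,2), of "- (\<sigma> *\<^sub>R a)"] L(2)] by simp
    then show "AE \<sigma> in lborel. integrable lborel (\<lambda>z. case (\<sigma>, z) of (\<sigma>, z) \<Rightarrow> indicat_real I \<sigma> * (D (z - \<sigma> *\<^sub>R a) * L z))"
      by simp
    have ib: "integrable lborel (\<lambda>\<sigma>. indicat_real {0..T} \<sigma> *\<^sub>R (norm2 lborel D * norm2 lborel L))"
      by (rule borel_integrable_compact) auto
    show "integrable lborel (\<lambda>\<sigma>. LINT z|lborel. norm (case (\<sigma>, z) of (\<sigma>, z) \<Rightarrow> indicat_real I \<sigma> * (D (z - \<sigma> *\<^sub>R a) * L z)))"
    proof (rule Bochner_Integration.integrable_bound[OF ib])
      show "(\<lambda>\<sigma>. LINT z|lborel. norm (case (\<sigma>, z) of (\<sigma>, z) \<Rightarrow> indicat_real I \<sigma> * (D (z - \<sigma> *\<^sub>R a) * L z))) \<in> borel_measurable lborel"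
        by (rule lborel.borel_measurable_lebesgue_integral) (use mm in \<open>simp add: split_beta'\<close>)
      show "AE \<sigma> in lborel. norm (LINT z|lborel. norm (case (\<sigma>, z) of (\<sigma>, z) \<Rightarrow> indicat_real I \<sigma> * (D (z - \<sigma> *\<^sub>R a) * L z)))
          \<le> norm (indicat_real {0..T} \<sigma> *\<^sub>R (norm2 lborel D * norm2 lborel L))"
      proof (rule AE_I2)
        fix \<sigma> :: real
        have s: "(\<lambda>z. \<bar>D (z - \<sigma> *\<^sub>R a)\<bar>) \<in> sq_integrable lborel"
          using sq_integrable_abs[OF sq_integrable_shift(1)[OF D(1,2), of "- (\<sigma> *\<^sub>R a)"]] by simp
        have s3: "norm2 lborel (\<lambda>z. D (z - \<sigma> *\<^sub>R a)) = norm2 lborel D"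
          using sq_integrable_shift(2)[OF D(1,2), of "- (\<sigma> *\<^sub>R a)"] by simp
        have "(LINT z|lborel. \<bar>D (z - \<sigma> *\<^sub>R a)\<bar> * \<bar>L z\<bar>) \<le> norm2 lborel D * norm2 lborel L"
          using norm2_Cauchy_Schwarz[OF s sq_integrable_abs[OF L(2)]] by (simp add: s3 norm2_abs abs_le_iff)
        moreover have "0 \<le> (LINT z|lborel. \<bar>D (z - \<sigma> *\<^sub>R a)\<bar> * \<bar>L z\<bar>)" by simp
        ultimately show "norm (LINT z|lborel. norm (case (\<sigma>, z) of (\<sigma>, z) \<Rightarrow> indicat_real I \<sigma> * (D (z - \<sigma> *\<^sub>R a) * L z)))
          \<le> norm (indicat_real {0..T} \<sigma> *\<^sub>R (norm2 lborel D * norm2 lborel L))"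
          using I(2) by (auto simp: abs_mult indicator_def)
      qed
    qed
  qed
  have refl_int: "(LINT s|lborel. f s) = (LINT \<sigma>|lborel. f (t - \<sigma>))" for f :: "real \<Rightarrow> real" and t
    using lborel_integral_real_affine[of "-1" f t] by simp
  \<comment> \<open>Between two points of the cylinder, going back to an earlier time means a shift
    \<open>\<sigma>\<close> with \<open>0 < \<sigma> < T\<close>. The bounded range of shifts is
    what makes the triple integral absolutely convergent.\<close>
  have KL: "K x t * L (x, t) = (LINT \<sigma>|lborel. indicat_real {0<..<T} \<sigma> * (D ((x, t) - \<sigma> *\<^sub>R a) * L (x, t)))" for x t
  proof -
    have "K x t * L (x, t) = (LINT \<sigma>|lborel. indicat_real {..<t} (t - \<sigma>) * D (x, t - \<sigma>) * L (x, t))"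
      unfolding K by (subst refl_int[of _ t]) simp
    also have "\<dots> = (LINT \<sigma>|lborel. indicat_real {0<..<T} \<sigma> * (D ((x, t) - \<sigma> *\<^sub>R a) * L (x, t)))"
    proof (rule Bochner_Integration.integral_cong[OF refl])
      fix \<sigma>
      show "indicat_real {..<t} (t - \<sigma>) * D (x, t - \<sigma>) * L (x, t)
          = indicat_real {0<..<T} \<sigma> * (D ((x, t) - \<sigma> *\<^sub>R a) * L (x, t))"
      proof (cases "D (x, t - \<sigma>) = 0 \<or> L (x, t) = 0")
        case False
        then have "(x, t - \<sigma>) \<in> \<Omega> \<times> {0<..<T}" "(x, t) \<in> \<Omega> \<times> {0<..<T}" using D(3) L(3) by blast+
        then have "indicat_real {..<t} (t - \<sigma>) = indicat_real {0<..<T} \<sigma>" by (auto simp: indicator_def)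
        then show ?thesis by (simp add: za)
      qed (auto simp: za)
    qed
    finally show ?thesis .
  qed
  have int_slices: "integrable lborel (\<lambda>t. LINT x|lborel. LINT \<sigma>|lborel. indicat_real I \<sigma> * (D ((x, t) - \<sigma> *\<^sub>R a) * L (x, t)))"
    and eq_slices: "(LINT t|lborel. LINT x|lborel. LINT \<sigma>|lborel. indicat_real I \<sigma> * (D ((x, t) - \<sigma> *\<^sub>R a) * L (x, t)))
       = (LINT \<sigma>|lborel. indicat_real I \<sigma> * c \<sigma>)"
    and int_c: "integrable lborel (\<lambda>\<sigma>. indicat_real I \<sigma> * c \<sigma>)"
    if I: "I \<in> sets borel" "I \<subseteq> {0..T}" for I :: "real set"
  proof -
    define G where "G z = (LINT \<sigma>|lborel. indicat_real I \<sigma> * (D (z - \<sigma> *\<^sub>R a) * L z))" for z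
    have G: "integrable lborel G" unfolding G_def by (rule lborel_pair.integrable_snd[OF Bint[OF I]])
    then have G2: "integrable (lborel \<Otimes>\<^sub>M lborel) (\<lambda>(x, t). G (x, t))" by (simp add: lborel_prod)
    show "integrable lborel (\<lambda>t. LINT x|lborel. LINT \<sigma>|lborel. indicat_real I \<sigma> * (D ((x, t) - \<sigma> *\<^sub>R a) * L (x, t)))"
      using lborel_pair.integrable_snd[OF G2] by (simp add: G_def)
    have "(LINT t|lborel. LINT x|lborel. G (x, t)) = (LINT z|lborel. G z)"
      using lborel_pair.integral_snd[OF G2] by (simp add: lborel_prod)
    also have "\<dots> = (LINT \<sigma>|lborel. LINT z|lborel. indicat_real I \<sigma> * (D (z - \<sigma> *\<^sub>R a) * L z))"
      unfolding G_def by (rule lborel_pair.Fubini_integral[OF Bint[OF I]])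
    also have "\<dots> = (LINT \<sigma>|lborel. indicat_real I \<sigma> * c \<sigma>)" by (simp add: c_def)
    finally show "(LINT t|lborel. LINT x|lborel. LINT \<sigma>|lborel. indicat_real I \<sigma> * (D ((x, t) - \<sigma> *\<^sub>R a) * L (x, t)))
       = (LINT \<sigma>|lborel. indicat_real I \<sigma> * c \<sigma>)" by (simp add: G_def)
    show "integrable lborel (\<lambda>\<sigma>. indicat_real I \<sigma> * c \<sigma>)"
      using lborel_pair.integrable_fst[OF Bint[OF I]] by (simp add: c_def)
  qed
  have I1: "{0<..<T} \<in> sets borel" "{0<..<T} \<subseteq> {0..T}" by auto
  have I2: "{0<..h} \<in> sets borel" "{0<..h} \<subseteq> {0..T}" using h by auto
  have \<phi>int: "integrable lborel \<phi>"
    unfolding \<phi>[abs_def] KL by (intro integrable_mult_right int_slices I1)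
  have \<phi>m: "\<phi> \<in> borel_measurable borel" using \<phi>int by simp
  have aeD: "AE x in lborel. integrable lborel (\<lambda>s. D (x, s))"
    using lborel_pair.AE_integrable_fst[of "\<lambda>x s. D (x, s)"] Dint by (simp add: lborel_prod)
  have Km: "(\<lambda>x. K x t) \<in> borel_measurable borel" for t
  proof -
    have "(\<lambda>p. indicat_real {..<t} (snd p) * D p) \<in> borel_measurable (borel \<Otimes>\<^sub>M borel)"
    proof (intro borel_measurable_times)
      show "(\<lambda>p::'a \<times> real. indicat_real {..<t} (snd p)) \<in> borel_measurable (borel \<Otimes>\<^sub>M borel)"
        by (rule measurable_compose[OF measurable_snd borel_measurable_indicator]) simp
      show "D \<in> borel_measurable (borel \<Otimes>\<^sub>M borel)" using D(1) by (simp add: borel_prod)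
    qed
    then have "(\<lambda>(x, s). indicat_real {..<t} s * D (x, s)) \<in> borel_measurable (lborel \<Otimes>\<^sub>M lborel)"
      by (simp add: split_beta' cong: measurable_cong_sets)
    from lborel.borel_measurable_lebesgue_integral[OF this] show ?thesis by (simp add: K[abs_def])
  qed
  \<comment> \<open>The sets \<open>{..<t}\<close> and \<open>{..<t - h}\<close> differ by the times
    \<open>t - \<sigma>\<close> with \<open>0 < \<sigma> \<le> h\<close>, which is why the interval
    of shifts is open at 0 and closed at \<open>h\<close>.\<close>
  have slice: "(LINT x|lborel. (K x t - K x (t - h)) * L (x, t))
      = (LINT x|lborel. LINT \<sigma>|lborel. indicat_real {0<..h} \<sigma> * (D ((x, t) - \<sigma> *\<^sub>R a) * L (x, t)))" for t
  proof (rule integral_cong_AE)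
    have Lm: "(\<lambda>x. L (x, t)) \<in> borel_measurable borel" using L(1) by (simp add: borel_prod[symmetric])
    show "(\<lambda>x. (K x t - K x (t - h)) * L (x, t)) \<in> borel_measurable lborel" using Km Lm by simp
    have shm: "(\<lambda>p::'a \<times> real. (fst p, t - snd p)) \<in> borel_measurable (borel \<Otimes>\<^sub>M borel)"
      unfolding borel_prod[symmetric] by measurable
    have m1: "(\<lambda>p. D (fst p, t - snd p)) \<in> borel_measurable (borel \<Otimes>\<^sub>M borel)"
      by (rule measurable_compose[OF shm D(1)])
    have m2: "(\<lambda>p::'a \<times> real. L (fst p, t)) \<in> borel_measurable (borel \<Otimes>\<^sub>M borel)"
      by (rule measurable_compose[OF measurable_fst Lm])
    have m3: "(\<lambda>p::'a \<times> real. indicat_real {0<..h} (snd p)) \<in> borel_measurable (borel \<Otimes>\<^sub>M borel)"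
      by (rule measurable_compose[OF measurable_snd borel_measurable_indicator]) simp
    have "(\<lambda>(x, \<sigma>). indicat_real {0<..h} \<sigma> * (D ((x, t) - \<sigma> *\<^sub>R a) * L (x, t))) \<in> borel_measurable (borel \<Otimes>\<^sub>M borel)"
      unfolding split_beta' za by (intro borel_measurable_times m1 m2 m3)
    then have "(\<lambda>(x, \<sigma>). indicat_real {0<..h} \<sigma> * (D ((x, t) - \<sigma> *\<^sub>R a) * L (x, t))) \<in> borel_measurable (lborel \<Otimes>\<^sub>M lborel)"
      by (simp cong: measurable_cong_sets)
    from lborel.borel_measurable_lebesgue_integral[OF this]
    show "(\<lambda>x. LINT \<sigma>|lborel. indicat_real {0<..h} \<sigma> * (D ((x, t) - \<sigma> *\<^sub>R a) * L (x, t))) \<in> borel_measurable lborel" .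
    show "AE x in lborel. (K x t - K x (t - h)) * L (x, t)
        = (LINT \<sigma>|lborel. indicat_real {0<..h} \<sigma> * (D ((x, t) - \<sigma> *\<^sub>R a) * L (x, t)))"
      using aeD
    proof eventually_elim
      case (elim x)
      have i: "integrable lborel (\<lambda>s. indicat_real {..<y} s * D (x, s))" for y
        using integrable_mult_indicator[OF _ elim, of "{..<y}"] by simp
      have "K x t - K x (t - h) = (LINT s|lborel. indicat_real {..<t} s * D (x, s) - indicat_real {..<t - h} s * D (x, s))"
        unfolding K using i by simp
      also have "\<dots> = (LINT \<sigma>|lborel. indicat_real {..<t} (t - \<sigma>) * D (x, t - \<sigma>) - indicat_real {..<t - h} (t - \<sigma>) * D (x, t - \<sigma>))"
        by (rule refl_int)
      also have "\<dots> = (LINT \<sigma>|lborel. indicat_real {0<..h} \<sigma> * D (x, t - \<sigma>))"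
        using h by (intro Bochner_Integration.integral_cong) (auto simp: indicator_def)
      finally show ?case by (simp add: za mult.assoc[symmetric])
    qed
  qed
  have "(LINT \<sigma>|lborel. indicat_real {0<..h} \<sigma> * c \<sigma>) = (LINT t|lborel. LINT x|lborel. (K x t - K x (t - h)) * L (x, t))"
    unfolding slice eq_slices[OF I2] ..
  also have "\<dots> \<le> (LINT t|lborel. \<phi> (t - h) - \<phi> t)"
  proof (rule integral_mono_AE)
    show "integrable lborel (\<lambda>t. LINT x|lborel. (K x t - K x (t - h)) * L (x, t))"
      unfolding slice by (rule int_slices[OF I2])
    show "integrable lborel (\<lambda>t. \<phi> (t - h) - \<phi> t)"
      using lborel_shift(2)[OF \<phi>m, of "- h"] \<phi>int by simp
  qed (rule energy[OF h(1)])
  \<comment> \<open>The energies at \<open>t - h\<close> and at \<open>t\<close> have the same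
    integral over the line.\<close>
  also have "\<dots> = 0"
    using lborel_shift[OF \<phi>m, of "- h"] \<phi>int by simp
  finally have le0: "(LINT \<sigma>|lborel. indicat_real {0<..h} \<sigma> * c \<sigma>) \<le> 0" .
  have "h * ((LINT z|lborel. D z * L z) / 2) = (LINT \<sigma>|lborel. indicat_real {0<..h} \<sigma> * ((LINT z|lborel. D z * L z) / 2))"
    using h by simp
  also have "\<dots> \<le> (LINT \<sigma>|lborel. indicat_real {0<..h} \<sigma> * c \<sigma>)"
  proof (rule integral_mono[OF _ int_c[OF I2]])
    show "integrable lborel (\<lambda>\<sigma>. indicat_real {0<..h} \<sigma> * ((LINT z|lborel. D z * L z) / 2))"
      using h by (intro integrable_mult_left integrable_real_indicator) auto
    fix \<sigma>
    show "indicat_real {0<..h} \<sigma> * ((LINT z|lborel. D z * L z) / 2) \<le> indicat_real {0<..h} \<sigma> * c \<sigma>"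
    proof (cases "\<sigma> \<in> {0<..h}")
      case True
      then have "(LINT z|lborel. D z * L z) / 2 < c \<sigma>" using h(2) by (intro d(2)) auto
      then show ?thesis using True by simp
    qed simp
  qed
  also note le0
  finally have "h * ((LINT z|lborel. D z * L z) / 2) \<le> 0" .
  moreover have "0 < h * ((LINT z|lborel. D z * L z) / 2)" using h(1) pos by simp
  ultimately show False by simp
qed

section \<open>Uniqueness\<close>

lemma sq_integrable_bounded_support_integrable:
  fixes D :: "'a::euclidean_space \<Rightarrow> real"
  assumes "bounded Q" "D \<in> sq_integrable lborel" "\<forall>z. z \<notin> Q \<longrightarrow> D z = 0"
  shows "integrable lborel D"
proof -
  obtain r where "Q \<subseteq> cball 0 r"
    using bounded_subset_ballD[OF assms(1), of 0] ball_subset_cball by blast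
  then show ?thesis
    by (intro integrable_of_sq_integrable_support[OF assms(2), of r]) (use assms(3) in blast)
qed

text \<open>The Dirichlet energy of \<open>p - q\<close>, written with the chosen derivatives of
  \<open>p\<close> and \<open>q\<close> separately, as they appear after expanding Green's
  formula.\<close>

definition dirichlet_energy_diff :: "'a::euclidean_space set \<Rightarrow> ('a \<Rightarrow> real) \<Rightarrow> ('a \<Rightarrow> real) \<Rightarrow> real" where
  "dirichlet_energy_diff \<Omega> p q =
     1 / 2 * (\<Sum>b\<in>Basis. LINT x|lebesgue_on \<Omega>. (weak_partial \<Omega> b p x - weak_partial \<Omega> b q x)\<^sup>2)"

lemma dirichlet_energy_diff_nonneg: "0 \<le> dirichlet_energy_diff \<Omega> p q"
  by (simp add: dirichlet_energy_diff_def sum_nonneg)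

lemma space_X_laplacian:
  assumes "w \<in> space_X \<Omega> \<Gamma>\<^sub>N"
  shows "laplacian \<Omega> w \<in> sq_integrable (lebesgue_on \<Omega>)" "w \<in> sobolev_H1 \<Omega>"
proof -
  have "w \<in> sobolev_H1 \<Omega>" "\<And>b. b \<in> Basis \<Longrightarrow> weak_partial \<Omega> b w \<in> sobolev_H1 \<Omega>"
    using assms by (auto simp: space_X_def sobolev_H2_def)
  then show "w \<in> sobolev_H1 \<Omega>" "laplacian \<Omega> w \<in> sq_integrable (lebesgue_on \<Omega>)"
    unfolding laplacian_def[abs_def] by (auto intro!: sq_integrable_sum weak_partial(1))
qed

text \<open>
  Using Green's formula only for the individual functions and expanding bilinearly, we avoid showing
  that the spaces \<open>X\<close> and \<open>V\<close> and the operators \<open>\<nabla>\<close> and \<open>\<Delta>\<close> are linear.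
\<close>

lemma Green_formula_diff:
  fixes \<Omega> :: "'a::euclidean_space set"
  assumes dom: "bounded_lipschitz_domain \<Omega>" and \<Gamma>: "\<Gamma>\<^sub>D \<union> \<Gamma>\<^sub>N = frontier \<Omega>"
    and p: "p1 \<in> space_X \<Omega> \<Gamma>\<^sub>N \<inter> space_V \<Omega> \<Gamma>\<^sub>D" "p2 \<in> space_X \<Omega> \<Gamma>\<^sub>N \<inter> space_V \<Omega> \<Gamma>\<^sub>D"
    and q: "q1 \<in> space_X \<Omega> \<Gamma>\<^sub>N \<inter> space_V \<Omega> \<Gamma>\<^sub>D" "q2 \<in> space_X \<Omega> \<Gamma>\<^sub>N \<inter> space_V \<Omega> \<Gamma>\<^sub>D"
  shows "(LINT x|lebesgue_on \<Omega>. (p1 x - p2 x) * (laplacian \<Omega> q1 x - laplacian \<Omega> q2 x))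
    = - (\<Sum>b\<in>Basis. LINT x|lebesgue_on \<Omega>.
          (weak_partial \<Omega> b p1 x - weak_partial \<Omega> b p2 x) * (weak_partial \<Omega> b q1 x - weak_partial \<Omega> b q2 x))"
proof -
  let ?M = "lebesgue_on \<Omega>"
  have G: "(LINT x|?M. v x * laplacian \<Omega> w x) = - (\<Sum>b\<in>Basis. LINT x|?M. weak_partial \<Omega> b v x * weak_partial \<Omega> b w x)"
    if "v \<in> space_X \<Omega> \<Gamma>\<^sub>N \<inter> space_V \<Omega> \<Gamma>\<^sub>D" "w \<in> space_X \<Omega> \<Gamma>\<^sub>N \<inter> space_V \<Omega> \<Gamma>\<^sub>D" for v w
    using Green_formula[OF dom \<Gamma>] that by blast
  have bil: "(LINT x|M. (f1 x - f2 x) * (g1 x - g2 x))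
      = (LINT x|M. f1 x * g1 x) - (LINT x|M. f1 x * g2 x) - (LINT x|M. f2 x * g1 x) + (LINT x|M. f2 x * g2 x)"
    if "f1 \<in> sq_integrable M" "f2 \<in> sq_integrable M" "g1 \<in> sq_integrable M" "g2 \<in> sq_integrable M"
    for f1 f2 g1 g2 and M :: "'a measure"
  proof -
    have "(LINT x|M. (f1 x - f2 x) * (g1 x - g2 x)) = (LINT x|M. f1 x * g1 x - f1 x * g2 x - f2 x * g1 x + f2 x * g2 x)"
      by (simp add: algebra_simps)
    then show ?thesis using that by (simp add: sq_integrable_mult)
  qed
  have H1: "v \<in> sobolev_H1 \<Omega>" "laplacian \<Omega> v \<in> sq_integrable ?M" if "v \<in> space_X \<Omega> \<Gamma>\<^sub>N \<inter> space_V \<Omega> \<Gamma>\<^sub>D" for v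
    using space_X_laplacian that by auto
  note H = H1[OF p(1)] H1[OF p(2)] H1[OF q(1)] H1[OF q(2)]
  show ?thesis
    using H G[OF p(1) q(1)] G[OF p(1) q(2)] G[OF p(2) q(1)] G[OF p(2) q(2)]
    by (simp add: bil sobolev_H1_sq_integrable weak_partial(1) sum.distrib sum_subtractf)
qed

lemma dirichlet_energy_identity:
  fixes \<Omega> :: "'a::euclidean_space set"
  assumes dom: "bounded_lipschitz_domain \<Omega>" and \<Gamma>: "\<Gamma>\<^sub>D \<union> \<Gamma>\<^sub>N = frontier \<Omega>"
    and p: "p \<in> space_X \<Omega> \<Gamma>\<^sub>N \<inter> space_V \<Omega> \<Gamma>\<^sub>D" and q: "q \<in> space_X \<Omega> \<Gamma>\<^sub>N \<inter> space_V \<Omega> \<Gamma>\<^sub>D"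
  shows "(LINT x|lebesgue_on \<Omega>. (p x - q x) * (laplacian \<Omega> p x - laplacian \<Omega> q x))
    = - 2 * dirichlet_energy_diff \<Omega> p q"
  unfolding Green_formula_diff[OF dom \<Gamma> p q p q] dirichlet_energy_diff_def
  by (simp add: power2_eq_square)

text \<open>A convex quadratic functional lies above its tangents: by Green's formula the left-hand
  side is the derivative of the energy at \<open>p1 - p2\<close> in the direction from there to
  \<open>q1 - q2\<close>. The remainder is half of the squared differences of the gradients, and it
  is dropped.\<close>

lemma dirichlet_energy_convex:
  fixes \<Omega> :: "'a::euclidean_space set"
  assumes dom: "bounded_lipschitz_domain \<Omega>" and \<Gamma>: "\<Gamma>\<^sub>D \<union> \<Gamma>\<^sub>N = frontier \<Omega>"
    and p: "p1 \<in> space_X \<Omega> \<Gamma>\<^sub>N \<inter> space_V \<Omega> \<Gamma>\<^sub>D" "p2 \<in> space_X \<Omega> \<Gamma>\<^sub>N \<inter> space_V \<Omega> \<Gamma>\<^sub>D"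
    and q: "q1 \<in> space_X \<Omega> \<Gamma>\<^sub>N \<inter> space_V \<Omega> \<Gamma>\<^sub>D" "q2 \<in> space_X \<Omega> \<Gamma>\<^sub>N \<inter> space_V \<Omega> \<Gamma>\<^sub>D"
  shows "(LINT x|lebesgue_on \<Omega>. ((p1 x - p2 x) - (q1 x - q2 x)) * (laplacian \<Omega> p1 x - laplacian \<Omega> p2 x))
    \<le> dirichlet_energy_diff \<Omega> q1 q2 - dirichlet_energy_diff \<Omega> p1 p2"
proof -
  let ?M = "lebesgue_on \<Omega>"
  have H: "v \<in> sobolev_H1 \<Omega>" "laplacian \<Omega> v \<in> sq_integrable ?M" if "v \<in> space_X \<Omega> \<Gamma>\<^sub>N \<inter> space_V \<Omega> \<Gamma>\<^sub>D" for v
    using space_X_laplacian that by auto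
  have sq: "v \<in> sq_integrable ?M" if "v \<in> space_X \<Omega> \<Gamma>\<^sub>N \<inter> space_V \<Omega> \<Gamma>\<^sub>D" for v
    using H(1)[OF that] by (rule sobolev_H1_sq_integrable)
  define A where "A b x = weak_partial \<Omega> b p1 x - weak_partial \<Omega> b p2 x" for b x
  define C where "C b x = weak_partial \<Omega> b q1 x - weak_partial \<Omega> b q2 x" for b x
  have A: "A b \<in> sq_integrable ?M" and C: "C b \<in> sq_integrable ?M" if "b \<in> Basis" for b
    unfolding A_def[abs_def] C_def[abs_def] using that H(1) p q
    by (auto intro!: sq_integrable_diff weak_partial(1))
  have lp: "(\<lambda>x. laplacian \<Omega> p1 x - laplacian \<Omega> p2 x) \<in> sq_integrable ?M"
    by (intro sq_integrable_diff H p)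
  have "(LINT x|?M. ((p1 x - p2 x) - (q1 x - q2 x)) * (laplacian \<Omega> p1 x - laplacian \<Omega> p2 x))
    = (LINT x|?M. (p1 x - p2 x) * (laplacian \<Omega> p1 x - laplacian \<Omega> p2 x))
      - (LINT x|?M. (q1 x - q2 x) * (laplacian \<Omega> p1 x - laplacian \<Omega> p2 x))"
    using sq_integrable_mult[OF sq_integrable_diff[OF sq[OF p(1)] sq[OF p(2)]] lp]
      sq_integrable_mult[OF sq_integrable_diff[OF sq[OF q(1)] sq[OF q(2)]] lp]
    by (subst left_diff_distrib) simp
  also have "\<dots> = (\<Sum>b\<in>Basis. (LINT x|?M. C b x * A b x) - (LINT x|?M. A b x * A b x))"
    unfolding Green_formula_diff[OF dom \<Gamma> p p] Green_formula_diff[OF dom \<Gamma> q p]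
    by (simp add: A_def C_def sum_subtractf)
  also have "\<dots> \<le> (\<Sum>b\<in>Basis. 1 / 2 * (LINT x|?M. (C b x)\<^sup>2) - 1 / 2 * (LINT x|?M. (A b x)\<^sup>2))"
  proof (rule sum_mono)
    fix b :: 'a assume b: "b \<in> Basis"
    have "0 \<le> (LINT x|?M. (C b x - A b x)\<^sup>2)" by simp
    also have "(\<lambda>x. (C b x - A b x)\<^sup>2) = (\<lambda>x. (C b x)\<^sup>2 - 2 * (C b x * A b x) + (A b x)\<^sup>2)"
      by (simp add: power2_eq_square algebra_simps)
    also have "(LINT x|?M. (C b x)\<^sup>2 - 2 * (C b x * A b x) + (A b x)\<^sup>2)
        = (LINT x|?M. (C b x)\<^sup>2) - 2 * (LINT x|?M. C b x * A b x) + (LINT x|?M. (A b x)\<^sup>2)"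
      using sq_integrableD(2)[OF C[OF b]] sq_integrableD(2)[OF A[OF b]] sq_integrable_mult[OF C[OF b] A[OF b]] by simp
    finally show "(LINT x|?M. C b x * A b x) - (LINT x|?M. A b x * A b x)
        \<le> 1 / 2 * (LINT x|?M. (C b x)\<^sup>2) - 1 / 2 * (LINT x|?M. (A b x)\<^sup>2)"
      by (simp add: power2_eq_square)
  qed
  also have "\<dots> = dirichlet_energy_diff \<Omega> q1 q2 - dirichlet_energy_diff \<Omega> p1 p2"
    by (simp add: dirichlet_energy_diff_def A_def C_def sum_subtractf sum_distrib_left)
  finally show ?thesis .
qed

text \<open>The positive part is the projection of the line onto the nonnegative half-line, and
  projections onto closed convex sets are firmly nonexpansive.\<close>

lemma positive_part_monotone:
  fixes a b :: real
  shows "(max a 0 - max b 0)\<^sup>2 \<le> (max a 0 - max b 0) * (a - b)"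
proof -
  have "0 \<le> (max a 0 - max b 0) * ((a - b) - (max a 0 - max b 0))"
    by (cases "0 \<le> a"; cases "0 \<le> b") (auto simp: max_def mult_nonneg_nonpos)
  then show ?thesis by (simp add: power2_eq_square right_diff_distrib)
qed

theorem theorem2p4:
  fixes \<Omega> \<Gamma>\<^sub>D \<Gamma>\<^sub>N :: "'a::euclidean_space set"
    and T :: real
    and u\<^sub>0 :: "'a \<Rightarrow> real"
    and f :: "'a \<times> real \<Rightarrow> real"
    and u v :: "real \<Rightarrow> 'a \<Rightarrow> real"
  assumes "bounded_lipschitz_domain \<Omega>"
    and "\<Gamma>\<^sub>D \<union> \<Gamma>\<^sub>N = frontier \<Omega>" and "\<Gamma>\<^sub>D \<inter> \<Gamma>\<^sub>N = {}"
    and "openin (top_of_set (frontier \<Omega>)) \<Gamma>\<^sub>D"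
    and "T > 0"
    and "u\<^sub>0 \<in> space_V \<Omega> \<Gamma>\<^sub>D"
    and "f \<in> L2_space (\<Omega> \<times> {0<..<T})"
    and "strong_solution \<Omega> \<Gamma>\<^sub>D \<Gamma>\<^sub>N T u\<^sub>0 f u"
    and "strong_solution \<Omega> \<Gamma>\<^sub>D \<Gamma>\<^sub>N T u\<^sub>0 f v"
  shows "\<forall>t\<in>{0..T}. AE x in lebesgue_on \<Omega>. u t x = v t x"
proof -
  note dom = assms(1) and \<Gamma> = assms(2) and T = assms(5)
  let ?M = "lebesgue_on \<Omega>" and ?Q = "\<Omega> \<times> {0<..<T}" and ?Y = "space_X \<Omega> \<Gamma>\<^sub>N \<inter> space_V \<Omega> \<Gamma>\<^sub>D"
  have \<Omega>: "open \<Omega>" "bounded \<Omega>" using dom by (auto simp: bounded_lipschitz_domain_def)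
  have Q: "open ?Q" using \<Omega>(1) by (intro open_Times) auto
  have "bounded {0<..<T}" by (rule bounded_subset[OF bounded_closed_interval[of 0 T]]) auto
  with \<Omega>(2) have bQ: "bounded ?Q" by (rule bounded_Times)
  \<comment> \<open>All that is used of a solution, in terms of two Borel functions on space-time
    that vanish outside the cylinder: \<open>D\<close> for its time derivative and \<open>L\<close>
    for its Laplacian. The last clause recovers the solution at every time, not only at almost every
    one, from \<open>u\<^sub>0\<close> and \<open>D\<close>.\<close>
  have sol: "\<exists>D L. D \<in> borel_measurable borel \<and> D \<in> sq_integrable lborel \<and> (\<forall>z. z \<notin> ?Q \<longrightarrow> D z = 0) \<and>
      L \<in> borel_measurable borel \<and> L \<in> sq_integrable lborel \<and> (\<forall>z. z \<notin> ?Q \<longrightarrow> L z = 0) \<and>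
      (AE z in lborel. z \<in> ?Q \<longrightarrow> D z = max (L z + f z) 0) \<and>
      (AE t in lborel. t \<in> {0<..<T} \<longrightarrow> w t \<in> ?Y \<and> (AE x in ?M. L (x, t) = laplacian \<Omega> (w t) x)) \<and>
      (\<forall>t\<in>{0..T}. w t \<in> sq_integrable ?M) \<and>
      (\<forall>t\<in>{0..T}. AE x in ?M. w t x - u\<^sub>0 x = (LINT s|lborel. indicat_real {..<t} s * D (x, s)))"
    if w: "strong_solution \<Omega> \<Gamma>\<^sub>D \<Gamma>\<^sub>N T u\<^sub>0 f w" for w
  proof -
    from w obtain d wt lap where cont: "continuous_L2_valued T \<Omega> w"
      and Y: "w \<in> bochner_L2 T ?Y (H2_norm \<Omega>)"
      and W12: "has_W12_deriv T \<Omega> w d" and rd: "represents_on_QT T \<Omega> d wt"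
      and rl: "represents_on_QT T \<Omega> (\<lambda>t. laplacian \<Omega> (w t)) lap"
      and eq: "AE z in lebesgue_on ?Q. wt z = max (lap z + f z) 0"
      and init: "AE x in ?M. w 0 x = u\<^sub>0 x"
      unfolding strong_solution_def by blast
    obtain D where D: "D \<in> borel_measurable borel" "D \<in> sq_integrable lborel" "\<forall>z. z \<notin> ?Q \<longrightarrow> D z = 0"
        "AE z in lborel. z \<in> ?Q \<longrightarrow> D z = wt z"
      using borel_representative[OF Q] rd unfolding represents_on_QT_def by blast
    obtain L where L: "L \<in> borel_measurable borel" "L \<in> sq_integrable lborel" "\<forall>z. z \<notin> ?Q \<longrightarrow> L z = 0"
        "AE z in lborel. z \<in> ?Q \<longrightarrow> L z = lap z"
      using borel_representative[OF Q] rl unfolding represents_on_QT_def by blast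
    have DL: "AE z in lborel. z \<in> ?Q \<longrightarrow> D z = max (L z + f z) 0"
      using D(4) L(4) eq[unfolded AE_lebesgue_on_iff[OF Q]] by eventually_elim simp
    have "AE t in lborel. t \<in> {0<..<T} \<longrightarrow> w t \<in> ?Y"
      using Y unfolding bochner_L2_def bochner_measurable_def
        AE_lebesgue_on_iff[OF open_greaterThanLessThan] by blast
    with representative_slices[OF \<Omega>(1) rl L(4)]
    have good: "AE t in lborel. t \<in> {0<..<T} \<longrightarrow> w t \<in> ?Y \<and> (AE x in ?M. L (x, t) = laplacian \<Omega> (w t) x)"
      by eventually_elim blast
    have wsq: "\<forall>t\<in>{0..T}. w t \<in> sq_integrable ?M"
      using cont by (simp add: continuous_L2_valued_def L2_space_eq)
    note Dint = sq_integrable_bounded_support_integrable[OF bQ D(2,3)]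
    have D0: "D z = 0" if "z \<notin> ?Q" for z using D(3) that by blast
    have rep: "\<forall>t\<in>{0..T}. AE x in ?M. w t x - u\<^sub>0 x = (LINT s|lborel. indicat_real {..<t} s * D (x, s))"
    proof
      fix t assume t: "t \<in> {0..T}"
      show "AE x in ?M. w t x - u\<^sub>0 x = (LINT s|lborel. indicat_real {..<t} s * D (x, s))"
      proof -
        have "AE x in ?M. w t x - w 0 x = (LINT s|lborel. indicat_real {..<t} s * D (x, s))"
          by (rule solution_eq_integral[OF \<Omega> T cont W12 D(1) Dint _ representative_slices[OF \<Omega>(1) rd D(4)] t])
             (rule D0)
        with init show ?thesis by eventually_elim simp
      qed
    qed
    show ?thesis
      by (rule exI[of _ D], rule exI[of _ L]) (intro conjI D(1,2,3) L(1,2,3) DL good wsq rep)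
  qed
  from sol[OF assms(8)] obtain Du Lu where
    Du: "Du \<in> borel_measurable borel" "Du \<in> sq_integrable lborel" "\<forall>z. z \<notin> ?Q \<longrightarrow> Du z = 0"
    and Lu: "Lu \<in> borel_measurable borel" "Lu \<in> sq_integrable lborel" "\<forall>z. z \<notin> ?Q \<longrightarrow> Lu z = 0"
    and equ: "AE z in lborel. z \<in> ?Q \<longrightarrow> Du z = max (Lu z + f z) 0"
    and goodu: "AE t in lborel. t \<in> {0<..<T} \<longrightarrow> u t \<in> ?Y \<and> (AE x in ?M. Lu (x, t) = laplacian \<Omega> (u t) x)"
    and usq: "\<forall>t\<in>{0..T}. u t \<in> sq_integrable ?M"
    and repu: "\<forall>t\<in>{0..T}. AE x in ?M. u t x - u\<^sub>0 x = (LINT s|lborel. indicat_real {..<t} s * Du (x, s))"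
    by (elim exE conjE)
  from sol[OF assms(9)] obtain Dv Lv where
    Dv: "Dv \<in> borel_measurable borel" "Dv \<in> sq_integrable lborel" "\<forall>z. z \<notin> ?Q \<longrightarrow> Dv z = 0"
    and Lv: "Lv \<in> borel_measurable borel" "Lv \<in> sq_integrable lborel" "\<forall>z. z \<notin> ?Q \<longrightarrow> Lv z = 0"
    and eqv: "AE z in lborel. z \<in> ?Q \<longrightarrow> Dv z = max (Lv z + f z) 0"
    and goodv: "AE t in lborel. t \<in> {0<..<T} \<longrightarrow> v t \<in> ?Y \<and> (AE x in ?M. Lv (x, t) = laplacian \<Omega> (v t) x)"
    and vsq: "\<forall>t\<in>{0..T}. v t \<in> sq_integrable ?M"
    and repv: "\<forall>t\<in>{0..T}. AE x in ?M. v t x - u\<^sub>0 x = (LINT s|lborel. indicat_real {..<t} s * Dv (x, s))"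
    by (elim exE conjE)
  define D where "D z = Du z - Dv z" for z
  define L where "L z = Lu z - Lv z" for z
  have D: "D \<in> borel_measurable borel" "D \<in> sq_integrable lborel" "\<And>z. z \<notin> ?Q \<Longrightarrow> D z = 0"
  proof -
    show "D \<in> borel_measurable borel" unfolding D_def[abs_def] using Du(1) Dv(1) by simp
    show "D \<in> sq_integrable lborel" unfolding D_def[abs_def] by (rule sq_integrable_diff[OF Du(2) Dv(2)])
    show "D z = 0" if "z \<notin> ?Q" for z
      using Du(3)[rule_format, OF that] Dv(3)[rule_format, OF that] by (simp add: D_def)
  qed
  have L: "L \<in> borel_measurable borel" "L \<in> sq_integrable lborel" "\<And>z. z \<notin> ?Q \<Longrightarrow> L z = 0"
  proof -
    show "L \<in> borel_measurable borel" unfolding L_def[abs_def] using Lu(1) Lv(1) by simp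
    show "L \<in> sq_integrable lborel" unfolding L_def[abs_def] by (rule sq_integrable_diff[OF Lu(2) Lv(2)])
    show "L z = 0" if "z \<notin> ?Q" for z
      using Lu(3)[rule_format, OF that] Lv(3)[rule_format, OF that] by (simp add: L_def)
  qed
  \<comment> \<open>This realises the difference of the solutions together with its extension by 0:
    since \<open>D\<close> vanishes outside the cylinder, the integral is 0 for
    \<open>t \<le> 0\<close>, in accordance with the equal initial data.\<close>
  define K where "K x t = (LINT s|lborel. indicat_real {..<t} s * D (x, s))" for x t
  \<comment> \<open>At almost every time in (0, T) this is the Dirichlet energy of the difference.
    The formula is defined at all times and gives 0 outside that interval.\<close>
  define \<phi> where "\<phi> t = - (1 / 2) * (LINT x|lborel. K x t * L (x, t))" for t
  note Dint = sq_integrable_bounded_support_integrable[OF bQ Du(2,3)] sq_integrable_bounded_support_integrable[OF bQ Dv(2,3)]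
  have aeD: "AE x in lborel. integrable lborel (\<lambda>s. Du (x, s))" "AE x in lborel. integrable lborel (\<lambda>s. Dv (x, s))"
    using lborel_pair.AE_integrable_fst[of "\<lambda>x s. Du (x, s)"] lborel_pair.AE_integrable_fst[of "\<lambda>x s. Dv (x, s)"] Dint
    by (simp_all add: lborel_prod)
  have w_eq: "AE x in ?M. u t x - v t x = K x t" if t: "t \<in> {0..T}" for t
    unfolding AE_lebesgue_on_iff[OF \<Omega>(1)]
    using aeD bspec[OF repu t, unfolded AE_lebesgue_on_iff[OF \<Omega>(1)]] bspec[OF repv t, unfolded AE_lebesgue_on_iff[OF \<Omega>(1)]]
  proof eventually_elim
    case (elim x)
    have i: "integrable lborel (\<lambda>s. indicat_real {..<t} s * Du (x, s))" "integrable lborel (\<lambda>s. indicat_real {..<t} s * Dv (x, s))"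
      using integrable_mult_indicator[OF _ elim(1), of "{..<t}"] integrable_mult_indicator[OF _ elim(2), of "{..<t}"] by simp_all
    have "K x t = (LINT s|lborel. indicat_real {..<t} s * Du (x, s)) - (LINT s|lborel. indicat_real {..<t} s * Dv (x, s))"
      using i by (simp add: K_def D_def right_diff_distrib)
    then show ?case using elim(3,4) by auto
  qed
  have Km: "(\<lambda>x. K x t) \<in> borel_measurable borel" for t
  proof -
    have "(\<lambda>p. indicat_real {..<t} (snd p) * D p) \<in> borel_measurable (borel \<Otimes>\<^sub>M borel)"
    proof (intro borel_measurable_times)
      show "(\<lambda>p::'a \<times> real. indicat_real {..<t} (snd p)) \<in> borel_measurable (borel \<Otimes>\<^sub>M borel)"
        by (rule measurable_compose[OF measurable_snd borel_measurable_indicator]) simp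
      show "D \<in> borel_measurable (borel \<Otimes>\<^sub>M borel)" using D(1) by (simp add: borel_prod)
    qed
    then have "(\<lambda>(x, s). indicat_real {..<t} s * D (x, s)) \<in> borel_measurable (lborel \<Otimes>\<^sub>M lborel)"
      by (simp add: split_beta' cong: measurable_cong_sets)
    from lborel.borel_measurable_lebesgue_integral[OF this] show ?thesis by (simp add: K_def[abs_def])
  qed
  have Lm: "(\<lambda>x. L (x, t)) \<in> borel_measurable borel" for t
    using L(1) by (simp add: borel_prod[symmetric])
  have K0: "K x t = 0" if "t \<le> 0" for x t
  proof -
    have "indicat_real {..<t} s * D (x, s) = 0" for s
      using D(3)[of "(x, s)"] that by (auto simp: indicator_def)
    then show ?thesis unfolding K_def by (intro integral_eq_zero_AE AE_I2)
  qed
  have L0: "L (x, t) = 0" if "t \<notin> {0<..<T}" for x t using L(3)[of "(x, t)"] that by auto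
  define good where "good t \<longleftrightarrow> u t \<in> ?Y \<and> v t \<in> ?Y \<and>
     (AE x in ?M. L (x, t) = laplacian \<Omega> (u t) x - laplacian \<Omega> (v t) x)" for t
  have aegood: "AE t in lborel. t \<in> {0<..<T} \<longrightarrow> good t"
    using goodu goodv
  proof eventually_elim
    case (elim t)
    show ?case
    proof
      assume "t \<in> {0<..<T}"
      with elim have ae: "AE x in ?M. Lu (x, t) = laplacian \<Omega> (u t) x" "AE x in ?M. Lv (x, t) = laplacian \<Omega> (v t) x"
        and Y: "u t \<in> ?Y" "v t \<in> ?Y" by auto
      from ae have "AE x in ?M. L (x, t) = laplacian \<Omega> (u t) x - laplacian \<Omega> (v t) x"
        by eventually_elim (simp add: L_def)
      then show "good t" using Y by (simp add: good_def)
    qed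
  qed
  have pair: "(LINT x|lborel. (K x t - K x s) * L (x, t))
      = (LINT x|?M. ((u t x - v t x) - (u s x - v s x)) * (laplacian \<Omega> (u t) x - laplacian \<Omega> (v t) x))"
    if t: "t \<in> {0<..<T}" "good t" and s: "s \<in> {0..T}" for t s
  proof -
    have "(LINT x|lborel. (K x t - K x s) * L (x, t)) = (LINT x|?M. (K x t - K x s) * L (x, t))"
      using Km Lm L(3) by (intro integral_lebesgue_on_eq_lborel_support[OF \<Omega>(1), symmetric]) auto
    also have "\<dots> = (LINT x|?M. ((u t x - v t x) - (u s x - v s x)) * (laplacian \<Omega> (u t) x - laplacian \<Omega> (v t) x))"
    proof (rule integral_cong_AE)
      have "(\<lambda>x. (K x t - K x s) * L (x, t)) \<in> borel_measurable borel" using Km Lm by simp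
      then show "(\<lambda>x. (K x t - K x s) * L (x, t)) \<in> borel_measurable ?M"
        by (intro measurable_restrict_space1 measurable_completion) simp
      have "u t \<in> borel_measurable ?M" "v t \<in> borel_measurable ?M" "u s \<in> borel_measurable ?M" "v s \<in> borel_measurable ?M"
        using usq vsq t s by (auto intro!: sq_integrableD(1))
      moreover have "laplacian \<Omega> (u t) \<in> borel_measurable ?M" "laplacian \<Omega> (v t) \<in> borel_measurable ?M"
        using t(2) by (auto simp: good_def intro!: sq_integrableD(1) space_X_laplacian(1))
      ultimately show "(\<lambda>x. ((u t x - v t x) - (u s x - v s x)) * (laplacian \<Omega> (u t) x - laplacian \<Omega> (v t) x)) \<in> borel_measurable ?M"
        by (intro borel_measurable_times borel_measurable_diff)
      have "AE x in ?M. L (x, t) = laplacian \<Omega> (u t) x - laplacian \<Omega> (v t) x" using t(2) by (simp add: good_def)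
      moreover have "AE x in ?M. u t x - v t x = K x t" "AE x in ?M. u s x - v s x = K x s"
        using t s by (auto intro!: w_eq)
      ultimately show "AE x in ?M. (K x t - K x s) * L (x, t)
          = ((u t x - v t x) - (u s x - v s x)) * (laplacian \<Omega> (u t) x - laplacian \<Omega> (v t) x)"
        by eventually_elim simp
    qed
    finally show ?thesis .
  qed
  have \<phi>_eq: "\<phi> t = dirichlet_energy_diff \<Omega> (u t) (v t)" if t: "t \<in> {0<..<T}" "good t" for t
  proof -
    have w0: "AE x in ?M. u 0 x - v 0 x = 0"
      using w_eq[of 0] T by (auto simp: K0)
    \<comment> \<open>Inserting \<open>K x 0\<close>, which is 0, brings the integral into the form
      of \<open>pair\<close> with the initial time for \<open>s\<close>; the initial values of the
      solutions then cancel.\<close>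
    have "(LINT x|lborel. K x t * L (x, t)) = (LINT x|lborel. (K x t - K x 0) * L (x, t))" by (simp add: K0)
    also have "\<dots> = (LINT x|?M. ((u t x - v t x) - (u 0 x - v 0 x)) * (laplacian \<Omega> (u t) x - laplacian \<Omega> (v t) x))"
      using T by (intro pair t) auto
    also have "\<dots> = (LINT x|?M. (u t x - v t x) * (laplacian \<Omega> (u t) x - laplacian \<Omega> (v t) x))"
    proof (rule integral_cong_AE)
      have m: "u t \<in> borel_measurable ?M" "v t \<in> borel_measurable ?M" "u 0 \<in> borel_measurable ?M" "v 0 \<in> borel_measurable ?M"
        using usq vsq t T by (auto intro!: sq_integrableD(1))
      have lm: "laplacian \<Omega> (u t) \<in> borel_measurable ?M" "laplacian \<Omega> (v t) \<in> borel_measurable ?M"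
        using t(2) by (auto simp: good_def intro!: sq_integrableD(1) space_X_laplacian(1))
      show "(\<lambda>x. ((u t x - v t x) - (u 0 x - v 0 x)) * (laplacian \<Omega> (u t) x - laplacian \<Omega> (v t) x)) \<in> borel_measurable ?M"
        "(\<lambda>x. (u t x - v t x) * (laplacian \<Omega> (u t) x - laplacian \<Omega> (v t) x)) \<in> borel_measurable ?M"
        by (intro borel_measurable_times borel_measurable_diff m lm)+
      show "AE x in ?M. ((u t x - v t x) - (u 0 x - v 0 x)) * (laplacian \<Omega> (u t) x - laplacian \<Omega> (v t) x)
          = (u t x - v t x) * (laplacian \<Omega> (u t) x - laplacian \<Omega> (v t) x)"
        using w0 by eventually_elim simp
    qed
    also have "\<dots> = - 2 * dirichlet_energy_diff \<Omega> (u t) (v t)"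
      using t(2) by (intro dirichlet_energy_identity[OF dom \<Gamma>]) (auto simp: good_def)
    finally show ?thesis by (simp add: \<phi>_def)
  qed
  have \<phi>0: "\<phi> t = 0" if "t \<notin> {0<..<T}" for t using L0[OF that] by (simp add: \<phi>_def)
  \<comment> \<open>For almost every \<open>t\<close> both \<open>t\<close> and \<open>t - h\<close>
    avoid the exceptional times, as shifts preserve null sets.\<close>
  have energy: "AE t in lborel. (LINT x|lborel. (K x t - K x (t - h)) * L (x, t)) \<le> \<phi> (t - h) - \<phi> t" if h: "0 < h" for h
    using aegood AE_lborel_shift[OF aegood, of "- h"]
  proof eventually_elim
    case (elim t)
    have s: "t - h \<in> {0<..<T} \<longrightarrow> good (t - h)" using elim(2) by simp
    have pos: "0 \<le> \<phi> (t - h)"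
      using s \<phi>_eq[of "t - h"] \<phi>0[of "t - h"] dirichlet_energy_diff_nonneg[of \<Omega>]
      by (cases "t - h \<in> {0<..<T}") auto
    show ?case
    proof (cases "t \<in> {0<..<T}")
      \<comment> \<open>Here the left-hand side and \<open>\<phi> t\<close> are 0, so only the sign
        of \<open>\<phi> (t - h)\<close> matters. This covers the drop of the energy to 0 after the
        final time.\<close>
      case False
      then show ?thesis using L0[OF False] \<phi>0[OF False] pos by simp
    next
      case True
      then have t: "good t" using elim(1) by blast
      have E: "0 \<le> \<phi> t" using \<phi>_eq[OF True t] dirichlet_energy_diff_nonneg[of \<Omega>] by simp
      show ?thesis
      proof (cases "t - h \<le> 0")
        \<comment> \<open>The earlier difference is 0, and the left-hand side is minus twice the
          energy, which is at most \<open>- \<phi> t\<close>.\<close>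
        case le: True
        have "(LINT x|lborel. (K x t - K x (t - h)) * L (x, t)) = - 2 * \<phi> t" by (simp add: K0[OF le] \<phi>_def)
        then show ?thesis using E pos by simp
      next
        case False
        then have s': "t - h \<in> {0<..<T}" "good (t - h)" using True h s by auto
        have "(LINT x|lborel. (K x t - K x (t - h)) * L (x, t))
          \<le> dirichlet_energy_diff \<Omega> (u (t - h)) (v (t - h)) - dirichlet_energy_diff \<Omega> (u t) (v t)"
          using t s' unfolding good_def
          by (subst pair[OF True t]) (use s'(1) in \<open>auto intro!: dirichlet_energy_convex[OF dom \<Gamma>]\<close>)
        then show ?thesis using \<phi>_eq[OF True t] \<phi>_eq[OF s'] by simp
      qed
    qed
  qed
  have nonpos: "(LINT z|lborel. D z * L z) \<le> 0"
    by (rule correlation_nonpos[OF T \<Omega>(2) D L K_def \<phi>_def energy])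
  \<comment> \<open>The datum \<open>f\<close> cancels in the difference of the arguments of the
    positive part; outside the cylinder both sides are 0.\<close>
  have mono: "AE z in lborel. (D z)\<^sup>2 \<le> D z * L z"
    using equ eqv
  proof eventually_elim
    case (elim z)
    show ?case
    proof (cases "z \<in> ?Q")
      case True
      then show ?thesis using elim positive_part_monotone[of "Lu z + f z" "Lv z + f z"]
        by (simp add: D_def L_def)
    next
      case False
      then show ?thesis using D(3)[OF False] by simp
    qed
  qed
  have "(LINT z|lborel. (D z)\<^sup>2) \<le> (LINT z|lborel. D z * L z)"
    by (rule integral_mono_AE[OF sq_integrableD(2)[OF D(2)] sq_integrable_mult[OF D(2) L(2)] mono])
  then have "(LINT z|lborel. (D z)\<^sup>2) = 0" using nonpos by (simp add: antisym)
  then have "AE z in lborel. (D z)\<^sup>2 = 0"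
    using sq_integrableD(2)[OF D(2)] by (subst (asm) integral_nonneg_eq_0_iff_AE) auto
  then have "AE z in lborel \<Otimes>\<^sub>M lborel. D z = 0" unfolding lborel_prod by eventually_elim simp
  from lborel_pair.AE_pair[OF this] have Dz: "AE x in lborel. AE s in lborel. D (x, s) = 0" .
  have Kz: "AE x in lborel. K x t = 0" for t
    using Dz
  proof eventually_elim
    case (elim x)
    then have "AE s in lborel. indicat_real {..<t} s * D (x, s) = 0" by eventually_elim simp
    then show ?case unfolding K_def by (rule integral_eq_zero_AE)
  qed
  show ?thesis
  proof
    fix t assume "t \<in> {0..T}"
    from w_eq[OF this] Kz[of t] show "AE x in ?M. u t x = v t x"
      unfolding AE_lebesgue_on_iff[OF \<Omega>(1)] by eventually_elim auto
  qed
qed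

end
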